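(* Consider the hidden Markov model $(X_n,Y_n)_{n\in\mathbb{Z}}$ with signal state space $E$, observation state space $F$, reference measure $\varphi$, matrix function $M$, signal transition matrix $P$ and filter transition kernel $\mathsf{\Pi}$ on $\mathcal{P}(E)$, as described in the context. Suppose $E$ is a finite set and that one of the following holds: - $F$ is a finite or countable set, and $\varphi$ is the counting measure; or - $F=\mathbb{R}^d$, $\varphi$ is the Lebesgue measure, and $y\mapsto M(y)$ is continuous. Then the following are equivalent: 1. The filter admits a unique invariant measure: there is exactly one $\mathsf{M}\in\mathcal{P}(\mathcal{P}(E))$ with $\mathsf{M}\mathsf{\Pi}=\mathsf{M}$. 2. (Condition (KR)) The closure $\operatorname{cl}\mathcal{K}$ of the cone of matrices $$\mathcal{K}=\{c\,M(y_1)\cdots M(y_n): n\in\mathbb{N},\ y_1,\ldots,y_n\in F,\ c\in\mathbb{R}_+\}$$ contains a matrix of rank $1$. 3. (Condition (C)) For every $\varepsilon>0$ there exist an integer $N\in\mathbb{N}$ and Borel subsets $\mathcal{S}\subset\mathcal{P}(E)$ and $\mathcal{O}\subset F^N$ such that: (i) $\mathbf{P}(\pi^{\min}_0\in\mathcal{S}\text{ and }\pi^{\max}_0\in\mathcal{S})>0$ and $\varphi^{\otimes N}(\mathcal{O})>0$; (ii) $\mu M(y_1)\cdots M(y_N)1>0$ for all $\mu\in\mathcal{S}$ and $(y_1,\ldots,y_N)\in\mathcal{O}$; (iii) for all $\mu,\nu\in\mathcal{S}$ and $(y_1,\ldots,y_N)\in\mathcal{O}$, $$\left\|\frac{\mu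 M(y_1)\cdots M(y_N)}{\mu M(y_1)\cdots M(y_N)1}-\frac{\nu M(y_1)\cdots M(y_N)}{\nu M(y_1)\cdots M(y_N)1}\right\|<\varepsilon .$$ When any of these conditions holds, $n^{-1}\sum_{k=1}^n\mathsf{M}_0\mathsf{\Pi}^k\Rightarrow\mathsf{M}$ as $n\to\infty$ for any $\mathsf{M}_0\in\mathcal{P}(\mathcal{P}(E))$, where $\mathsf{M}$ is the unique invariant measure. If, in addition, $P$ is aperiodic, then $\mathsf{M}_0\mathsf{\Pi}^n\Rightarrow\mathsf{M}$ as $n\to\infty$ for any $\mathsf{M}_0\in\mathcal{P}(\mathcal{P}(E))$.
   Context: Conventions. For a Polish space $S$, $\mathcal{P}(S)$ is the space of Borel probability measures on $S$ with the topology of weak convergence (itself Polish), $\mathcal{C}_b(S)$ the bounded continuous functions, $\Rightarrow$ denotes weak convergence, and $\|\mu-\nu\|=\sup_{\|f\|_\infty\le 1}|\int f\,d\mu-\int f\,d\nu|$. Measures on $E$ are identified with row vectors, functions on $E$ with column vectors; $1$ is the constant function. $\mathbb{R}_+=[0,\infty)$. Model. $E$ is a finite set $\{1,\ldots,p\}$ (here); $F$ is a Polish space; $\varphi$ is a $\sigma$-finite measure on $F$; $M:F\to\mathbb{R}_+^{E\times E}$ is a (Borel measurable) nonnegative matrix function such that $P_{ij}=\int M_{ij}(y)\,\varphi(dy)$ is the transition matrix of an irreducible, positive recurrent (not necessarily aperiodic) Markov chain on $E$. Its unique invariant probability measure is $\lambda$. On $\Omega=E^{\mathbb{Z}}\times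 F^{\mathbb{Z}}$ with Borel $\sigma$-field and coordinate process $(X_n,Y_n)_{n\in\mathbb{Z}}$, $\mathbf{P}$ is the probability measure under which $(X_n,Y_n)_{n\in\mathbb{Z}}$ is a stationary Markov chain with $$\mathbf{P}(X_k=j,\,Y_k\in A\mid X_{k-1}=i,\,Y_{k-1}=y)=\int_A M_{ij}(y')\,\varphi(dy').$$ $\sigma$-fields and filters. $\mathcal{F}^X_{-\infty,m}=\sigma\{X_k:k\le m\}$, $\mathcal{F}^Y_{-\infty,n}=\sigma\{Y_k:k\le n\}$, $\mathcal{G}_{m,n}=\mathcal{F}^X_{-\infty,m}\vee\mathcal{F}^Y_{-\infty,n}$, $\mathcal{G}_{-\infty,n}=\bigcap_{m\le n}\mathcal{G}_{m,n}$. Define the (regular) conditional distributions $\pi^{\min}_n=\mathbf{P}(X_n\in\cdot\mid\mathcal{F}^Y_{-\infty,n})$ and $\pi^{\max}_n=\mathbf{P}(X_n\in\cdot\mid\mathcal{G}_{-\infty,n})$. Filter kernel. $\mathsf{\Pi}$ is the Markov transition kernel on $\mathcal{P}(E)$ given by $$\int f(\nu)\,\mathsf{\Pi}(\mu,d\nu)=\int f\left(\frac{\mu M(y)}{\mu M(y)1}\right)\mu M(y)1\,\varphi(dy),\qquad f\in\mathcal{C}_b(\mathcal{P}(E)),$$ the integrand being read as $0$ where $\mu M(y)1=0$. For $\mathsf{M}\in\mathcal{P}(\mathcal{P}(E))$, $\mathsf{M}\mathsf{\Pi}=\int\mathsf{\Pi}(\mu,\cdot)\,\mathsf{M}(d\mu)$.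 *)

theory Defs
  imports "HOL-Probability.Probability"
begin

text \<open>
  The signal space is the finite type \<open>'e\<close>.  Measures on it are row vectors \<open>\<mu> :: real ^ 'e\<close>
  acting by \<open>\<mu> v* A\<close>, and matrices multiply by \<open>**\<close>.  The observation space \<open>F\<close> with its Borel
  sets is the measurable space underlying the reference measure \<open>\<phi>\<close>, that is
  \<open>F = space \<phi>\<close>; its topology is only used through the Borel sets.
\<close>

section \<open>Probability measures on the signal space\<close>

text \<open>The weak topology on the probability measures of a finite set is the Euclidean one.\<close>

definition prob_simplex :: "(real ^ 'e::finite) set" where
  "prob_simplex = {\<mu>. (\<forall>i. 0 \<le> \<mu> $ i) \<and> (\<Sum>i\<in>UNIV. \<mu> $ i) = 1}"

definition simplex_borel :: "(real ^ 'e::finite) measure" where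
  "simplex_borel = restrict_space borel prob_simplex"

definition mass :: "real ^ 'e::finite \<Rightarrow> real" where
  "mass v = (\<Sum>i\<in>UNIV. v $ i)"

definition normalized :: "real ^ 'e::finite \<Rightarrow> real ^ 'e" where
  "normalized v = (1 / mass v) *\<^sub>R v"

definition tv_dist :: "real ^ 'e::finite \<Rightarrow> real ^ 'e \<Rightarrow> real" where
  "tv_dist \<mu> \<nu> = (SUP f\<in>{f :: 'e \<Rightarrow> real. \<forall>i. \<bar>f i\<bar> \<le> 1}.
     \<bar>(\<Sum>i\<in>UNIV. \<mu> $ i * f i) - (\<Sum>i\<in>UNIV. \<nu> $ i * f i)\<bar>)"

section \<open>Matrices\<close>

text \<open>\<open>mat_prod A n = A 0 ** \<dots> ** A (n - 1)\<close>\<close>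

primrec mat_prod :: "(nat \<Rightarrow> real ^ 'e ^ 'e) \<Rightarrow> nat \<Rightarrow> real ^ 'e ^ 'e::finite" where
  "mat_prod A 0 = mat 1"
| "mat_prod A (Suc n) = mat_prod A n ** A n"

definition mat_power :: "real ^ 'e ^ 'e \<Rightarrow> nat \<Rightarrow> real ^ 'e ^ 'e::finite" where
  "mat_power Q n = mat_prod (\<lambda>_. Q) n"

definition stochastic :: "real ^ 'e ^ 'e::finite \<Rightarrow> bool" where
  "stochastic Q \<longleftrightarrow> (\<forall>i j. 0 \<le> Q $ i $ j) \<and> (\<forall>i. (\<Sum>j\<in>UNIV. Q $ i $ j) = 1)"

definition irreducible_mat :: "real ^ 'e ^ 'e::finite \<Rightarrow> bool" where
  "irreducible_mat Q \<longleftrightarrow> (\<forall>i j. \<exists>n\<ge>1. mat_power Q n $ i $ j > 0)"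

definition aperiodic_mat :: "real ^ 'e ^ 'e::finite \<Rightarrow> bool" where
  "aperiodic_mat Q \<longleftrightarrow> (\<forall>i. Gcd {n :: nat. n \<ge> 1 \<and> mat_power Q n $ i $ i > 0} = 1)"

section \<open>The hidden Markov model\<close>

definition signal_matrix :: "'f measure \<Rightarrow> ('f \<Rightarrow> real ^ 'e ^ 'e) \<Rightarrow> real ^ 'e ^ 'e::finite" where
  "signal_matrix \<phi> M = (\<chi> i j. \<integral>y. M y $ i $ j \<partial>\<phi>)"

type_synonym ('e, 'f) path = "(int \<Rightarrow> 'e) \<times> (int \<Rightarrow> 'f)"

definition path_space :: "'f measure \<Rightarrow> ('e, 'f) path measure" where
  "path_space \<phi> = (\<Pi>\<^sub>M n\<in>UNIV. count_space UNIV) \<Otimes>\<^sub>M (\<Pi>\<^sub>M n\<in>UNIV. \<phi>)"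

definition coord_X :: "int \<Rightarrow> ('e, 'f) path \<Rightarrow> 'e" where
  "coord_X n \<omega> = fst \<omega> n"

definition coord_Y :: "int \<Rightarrow> ('e, 'f) path \<Rightarrow> 'f" where
  "coord_Y n \<omega> = snd \<omega> n"

definition path_shift :: "('e, 'f) path \<Rightarrow> ('e, 'f) path" where
  "path_shift \<omega> = (\<lambda>n. coord_X (n + 1) \<omega>, \<lambda>n. coord_Y (n + 1) \<omega>)"

definition FX :: "'f measure \<Rightarrow> int \<Rightarrow> ('e, 'f) path measure" where
  "FX \<phi> m = sigma (space (path_space \<phi>)) {coord_X k -` B \<inter> space (path_space \<phi>) | k B. k \<le> m}"

definition FY :: "'f measure \<Rightarrow> int \<Rightarrow> ('e, 'f) path measure" where
  "FY \<phi> n = sigma (space (path_space \<phi>))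
     {coord_Y k -` A \<inter> space (path_space \<phi>) | k A. k \<le> n \<and> A \<in> sets \<phi>}"

definition GXY :: "'f measure \<Rightarrow> int \<Rightarrow> int \<Rightarrow> ('e, 'f) path measure" where
  "GXY \<phi> m n = sigma (space (path_space \<phi>)) (sets (FX \<phi> m) \<union> sets (FY \<phi> n))"

definition GXY_inf :: "'f measure \<Rightarrow> int \<Rightarrow> ('e, 'f) path measure" where
  "GXY_inf \<phi> n = sigma (space (path_space \<phi>)) (\<Inter>m\<in>{..n}. sets (GXY \<phi> m n))"

text \<open>
  The assumptions \<open>markov\<close> and \<open>stationary\<close> determine \<open>P\<close>: they make the law of \<open>coord_X 0\<close> the unique
  invariant probability of the signal matrix.  Positive recurrence is not listed because an
  irreducible chain on a finite state space is positive recurrent.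
\<close>

locale hidden_markov_model = sigma_finite_measure \<phi> + P: prob_space P
  for \<phi> :: "'f measure" and M :: "'f \<Rightarrow> real ^ 'e ^ 'e::finite" and P :: "('e, 'f) path measure" +
  assumes M_measurable: "M \<in> borel_measurable \<phi>"
    and M_nonneg: "\<And>y i j. y \<in> space \<phi> \<Longrightarrow> 0 \<le> M y $ i $ j"
    and M_integrable: "\<And>i j. integrable \<phi> (\<lambda>y. M y $ i $ j)"
    and signal_stochastic: "stochastic (signal_matrix \<phi> M)"
    and signal_irreducible: "irreducible_mat (signal_matrix \<phi> M)"
    and sets_P: "sets P = sets (path_space \<phi>)"
    and markov: "\<And>k j A. A \<in> sets \<phi> \<Longrightarrow>
      AE \<omega> in P. real_cond_exp P (GXY \<phi> (k - 1) (k - 1))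
          (indicator {\<omega> \<in> space P. coord_X k \<omega> = j \<and> coord_Y k \<omega> \<in> A}) \<omega>
        = (LINT y:A|\<phi>. M y $ coord_X (k - 1) \<omega> $ j)"
    and stationary: "distr P P path_shift = P"

text \<open>
  Since the signal space is finite, the conditional distributions are the vectors of conditional
  probabilities of its points; these lie in \<open>prob_simplex\<close> almost surely.
\<close>

definition pi_min :: "'f measure \<Rightarrow> ('e, 'f) path measure \<Rightarrow> int \<Rightarrow> ('e, 'f) path \<Rightarrow> real ^ 'e::finite" where
  "pi_min \<phi> P n \<omega> = (\<chi> i. real_cond_exp P (FY \<phi> n) (indicator {\<omega> \<in> space P. coord_X n \<omega> = i}) \<omega>)"

definition pi_max :: "'f measure \<Rightarrow> ('e, 'f) path measure \<Rightarrow> int \<Rightarrow> ('e, 'f) path \<Rightarrow> real ^ 'e::finite" where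
  "pi_max \<phi> P n \<omega> = (\<chi> i. real_cond_exp P (GXY_inf \<phi> n) (indicator {\<omega> \<in> space P. coord_X n \<omega> = i}) \<omega>)"

section \<open>The filter kernel\<close>

text \<open>
  The value \<open>\<mu>\<close> chosen on the null set where the density vanishes is immaterial; it only keeps
  the map inside the simplex.
\<close>

definition filter_kernel ::
    "'f measure \<Rightarrow> ('f \<Rightarrow> real ^ 'e ^ 'e) \<Rightarrow> real ^ 'e \<Rightarrow> (real ^ 'e::finite) measure" where
  "filter_kernel \<phi> M \<mu> =
     distr (density \<phi> (\<lambda>y. ennreal (mass (\<mu> v* M y)))) simplex_borel
       (\<lambda>y. if mass (\<mu> v* M y) = 0 then \<mu> else normalized (\<mu> v* M y))"

definition filter_step ::
    "'f measure \<Rightarrow> ('f \<Rightarrow> real ^ 'e ^ 'e) \<Rightarrow> (real ^ 'e) measure \<Rightarrow> (real ^ 'e::finite) measure" where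
  "filter_step \<phi> M \<MM> = \<MM> \<bind> filter_kernel \<phi> M"

definition invariant_measure ::
    "'f measure \<Rightarrow> ('f \<Rightarrow> real ^ 'e ^ 'e) \<Rightarrow> (real ^ 'e::finite) measure \<Rightarrow> bool" where
  "invariant_measure \<phi> M \<MM> \<longleftrightarrow>
     \<MM> \<in> space (prob_algebra simplex_borel) \<and> filter_step \<phi> M \<MM> = \<MM>"

text \<open>The measure $n^{-1}\sum_{k=1}^n \mathsf{M}_0 \mathsf{\Pi}^k$ (for $n \ge 1$).\<close>

definition cesaro_mean ::
    "'f measure \<Rightarrow> ('f \<Rightarrow> real ^ 'e ^ 'e) \<Rightarrow> (real ^ 'e) measure \<Rightarrow> nat \<Rightarrow> (real ^ 'e::finite) measure" where
  "cesaro_mean \<phi> M \<MM>\<^sub>0 n = measure_of prob_simplex (sets simplex_borel)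
     (\<lambda>A. (\<Sum>k=1..n. emeasure ((filter_step \<phi> M ^^ k) \<MM>\<^sub>0) A) / of_nat n)"

definition weakly_converges ::
    "(nat \<Rightarrow> (real ^ 'e) measure) \<Rightarrow> (real ^ 'e::finite) measure \<Rightarrow> bool" where
  "weakly_converges \<MM>s \<MM> \<longleftrightarrow>
     (\<forall>f :: real ^ 'e \<Rightarrow> real. continuous_on prob_simplex f \<and> bounded (f ` prob_simplex) \<longrightarrow>
        (\<lambda>n. \<integral>\<nu>. f \<nu> \<partial>\<MM>s n) \<longlonglongrightarrow> (\<integral>\<nu>. f \<nu> \<partial>\<MM>))"

section \<open>The conditions (KR) and (C)\<close>

definition matrix_cone :: "'f set \<Rightarrow> ('f \<Rightarrow> real ^ 'e ^ 'e) \<Rightarrow> (real ^ 'e ^ 'e::finite) set" where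
  "matrix_cone F M = {c *\<^sub>R mat_prod (\<lambda>k. M (y k)) n | c y n.
     n \<ge> 1 \<and> (\<forall>k<n. y k \<in> F) \<and> 0 \<le> c}"

definition condition_KR :: "'f measure \<Rightarrow> ('f \<Rightarrow> real ^ 'e ^ 'e::finite) \<Rightarrow> bool" where
  "condition_KR \<phi> M \<longleftrightarrow> (\<exists>A \<in> closure (matrix_cone (space \<phi>) M). rank A = 1)"

definition condition_C ::
    "'f measure \<Rightarrow> ('f \<Rightarrow> real ^ 'e ^ 'e::finite) \<Rightarrow> ('e, 'f) path measure \<Rightarrow> bool" where
  "condition_C \<phi> M P \<longleftrightarrow>
     (\<forall>\<epsilon>>0. \<exists>N\<ge>1. \<exists>S \<in> sets simplex_borel. \<exists>Ob \<in> sets (\<Pi>\<^sub>M k\<in>{..<N}. \<phi>).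
        measure P {\<omega> \<in> space P. pi_min \<phi> P 0 \<omega> \<in> S \<and> pi_max \<phi> P 0 \<omega> \<in> S} > 0 \<and>
        emeasure (\<Pi>\<^sub>M k\<in>{..<N}. \<phi>) Ob > 0 \<and>
        (\<forall>\<mu>\<in>S. \<forall>y\<in>Ob. mass (\<mu> v* mat_prod (\<lambda>k. M (y k)) N) > 0) \<and>
        (\<forall>\<mu>\<in>S. \<forall>\<nu>\<in>S. \<forall>y\<in>Ob.
           tv_dist (normalized (\<mu> v* mat_prod (\<lambda>k. M (y k)) N))
                   (normalized (\<nu> v* mat_prod (\<lambda>k. M (y k)) N)) < \<epsilon>))"

end

theory Submission
  imports Defs "HOL-Complex_Analysis.Great_Picard"
begin

text \<open>
  A function \<open>F\<close> on the simplex is identified with its positively homogeneous extension to the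
  nonnegative cone. On such functions the filter kernel acts by \<open>F \<mapsto> (\<lambda>v. \<integral>y. F (v v* M y) \<partial>\<phi>)\<close>,
  without normalization; this operator preserves sublinearity and the \<open>l\<^sup>1\<close>-Lipschitz constant.

  Under (KR) some words contract all simplex vectors that charge a fixed state by at least \<open>c\<close> into a
  small neighbourhood of one point. By irreducibility a suitable average of powers of the operator
  therefore contracts the oscillation of equicontinuous functions, which gives uniqueness and
  convergence.

  For the converse, take a subsequential limit \<open>f\<close> of the Cesaro means of the iterates of the
  Euclidean norm. It is sublinear and invariant. By the maximum principle it takes its maximum at
  all vertices, and it takes its minimum at the stationary vector. By martingale convergence \<open>f\<close>
  almost surely equals its minimum at \<open>pi_min\<close> and its maximum at \<open>pi_max\<close>, and the laws of both
  filters are invariant. Uniqueness as well as (C) forces minimum and maximum to coincide, so the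
  triangle inequality for the rows of long products is nearly an equality, and a limit of normalized
  products has parallel rows.
\<close>

section \<open>Positively homogeneous functions\<close>

text \<open>Normalization is the obstacle: \<open>normalized (\<mu> v* M y)\<close> is singular
  where the mass vanishes, and a Lipschitz function composed with it loses its constant. For a
  homogeneous function the transition density \<open>mass (\<mu> v* M y)\<close> cancels the
  denominator, and the estimates reduce to \<open>Q\<close>, whose row sums are one. All iterates of
  a test function are then equicontinuous; this gives the compactness behind the limit
  \<open>f\<close> and a contraction uniform along the iteration.

  Existence is never in doubt: the law of \<open>pi_min\<close> is always invariant, so only
  uniqueness has to be decided. The Euclidean norm is the starting function because equality in its
  triangle inequality forces vectors to be parallel. That the stationary vector is a minimizer rests
  on Jensen's inequality in the form \<open>f (v v* Q) \<le> f v\<close>.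

  In the other direction a contracting word helps only vectors that charge one fixed state, and for
  a periodic signal there may be no single time at which this state is charged from every starting
  point. This is why averages of powers occur, and why the function being contracted must remember
  how it arose from the test function.\<close>

definition nonneg_cone :: "(real ^ 'e::finite) set" where
  "nonneg_cone = {v. \<forall>i. 0 \<le> v $ i}"

definition l1norm :: "real ^ 'e::finite \<Rightarrow> real" where
  "l1norm v = (\<Sum>i\<in>UNIV. \<bar>v $ i\<bar>)"

text \<open>Homogeneity and the Lipschitz bound are demanded only on the cone, where the operator
  acts; Borel measurability is demanded everywhere, so that compositions need no restriction of
  domain. The \<open>l1norm\<close> is chosen because it equals \<open>mass\<close> on the cone,
  which the operator preserves.\<close>

definition hom_lip :: "real \<Rightarrow> (real ^ 'e::finite \<Rightarrow> real) \<Rightarrow> bool" where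
  "hom_lip L F \<longleftrightarrow> 0 \<le> L \<and> F \<in> borel_measurable borel \<and>
     (\<forall>c v. 0 \<le> c \<longrightarrow> v \<in> nonneg_cone \<longrightarrow> F (c *\<^sub>R v) = c * F v) \<and>
     (\<forall>v\<in>nonneg_cone. \<forall>w\<in>nonneg_cone. \<bar>F v - F w\<bar> \<le> L * l1norm (v - w))"

lemma vector_matrix_nth: "(v v* A) $ j = (\<Sum>i\<in>UNIV. v $ i * A $ i $ j)"
  by (simp add: vector_matrix_mult_def)

lemma l1norm_nonneg [simp]: "0 \<le> l1norm v"
  by (simp add: l1norm_def sum_nonneg)

lemma l1norm_zero [simp]: "l1norm 0 = 0"
  by (simp add: l1norm_def)

lemma l1norm_triangle: "l1norm (v + w) \<le> l1norm v + l1norm w"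
  unfolding l1norm_def sum.distrib[symmetric] by (rule sum_mono) (simp add: abs_triangle_ineq)

lemma l1norm_scaleR: "l1norm (c *\<^sub>R v) = \<bar>c\<bar> * l1norm v"
  by (simp add: l1norm_def abs_mult sum_distrib_left)

lemma l1norm_minus_commute: "l1norm (v - w) = l1norm (w - v)"
  by (simp add: l1norm_def abs_minus_commute)

lemma norm_le_l1norm: "norm v \<le> l1norm v"
  unfolding l1norm_def norm_vec_def using L2_set_le_sum_abs[of "\<lambda>i. norm (v $ i)" UNIV] by simp

lemma l1norm_le_norm: "l1norm (v :: real ^ 'e::finite) \<le> real CARD('e) * norm v"
proof -
  have "l1norm v \<le> (\<Sum>i\<in>(UNIV::'e set). norm v)"
    unfolding l1norm_def by (rule sum_mono) (rule component_le_norm_cart)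
  then show ?thesis by simp
qed

lemma mass_add: "mass (v + w) = mass v + mass w"
  by (simp add: mass_def sum.distrib)

lemma mass_diff: "mass (v - w) = mass v - mass w"
  by (simp add: mass_def sum_subtractf)

lemma mass_scaleR: "mass (c *\<^sub>R v) = c * mass v"
  by (simp add: mass_def sum_distrib_left)

lemma mass_zero [simp]: "mass 0 = 0"
  by (simp add: mass_def)

lemma abs_mass_le_l1norm: "\<bar>mass v\<bar> \<le> l1norm v"
  unfolding mass_def l1norm_def by (rule sum_abs)

lemma l1norm_cone: "v \<in> nonneg_cone \<Longrightarrow> l1norm v = mass v"
  by (simp add: l1norm_def mass_def nonneg_cone_def)

lemma mass_nonneg: "v \<in> nonneg_cone \<Longrightarrow> 0 \<le> mass v"
  by (simp add: mass_def nonneg_cone_def sum_nonneg)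

lemma nth_le_mass: "v \<in> nonneg_cone \<Longrightarrow> v $ i \<le> mass v"
  unfolding mass_def nonneg_cone_def by (rule member_le_sum) auto

lemma mass_zero_cone: "v \<in> nonneg_cone \<Longrightarrow> mass v = 0 \<Longrightarrow> v = 0"
  by (simp add: mass_def nonneg_cone_def sum_nonneg_eq_0_iff vec_eq_iff)

lemma simplex_cone: "\<mu> \<in> prob_simplex \<Longrightarrow> \<mu> \<in> nonneg_cone"
  by (simp add: prob_simplex_def nonneg_cone_def)

lemma simplex_iff: "\<mu> \<in> prob_simplex \<longleftrightarrow> \<mu> \<in> nonneg_cone \<and> mass \<mu> = 1"
  by (simp add: prob_simplex_def nonneg_cone_def mass_def)

lemma zero_cone [simp]: "0 \<in> nonneg_cone"
  by (simp add: nonneg_cone_def)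

lemma scaleR_cone: "0 \<le> c \<Longrightarrow> v \<in> nonneg_cone \<Longrightarrow> c *\<^sub>R v \<in> nonneg_cone"
  by (simp add: nonneg_cone_def)

lemma add_cone: "v \<in> nonneg_cone \<Longrightarrow> w \<in> nonneg_cone \<Longrightarrow> v + w \<in> nonneg_cone"
  by (simp add: nonneg_cone_def)

lemma axis_simplex: "axis i 1 \<in> prob_simplex"
  by (simp add: prob_simplex_def axis_def)

lemma normalized_simplex:
  assumes "v \<in> nonneg_cone" "mass v \<noteq> 0" shows "normalized v \<in> prob_simplex"
  using assms mass_nonneg[OF assms(1)]
  by (simp add: simplex_iff normalized_def mass_scaleR scaleR_cone)

lemma mass_normalized: "v \<in> nonneg_cone \<Longrightarrow> mass v *\<^sub>R normalized v = v"
  using mass_zero_cone[of v] by (auto simp: normalized_def)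

lemma normalized_scaleR: "c \<noteq> 0 \<Longrightarrow> normalized (c *\<^sub>R v) = normalized v"
  by (simp add: normalized_def mass_scaleR)

lemma vm_cone:
  "v \<in> nonneg_cone \<Longrightarrow> (\<And>i j. 0 \<le> A $ i $ j) \<Longrightarrow> v v* A \<in> nonneg_cone"
  by (auto simp: nonneg_cone_def vector_matrix_nth intro!: sum_nonneg)

text \<open>The right side is linear in the entries of \<open>A\<close>, so integration over the
  observations puts \<open>Q\<close> in place of \<open>A\<close>.\<close>

lemma l1norm_vm_le:
  assumes "\<And>i j. 0 \<le> A $ i $ j"
  shows "l1norm (v v* A) \<le> (\<Sum>j\<in>UNIV. \<Sum>i\<in>UNIV. \<bar>v $ i\<bar> * A $ i $ j)"
  unfolding l1norm_def vector_matrix_nth using assms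
  by (intro sum_mono order_trans[OF sum_abs]) (simp add: abs_mult)

lemma continuous_on_mass [continuous_intros]:
  "continuous_on S f \<Longrightarrow> continuous_on S (\<lambda>x. mass (f x))"
  unfolding mass_def by (intro continuous_intros)

lemma continuous_on_l1norm [continuous_intros]:
  "continuous_on S f \<Longrightarrow> continuous_on S (\<lambda>x. l1norm (f x))"
  unfolding l1norm_def by (intro continuous_intros)

lemma continuous_on_vm [continuous_intros]:
  fixes f :: "'a::topological_space \<Rightarrow> real ^ 'e::finite" and A :: "'a \<Rightarrow> real ^ 'k::finite ^ 'e"
  shows "continuous_on S f \<Longrightarrow> continuous_on S A \<Longrightarrow> continuous_on S (\<lambda>x. f x v* A x)"
  unfolding vector_matrix_mult_def by (intro continuous_intros)

lemma borel_measurable_mass [measurable]: "mass \<in> borel_measurable borel"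
  by (intro borel_measurable_continuous_onI continuous_intros)

lemma borel_measurable_vec_nth [measurable (raw)]:
  fixes f :: "'a \<Rightarrow> ('b::real_normed_vector) ^ 'e::finite"
  shows "f \<in> borel_measurable N \<Longrightarrow> (\<lambda>x. f x $ i) \<in> borel_measurable N"
  by (rule borel_measurable_continuous_on) (intro continuous_intros)

lemma borel_measurable_vec_iff:
  fixes f :: "'a \<Rightarrow> real ^ 'e::finite"
  shows "f \<in> borel_measurable N \<longleftrightarrow> (\<forall>i. (\<lambda>x. f x $ i) \<in> borel_measurable N)"
proof
  assume "\<forall>i. (\<lambda>x. f x $ i) \<in> borel_measurable N"
  then show "f \<in> borel_measurable N"
    by (subst borel_measurable_euclidean_space) (auto simp: Basis_vec_def inner_axis)
qed (auto intro: borel_measurable_vec_nth)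

lemma borel_measurable_vm [measurable (raw)]:
  fixes f :: "'a \<Rightarrow> real ^ 'e::finite" and A :: "'a \<Rightarrow> real ^ 'k::finite ^ 'e"
  assumes [measurable]: "f \<in> borel_measurable N" "A \<in> borel_measurable N"
  shows "(\<lambda>x. f x v* A x) \<in> borel_measurable N"
  unfolding borel_measurable_vec_iff vector_matrix_nth by measurable

lemma borel_measurable_normalized [measurable]: "normalized \<in> borel_measurable borel"
  unfolding normalized_def by measurable

section \<open>The simplex as a compact convex Borel set\<close>

lemma closed_simplex: "closed (prob_simplex :: (real ^ 'e::finite) set)"
proof -
  have "prob_simplex = (\<Inter>i. {\<mu> :: real ^ 'e. 0 \<le> \<mu> $ i}) \<inter> {\<mu>. mass \<mu> = 1}"
    by (auto simp: prob_simplex_def mass_def)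
  moreover have "closed {\<mu> :: real ^ 'e. mass \<mu> = 1}"
    by (intro closed_Collect_eq continuous_intros)
  moreover have "closed (\<Inter>i. {\<mu> :: real ^ 'e. 0 \<le> \<mu> $ i})"
    by (intro closed_INT ballI closed_Collect_le continuous_intros)
  ultimately show ?thesis by (metis closed_Int)
qed

lemma compact_simplex: "compact (prob_simplex :: (real ^ 'e::finite) set)"
proof -
  have "norm \<mu> \<le> 1" if "\<mu> \<in> prob_simplex" for \<mu> :: "real ^ 'e"
    using norm_le_l1norm[of \<mu>] that by (simp add: l1norm_cone simplex_iff)
  then have "bounded (prob_simplex :: (real ^ 'e) set)"
    unfolding bounded_iff by blast
  then show ?thesis using closed_simplex by (simp add: compact_eq_bounded_closed)
qed

lemma convex_simplex: "convex (prob_simplex :: (real ^ 'e::finite) set)"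
  unfolding convex_def by (auto simp: simplex_iff mass_add mass_scaleR scaleR_cone add_cone)

lemma simplex_sets [measurable]: "prob_simplex \<in> sets borel"
  using closed_simplex by (rule borel_closed)

lemma space_simplex_borel: "space simplex_borel = prob_simplex"
  by (simp add: simplex_borel_def space_restrict_space)

lemma sets_simplex_borel: "A \<in> sets simplex_borel \<longleftrightarrow> A \<in> sets borel \<and> A \<subseteq> prob_simplex"
  by (auto simp: simplex_borel_def sets_restrict_space image_iff)

abbreviation simplex_laws :: "(real ^ 'e::finite) measure set" where
  "simplex_laws \<equiv> space (prob_algebra simplex_borel)"

lemma hom_lipD:
  assumes "hom_lip L F"
  shows "0 \<le> L" "F \<in> borel_measurable borel"
    "\<And>c v. 0 \<le> c \<Longrightarrow> v \<in> nonneg_cone \<Longrightarrow> F (c *\<^sub>R v) = c * F v"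
    "\<And>v w. v \<in> nonneg_cone \<Longrightarrow> w \<in> nonneg_cone \<Longrightarrow> \<bar>F v - F w\<bar> \<le> L * l1norm (v - w)"
  using assms unfolding hom_lip_def by auto

lemma hom_lip_zero: "hom_lip L F \<Longrightarrow> F 0 = 0"
  using hom_lipD(3)[of L F 0 0] by simp

lemma hom_lip_bound: "hom_lip L F \<Longrightarrow> v \<in> nonneg_cone \<Longrightarrow> \<bar>F v\<bar> \<le> L * mass v"
  using hom_lipD(4)[of L F v 0] hom_lip_zero[of L F] by (simp add: l1norm_cone)

text \<open>If \<open>mass v = 0\<close> then \<open>v\<close> is zero and both sides vanish, so
  passing between cone and simplex needs no separate treatment of the undefined direction.\<close>

lemma hom_lip_normalized: "hom_lip L F \<Longrightarrow> v \<in> nonneg_cone \<Longrightarrow> mass v * F (normalized v) = F v"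
  using hom_lipD(3)[of L F "mass v" "normalized v"] mass_nonneg[of v] mass_normalized[of v]
    normalized_simplex[of v] mass_zero_cone[of v] hom_lip_zero[of L F]
  by (cases "mass v = 0") (auto simp: simplex_cone)

lemma hom_lip_mono: "hom_lip L F \<Longrightarrow> L \<le> L' \<Longrightarrow> hom_lip L' F"
  unfolding hom_lip_def by (meson l1norm_nonneg mult_right_mono order_trans)

lemma hom_lip_add:
  assumes "hom_lip L F" "hom_lip K G" shows "hom_lip (L + K) (\<lambda>v. F v + G v)"
  unfolding hom_lip_def
proof (intro conjI ballI allI impI)
  show "(\<lambda>v. F v + G v) \<in> borel_measurable borel"
    using assms[THEN hom_lipD(2)] by measurable
  fix v w :: "real ^ 'a" assume "v \<in> nonneg_cone" "w \<in> nonneg_cone"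
  then have "\<bar>F v - F w\<bar> \<le> L * l1norm (v - w)" "\<bar>G v - G w\<bar> \<le> K * l1norm (v - w)"
    using assms by (simp_all add: hom_lipD(4))
  then show "\<bar>F v + G v - (F w + G w)\<bar> \<le> (L + K) * l1norm (v - w)"
    unfolding distrib_right by linarith
qed (use assms[THEN hom_lipD(1)] assms[THEN hom_lipD(3)] in \<open>auto simp: algebra_simps\<close>)

lemma hom_lip_cmult:
  assumes "hom_lip L F" shows "hom_lip (\<bar>c\<bar> * L) (\<lambda>v. c * F v)"
  unfolding hom_lip_def
proof (intro conjI ballI allI impI)
  show "(\<lambda>v. c * F v) \<in> borel_measurable borel"
    using hom_lipD(2)[OF assms] by measurable
  fix v w :: "real ^ 'a" assume "v \<in> nonneg_cone" "w \<in> nonneg_cone"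
  then have "\<bar>F v - F w\<bar> \<le> L * l1norm (v - w)"
    using assms by (simp add: hom_lipD(4))
  then have "\<bar>c\<bar> * \<bar>F v - F w\<bar> \<le> \<bar>c\<bar> * (L * l1norm (v - w))"
    by (intro mult_left_mono) auto
  then show "\<bar>c * F v - c * F w\<bar> \<le> \<bar>c\<bar> * L * l1norm (v - w)"
    unfolding right_diff_distrib[symmetric] abs_mult by (simp add: mult.assoc)
qed (use hom_lipD(1)[OF assms] hom_lipD(3)[OF assms] in \<open>auto simp: algebra_simps\<close>)

lemma hom_lip_sum:
  assumes "finite I" "0 \<le> L" and F: "\<And>i. i \<in> I \<Longrightarrow> hom_lip L (F i)"
  shows "hom_lip ((\<Sum>i\<in>I. \<bar>c i\<bar>) * L) (\<lambda>v. \<Sum>i\<in>I. c i * F i v)"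
  using assms(1) F
proof (induction I)
  case (insert i I)
  then show ?case
    using hom_lip_add[OF hom_lip_cmult[of L "F i" "c i"], of "(\<Sum>i\<in>I. \<bar>c i\<bar>) * L"]
    by (simp add: distrib_right)
qed (simp add: hom_lip_def)

lemma hom_lip_minus: "hom_lip L F \<Longrightarrow> hom_lip L (\<lambda>v. - F v)"
  using hom_lip_cmult[of L F "-1"] by simp

lemma hom_lip_mass: "hom_lip 1 mass"
  unfolding hom_lip_def
  using abs_mass_le_l1norm by (auto simp: mass_scaleR mass_diff[symmetric])

lemma hom_lip_nth: "hom_lip 1 (\<lambda>v. v $ i)"
proof -
  have "\<bar>x $ i\<bar> \<le> l1norm x" for x :: "real ^ 'a"
    using component_le_norm_cart[of x i] norm_le_l1norm[of x] by simp
  from this[of "v - w" for v w] show ?thesis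
    unfolding hom_lip_def by simp
qed

lemma hom_lip_norm: "hom_lip 1 norm"
  unfolding hom_lip_def using norm_triangle_ineq3 norm_le_l1norm order_trans by fastforce

text \<open>Writing a vector as its mass times its direction, the difference splits into a change of
  mass, which costs \<open>C\<close>, and a change of direction, which costs \<open>K\<close> times
  twice \<open>l1norm (v - w)\<close>: once for moving \<open>v\<close> to \<open>w\<close> and once
  for correcting the mass. Hence the constant \<open>C + 2 * K\<close>.\<close>

lemma hom_lip_extension:
  fixes g :: "real ^ 'e::finite \<Rightarrow> real"
  assumes meas: "g \<in> borel_measurable borel" and K: "0 \<le> K" and C: "0 \<le> C"
    and lip: "\<And>x y. x \<in> prob_simplex \<Longrightarrow> y \<in> prob_simplex \<Longrightarrow> \<bar>g x - g y\<bar> \<le> K * l1norm (x - y)"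
    and bnd: "\<And>x. x \<in> prob_simplex \<Longrightarrow> \<bar>g x\<bar> \<le> C"
  shows "hom_lip (C + 2 * K) (\<lambda>v. mass v * g (normalized v))"
  unfolding hom_lip_def
proof (intro conjI ballI allI impI)
  show "(\<lambda>v. mass v * g (normalized v)) \<in> borel_measurable borel"
    using meas by measurable
  show "mass (c *\<^sub>R v) * g (normalized (c *\<^sub>R v)) = c * (mass v * g (normalized v))" for c v
    by (cases "c = 0") (auto simp: mass_scaleR normalized_scaleR)
  fix v w :: "real ^ 'e" assume v: "v \<in> nonneg_cone" and w: "w \<in> nonneg_cone"
  have l1: "0 \<le> l1norm (v - w)" by simp
  show "\<bar>mass v * g (normalized v) - mass w * g (normalized w)\<bar> \<le> (C + 2 * K) * l1norm (v - w)"
  proof (cases "mass v = 0 \<or> mass w = 0")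
    case True
    then have z: "v = 0 \<or> w = 0" using v w mass_zero_cone by blast
    have b: "\<bar>mass u * g (normalized u)\<bar> \<le> C * l1norm u" if "u \<in> nonneg_cone" for u
    proof (cases "mass u = 0")
      case False
      then have "\<bar>g (normalized u)\<bar> \<le> C" using that bnd normalized_simplex by blast
      then show ?thesis using that mass_nonneg[OF that]
        by (simp add: abs_mult l1norm_cone) (metis mult.commute mult_left_mono)
    qed (use C in auto)
    have "\<bar>mass v * g (normalized v) - mass w * g (normalized w)\<bar> \<le> C * l1norm (v - w)"
      using z b[OF v] b[OF w] l1norm_minus_commute[of 0 w] by auto
    also have "\<dots> \<le> (C + 2 * K) * l1norm (v - w)"
      using K by (intro mult_right_mono) auto
    finally show ?thesis .
  next
    case False
    let ?v = "normalized v" and ?w = "normalized w"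
    have vs: "?v \<in> prob_simplex" "?w \<in> prob_simplex"
      using False v w normalized_simplex by auto
    have "mass w * l1norm (?v - ?w) = l1norm (mass w *\<^sub>R ?v - w)"
      using mass_nonneg[OF w] l1norm_scaleR[of "mass w" "?v - ?w"] mass_normalized[OF w]
      by (simp add: scaleR_diff_right)
    also have "mass w *\<^sub>R ?v - w = (v - w) + (mass w - mass v) *\<^sub>R ?v"
      using mass_normalized[OF v] by (simp add: scaleR_diff_left)
    also have "l1norm \<dots> \<le> l1norm (v - w) + \<bar>mass w - mass v\<bar>"
      using l1norm_triangle[of "v - w" "(mass w - mass v) *\<^sub>R ?v"] vs(1)
      by (simp add: l1norm_scaleR simplex_iff l1norm_cone)
    also have "\<dots> \<le> 2 * l1norm (v - w)"
      using abs_mass_le_l1norm[of "v - w"] by (simp add: mass_diff abs_minus_commute)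
    finally have 1: "mass w * l1norm (?v - ?w) \<le> 2 * l1norm (v - w)" .
    have "mass w * \<bar>g ?v - g ?w\<bar> \<le> mass w * (K * l1norm (?v - ?w))"
      using lip[OF vs] mass_nonneg[OF w] by (intro mult_left_mono) auto
    also have "\<dots> \<le> K * (2 * l1norm (v - w))"
      using mult_left_mono[OF 1 K] by (simp add: ac_simps)
    finally have 2: "mass w * \<bar>g ?v - g ?w\<bar> \<le> K * (2 * l1norm (v - w))" .
    have 3: "\<bar>mass v - mass w\<bar> * \<bar>g ?v\<bar> \<le> l1norm (v - w) * C"
      using abs_mass_le_l1norm[of "v - w"] bnd[OF vs(1)]
      by (intro mult_mono) (auto simp: mass_diff)
    have "\<bar>mass v * g ?v - mass w * g ?w\<bar> = \<bar>(mass v - mass w) * g ?v + mass w * (g ?v - g ?w)\<bar>"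
      by (simp add: algebra_simps)
    also have "\<dots> \<le> \<bar>mass v - mass w\<bar> * \<bar>g ?v\<bar> + mass w * \<bar>g ?v - g ?w\<bar>"
      using mass_nonneg[OF w] by (intro order_trans[OF abs_triangle_ineq]) (simp add: abs_mult)
    finally show ?thesis using 2 3 by (simp add: algebra_simps)
  qed
qed (use K C in auto)

section \<open>The filter kernel as an operator on homogeneous functions\<close>

text \<open>The analytic half of the model, without a path space. Uniqueness and convergence under
  (KR) are proved at this level.\<close>

locale filter_model = sigma_finite_measure \<phi>
  for \<phi> :: "'f measure" and M :: "'f \<Rightarrow> real ^ 'e ^ 'e::finite" +
  assumes M_meas [measurable]: "M \<in> borel_measurable \<phi>"
    and M_pos: "\<And>y i j. y \<in> space \<phi> \<Longrightarrow> 0 \<le> M y $ i $ j"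
    and M_int: "\<And>i j. integrable \<phi> (\<lambda>y. M y $ i $ j)"
    and Q_stochastic: "stochastic (signal_matrix \<phi> M)"
    and Q_irreducible: "irreducible_mat (signal_matrix \<phi> M)"

sublocale hidden_markov_model \<subseteq> filter_model \<phi> M
  by unfold_locales
    (rule M_measurable M_nonneg M_integrable signal_stochastic signal_irreducible, assumption?)+

context filter_model
begin

abbreviation Q :: "real ^ 'e ^ 'e" where "Q \<equiv> signal_matrix \<phi> M"

definition step :: "(real ^ 'e \<Rightarrow> real) \<Rightarrow> real ^ 'e \<Rightarrow> real" where
  "step F v = (\<integral>y. F (v v* M y) \<partial>\<phi>)"

lemma vM_cone: "y \<in> space \<phi> \<Longrightarrow> v \<in> nonneg_cone \<Longrightarrow> v v* M y \<in> nonneg_cone"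
  by (rule vm_cone) (auto simp: M_pos)

lemma Q_nth: "Q $ i $ j = (\<integral>y. M y $ i $ j \<partial>\<phi>)"
  by (simp add: signal_matrix_def)

lemma Q_nonneg: "0 \<le> Q $ i $ j"
  using Q_stochastic by (simp add: stochastic_def)

lemma Q_row_sum: "(\<Sum>j\<in>UNIV. Q $ i $ j) = 1"
  using Q_stochastic by (simp add: stochastic_def)

lemma integrable_vM_nth: "integrable \<phi> (\<lambda>y. (v v* M y) $ j)"
  unfolding vector_matrix_nth by (intro Bochner_Integration.integrable_sum integrable_mult_right M_int)

lemma integral_vM_nth: "(\<integral>y. (v v* M y) $ j \<partial>\<phi>) = (v v* Q) $ j"
  unfolding vector_matrix_nth Q_nth
  by (subst Bochner_Integration.integral_sum) (auto intro!: integrable_mult_right M_int)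

lemma integrable_vM_mass: "integrable \<phi> (\<lambda>y. mass (v v* M y))"
  unfolding mass_def by (intro Bochner_Integration.integrable_sum integrable_vM_nth)

lemma mass_vQ: "mass (v v* Q) = mass v"
proof -
  have "mass (v v* Q) = (\<Sum>i\<in>UNIV. \<Sum>j\<in>UNIV. v $ i * Q $ i $ j)"
    unfolding mass_def vector_matrix_nth by (rule sum.swap)
  also have "\<dots> = mass v"
    by (simp add: sum_distrib_left[symmetric] Q_row_sum mass_def)
  finally show ?thesis .
qed

lemma vQ_cone: "v \<in> nonneg_cone \<Longrightarrow> v v* Q \<in> nonneg_cone"
  by (rule vm_cone) (auto simp: Q_nonneg)

lemma vQ_simplex: "v \<in> prob_simplex \<Longrightarrow> v v* Q \<in> prob_simplex"
  by (simp add: simplex_iff vQ_cone mass_vQ)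

lemma step_nth: "step (\<lambda>v. v $ j) v = (v v* Q) $ j"
  by (simp add: step_def integral_vM_nth)

text \<open>Row sums of \<open>Q\<close> are one. This makes the density in
  \<open>filter_kernel\<close> a probability density, and it allows constants on the simplex to be
  handled as multiples of the homogeneous function \<open>mass\<close>.\<close>

lemma step_mass: "step mass v = mass v"
proof -
  have "step mass v = (\<Sum>j\<in>UNIV. \<integral>y. (v v* M y) $ j \<partial>\<phi>)"
    unfolding step_def mass_def
    by (rule Bochner_Integration.integral_sum) (rule integrable_vM_nth)
  also have "\<dots> = mass (v v* Q)" by (simp add: integral_vM_nth mass_def)
  finally show ?thesis by (simp add: mass_vQ)
qed

lemma integrable_step:
  assumes F: "hom_lip L F" and v: "v \<in> nonneg_cone"
  shows "integrable \<phi> (\<lambda>y. F (v v* M y))"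
proof (rule Bochner_Integration.integrable_bound)
  show "integrable \<phi> (\<lambda>y. L * mass (v v* M y))"
    by (intro integrable_mult_right integrable_vM_mass)
  show "(\<lambda>y. F (v v* M y)) \<in> borel_measurable \<phi>"
    using hom_lipD(2)[OF F] by measurable
  show "AE y in \<phi>. norm (F (v v* M y)) \<le> norm (L * mass (v v* M y))"
    using hom_lip_bound[OF F vM_cone[OF _ v]] by (intro AE_I2) (fastforce intro: order_trans)
qed

lemma step_mono:
  assumes "hom_lip L F" "hom_lip K G" "v \<in> nonneg_cone"
    and "\<And>u. u \<in> nonneg_cone \<Longrightarrow> F u \<le> G u"
  shows "step F v \<le> step G v"
  unfolding step_def using assms vM_cone
  by (intro integral_mono integrable_step) auto

lemma step_cong:
  assumes "v \<in> nonneg_cone" "\<And>u. u \<in> nonneg_cone \<Longrightarrow> F u = G u"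
  shows "step F v = step G v"
  unfolding step_def using assms vM_cone by (intro Bochner_Integration.integral_cong) auto

lemma step_add:
  assumes "hom_lip L F" "hom_lip K G" "v \<in> nonneg_cone"
  shows "step (\<lambda>u. F u + G u) v = step F v + step G v"
  unfolding step_def using assms by (intro Bochner_Integration.integral_add integrable_step)

lemma step_cmult: "step (\<lambda>u. c * F u) v = c * step F v"
  by (simp add: step_def)

text \<open>The constant does not grow: the absolute values of the coordinates of
  \<open>v - w\<close> are distributed by the nonnegative matrices \<open>M y\<close>, and
  integrating these gives \<open>Q\<close>, whose row sums are one, so exactly
  \<open>l1norm (v - w)\<close> comes back.\<close>

lemma hom_lip_step:
  assumes F: "hom_lip L F" shows "hom_lip L (step F)"
  unfolding hom_lip_def
proof (intro conjI ballI allI impI)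
  show "0 \<le> L" using F by (rule hom_lipD)
  have [measurable]: "F \<in> borel_measurable borel" using F by (rule hom_lipD)
  show "step F \<in> borel_measurable borel" unfolding step_def by measurable
  show "step F (c *\<^sub>R v) = c * step F v" if "0 \<le> c" "v \<in> nonneg_cone" for c v
  proof -
    have "step F (c *\<^sub>R v) = (\<integral>y. c * F (v v* M y) \<partial>\<phi>)"
      unfolding step_def using that hom_lipD(3)[OF F that(1) vM_cone[OF _ that(2)]]
      by (intro Bochner_Integration.integral_cong) (auto simp: scaleR_vector_matrix_assoc[symmetric])
    then show ?thesis by (simp add: step_def)
  qed
  fix v w :: "real ^ 'e" assume v: "v \<in> nonneg_cone" and w: "w \<in> nonneg_cone"
  have "\<bar>step F v - step F w\<bar> = \<bar>\<integral>y. F (v v* M y) - F (w v* M y) \<partial>\<phi>\<bar>"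
    unfolding step_def using integrable_step[OF F v] integrable_step[OF F w] by simp
  also have "\<dots> \<le> (\<integral>y. \<bar>F (v v* M y) - F (w v* M y)\<bar> \<partial>\<phi>)"
    by (rule integral_abs_bound)
  also have "\<dots> \<le> (\<integral>y. L * (\<Sum>j\<in>UNIV. \<Sum>i\<in>UNIV. \<bar>(v - w) $ i\<bar> * M y $ i $ j) \<partial>\<phi>)"
  proof (intro integral_mono)
    show "integrable \<phi> (\<lambda>y. \<bar>F (v v* M y) - F (w v* M y)\<bar>)"
      using integrable_step[OF F v] integrable_step[OF F w] by simp
    show "integrable \<phi> (\<lambda>y. L * (\<Sum>j\<in>UNIV. \<Sum>i\<in>UNIV. \<bar>(v - w) $ i\<bar> * M y $ i $ j))"
      by (intro integrable_mult_right Bochner_Integration.integrable_sum M_int)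
    fix y assume y: "y \<in> space \<phi>"
    have "\<bar>F (v v* M y) - F (w v* M y)\<bar> \<le> L * l1norm ((v - w) v* M y)"
      using hom_lipD(4)[OF F vM_cone[OF y v] vM_cone[OF y w]] by (simp add: vector_matrix_mult_diff_distrib)
    also have "\<dots> \<le> L * (\<Sum>j\<in>UNIV. \<Sum>i\<in>UNIV. \<bar>(v - w) $ i\<bar> * M y $ i $ j)"
      using hom_lipD(1)[OF F] by (intro mult_left_mono l1norm_vm_le) (auto simp: M_pos y)
    finally show "\<bar>F (v v* M y) - F (w v* M y)\<bar> \<le> L * (\<Sum>j\<in>UNIV. \<Sum>i\<in>UNIV. \<bar>(v - w) $ i\<bar> * M y $ i $ j)" .
  qed
  also have "\<dots> = L * (\<Sum>j\<in>UNIV. \<Sum>i\<in>UNIV. \<bar>(v - w) $ i\<bar> * Q $ i $ j)"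
    by (simp add: Q_nth M_int)
  also have "(\<Sum>j\<in>UNIV. \<Sum>i\<in>UNIV. \<bar>(v - w) $ i\<bar> * Q $ i $ j) = l1norm (v - w)"
    by (subst sum.swap) (simp add: sum_distrib_left[symmetric] Q_row_sum l1norm_def)
  finally show "\<bar>step F v - step F w\<bar> \<le> L * l1norm (v - w)" .
qed

lemma hom_lip_steps: "hom_lip L F \<Longrightarrow> hom_lip L ((step ^^ n) F)"
  by (induction n) (auto intro: hom_lip_step)

lemma steps_mass: "(step ^^ n) mass = mass"
  by (induction n) (simp_all add: step_mass[abs_def])

lemma steps_mono:
  assumes "hom_lip L F" "hom_lip K G" "v \<in> nonneg_cone"
    and "\<And>u. u \<in> nonneg_cone \<Longrightarrow> F u \<le> G u"
  shows "(step ^^ n) F v \<le> (step ^^ n) G v"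
  using assms(3)
proof (induction n arbitrary: v)
  case (Suc n)
  have "step ((step ^^ n) F) v \<le> step ((step ^^ n) G) v"
    by (rule step_mono[OF hom_lip_steps[OF assms(1)] hom_lip_steps[OF assms(2)] Suc.prems Suc.IH])
  then show ?case by simp
qed (use assms(4) in simp)

text \<open>Identities between homogeneous functions hold on the cone only and cannot be rewritten
  under the iterates; this lemma replaces such rewriting.\<close>

lemma steps_cong:
  assumes "v \<in> nonneg_cone" "\<And>u. u \<in> nonneg_cone \<Longrightarrow> F u = G u"
  shows "(step ^^ n) F v = (step ^^ n) G v"
  using assms(1)
  by (induction n arbitrary: v) (auto simp: assms(2) intro: step_cong)

lemma steps_add:
  assumes "hom_lip L F" "hom_lip K G" "v \<in> nonneg_cone"
  shows "(step ^^ n) (\<lambda>u. F u + G u) v = (step ^^ n) F v + (step ^^ n) G v"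
  using assms(3)
proof (induction n arbitrary: v)
  case (Suc n)
  have "step ((step ^^ n) (\<lambda>u. F u + G u)) v = step (\<lambda>u. (step ^^ n) F u + (step ^^ n) G u) v"
    using Suc by (intro step_cong) auto
  also have "\<dots> = step ((step ^^ n) F) v + step ((step ^^ n) G) v"
    by (rule step_add[OF hom_lip_steps[OF assms(1)] hom_lip_steps[OF assms(2)] Suc.prems])
  finally show ?case by simp
qed simp

lemma steps_cmult: "(step ^^ n) (\<lambda>u. c * F u) = (\<lambda>v. c * (step ^^ n) F v)"
  by (induction n) (auto simp: step_cmult[abs_def])

lemma steps_sum:
  assumes F: "\<And>i. i \<in> I \<Longrightarrow> hom_lip L (F i)" and v: "v \<in> nonneg_cone"
  shows "(step ^^ n) (\<lambda>u. \<Sum>i\<in>I. c i * F i u) v = (\<Sum>i\<in>I. c i * (step ^^ n) (F i) v)"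
  using F
proof (induction I rule: infinite_finite_induct)
  case (insert i I)
  have "hom_lip ((\<Sum>i\<in>I. \<bar>c i\<bar>) * L) (\<lambda>u. \<Sum>i\<in>I. c i * F i u)"
    by (rule hom_lip_sum[OF insert.hyps(1) hom_lipD(1)[OF insert.prems[of i]]]) (use insert.prems in auto)
  then have "(step ^^ n) (\<lambda>u. c i * F i u + (\<Sum>i\<in>I. c i * F i u)) v
      = (step ^^ n) (\<lambda>u. c i * F i u) v + (step ^^ n) (\<lambda>u. \<Sum>i\<in>I. c i * F i u) v"
    using hom_lip_cmult[of L "F i" "c i"] insert.prems v by (intro steps_add) auto
  then show ?case using insert by (simp add: steps_cmult)
\<comment> \<open>An empty or infinite sum is the zero function, read as \<open>0\<close> times
  \<open>mass\<close>.\<close>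
qed (use steps_cmult[of n 0 mass] in \<open>simp_all add: fun_eq_iff\<close>)

text \<open>On linear functions the operator is the signal matrix: one step turns a coordinate into
  the linear form given by a column of \<open>Q\<close>. The induction needs all coordinates
  \<open>j\<close> at once to expand that form.\<close>

lemma steps_nth: "v \<in> nonneg_cone \<Longrightarrow> (step ^^ n) (\<lambda>v. v $ j) v = (v v* mat_power Q n) $ j"
proof (induction n arbitrary: v j)
  case (Suc n)
  have "(step ^^ Suc n) (\<lambda>v. v $ j) v = (step ^^ n) (step (\<lambda>v. v $ j)) v"
    by (simp add: funpow_Suc_right del: funpow.simps)
  also have "\<dots> = (step ^^ n) (\<lambda>v. \<Sum>i\<in>UNIV. Q $ i $ j * v $ i) v"
    using Suc.prems by (intro steps_cong) (simp_all add: step_nth vector_matrix_nth mult.commute)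
  also have "\<dots> = (\<Sum>i\<in>UNIV. Q $ i $ j * (step ^^ n) (\<lambda>v. v $ i) v)"
    by (rule steps_sum[OF hom_lip_nth Suc.prems])
  also have "\<dots> = (v v* mat_power Q (Suc n)) $ j"
    by (simp add: Suc mat_power_def vector_matrix_mul_assoc[symmetric] vector_matrix_nth mult.commute)
  finally show ?case .
qed (simp add: mat_power_def)

lemma steps_nonneg:
  assumes "hom_lip L F" "\<And>u. u \<in> nonneg_cone \<Longrightarrow> 0 \<le> F u" "v \<in> nonneg_cone"
  shows "0 \<le> (step ^^ n) F v"
proof -
  have "(step ^^ n) (\<lambda>u. 0 * mass u) v \<le> (step ^^ n) F v"
    by (rule steps_mono[OF hom_lip_cmult[OF hom_lip_mass] assms(1,3)]) (simp add: assms(2))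
  then show ?thesis unfolding steps_cmult by simp
qed

lemma step_sublinear:
  assumes F: "hom_lip L F" and v: "v \<in> nonneg_cone" "w \<in> nonneg_cone"
    and sub: "\<And>v w. v \<in> nonneg_cone \<Longrightarrow> w \<in> nonneg_cone \<Longrightarrow> F (v + w) \<le> F v + F w"
  shows "step F (v + w) \<le> step F v + step F w"
proof -
  have "step F (v + w) \<le> (\<integral>y. F (v v* M y) + F (w v* M y) \<partial>\<phi>)"
    unfolding step_def vector_matrix_left_distrib
  proof (intro integral_mono)
    show "integrable \<phi> (\<lambda>y. F (v v* M y + w v* M y))"
      using integrable_step[OF F add_cone[OF v]] by (simp add: vector_matrix_left_distrib)
  qed (use sub vM_cone v in \<open>auto intro!: integrable_step[OF F]\<close>)
  then show ?thesis using v by (simp add: step_def integrable_step[OF F])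
qed

lemma steps_sublinear:
  assumes "hom_lip L F" "v \<in> nonneg_cone" "w \<in> nonneg_cone"
    and "\<And>v w. v \<in> nonneg_cone \<Longrightarrow> w \<in> nonneg_cone \<Longrightarrow> F (v + w) \<le> F v + F w"
  shows "(step ^^ n) F (v + w) \<le> (step ^^ n) F v + (step ^^ n) F w"
  using assms(2,3)
proof (induction n arbitrary: v w)
  case (Suc n)
  then show ?case using step_sublinear[OF hom_lip_steps[OF assms(1), of n]] by simp
qed (use assms(4) in simp)

subsection \<open>Measures on the simplex\<close>

lemma filter_density:
  assumes "\<mu> \<in> prob_simplex"
  shows "density \<phi> (\<lambda>y. ennreal (mass (\<mu> v* M y))) \<in> space (prob_algebra \<phi>)"
proof -
  have "(\<integral>\<^sup>+ y. ennreal (mass (\<mu> v* M y)) \<partial>\<phi>) = ennreal (step mass \<mu>)"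
    unfolding step_def using assms simplex_cone vM_cone mass_nonneg
    by (intro nn_integral_eq_integral integrable_vM_mass AE_I2) blast
  also have "\<dots> = 1" using assms by (simp add: step_mass simplex_iff)
  finally show ?thesis
    by (auto simp: space_prob_algebra emeasure_density cong: nn_integral_cong intro!: prob_spaceI)
qed

lemma filter_map_measurable:
  "(\<lambda>(\<mu>, y). if mass (\<mu> v* M y) = 0 then \<mu> else normalized (\<mu> v* M y))
     \<in> simplex_borel \<Otimes>\<^sub>M \<phi> \<rightarrow>\<^sub>M simplex_borel"
proof -
  have [measurable]: "fst \<in> simplex_borel \<Otimes>\<^sub>M \<phi> \<rightarrow>\<^sub>M borel"
    unfolding simplex_borel_def using measurable_compose[OF measurable_fst measurable_restrict_space1[OF measurable_ident]] by simp
  have "(\<lambda>x. if mass (fst x v* M (snd x)) = 0 then fst x else normalized (fst x v* M (snd x)))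
     \<in> simplex_borel \<Otimes>\<^sub>M \<phi> \<rightarrow>\<^sub>M borel" by measurable
  moreover have "normalized (\<mu> v* M y) \<in> prob_simplex"
    if "\<mu> \<in> prob_simplex" "y \<in> space \<phi>" "mass (\<mu> v* M y) \<noteq> 0" for \<mu> y
    using that by (intro normalized_simplex vM_cone simplex_cone)
  ultimately show ?thesis
    by (subst (2) simplex_borel_def, intro measurable_restrict_space2)
      (auto simp: space_pair_measure space_simplex_borel split_beta)
qed

lemma filter_kernel_measurable: "filter_kernel \<phi> M \<in> simplex_borel \<rightarrow>\<^sub>M prob_algebra simplex_borel"
proof -
  have "(\<lambda>\<mu>. density \<phi> (\<lambda>y. ennreal (mass (\<mu> v* M y)))) \<in> simplex_borel \<rightarrow>\<^sub>M prob_algebra \<phi>"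
  proof (intro measurable_prob_algebraI measurable_subprob_algebra)
    fix A assume [measurable]: "A \<in> sets \<phi>"
    have [measurable]: "(\<lambda>x. x) \<in> borel_measurable simplex_borel"
      unfolding simplex_borel_def by (rule measurable_restrict_space1) simp
    have "(\<lambda>\<mu>. \<integral>\<^sup>+y. ennreal (mass (\<mu> v* M y)) * indicator A y \<partial>\<phi>) \<in> borel_measurable simplex_borel"
      by measurable
    then show "(\<lambda>\<mu>. emeasure (density \<phi> (\<lambda>y. ennreal (mass (\<mu> v* M y)))) A) \<in> borel_measurable simplex_borel"
      by (simp add: emeasure_density)
  qed (use filter_density in \<open>auto simp: space_prob_algebra space_simplex_borel prob_space_imp_subprob_space\<close>)
  then show ?thesis
    unfolding filter_kernel_def[abs_def]
    by (rule measurable_distr_prob_space2[OF _ filter_map_measurable])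
qed

text \<open>The density \<open>mass (\<mu> v* M y)\<close> multiplies \<open>F\<close> at the
  normalized vector, and homogeneity turns the product into \<open>F (\<mu> v* M y)\<close>. Where
  the mass is zero both sides vanish, whatever default value the kernel takes there.\<close>

lemma integral_filter_kernel:
  assumes F: "hom_lip L F" and \<mu>: "\<mu> \<in> prob_simplex"
  shows "(\<integral>\<nu>. F \<nu> \<partial>filter_kernel \<phi> M \<mu>) = step F \<mu>"
proof -
  let ?g = "\<lambda>y. if mass (\<mu> v* M y) = 0 then \<mu> else normalized (\<mu> v* M y)"
  have [measurable]: "F \<in> borel_measurable borel" using F by (rule hom_lipD)
  have Fs: "F \<in> borel_measurable simplex_borel"
    unfolding simplex_borel_def by (rule measurable_restrict_space1) measurable
  have g: "?g \<in> density \<phi> (\<lambda>y. ennreal (mass (\<mu> v* M y))) \<rightarrow>\<^sub>M simplex_borel"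
    using measurable_compose[OF measurable_Pair1' filter_map_measurable, of \<mu>] \<mu>
    by (simp add: space_simplex_borel)
  have "(\<integral>\<nu>. F \<nu> \<partial>filter_kernel \<phi> M \<mu>) = (\<integral>y. F (?g y) \<partial>density \<phi> (\<lambda>y. ennreal (mass (\<mu> v* M y))))"
    unfolding filter_kernel_def by (rule integral_distr[OF g Fs])
  also have "\<dots> = (\<integral>y. mass (\<mu> v* M y) *\<^sub>R F (?g y) \<partial>\<phi>)"
  proof (intro integral_density)
    show "AE y in \<phi>. 0 \<le> mass (\<mu> v* M y)"
      using \<mu> by (intro AE_I2 mass_nonneg vM_cone simplex_cone)
  qed measurable
  also have "\<dots> = step F \<mu>" unfolding step_def
  proof (intro Bochner_Integration.integral_cong refl)
    fix y assume "y \<in> space \<phi>"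
    then have c: "\<mu> v* M y \<in> nonneg_cone" using \<mu> by (intro vM_cone simplex_cone)
    then show "mass (\<mu> v* M y) *\<^sub>R F (?g y) = F (\<mu> v* M y)"
      using hom_lip_normalized[OF F c] by auto
  qed
  finally show ?thesis .
qed

lemma hom_lip_integrable:
  assumes F: "hom_lip L F" and N: "N \<in> simplex_laws"
  shows "integrable N F"
proof -
  have s: "sets N = sets simplex_borel" "space N = prob_simplex" and "prob_space N"
    using N sets_eq_imp_space_eq[of N simplex_borel] by (auto simp: space_prob_algebra space_simplex_borel)
  then interpret N: prob_space N by simp
  have "F \<in> borel_measurable simplex_borel"
    unfolding simplex_borel_def using hom_lipD(2)[OF F] by (rule measurable_restrict_space1)
  then have "F \<in> borel_measurable N" using s(1) by (simp cong: measurable_cong_sets)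
  then show ?thesis
    using hom_lip_bound[OF F] s(2)
    by (intro N.integrable_const_bound[of _ L]) (fastforce intro!: AE_I2 simp: simplex_iff)+
qed

lemma filter_step_prob: "N \<in> simplex_laws \<Longrightarrow> filter_step \<phi> M N \<in> simplex_laws"
  unfolding filter_step_def
  using prob_space_bind'[OF _ filter_kernel_measurable] sets_bind'[OF _ filter_kernel_measurable]
  by (auto simp: space_prob_algebra)

lemma filter_steps_prob:
  "N \<in> simplex_laws \<Longrightarrow> (filter_step \<phi> M ^^ n) N \<in> simplex_laws"
  by (induction n) (auto intro: filter_step_prob)

lemma integral_filter_step:
  assumes F: "hom_lip L F" and N: "N \<in> simplex_laws"
  shows "(\<integral>\<nu>. F \<nu> \<partial>filter_step \<phi> M N) = (\<integral>\<mu>. step F \<mu> \<partial>N)"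
proof -
  have s: "sets N = sets simplex_borel" "space N = prob_simplex" and "prob_space N"
    using N sets_eq_imp_space_eq[of N simplex_borel] by (auto simp: space_prob_algebra space_simplex_borel)
  then interpret N: prob_space N by simp
  have k: "filter_kernel \<phi> M \<in> N \<rightarrow>\<^sub>M subprob_algebra simplex_borel"
    using measurable_prob_algebraD[OF filter_kernel_measurable] s(1) by (simp cong: measurable_cong_sets)
  have Fs: "F \<in> borel_measurable simplex_borel"
    unfolding simplex_borel_def using hom_lipD(2)[OF F] by (rule measurable_restrict_space1)
  have "(\<integral>\<nu>. F \<nu> \<partial>filter_step \<phi> M N) = (\<integral>\<mu>. \<integral>\<nu>. F \<nu> \<partial>filter_kernel \<phi> M \<mu> \<partial>N)"
    unfolding filter_step_def
  proof (rule integral_bind[OF Fs _ k])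
    show "\<bar>F x\<bar> \<le> L" if "x \<in> space simplex_borel" for x
      using hom_lip_bound[OF F, of x] that by (simp add: space_simplex_borel simplex_iff)
    show "finite_measure N" by unfold_locales
    show "AE x in N. emeasure (filter_kernel \<phi> M x) (space (filter_kernel \<phi> M x)) \<le> ennreal 1"
      using measurable_space[OF filter_kernel_measurable] s(2)
      by (intro AE_I2) (auto simp: space_simplex_borel space_prob_algebra prob_space.emeasure_space_1)
  qed
  also have "\<dots> = (\<integral>\<mu>. step F \<mu> \<partial>N)"
    using s(2) by (intro Bochner_Integration.integral_cong) (auto simp: integral_filter_kernel[OF F])
  finally show ?thesis .
qed

text \<open>Duality of kernel and operator. Each step is moved from the measure onto the function,
  so the induction generalizes over \<open>F\<close>.\<close>

lemma integral_filter_steps: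
  assumes F: "hom_lip L F" and N: "N \<in> simplex_laws"
  shows "(\<integral>\<nu>. F \<nu> \<partial>(filter_step \<phi> M ^^ n) N) = (\<integral>\<mu>. (step ^^ n) F \<mu> \<partial>N)"
  using F
proof (induction n arbitrary: F)
  case (Suc n)
  have "(\<integral>\<nu>. F \<nu> \<partial>(filter_step \<phi> M ^^ Suc n) N) = (\<integral>\<mu>. step F \<mu> \<partial>(filter_step \<phi> M ^^ n) N)"
    using integral_filter_step[OF Suc.prems filter_steps_prob[OF N, of n]] by simp
  also have "\<dots> = (\<integral>\<mu>. (step ^^ n) (step F) \<mu> \<partial>N)"
    by (rule Suc.IH[OF hom_lip_step[OF Suc.prems]])
  finally show ?case by (simp add: funpow_Suc_right del: funpow.simps)
qed simp

end

section \<open>Invariant vectors of the signal\<close>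

text \<open>\<open>mat_prod\<close> appends factors on the right, whereas \<open>step\<close>
  integrates out the first letter; inductions over words need this decomposition.\<close>

lemma mat_prod_Suc_shift: "mat_prod A (Suc n) = A 0 ** mat_prod (\<lambda>k. A (Suc k)) n"
  by (induction n) (simp_all add: matrix_mul_assoc)

lemma mat_prod_nonneg: "(\<And>k i j. k < n \<Longrightarrow> 0 \<le> A k $ i $ j) \<Longrightarrow> 0 \<le> mat_prod A n $ i $ j"
  by (induction n arbitrary: i j) (auto simp: mat_def matrix_matrix_mult_def intro!: sum_nonneg)

context filter_model
begin

abbreviation word :: "(nat \<Rightarrow> 'f) \<Rightarrow> nat \<Rightarrow> real ^ 'e ^ 'e" where
  "word y n \<equiv> mat_prod (\<lambda>k. M (y k)) n"

lemma Q_power_nonneg: "0 \<le> mat_power Q n $ i $ j"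
  unfolding mat_power_def by (rule mat_prod_nonneg) (rule Q_nonneg)

lemma axis_vm_nth: "(axis i 1 v* A) $ j = A $ i $ j"
  by (simp add: vector_matrix_nth axis_def if_distrib[of "\<lambda>x. x * _"] cong: if_cong)

lemma Q_power_row_sum: "(\<Sum>j\<in>UNIV. mat_power Q n $ i $ j) = 1"
proof -
  have "(\<Sum>j\<in>UNIV. mat_power Q n $ i $ j) = mass (axis i 1 v* mat_power Q n)"
    by (simp add: mass_def axis_vm_nth)
  also have "\<dots> = 1"
  proof (induction n)
    case 0
    then show ?case using axis_simplex[of i] by (simp add: mat_power_def simplex_iff)
  next
    case (Suc n)
    then show ?case by (simp add: mat_power_def vector_matrix_mul_assoc[symmetric] mass_vQ)
  qed
  finally show ?thesis .
qed

lemma stationary_power: "\<mu> v* Q = \<mu> \<Longrightarrow> \<mu> v* mat_power Q n = \<mu>"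
  by (induction n) (simp_all add: mat_power_def vector_matrix_mul_assoc[symmetric])

text \<open>The coordinate \<open>w $ j\<close> is a sum of nonnegative terms
  \<open>w $ i * mat_power Q n $ i $ j\<close>, so all of them vanish; irreducibility leads to
  \<open>j\<close> from every \<open>i\<close>.\<close>

lemma stationary_zero:
  assumes w: "w \<in> nonneg_cone" and inv: "w v* Q = w" and z: "w $ j = 0"
  shows "w = 0"
proof -
  have "w $ i = 0" for i
  proof -
    obtain n where n: "mat_power Q n $ i $ j > 0"
      using Q_irreducible unfolding irreducible_mat_def by blast
    have "(\<Sum>i\<in>UNIV. w $ i * mat_power Q n $ i $ j) = 0"
      using stationary_power[OF inv, of n] z by (simp add: vector_matrix_nth[symmetric])
    then have "w $ i * mat_power Q n $ i $ j = 0"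
      using w Q_power_nonneg by (simp add: sum_nonneg_eq_0_iff nonneg_cone_def)
    then show ?thesis using n by simp
  qed
  then show ?thesis by (simp add: vec_eq_iff)
qed

lemma stationary_pos:
  assumes "\<mu> \<in> prob_simplex" "\<mu> v* Q = \<mu>" shows "0 < \<mu> $ i"
proof (rule ccontr)
  assume "\<not> 0 < \<mu> $ i"
  then have "\<mu> = 0"
    using assms by (intro stationary_zero[of _ i]) (auto simp: prob_simplex_def nonneg_cone_def antisym not_less)
  then show False using assms by (simp add: simplex_iff)
qed

text \<open>Subtract the largest multiple of \<open>\<nu>\<close> that keeps \<open>\<mu>\<close> in
  the cone. The difference is invariant and has a zero coordinate, hence vanishes.\<close>

lemma stationary_unique:
  assumes \<mu>: "\<mu> \<in> prob_simplex" "\<mu> v* Q = \<mu>" and \<nu>: "\<nu> \<in> prob_simplex" "\<nu> v* Q = \<nu>"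
  shows "\<mu> = \<nu>"
proof -
  define t where "t = (MIN i. \<mu> $ i / \<nu> $ i)"
  have "t \<in> range (\<lambda>i. \<mu> $ i / \<nu> $ i)" unfolding t_def by (rule Min_in) auto
  then obtain j where j: "t = \<mu> $ j / \<nu> $ j" by auto
  have le: "t \<le> \<mu> $ i / \<nu> $ i" for i unfolding t_def by simp
  have pos: "0 < \<nu> $ i" for i using \<nu> by (rule stationary_pos)
  have "\<mu> - t *\<^sub>R \<nu> = 0"
  proof (rule stationary_zero)
    show "\<mu> - t *\<^sub>R \<nu> \<in> nonneg_cone"
      using le pos by (simp add: nonneg_cone_def pos_le_divide_eq)
    show "(\<mu> - t *\<^sub>R \<nu>) v* Q = \<mu> - t *\<^sub>R \<nu>"
      using \<mu> \<nu> by (simp add: vector_matrix_mult_diff_distrib scaleR_vector_matrix_assoc)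
    show "(\<mu> - t *\<^sub>R \<nu>) $ j = 0" using pos[of j] by (simp add: j)
  qed
  then have *: "\<mu> = t *\<^sub>R \<nu>" by simp
  then have "t = 1" using \<mu>(1) \<nu>(1) by (simp add: simplex_iff mass_scaleR)
  then show ?thesis using * by simp
qed

section \<open>An invariant sublinear function\<close>

text \<open>Jensen's inequality over the possibly infinite measure \<open>\<phi>\<close>: for a
  sublinear function homogeneity takes the place of normalization. Stated as an integral inequality
  it passes to \<open>step F\<close> by Fubini.\<close>

definition jensen :: "(real ^ 'e \<Rightarrow> real) \<Rightarrow> bool" where
  "jensen F \<longleftrightarrow> (\<forall>w. integrable \<phi> w \<longrightarrow> (\<forall>z\<in>space \<phi>. w z \<in> nonneg_cone) \<longrightarrow>
     F (\<integral>z. w z \<partial>\<phi>) \<le> (\<integral>z. F (w z) \<partial>\<phi>))"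

lemma bounded_linear_vm: "bounded_linear (\<lambda>v :: real ^ 'e. v v* A)"
  unfolding linear_conv_bounded_linear[symmetric]
  by (rule linearI) (simp_all add: vector_matrix_left_distrib scaleR_vector_matrix_assoc)

lemma integral_nth: "integrable \<phi> w \<Longrightarrow> (\<integral>z. w z \<partial>\<phi>) $ j = (\<integral>z. w z $ j \<partial>\<phi>)" for w :: "'f \<Rightarrow> real ^ 'b::finite"
  using integral_bounded_linear[OF bounded_linear_vec_nth, of \<phi> w j] by simp

lemma integrable_nth: "integrable \<phi> w \<Longrightarrow> integrable \<phi> (\<lambda>z. w z $ j)" for w :: "'f \<Rightarrow> real ^ 'b::finite"
  by (rule integrable_bounded_linear[OF bounded_linear_vec_nth])

lemma integral_cone:
  assumes "integrable \<phi> w" "\<And>z. z \<in> space \<phi> \<Longrightarrow> w z \<in> nonneg_cone"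
  shows "(\<integral>z. w z \<partial>\<phi>) \<in> nonneg_cone"
  using assms by (auto simp: nonneg_cone_def integral_nth intro!: integral_nonneg)

lemma jensen_norm: "jensen norm"
  unfolding jensen_def by simp

text \<open>For fixed \<open>y\<close> the inequality is applied to the image of \<open>w\<close>
  under \<open>M y\<close>, and Fubini exchanges the integrals. Most of the proof supplies
  integrability on the product, by domination with \<open>L * mass\<close>, whose inner integral is
  known from \<open>step_mass\<close>.\<close>

lemma jensen_step:
  assumes F: "hom_lip L F" and J: "jensen F"
  shows "jensen (step F)"
  unfolding jensen_def
proof (intro allI impI)
  fix w :: "'f \<Rightarrow> real ^ 'e"
  assume w: "integrable \<phi> w" "\<forall>z\<in>space \<phi>. w z \<in> nonneg_cone"
  have wm [measurable]: "w \<in> borel_measurable \<phi>" using w(1) by simp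
  have [measurable]: "F \<in> borel_measurable borel" using F by (rule hom_lipD)
  interpret pair_sigma_finite \<phi> \<phi> ..
  have wc: "w z v* M y \<in> nonneg_cone" if "z \<in> space \<phi>" "y \<in> space \<phi>" for z y
    using that w(2) vM_cone by blast
  have wi: "integrable \<phi> (\<lambda>z. w z v* A)" for A
    by (rule integrable_bounded_linear[OF bounded_linear_vm w(1)])
  have int: "integrable (\<phi> \<Otimes>\<^sub>M \<phi>) (\<lambda>(z, y). F (w z v* M y))"
  proof (rule Bochner_Integration.integrable_bound)
    show "integrable (\<phi> \<Otimes>\<^sub>M \<phi>) (\<lambda>(z, y). L * mass (w z v* M y))"
    proof (rule Fubini_integrable)
      show "AE z in \<phi>. integrable \<phi> (\<lambda>y. case (z, y) of (z, y) \<Rightarrow> L * mass (w z v* M y))"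
        by (auto intro!: integrable_vM_mass)
      have "integrable \<phi> (\<lambda>z. L * mass (w z))"
        unfolding mass_def by (intro integrable_mult_right Bochner_Integration.integrable_sum integrable_nth w)
      then show "integrable \<phi> (\<lambda>z. \<integral>y. norm (case (z, y) of (z, y) \<Rightarrow> L * mass (w z v* M y)) \<partial>\<phi>)"
      proof (rule Bochner_Integration.integrable_cong[THEN iffD1, rotated 2])
        fix z assume z: "z \<in> space \<phi>"
        have "(\<integral>y. norm (L * mass (w z v* M y)) \<partial>\<phi>) = (\<integral>y. L * mass (w z v* M y) \<partial>\<phi>)"
          using mass_nonneg[OF wc[OF z]] hom_lipD(1)[OF F]
          by (intro Bochner_Integration.integral_cong) auto
        then show "L * mass (w z) = (\<integral>y. norm (case (z, y) of (z, y) \<Rightarrow> L * mass (w z v* M y)) \<partial>\<phi>)"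
          using step_mass[of "w z"] by (simp add: step_def)
      qed simp
    qed measurable
    show "AE x in \<phi> \<Otimes>\<^sub>M \<phi>. norm (case x of (z, y) \<Rightarrow> F (w z v* M y)) \<le> norm (case x of (z, y) \<Rightarrow> L * mass (w z v* M y))"
    proof (intro AE_I2)
      fix x assume "x \<in> space (\<phi> \<Otimes>\<^sub>M \<phi>)"
      then have "w (fst x) v* M (snd x) \<in> nonneg_cone"
        by (auto simp: space_pair_measure intro: wc)
      from hom_lip_bound[OF F this]
      show "norm (case x of (z, y) \<Rightarrow> F (w z v* M y)) \<le> norm (case x of (z, y) \<Rightarrow> L * mass (w z v* M y))"
        by (simp add: split_beta)
    qed
  qed measurable
  have "step F (\<integral>z. w z \<partial>\<phi>) \<le> (\<integral>y. (\<integral>z. F (w z v* M y) \<partial>\<phi>) \<partial>\<phi>)"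
    unfolding step_def
  proof (rule integral_mono)
    show "integrable \<phi> (\<lambda>y. F ((\<integral>z. w z \<partial>\<phi>) v* M y))"
      using w by (intro integrable_step[OF F] integral_cone) auto
    show "integrable \<phi> (\<lambda>y. \<integral>z. F (w z v* M y) \<partial>\<phi>)"
      by (rule integrable_snd[OF int])
    fix y assume y: "y \<in> space \<phi>"
    have "(\<integral>z. w z \<partial>\<phi>) v* M y = (\<integral>z. w z v* M y \<partial>\<phi>)"
      using integral_bounded_linear[OF bounded_linear_vm w(1), of "M y"] by simp
    then show "F ((\<integral>z. w z \<partial>\<phi>) v* M y) \<le> (\<integral>z. F (w z v* M y) \<partial>\<phi>)"
      using J[unfolded jensen_def, rule_format, OF wi[of "M y"]] wc y by simp
  qed
  also have "\<dots> = (\<integral>z. step F (w z) \<partial>\<phi>)"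
    unfolding step_def by (rule Fubini_integral[OF int])
  finally show "step F (\<integral>z. w z \<partial>\<phi>) \<le> (\<integral>z. step F (w z) \<partial>\<phi>)" .
qed

lemma jensen_steps: "jensen ((step ^^ n) norm)"
  by (induction n) (auto intro: jensen_norm jensen_step hom_lip_steps hom_lip_norm)

text \<open>\<open>v v* Q\<close> is the \<open>\<phi>\<close>-integral of
  \<open>v v* M y\<close>.\<close>

lemma jensen_vQ:
  assumes "jensen F" "v \<in> nonneg_cone" shows "F (v v* Q) \<le> step F v"
proof -
  have i: "integrable \<phi> (\<lambda>y. v v* M y)"
  proof (rule Bochner_Integration.integrable_bound)
    show "integrable \<phi> (\<lambda>y. mass (v v* M y))" by (rule integrable_vM_mass)
    show "AE y in \<phi>. norm (v v* M y) \<le> norm (mass (v v* M y))"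
    proof (intro AE_I2)
      fix y assume "y \<in> space \<phi>"
      from vM_cone[OF this assms(2)] show "norm (v v* M y) \<le> norm (mass (v v* M y))"
        using norm_le_l1norm[of "v v* M y"] by (simp add: l1norm_cone)
    qed
  qed measurable
  have "(\<integral>y. v v* M y \<partial>\<phi>) = v v* Q"
    by (simp add: vec_eq_iff integral_nth[OF i] integral_vM_nth)
  then show ?thesis using assms i vM_cone unfolding jensen_def step_def by metis
qed

definition average :: "(real ^ 'e \<Rightarrow> real) \<Rightarrow> nat \<Rightarrow> real ^ 'e \<Rightarrow> real" where
  "average F n v = (\<Sum>k=1..n. (1 / real n) * (step ^^ k) F v)"

lemma hom_lip_average:
  assumes "hom_lip L F" shows "hom_lip L (average F n)"
proof -
  have "hom_lip ((\<Sum>k=1..n. \<bar>1 / real n\<bar>) * L) (\<lambda>v. \<Sum>k=1..n. (1 / real n) * (step ^^ k) F v)"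
    by (rule hom_lip_sum) (use assms in \<open>auto intro: hom_lip_steps hom_lipD(1)\<close>)
  moreover have "(\<Sum>k=1..n. \<bar>1 / real n\<bar>) * L \<le> L"
    using hom_lipD(1)[OF assms] by (cases "n = 0") auto
  ultimately show ?thesis unfolding average_def[abs_def] by (rule hom_lip_mono)
qed

text \<open>One step moves the time window from 1..n to 2..n+1, so only the two boundary terms
  change.\<close>

lemma step_average:
  assumes F: "hom_lip L F" and v: "v \<in> nonneg_cone"
  shows "step (average F n) v = average F n v + (1 / real n) * ((step ^^ Suc n) F v - step F v)"
proof -
  have "step (average F n) v = (\<Sum>k=1..n. (1 / real n) * step ((step ^^ k) F) v)"
    using steps_sum[OF hom_lip_steps[OF F] v, of 1 "\<lambda>_. 1 / real n" id "{1..n}"]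
    by (simp add: average_def[abs_def])
  also have "\<dots> = (1 / real n) * (\<Sum>k=1..n. (step ^^ Suc k) F v)"
    by (simp add: sum_distrib_left)
  also have "(\<Sum>k=1..n. (step ^^ Suc k) F v) = (\<Sum>k=1..n. (step ^^ k) F v) + ((step ^^ Suc n) F v - step F v)"
    by (induction n) auto
  also have "(1 / real n) * \<dots> = average F n v + (1 / real n) * ((step ^^ Suc n) F v - step F v)"
    by (simp add: average_def sum_distrib_left distrib_left)
  finally show ?thesis .
qed

text \<open>The averages are bounded and equi-Lipschitz on the simplex, so Arzela-Ascoli yields a
  subsequential limit, which homogeneity carries to the cone. Invariance holds because one step
  changes an average by O(1/n); the last property is Jensen's inequality with the same
  error.\<close>

lemma invariant_function_exists:
  obtains f k where "hom_lip 1 f" "strict_mono (k :: nat \<Rightarrow> nat)"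
    "\<And>v. v \<in> nonneg_cone \<Longrightarrow> (\<lambda>n. average norm (k n) v) \<longlonglongrightarrow> f v"
    "\<And>v. v \<in> nonneg_cone \<Longrightarrow> step f v = f v"
    "\<And>v w. v \<in> nonneg_cone \<Longrightarrow> w \<in> nonneg_cone \<Longrightarrow> f (v + w) \<le> f v + f w"
    "\<And>v. v \<in> nonneg_cone \<Longrightarrow> f (v v* Q) \<le> f v"
proof -
  note hl = hom_lip_average[OF hom_lip_norm]
  have bnd: "norm (average norm n v) \<le> 1" if "v \<in> prob_simplex" for n v
    using hom_lip_bound[OF hl, of v n] that by (simp add: simplex_iff)
  have equi: "\<exists>d. 0 < d \<and> (\<forall>n y. y \<in> prob_simplex \<and> norm (x - y) < d \<longrightarrow> norm (average norm n x - average norm n y) < e)"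
    if "x \<in> prob_simplex" "0 < e" for x :: "real ^ 'e" and e
  proof (intro exI conjI allI impI)
    \<comment> \<open>\<open>CARD('e)\<close> converts the Euclidean distance of Arzela-Ascoli into
      the \<open>l1norm\<close>.\<close>
    show "0 < e / real CARD('e)" using that by simp
    fix n y assume y: "y \<in> prob_simplex \<and> norm (x - y) < e / real CARD('e)"
    have "norm (average norm n x - average norm n y) \<le> l1norm (x - y)"
      using hom_lipD(4)[OF hl, of x y n] that y by (simp add: simplex_cone)
    also have "\<dots> < e"
      using l1norm_le_norm[of "x - y"] y by (simp add: field_simps)
    finally show "norm (average norm n x - average norm n y) < e" .
  qed
  obtain g and k :: "nat \<Rightarrow> nat" where k: "strict_mono k"
    and g: "\<And>e. 0 < e \<Longrightarrow> \<exists>N. \<forall>n x. n \<ge> N \<and> x \<in> prob_simplex \<longrightarrow> norm (average norm (k n) x - g x) < e"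
    using Arzela_Ascoli[OF compact_simplex bnd equi] by metis
  \<comment> \<open>A pointwise \<open>lim\<close> is Borel on the whole space, as
    \<open>hom_lip\<close> demands; on the cone it is the homogeneous extension of
    \<open>g\<close>.\<close>
  define f where "f v = lim (\<lambda>n. average norm (k n) v)" for v
  have lim_simplex: "(\<lambda>n. average norm (k n) v) \<longlonglongrightarrow> g v" if "v \<in> prob_simplex" for v
    unfolding LIMSEQ_iff using g that by blast
  have lim: "(\<lambda>n. average norm (k n) v) \<longlonglongrightarrow> f v" if "v \<in> nonneg_cone" for v
  proof (cases "mass v = 0")
    case True
    then have "(\<lambda>n. average norm (k n) v) = (\<lambda>n. 0)"
      using mass_zero_cone[OF that] hom_lip_zero[OF hl] by simp
    then show ?thesis by (simp add: f_def)
  next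
    case False
    have "(\<lambda>n. mass v * average norm (k n) (normalized v)) \<longlonglongrightarrow> mass v * g (normalized v)"
      using that False by (intro tendsto_mult_left lim_simplex normalized_simplex)
    then have "(\<lambda>n. average norm (k n) v) \<longlonglongrightarrow> mass v * g (normalized v)"
      using hom_lip_normalized[OF hl that] by simp
    then show ?thesis unfolding f_def by (simp add: limI)
  qed
  have f_hl: "hom_lip 1 f"
    unfolding hom_lip_def
  proof (intro conjI ballI allI impI)
    have "average norm n \<in> borel_measurable borel" for n using hl by (rule hom_lipD)
    then show "f \<in> borel_measurable borel" unfolding f_def[abs_def] by measurable
    show "f (c *\<^sub>R v) = c * f v" if "0 \<le> c" "v \<in> nonneg_cone" for c v
    proof (rule LIMSEQ_unique)
      show "(\<lambda>n. average norm (k n) (c *\<^sub>R v)) \<longlonglongrightarrow> f (c *\<^sub>R v)"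
        by (intro lim scaleR_cone that)
      show "(\<lambda>n. average norm (k n) (c *\<^sub>R v)) \<longlonglongrightarrow> c * f v"
        using tendsto_mult_left[OF lim[OF that(2)], of c] hom_lipD(3)[OF hl that] by simp
    qed
    show "\<bar>f v - f w\<bar> \<le> 1 * l1norm (v - w)" if "v \<in> nonneg_cone" "w \<in> nonneg_cone" for v w
      by (rule LIMSEQ_le_const2[OF tendsto_rabs[OF tendsto_diff[OF lim[OF that(1)] lim[OF that(2)]]]])
        (use hom_lipD(4)[OF hl that] in auto)
  qed simp
  \<comment> \<open>By \<open>step_average\<close> this sequence is \<open>step\<close> applied to
    the averages. Its boundary term is at most \<open>2 * mass v / real (k n)\<close>, because the
    iterates of \<open>norm\<close> are bounded by \<open>mass\<close>.\<close>
  have tail: "(\<lambda>n. average norm (k n) v + (1 / real (k n)) * ((step ^^ Suc (k n)) norm v - step norm v)) \<longlonglongrightarrow> f v + 0"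
    if v: "v \<in> nonneg_cone" for v
  proof (rule tendsto_add[OF lim[OF v]], rule Lim_null_comparison)
    have "\<bar>(step ^^ Suc n) norm v - step norm v\<bar> \<le> 2 * mass v" for n
      using hom_lip_bound[OF hom_lip_steps[OF hom_lip_norm, of "Suc n"] v]
        hom_lip_bound[OF hom_lip_steps[OF hom_lip_norm, of 1] v] by simp
    then show "\<forall>\<^sub>F n in sequentially. norm ((1 / real (k n)) * ((step ^^ Suc (k n)) norm v - step norm v)) \<le> (2 * mass v) / real (k n)"
      by (intro always_eventually allI) (simp add: divide_right_mono del: funpow.simps)
    have "(\<lambda>n. inverse (real (k n))) \<longlonglongrightarrow> 0"
      using filterlim_compose[OF tendsto_inverse_0_at_top[OF filterlim_real_sequentially] filterlim_subseq[OF k]] .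
    from tendsto_mult_left[OF this, of "2 * mass v"]
    show "(\<lambda>n. (2 * mass v) / real (k n)) \<longlonglongrightarrow> 0" by (simp add: divide_inverse)
  qed
  have f_step: "step f v = f v" if v: "v \<in> nonneg_cone" for v
  proof (rule LIMSEQ_unique)
    show "(\<lambda>n. step (average norm (k n)) v) \<longlonglongrightarrow> f v"
      using tail[OF v] step_average[OF hom_lip_norm v] by simp
    show "(\<lambda>n. step (average norm (k n)) v) \<longlonglongrightarrow> step f v"
      unfolding step_def
    proof (rule integral_dominated_convergence[where w = "\<lambda>y. mass (v v* M y)"])
      show "(\<lambda>y. f (v v* M y)) \<in> borel_measurable \<phi>"
        using hom_lipD(2)[OF f_hl] by measurable
      show "(\<lambda>y. average norm (k n) (v v* M y)) \<in> borel_measurable \<phi>" for n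
        using hom_lipD(2)[OF hl, of "k n"] by measurable
      show "integrable \<phi> (\<lambda>y. mass (v v* M y))" by (rule integrable_vM_mass)
      show "AE y in \<phi>. (\<lambda>n. average norm (k n) (v v* M y)) \<longlonglongrightarrow> f (v v* M y)"
        using lim vM_cone[OF _ v] by auto
      show "AE y in \<phi>. norm (average norm (k n) (v v* M y)) \<le> mass (v v* M y)" for n
        using hom_lip_bound[OF hl vM_cone[OF _ v]] by (intro AE_I2) simp
    qed
  qed
  have f_sub: "f (v + w) \<le> f v + f w" if vw: "v \<in> nonneg_cone" "w \<in> nonneg_cone" for v w
  proof (rule LIMSEQ_le[OF lim[OF add_cone[OF vw]] tendsto_add[OF lim[OF vw(1)] lim[OF vw(2)]]])
    have "average norm n (v + w) \<le> average norm n v + average norm n w" for n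
      unfolding average_def sum.distrib[symmetric] distrib_left[symmetric]
      by (intro sum_mono mult_left_mono steps_sublinear[OF hom_lip_norm vw] norm_triangle_ineq) auto
    then show "\<exists>N. \<forall>n\<ge>N. average norm (k n) (v + w) \<le> average norm (k n) v + average norm (k n) w" by blast
  qed
  have f_vQ: "f (v v* Q) \<le> f v" if v: "v \<in> nonneg_cone" for v
  proof (rule LIMSEQ_le[OF lim[OF vQ_cone[OF v]] tail[OF v, unfolded add_0_right]])
    have "average norm n (v v* Q) \<le> step (average norm n) v" for n
    proof -
      have "average norm n (v v* Q) \<le> (\<Sum>k=1..n. (1 / real n) * step ((step ^^ k) norm) v)"
        unfolding average_def by (intro sum_mono mult_left_mono jensen_vQ jensen_steps v) auto
      also have "\<dots> = step (average norm n) v"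
        using steps_sum[OF hom_lip_steps[OF hom_lip_norm] v, of 1 "\<lambda>_. 1 / real n" id "{1..n}"]
        by (simp add: average_def[abs_def])
      finally show ?thesis .
    qed
    then show "\<exists>N. \<forall>n\<ge>N. average norm (k n) (v v* Q)
      \<le> average norm (k n) v + (1 / real (k n)) * ((step ^^ Suc (k n)) norm v - step norm v)"
      unfolding step_average[OF hom_lip_norm v] by blast
  qed
  show ?thesis by (rule that[OF f_hl k lim f_step f_sub f_vQ])
qed

end

lemma vec_axis_sum: "v = (\<Sum>i\<in>UNIV. v $ i *\<^sub>R axis i 1)" for v :: "real ^ 'e::finite"
  by (simp add: vec_eq_iff axis_def if_distrib cong: if_cong)

lemma axis_cone: "axis i 1 \<in> nonneg_cone"
  by (rule simplex_cone[OF axis_simplex])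

lemma sublinear_sum:
  assumes "finite I" "\<And>i. i \<in> I \<Longrightarrow> v i \<in> nonneg_cone" "f 0 = (0 :: real)"
    and "\<And>v w. v \<in> nonneg_cone \<Longrightarrow> w \<in> nonneg_cone \<Longrightarrow> f (v + w) \<le> f v + f w"
  shows "(\<Sum>i\<in>I. v i) \<in> nonneg_cone \<and> f (\<Sum>i\<in>I. v i) \<le> (\<Sum>i\<in>I. f (v i))"
  using assms(1,2)
proof (induction I)
  case (insert i I)
  then have "(\<Sum>i\<in>I. v i) \<in> nonneg_cone" "f (\<Sum>i\<in>I. v i) \<le> (\<Sum>i\<in>I. f (v i))" "v i \<in> nonneg_cone"
    by auto
  with assms(4)[of "v i" "\<Sum>i\<in>I. v i"] show ?case
    using insert.hyps by (auto intro: add_cone)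
qed (simp add: assms(3))

section \<open>Where an invariant sublinear function is maximal and minimal\<close>

locale invariant_sublinear = filter_model \<phi> M
  for \<phi> :: "'f measure" and M :: "'f \<Rightarrow> real ^ 'e ^ 'e::finite" +
  fixes f :: "real ^ 'e \<Rightarrow> real" and L :: real
  assumes f_hom_lip: "hom_lip L f"
    and f_step: "\<And>v. v \<in> nonneg_cone \<Longrightarrow> step f v = f v"
    and f_sub: "\<And>v w. v \<in> nonneg_cone \<Longrightarrow> w \<in> nonneg_cone \<Longrightarrow> f (v + w) \<le> f v + f w"
    and f_Q: "\<And>v. v \<in> nonneg_cone \<Longrightarrow> f (v v* Q) \<le> f v"
begin

lemma f_steps: "v \<in> nonneg_cone \<Longrightarrow> (step ^^ n) f v = f v"
proof (induction n arbitrary: v)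
  case (Suc n)
  have "step ((step ^^ n) f) v = step f v" using Suc by (intro step_cong) auto
  then show ?case using f_step Suc.prems by simp
qed simp

lemma f_le_vertices:
  assumes "v \<in> nonneg_cone" shows "f v \<le> (\<Sum>j\<in>UNIV. f (axis j 1) * v $ j)"
proof -
  have "f v = f (\<Sum>j\<in>UNIV. v $ j *\<^sub>R axis j 1)" by (simp add: vec_axis_sum[symmetric])
  also have "\<dots> \<le> (\<Sum>j\<in>UNIV. f (v $ j *\<^sub>R axis j 1))"
    using assms
    by (intro conjunct2[OF sublinear_sum] f_sub scaleR_cone axis_cone)
      (auto simp: nonneg_cone_def hom_lip_zero[OF f_hom_lip])
  also have "\<dots> = (\<Sum>j\<in>UNIV. f (axis j 1) * v $ j)"
    using assms by (intro sum.cong refl) (simp add: hom_lipD(3)[OF f_hom_lip _ axis_cone] nonneg_cone_def)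
  finally show ?thesis .
qed

text \<open>On the vertices \<open>f\<close> is subharmonic for the signal, hence constant by irreducibility.\<close>

lemma f_vertices_const: "f (axis i 1) = f (axis j 1)"
proof -
  define g where "g i = f (axis i 1)" for i
  \<comment> \<open>Sublinearity bounds \<open>f\<close> by the linear function with the same vertex
    values. Iterating both sides leaves \<open>f\<close> unchanged and turns the linear bound into a
    power of \<open>Q\<close>.\<close>
  have sub: "g i \<le> (\<Sum>j\<in>UNIV. g j * mat_power Q n $ i $ j)" for i n
  proof -
    have hl: "hom_lip ((\<Sum>j\<in>UNIV. \<bar>g j\<bar>) * 1) (\<lambda>v. \<Sum>j\<in>UNIV. g j * v $ j)"
      by (rule hom_lip_sum[OF _ _ hom_lip_nth]) auto
    have "g i = (step ^^ n) f (axis i 1)" by (simp add: g_def f_steps axis_cone)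
    also have "\<dots> \<le> (step ^^ n) (\<lambda>v. \<Sum>j\<in>UNIV. g j * v $ j) (axis i 1)"
      using f_le_vertices by (intro steps_mono[OF f_hom_lip hl axis_cone]) (simp add: g_def)
    also have "\<dots> = (\<Sum>j\<in>UNIV. g j * (step ^^ n) (\<lambda>v. v $ j) (axis i 1))"
      by (rule steps_sum[OF hom_lip_nth axis_cone])
    also have "\<dots> = (\<Sum>j\<in>UNIV. g j * mat_power Q n $ i $ j)"
      by (simp add: steps_nth axis_cone axis_vm_nth)
    finally show ?thesis .
  qed
  obtain m where m: "\<And>j. g j \<le> g m"
  proof -
    have "Max (range g) \<in> range g" by (rule Max_in) auto
    then obtain m where "Max (range g) = g m" by (rule rangeE)
    then show ?thesis using that[of m] by (metis Max_ge finite_class.finite_UNIV finite_imageI rangeI)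
  qed
  \<comment> \<open>At a maximizer the subharmonic inequality gives no weight to smaller values, and
    every \<open>j\<close> has positive weight for some power.\<close>
  have "g j = g m" for j
  proof -
    obtain n where n: "mat_power Q n $ m $ j > 0"
      using Q_irreducible unfolding irreducible_mat_def by blast
    have "(\<Sum>j\<in>UNIV. (g m - g j) * mat_power Q n $ m $ j) = g m * (\<Sum>j\<in>UNIV. mat_power Q n $ m $ j) - (\<Sum>j\<in>UNIV. g j * mat_power Q n $ m $ j)"
      by (simp add: left_diff_distrib sum_subtractf sum_distrib_left)
    also have "\<dots> \<le> 0" using sub[of m n] by (simp add: Q_power_row_sum)
    finally have "(\<Sum>j\<in>UNIV. (g m - g j) * mat_power Q n $ m $ j) \<le> 0" .
    moreover have nn: "0 \<le> (g m - g j) * mat_power Q n $ m $ j" for j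
      using m Q_power_nonneg by simp
    ultimately have "(\<Sum>j\<in>UNIV. (g m - g j) * mat_power Q n $ m $ j) = 0"
      by (intro antisym sum_nonneg) auto
    then have "(g m - g j) * mat_power Q n $ m $ j = 0"
      using nn by (simp add: sum_nonneg_eq_0_iff)
    then show ?thesis using n by simp
  qed
  then show ?thesis unfolding g_def by metis
qed

lemma f_le_vertex:
  assumes "\<mu> \<in> prob_simplex" shows "f \<mu> \<le> f (axis i 1)"
proof -
  have "(\<Sum>j\<in>UNIV. f (axis j 1) * \<mu> $ j) = (\<Sum>j\<in>UNIV. f (axis i 1) * \<mu> $ j)"
    by (intro sum.cong refl arg_cong2[where f = "(*)"] f_vertices_const)
  then have "f \<mu> \<le> (\<Sum>j\<in>UNIV. f (axis i 1) * \<mu> $ j)"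
    using f_le_vertices[OF simplex_cone[OF assms]] by simp
  then show ?thesis using assms by (simp add: sum_distrib_left[symmetric] prob_simplex_def)
qed

lemma f_continuous: "continuous_on prob_simplex f"
proof (rule continuous_onI)
  fix x :: "real ^ 'e" and e :: real assume x: "x \<in> prob_simplex" and e: "0 < e"
  \<comment> \<open>\<open>L + 1\<close> instead of \<open>L\<close> keeps the divisor positive when
    \<open>L = 0\<close>.\<close>
  have C: "0 < (L + 1) * real CARD('e)" using hom_lipD(1)[OF f_hom_lip] by simp
  show "\<exists>d>0. \<forall>x'\<in>prob_simplex. dist x' x < d \<longrightarrow> dist (f x') (f x) \<le> e"
  proof (intro exI conjI ballI impI)
    show "0 < e / ((L + 1) * real CARD('e))" using e C by simp
    fix x' assume x': "x' \<in> prob_simplex" and d: "dist x' x < e / ((L + 1) * real CARD('e))"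
    have "dist (f x') (f x) \<le> L * l1norm (x' - x)"
      using hom_lipD(4)[OF f_hom_lip] x x' by (simp add: dist_real_def simplex_cone)
    also have "\<dots> \<le> (L + 1) * (real CARD('e) * norm (x' - x))"
      using hom_lipD(1)[OF f_hom_lip] by (intro mult_mono l1norm_le_norm) auto
    also have "\<dots> \<le> e" using d C by (simp add: dist_norm pos_less_divide_eq mult_ac)
    finally show "dist (f x') (f x) \<le> e" .
  qed
qed

text \<open>The minimizers form a compact convex set mapped into itself by \<open>Q\<close>, so by Brouwer they
  include the stationary vector.\<close>

lemma f_stationary_le:
  assumes \<lambda>: "\<nu> \<in> prob_simplex" "\<nu> v* Q = \<nu>" and \<mu>: "\<mu> \<in> prob_simplex"
  shows "f \<nu> \<le> f \<mu>"
proof -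
  obtain m where m: "m \<in> prob_simplex" "\<And>x. x \<in> prob_simplex \<Longrightarrow> f m \<le> f x"
    using continuous_attains_inf[OF compact_simplex _ f_continuous] \<mu> by auto
  define K where "K = {x \<in> prob_simplex. f x \<le> f m}"
  have "closed K"
    unfolding K_def using continuous_on_closed_Collect_le[OF f_continuous continuous_on_const closed_simplex] .
  then have "compact K"
    using compact_Int_closed[OF compact_simplex, of K] by (simp add: K_def Int_absorb1 Collect_conj_eq)
  moreover have "convex K"
    unfolding convex_def
  proof (intro ballI allI impI)
    fix x y :: "real ^ 'e" and u v :: real
    assume *: "x \<in> K" "y \<in> K" "0 \<le> u" "0 \<le> v" "u + v = 1"
    then have xy: "x \<in> nonneg_cone" "y \<in> nonneg_cone" by (auto simp: K_def simplex_cone)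
    have "f (u *\<^sub>R x + v *\<^sub>R y) \<le> u * f x + v * f y"
      using f_sub[OF scaleR_cone[OF *(3) xy(1)] scaleR_cone[OF *(4) xy(2)]]
      by (simp add: hom_lipD(3)[OF f_hom_lip] * xy)
    also have "\<dots> \<le> u * f m + v * f m"
      using * by (intro add_mono mult_left_mono) (auto simp: K_def)
    also have "\<dots> = f m" using * by (simp add: distrib_right[symmetric])
    finally show "u *\<^sub>R x + v *\<^sub>R y \<in> K"
      using * convexD[OF convex_simplex] by (auto simp: K_def)
  qed
  moreover have "K \<noteq> {}" using m by (auto simp: K_def)
  moreover have "continuous_on K (\<lambda>x. x v* Q)" by (intro continuous_intros)
  moreover have "(\<lambda>x. x v* Q) \<in> K \<rightarrow> K"
  proof (intro funcsetI)
    fix x assume "x \<in> K"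
    then show "x v* Q \<in> K" using f_Q[of x] by (auto simp: K_def simplex_cone vQ_simplex)
  qed
  ultimately obtain x where "x \<in> K" "x v* Q = x"
    using brouwer[of K "\<lambda>x. x v* Q"] by blast
  then have "\<nu> \<in> K" using stationary_unique[OF \<lambda>, of x] by (auto simp: K_def)
  then show ?thesis using m(2)[OF \<mu>] by (auto simp: K_def)
qed

end

section \<open>From a constant invariant function to a rank one matrix\<close>

context filter_model
begin

text \<open>Integrating out one letter at a time preserves a pointwise inequality. The
  contrapositive selects a single word at which a combination of several functions with several
  starting vectors is negative.\<close>

lemma steps_words_nonneg:
  assumes I: "finite I" and G: "\<And>t. t \<in> I \<Longrightarrow> hom_lip L (G t)"
    and v: "\<And>t. t \<in> I \<Longrightarrow> v t \<in> nonneg_cone"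
    and words: "\<And>y. (\<And>k. k < n \<Longrightarrow> y k \<in> space \<phi>) \<Longrightarrow> 0 \<le> (\<Sum>t\<in>I. G t (v t v* word y n))"
  shows "0 \<le> (\<Sum>t\<in>I. (step ^^ n) (G t) (v t))"
  using v words
proof (induction n arbitrary: v)
  case (Suc n)
  have "0 \<le> (\<integral>y. (\<Sum>t\<in>I. (step ^^ n) (G t) (v t v* M y)) \<partial>\<phi>)"
  proof (intro Bochner_Integration.integral_nonneg Suc.IH)
    fix y assume y: "y \<in> space \<phi>"
    show "v t v* M y \<in> nonneg_cone" if "t \<in> I" for t
      using Suc.prems(1)[OF that] y by (rule vM_cone[rotated])
    fix z assume z: "\<And>k. k < n \<Longrightarrow> z k \<in> space \<phi>"
    \<comment> \<open>\<open>case_nat y z\<close> is the letter \<open>y\<close> followed by the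
      word \<open>z\<close>.\<close>
    have "0 \<le> (\<Sum>t\<in>I. G t (v t v* mat_prod (\<lambda>k. M (case_nat y z k)) (Suc n)))"
      using y z by (intro Suc.prems(2)) (auto split: nat.split)
    then show "0 \<le> (\<Sum>t\<in>I. G t (v t v* M y v* word z n))"
      by (simp add: mat_prod_Suc_shift vector_matrix_mul_assoc del: mat_prod.simps)
  qed
  also have "\<dots> = (\<Sum>t\<in>I. (step ^^ Suc n) (G t) (v t))"
    using integrable_step[OF hom_lip_steps[OF G] Suc.prems(1)]
    by (simp add: step_def Bochner_Integration.integral_sum)
  finally show ?case .
qed simp

lemma mat_prod_M_nonneg: "(\<And>k. k < n \<Longrightarrow> y k \<in> space \<phi>) \<Longrightarrow> 0 \<le> word y n $ i $ j"
  by (rule mat_prod_nonneg) (rule M_pos)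

text \<open>The equality case of the triangle inequality: tested against
  \<open>r = \<nu> v* B\<close>, every row has a nonnegative Cauchy-Schwarz deficit, and the sum of
  these deficits with positive weights is at most zero. So all rows are multiples of
  \<open>r\<close>; the mass condition excludes \<open>B = 0\<close>.\<close>

lemma rank_one_if_parallel:
  fixes B :: "real ^ 'e ^ 'e"
  assumes \<nu>: "\<And>i. 0 < \<nu> $ i" and m: "mass (\<nu> v* B) = 1"
    and eq: "(\<Sum>i\<in>UNIV. \<nu> $ i * norm (axis i 1 v* B)) \<le> norm (\<nu> v* B)"
  shows "rank B = 1"
proof -
  define r where "r = \<nu> v* B"
  have r: "r \<noteq> 0" using m by (auto simp: r_def)
  have row: "row i B = axis i 1 v* B" for i
    by (simp add: vec_eq_iff row_def axis_vm_nth)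
  have r_sum: "r = (\<Sum>i\<in>UNIV. \<nu> $ i *\<^sub>R row i B)"
    by (simp add: vec_eq_iff r_def vector_matrix_nth row_def)
  have "(\<Sum>i\<in>UNIV. \<nu> $ i * (norm (row i B) * norm r - row i B \<bullet> r))
      = (\<Sum>i\<in>UNIV. \<nu> $ i * norm (row i B)) * norm r - (\<Sum>i\<in>UNIV. \<nu> $ i *\<^sub>R row i B) \<bullet> r"
    by (simp add: right_diff_distrib sum_subtractf sum_distrib_right inner_sum_left mult.assoc)
  also have "\<dots> \<le> norm r * norm r - r \<bullet> r"
    unfolding r_sum[symmetric] using eq by (intro diff_mono mult_right_mono) (auto simp: r_def row)
  also have "\<dots> = 0" by (simp add: power2_norm_eq_inner[symmetric] power2_eq_square)
  finally have le: "(\<Sum>i\<in>UNIV. \<nu> $ i * (norm (row i B) * norm r - row i B \<bullet> r)) \<le> 0" .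
  have nn: "0 \<le> \<nu> $ i * (norm (row i B) * norm r - row i B \<bullet> r)" for i
    using \<nu>[of i] norm_cauchy_schwarz[of "row i B" r] by simp
  have "row i B \<in> span {r}" for i
  proof -
    have "(\<Sum>i\<in>UNIV. \<nu> $ i * (norm (row i B) * norm r - row i B \<bullet> r)) = 0"
      using le nn by (intro antisym sum_nonneg) auto
    then have "\<nu> $ i * (norm (row i B) * norm r - row i B \<bullet> r) = 0"
      using nn by (simp add: sum_nonneg_eq_0_iff)
    then have "row i B \<bullet> r = norm (row i B) * norm r" using \<nu>[of i] by simp
    then have "norm r *\<^sub>R row i B = norm (row i B) *\<^sub>R r"
      using norm_cauchy_schwarz_eq[of "row i B" r] by simp
    then have "row i B = (norm (row i B) / norm r) *\<^sub>R r"
      using r by (metis divide_inverse_commute inverse_eq_divide norm_eq_zero scaleR_scaleR scaleR_one left_inverse)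
    then show ?thesis by (metis span_base span_scale singletonI)
  qed
  then have "rows B \<subseteq> span {r}" by (auto simp: rows_def)
  then have "rank B \<le> card {r}" unfolding row_rank_def by (rule dim_le_card) simp
  moreover have "B \<noteq> 0" using m by auto
  then have "rank B \<noteq> 0" by (simp add: rank_eq_0)
  ultimately show ?thesis by simp
qed

text \<open>Products along words may be tiny, so the gap of a word is measured relative to its mass.
  Since \<open>mass\<close> is preserved by the operator, the term \<open>e * mass\<close>
  integrates to \<open>e\<close> over all words, and the averaged inequality must hold for some
  word.\<close>

lemma approximate_parallel_word:
  assumes \<nu>: "\<nu> \<in> prob_simplex" and e: "0 < e"
    and gap: "(\<Sum>i\<in>UNIV. \<nu> $ i * (step ^^ n) norm (axis i 1)) - (step ^^ n) norm \<nu> < e"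
  obtains y where "\<forall>k<n. y k \<in> space \<phi>"
    "(\<Sum>i\<in>UNIV. \<nu> $ i * norm (axis i 1 v* word y n)) - norm (\<nu> v* word y n)
       < e * mass (\<nu> v* word y n)"
proof (rule ccontr)
  assume no: "\<not> thesis"
  \<comment> \<open>The option type puts all terms into one family: \<open>Some i\<close> for the
    \<open>i\<close>-th row, \<open>None\<close> for the start \<open>\<nu>\<close> together with
    the mass penalty.\<close>
  define G where "G t v = (case t of Some i \<Rightarrow> \<nu> $ i * norm v | None \<Rightarrow> - norm v + (- e) * mass v)"
    for t :: "'e option" and v :: "real ^ 'e"
  define x where "x t = (case t of Some i \<Rightarrow> axis i 1 | None \<Rightarrow> \<nu>)" for t :: "'e option"
  have nu1: "\<nu> $ i \<le> 1" for i using \<nu> nth_le_mass[of \<nu> i] by (simp add: simplex_iff)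
  have hN: "hom_lip (1 + \<bar>-e\<bar> * 1) (\<lambda>v. - norm v + (- e) * mass v)"
    by (intro hom_lip_add hom_lip_cmult hom_lip_minus hom_lip_norm hom_lip_mass)
  have hl: "hom_lip (1 + \<bar>-e\<bar> * 1) (G t)" for t
  proof (cases t)
    case None
    then show ?thesis using hN by (simp add: G_def[abs_def])
  next
    case (Some i)
    have "hom_lip (\<bar>\<nu> $ i\<bar> * 1) (\<lambda>v. \<nu> $ i * norm v)" by (rule hom_lip_cmult[OF hom_lip_norm])
    moreover have "\<bar>\<nu> $ i\<bar> * 1 \<le> 1 + \<bar>-e\<bar> * 1"
      using nu1[of i] \<nu> e by (simp add: prob_simplex_def)
    ultimately have "hom_lip (1 + \<bar>-e\<bar> * 1) (\<lambda>v. \<nu> $ i * norm v)" by (rule hom_lip_mono)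
    then show ?thesis using Some by (simp add: G_def[abs_def])
  qed
  have split: "(\<Sum>t\<in>UNIV. h t) = h None + (\<Sum>i\<in>UNIV. h (Some i))" for h :: "'e option \<Rightarrow> real"
    by (simp add: UNIV_option_conv sum.reindex)
  have "0 \<le> (\<Sum>t\<in>UNIV. (step ^^ n) (G t) (x t))"
  proof (rule steps_words_nonneg[OF _ hl])
    show "x t \<in> nonneg_cone" for t
      using \<nu> by (auto simp: x_def axis_cone simplex_cone split: option.split)
    fix y assume "\<And>k. k < n \<Longrightarrow> y k \<in> space \<phi>"
    then have "\<not> (\<Sum>i\<in>UNIV. \<nu> $ i * norm (axis i 1 v* word y n)) - norm (\<nu> v* word y n)
       < e * mass (\<nu> v* word y n)"
      using no that by blast
    then show "0 \<le> (\<Sum>t\<in>UNIV. G t (x t v* word y n))"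
      unfolding split by (simp add: G_def x_def)
  qed simp
  moreover have "(step ^^ n) (G None) (x None) = - (step ^^ n) norm \<nu> - e"
  proof -
    have "(step ^^ n) (\<lambda>v. - norm v + (- e) * mass v) \<nu> = (step ^^ n) (\<lambda>v. - norm v) \<nu> + (step ^^ n) (\<lambda>v. (- e) * mass v) \<nu>"
      by (rule steps_add[OF hom_lip_minus[OF hom_lip_norm] hom_lip_cmult[OF hom_lip_mass] simplex_cone[OF \<nu>]])
    also have "\<dots> = - (step ^^ n) norm \<nu> - e"
      using \<nu> steps_cmult[of n "-1" norm] steps_cmult[of n "-e" mass] by (simp add: steps_mass simplex_iff)
    finally show ?thesis by (simp add: G_def[abs_def] x_def)
  qed
  moreover have "(step ^^ n) (G (Some i)) (x (Some i)) = \<nu> $ i * (step ^^ n) norm (axis i 1)" for i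
    using steps_cmult[of n "\<nu> $ i" norm] by (simp add: G_def[abs_def] x_def)
  ultimately show False unfolding split using gap by simp
qed

text \<open>Normalized by \<open>mass (\<nu> v* A)\<close>, the entries in row \<open>i\<close> are
  at most \<open>1 / \<nu> $ i\<close>, so the products stay in a compact set. A limit point has
  mass one and no gap, hence parallel rows.\<close>

lemma rank_one_limit:
  assumes \<nu>: "\<nu> \<in> prob_simplex" and pos: "\<And>i. 0 < \<nu> $ i"
    and gap: "\<And>e. 0 < e \<Longrightarrow> \<exists>n\<ge>1. (\<Sum>i\<in>UNIV. \<nu> $ i * (step ^^ n) norm (axis i 1)) - (step ^^ n) norm \<nu> < e"
  shows "condition_KR \<phi> M"
proof -
  let ?gap = "\<lambda>B :: real ^ 'e ^ 'e. (\<Sum>i\<in>UNIV. \<nu> $ i * norm (axis i 1 v* B)) - norm (\<nu> v* B)"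
  have "\<exists>B \<in> matrix_cone (space \<phi>) M. (\<forall>i j. 0 \<le> B $ i $ j) \<and> mass (\<nu> v* B) = 1 \<and> ?gap B < e" if e: "0 < e" for e
  proof -
    obtain n where n: "n \<ge> 1" "(\<Sum>i\<in>UNIV. \<nu> $ i * (step ^^ n) norm (axis i 1)) - (step ^^ n) norm \<nu> < e"
      using gap[OF e] by blast
    obtain y where "\<forall>k<n. y k \<in> space \<phi>"
      and lt: "?gap (word y n) < e * mass (\<nu> v* word y n)"
      by (rule approximate_parallel_word[OF \<nu> e n(2)])
    then have y: "\<And>k. k < n \<Longrightarrow> y k \<in> space \<phi>" by simp
    define A where "A = word y n"
    have A: "0 \<le> A $ i $ j" for i j unfolding A_def using y by (rule mat_prod_M_nonneg)
    have c: "\<nu> v* A \<in> nonneg_cone" using \<nu> A by (intro vm_cone simplex_cone)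
    have "norm (\<Sum>i\<in>UNIV. \<nu> $ i *\<^sub>R (axis i 1 v* A)) \<le> (\<Sum>i\<in>UNIV. norm (\<nu> $ i *\<^sub>R (axis i 1 v* A)))"
      by (rule norm_sum)
    moreover have "(\<Sum>i\<in>UNIV. \<nu> $ i *\<^sub>R (axis i 1 v* A)) = \<nu> v* A"
      by (simp add: vec_eq_iff axis_vm_nth vector_matrix_nth[of \<nu>])
    \<comment> \<open>The gap is nonnegative, so the strict bound by \<open>e * mass\<close> forces
      positive mass and permits the normalization.\<close>
    ultimately have "0 \<le> ?gap A" using pos by (simp add: less_imp_le)
    then have "0 < e * mass (\<nu> v* A)" using lt unfolding A_def[symmetric] by linarith
    then have m: "0 < mass (\<nu> v* A)" using e by (simp add: zero_less_mult_iff)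
    define B where "B = (1 / mass (\<nu> v* A)) *\<^sub>R A"
    have vB: "v v* B = (1 / mass (\<nu> v* A)) *\<^sub>R (v v* A)" for v
      unfolding B_def by (simp add: vec_eq_iff vector_matrix_nth sum_divide_distrib)
    have "B \<in> matrix_cone (space \<phi>) M"
      unfolding matrix_cone_def mem_Collect_eq using n(1) y m
      by (intro exI[of _ "1 / mass (\<nu> v* A)"] exI[of _ y] exI[of _ n]) (auto simp: B_def A_def)
    moreover have "0 \<le> B $ i $ j" for i j using A m by (simp add: B_def)
    moreover have "mass (\<nu> v* B) = 1" using m by (simp add: vB mass_scaleR)
    moreover have "?gap B = (1 / mass (\<nu> v* A)) * ?gap A"
      using m by (simp add: vB right_diff_distrib sum_divide_distrib diff_divide_distrib)
    moreover have "(1 / mass (\<nu> v* A)) * ?gap A < e"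
      using lt m unfolding A_def[symmetric] by (simp add: pos_divide_less_eq)
    ultimately show ?thesis by (intro bexI[of _ B]) auto
  qed
  then have "\<forall>n. \<exists>B. B \<in> matrix_cone (space \<phi>) M \<and> (\<forall>i j. 0 \<le> B $ i $ j) \<and> mass (\<nu> v* B) = 1 \<and> ?gap B < 1 / real (Suc n)"
    unfolding Bex_def by simp
  from choice[OF this] obtain B where B': "\<forall>n. B n \<in> matrix_cone (space \<phi>) M \<and> (\<forall>i j. 0 \<le> B n $ i $ j)
      \<and> mass (\<nu> v* B n) = 1 \<and> ?gap (B n) < 1 / real (Suc n)" by (rule exE)
  then have B: "\<And>n. B n \<in> matrix_cone (space \<phi>) M" "\<And>n i j. 0 \<le> B n $ i $ j"
    "\<And>n. mass (\<nu> v* B n) = 1" "\<And>n. ?gap (B n) < 1 / real (Suc n)" by simp_all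
  have ent: "\<nu> $ i * B n $ i $ j \<le> 1" for n i j
  proof -
    have "\<nu> $ i * B n $ i $ j \<le> (\<nu> v* B n) $ j"
      unfolding vector_matrix_nth using pos B(2) by (intro member_le_sum) (auto simp: less_imp_le)
    also have "\<dots> \<le> mass (\<nu> v* B n)"
      using B(2) \<nu> by (intro nth_le_mass vm_cone simplex_cone)
    finally show ?thesis using B(3) by simp
  qed
  have "norm (B n) \<le> (\<Sum>i\<in>UNIV. \<Sum>j\<in>(UNIV::'e set). 1 / \<nu> $ i)" for n
  proof -
    have "norm (B n) \<le> (\<Sum>i\<in>UNIV. norm (B n $ i))"
      unfolding norm_vec_def[of "B n"] by (rule L2_set_le_sum) simp
    also have "\<dots> \<le> (\<Sum>i\<in>UNIV. \<Sum>j\<in>UNIV. \<bar>B n $ i $ j\<bar>)"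
      by (intro sum_mono) (metis norm_le_l1norm l1norm_def)
    also have "\<dots> \<le> (\<Sum>i\<in>UNIV. \<Sum>j\<in>(UNIV::'e set). 1 / \<nu> $ i)"
      using ent pos B(2) by (intro sum_mono) (simp add: pos_le_divide_eq mult.commute)
    finally show ?thesis .
  qed
  then have "bounded (range B)" unfolding bounded_iff by blast
  then obtain A r where r: "strict_mono (r :: nat \<Rightarrow> nat)" and lim: "(B \<circ> r) \<longlonglongrightarrow> A"
    using bounded_imp_convergent_subsequence by blast
  have "A \<in> closure (matrix_cone (space \<phi>) M)"
    unfolding closure_sequential using B(1) lim by (intro exI[of _ "B \<circ> r"]) auto
  moreover have "rank A = 1"
  proof (rule rank_one_if_parallel[OF pos])
    have cont: "continuous_on UNIV (\<lambda>B :: real ^ 'e ^ 'e. v v* B)" for v by (intro continuous_intros)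
    have limv: "(\<lambda>n. v v* B (r n)) \<longlonglongrightarrow> v v* A" for v
      using continuous_on_tendsto_compose[OF cont lim] by simp
    have "(\<lambda>n. mass (\<nu> v* B (r n))) \<longlonglongrightarrow> mass (\<nu> v* A)"
      unfolding mass_def by (intro tendsto_intros limv)
    then show "mass (\<nu> v* A) = 1" using B(3) by (simp add: LIMSEQ_const_iff)
    have "(\<lambda>n. ?gap (B (r n))) \<longlonglongrightarrow> ?gap A"
      by (intro tendsto_intros limv)
    moreover have "(\<lambda>n. 1 / real (Suc (r n))) \<longlonglongrightarrow> 0"
      using LIMSEQ_subseq_LIMSEQ[OF LIMSEQ_inverse_real_of_nat r] by (simp add: o_def inverse_eq_divide)
    ultimately have "?gap A \<le> 0"
      using B(4) by (elim LIMSEQ_le) (auto intro: less_imp_le)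
    then show "(\<Sum>i\<in>UNIV. \<nu> $ i * norm (axis i 1 v* A)) \<le> norm (\<nu> v* A)" by simp
  qed
  ultimately show ?thesis unfolding condition_KR_def by blast
qed

end

section \<open>Words close to a rank one matrix\<close>

text \<open>\<open>regular\<close> is the form in which both kinds of observation space enter:
  singletons for the counting measure, small balls for Lebesgue measure. Since
  \<open>measure\<close> is zero on sets of infinite measure, its positivity includes
  finiteness.\<close>

locale regular_filter_model = filter_model \<phi> M
  for \<phi> :: "'f measure" and M :: "'f \<Rightarrow> real ^ 'e ^ 'e::finite" +
  assumes regular: "\<And>w d. w \<in> space \<phi> \<Longrightarrow> 0 < d \<Longrightarrow>
    \<exists>U\<in>sets \<phi>. 0 < measure \<phi> U \<and> (\<forall>y\<in>U. dist (M y) (M w) < d)"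

lemma dist_mat_prod_less:
  assumes "0 < d"
  shows "\<exists>d'>0. \<forall>B. (\<forall>k<n. dist (B k) (A k) < d') \<longrightarrow> dist (mat_prod B n) (mat_prod A n :: real ^ 'e ^ 'e::finite) < d"
  using assms
proof (induction n arbitrary: d)
  case (Suc n)
  have "continuous_on UNIV (\<lambda>p :: (real ^ 'e ^ 'e) \<times> (real ^ 'e ^ 'e). fst p ** snd p)"
    unfolding matrix_matrix_mult_def by (intro continuous_intros)
  from this[unfolded continuous_on_iff, rule_format, of "(mat_prod A n, A n)" d]
  obtain e where e: "e > 0" "\<And>X Y. dist (X, Y) (mat_prod A n, A n) < e \<Longrightarrow> dist (X ** Y) (mat_prod A n ** A n) < d"
    using Suc.prems by auto
  obtain d' where d': "d' > 0" "\<And>B. (\<forall>k<n. dist (B k) (A k) < d') \<Longrightarrow> dist (mat_prod B n) (mat_prod A n) < e / 2"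
    using Suc.IH[of "e / 2"] e(1) by auto
  show ?case
  proof (intro exI conjI allI impI)
    show "0 < min d' (e / 2)" using d' e by simp
    fix B :: "nat \<Rightarrow> real ^ 'e ^ 'e" assume B: "\<forall>k<Suc n. dist (B k) (A k) < min d' (e / 2)"
    have "dist (mat_prod B n, B n) (mat_prod A n, A n) \<le> dist (mat_prod B n) (mat_prod A n) + dist (B n) (A n)"
      unfolding dist_Pair_Pair by (rule sqrt_sum_squares_le_sum) auto
    also have "\<dots> < e" using d'(2)[of B] B by fastforce
    finally show "dist (mat_prod B (Suc n)) (mat_prod A (Suc n)) < d" using e(2) by simp
  qed
qed auto

text \<open>Chosen because it bounds \<open>l1norm (\<mu> v* A)\<close> for all \<open>\<mu>\<close>
  in the simplex at once.\<close>

definition entry_norm :: "real ^ 'e ^ 'e::finite \<Rightarrow> real" where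
  "entry_norm A = (\<Sum>i\<in>UNIV. \<Sum>j\<in>UNIV. \<bar>A $ i $ j\<bar>)"

lemma entry_norm_le_norm: "entry_norm (A :: real ^ 'e ^ 'e::finite) \<le> (real CARD('e))\<^sup>2 * norm A"
proof -
  have "\<bar>A $ i $ j\<bar> \<le> norm A" for i j
    using component_le_norm_cart[of "A $ i" j] Finite_Cartesian_Product.norm_nth_le[of A i] by linarith
  then have "entry_norm A \<le> (\<Sum>i\<in>(UNIV::'e set). \<Sum>j\<in>(UNIV::'e set). norm A)"
    unfolding entry_norm_def by (intro sum_mono)
  then show ?thesis by (simp add: power2_eq_square)
qed

lemma l1norm_vm_entry_norm:
  assumes "\<mu> \<in> prob_simplex" shows "l1norm (\<mu> v* A) \<le> entry_norm A"
proof -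
  have m: "0 \<le> \<mu> $ i" "\<mu> $ i \<le> 1" for i
    using assms nth_le_mass[of \<mu> i] by (auto simp: simplex_iff nonneg_cone_def)
  have "l1norm (\<mu> v* A) \<le> (\<Sum>j\<in>UNIV. \<Sum>i\<in>UNIV. \<bar>\<mu> $ i * A $ i $ j\<bar>)"
    unfolding l1norm_def vector_matrix_nth by (intro sum_mono sum_abs)
  also have "\<dots> \<le> (\<Sum>j\<in>UNIV. \<Sum>i\<in>UNIV. \<bar>A $ i $ j\<bar>)"
    using m by (intro sum_mono) (simp add: abs_mult mult_left_le_one_le)
  also have "\<dots> = entry_norm A" unfolding entry_norm_def by (rule sum.swap)
  finally show ?thesis .
qed

lemma rank_one_rows:
  fixes A :: "real ^ 'e ^ 'e::finite"
  assumes "rank A = 1"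
  obtains i t where "row i A \<noteq> 0" "\<And>j. row j A = t j *\<^sub>R row i A"
proof -
  have "A \<noteq> 0" using assms rank_0 by force
  then obtain i where i: "row i A \<noteq> 0" by (auto simp: vec_eq_iff row_def)
  obtain B where B: "B \<subseteq> rows A" "independent B" "rows A \<subseteq> span B" "card B = 1"
    using basis_exists[of "rows A"] assms unfolding row_rank_def by metis
  then obtain b where b: "B = {b}" by (auto simp: card_1_singleton_iff)
  have "\<exists>t. row j A = t *\<^sub>R b" for j
    using B(3) unfolding b span_singleton by (auto simp: rows_def)
  then obtain s where s: "\<And>j. row j A = s j *\<^sub>R b" by metis
  then have si: "s i \<noteq> 0" using i by auto
  have "row j A = (s j / s i) *\<^sub>R row i A" for j
    using si by (simp add: s)
  from that[OF i this] show ?thesis .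
qed

text \<open>The rank one matrix \<open>A\<close> sends \<open>\<mu>\<close> to a multiple of
  \<open>row i A\<close> of mass at least \<open>c * mass (row i A)\<close>. An error d in
  \<open>B\<close> costs at most d in mass and 2d in the unnormalized direction. The first bound on
  d keeps half of the mass, and the second makes 2d smaller than \<open>e\<close> times that
  half.\<close>

lemma near_rank_one:
  fixes A B :: "real ^ 'e ^ 'e::finite"
  assumes rows: "\<And>j. row j A = t j *\<^sub>R row i A" and t: "\<And>j. 0 \<le> t j" "t i = 1"
    and A: "\<And>j k. 0 \<le> A $ j $ k" and B: "\<And>j k. 0 \<le> B $ j $ k"
    and \<mu>: "\<mu> \<in> prob_simplex" "c \<le> \<mu> $ i" and c: "0 < c" and e: "0 < e"
    and m: "0 < mass (row i A)"
    and close: "entry_norm (B - A) < min (c * mass (row i A) / 2) (e * (c * mass (row i A)) / 4)"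
  shows "c * mass (row i A) / 2 \<le> mass (\<mu> v* B)"
    "l1norm (normalized (\<mu> v* B) - normalized (row i A)) < e"
proof -
  define s where "s = (\<Sum>j\<in>UNIV. \<mu> $ j * t j)"
  define r where "r = row i A"
  have \<mu>0: "0 \<le> \<mu> $ j" for j using \<mu>(1) by (simp add: prob_simplex_def)
  have "\<mu> $ i * t i \<le> s" unfolding s_def
    by (rule member_le_sum) (use \<mu>0 t in auto)
  then have s: "c \<le> s" using \<mu>(2) t(2) by simp
  have \<mu>A: "\<mu> v* A = s *\<^sub>R r"
  proof -
    have "A $ j $ k = t j * r $ k" for j k
      using rows[of j] by (simp add: vec_eq_iff row_def r_def)
    then show ?thesis by (simp add: vec_eq_iff vector_matrix_nth s_def sum_distrib_right mult.assoc)
  qed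
  have rc: "r \<in> nonneg_cone" using A by (simp add: r_def row_def nonneg_cone_def)
  have m0: "c * mass r \<le> mass (\<mu> v* A)"
    using s m by (simp add: \<mu>A mass_scaleR r_def)
  have m00: "0 < c * mass r" using c m by (simp add: r_def)
  let ?d = "entry_norm (B - A)"
  have d: "l1norm (\<mu> v* B - \<mu> v* A) \<le> ?d"
    using l1norm_vm_entry_norm[OF \<mu>(1), of "B - A"] by (simp add: vector_matrix_mult_diff_rdistrib)
  have md: "\<bar>mass (\<mu> v* B) - mass (\<mu> v* A)\<bar> \<le> ?d"
    using abs_mass_le_l1norm[of "\<mu> v* B - \<mu> v* A"] d by (simp add: mass_diff)
  show 1: "c * mass (row i A) / 2 \<le> mass (\<mu> v* B)"
    using abs_le_D2[OF md] m0 close unfolding r_def[symmetric] min_less_iff_conj by linarith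
  then have mB: "0 < mass (\<mu> v* B)" using m00 by (simp add: r_def)
  have nA: "mass (\<mu> v* A) *\<^sub>R normalized r = \<mu> v* A"
    using mass_normalized[OF rc] m by (simp add: \<mu>A mass_scaleR r_def[symmetric] flip: scaleR_scaleR)
  have Bc: "\<mu> v* B \<in> nonneg_cone" using B \<mu>(1) by (intro vm_cone simplex_cone)
  have "mass (\<mu> v* B) * l1norm (normalized (\<mu> v* B) - normalized r)
      = l1norm (\<mu> v* B - mass (\<mu> v* B) *\<^sub>R normalized r)"
    using mB l1norm_scaleR[of "mass (\<mu> v* B)" "normalized (\<mu> v* B) - normalized r"] mass_normalized[OF Bc]
    by (simp add: scaleR_diff_right)
  also have "\<mu> v* B - mass (\<mu> v* B) *\<^sub>R normalized r
      = (\<mu> v* B - \<mu> v* A) + (mass (\<mu> v* A) - mass (\<mu> v* B)) *\<^sub>R normalized r"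
    by (simp add: scaleR_diff_left nA)
  also have "l1norm \<dots> \<le> ?d + ?d"
  proof (rule order_trans[OF l1norm_triangle add_mono[OF d]])
    have "normalized r \<in> prob_simplex" using rc m by (intro normalized_simplex) (auto simp: r_def)
    then have "l1norm (normalized r) = 1" by (simp add: simplex_iff l1norm_cone)
    then show "l1norm ((mass (\<mu> v* A) - mass (\<mu> v* B)) *\<^sub>R normalized r) \<le> ?d"
      using md by (simp add: l1norm_scaleR abs_minus_commute)
  qed
  also have "?d + ?d < e * (c * mass r / 2)" using close by (simp add: r_def field_simps)
  also have "\<dots> \<le> e * mass (\<mu> v* B)" using 1 e by (intro mult_left_mono) (auto simp: r_def)
  finally show "l1norm (normalized (\<mu> v* B) - normalized (row i A)) < e"
    using mB by (simp add: r_def mult.commute)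
qed

lemma vm_scaleR_right: "v v* (c *\<^sub>R A) = c *\<^sub>R (v v* A)" for A :: "real ^ 'e ^ 'k::finite"
  by (simp add: vec_eq_iff vector_matrix_nth sum_distrib_left mult.left_commute)

context regular_filter_model
begin

text \<open>The bound \<open>\<kappa>\<close> gives the contraction a weight: from any start
  charging \<open>i\<close> by \<open>c\<close>, the words in the product of the sets
  \<open>U k\<close> carry at least \<open>\<kappa>\<close> times the product of their
  measures.\<close>

definition contracts :: "real ^ 'e \<Rightarrow> 'e \<Rightarrow> real \<Rightarrow> real \<Rightarrow> bool" where
  "contracts \<theta> i c e \<longleftrightarrow> (\<exists>n\<ge>1. \<exists>U \<kappa>. 0 < \<kappa> \<and> (\<forall>k<n. U k \<in> sets \<phi> \<and> 0 < measure \<phi> (U k)) \<and>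
       (\<forall>y. (\<forall>k<n. y k \<in> U k) \<longrightarrow> (\<forall>\<mu>\<in>prob_simplex. c \<le> \<mu> $ i \<longrightarrow>
          \<kappa> \<le> mass (\<mu> v* word y n) \<and>
          l1norm (normalized (\<mu> v* word y n) - \<theta>) < e)))"

text \<open>\<open>\<theta>\<close> is the common direction of the rows of the limit matrix and
  \<open>i\<close> the index of a nonzero row, so vectors charging \<open>i\<close> are not
  annihilated. Both are fixed before \<open>c\<close> and \<open>e\<close>; only the word and its
  neighbourhood depend on these.\<close>

lemma contracting_words:
  assumes "condition_KR \<phi> M"
  obtains \<theta> i where "\<theta> \<in> prob_simplex"
    "\<And>c e. 0 < c \<Longrightarrow> c \<le> 1 \<Longrightarrow> 0 < e \<Longrightarrow> contracts \<theta> i c e"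
proof -
  obtain A where A: "A \<in> closure (matrix_cone (space \<phi>) M)" "rank A = 1"
    using assms unfolding condition_KR_def by blast
  obtain X where X: "\<And>n. X n \<in> matrix_cone (space \<phi>) M" "X \<longlonglongrightarrow> A"
    using A(1) unfolding closure_sequential by blast
  have pos: "0 \<le> B $ i $ j" if "B \<in> matrix_cone (space \<phi>) M" for B i j
    using that mat_prod_M_nonneg unfolding matrix_cone_def by (auto intro!: mult_nonneg_nonneg)
  have A0: "0 \<le> A $ i $ j" for i j
    by (rule LIMSEQ_le_const[OF tendsto_vec_nth[OF tendsto_vec_nth[OF X(2)]]]) (use pos X(1) in auto)
  obtain i t where it: "row i A \<noteq> 0" "\<And>j. row j A = t j *\<^sub>R row i A"
    using rank_one_rows[OF A(2)] by blast
  have rc: "row j A \<in> nonneg_cone" for j using A0 by (simp add: row_def nonneg_cone_def)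
  have m: "0 < mass (row i A)"
    using mass_nonneg[OF rc[of i]] mass_zero_cone[OF rc[of i]] it(1) by fastforce
  have tm: "mass (row j A) = t j * mass (row i A)" for j
    by (subst it(2)) (simp add: mass_scaleR)
  have t: "0 \<le> t j" "t i = 1" for j
    using mass_nonneg[OF rc[of j]] tm[of j] tm[of i] m by (auto simp: zero_le_mult_iff)
  show ?thesis
  proof (rule that)
    show "normalized (row i A) \<in> prob_simplex" using rc m by (intro normalized_simplex) auto
    fix c e :: real assume c: "0 < c" "c \<le> 1" and e: "0 < e"
    \<comment> \<open>The tolerance of \<open>near_rank_one\<close>.\<close>
    define d where "d = min (c * mass (row i A) / 2) (e * (c * mass (row i A)) / 4)"
    define K where "K = (real CARD('e))\<^sup>2"
    have d: "0 < d" using c e m by (simp add: d_def)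
    have K: "0 < K" by (simp add: K_def)
    \<comment> \<open>Half of the tolerance \<open>d / K\<close> is spent on approximating
      \<open>A\<close> by \<open>X N\<close>, the other half on perturbing the letters;
      \<open>K\<close> converts \<open>norm\<close> into \<open>entry_norm\<close>.\<close>
    obtain N where "\<And>n. n \<ge> N \<Longrightarrow> dist (X n) A < d / (2 * K)"
      using X(2) d K unfolding lim_sequentially by (metis divide_pos_pos mult_pos_pos zero_less_numeral)
    then have N: "norm (X N - A) < d / (2 * K)" by (simp add: dist_norm)
    obtain a w n where a: "X N = a *\<^sub>R word w n" "1 \<le> n" "\<forall>k<n. w k \<in> space \<phi>" "0 \<le> a"
      using X(1)[of N] unfolding matrix_cone_def by auto
    have X0: "X N $ i $ j \<ge> 0" for i j using pos X(1) by blast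
    have near: "entry_norm (X - A) < d" if "norm (X - A) < d / K" for X :: "real ^ 'e ^ 'e"
    proof -
      have "entry_norm (X - A) \<le> K * norm (X - A)" unfolding K_def by (rule entry_norm_le_norm)
      also have "\<dots> < d" using that K by (simp add: pos_less_divide_eq mult.commute)
      finally show ?thesis .
    qed
    have "norm (X N - A) < d / K" using N K d by (smt (verit) frac_less2)
    from near[OF this] have "c * mass (row i A) / 2 \<le> mass (axis i 1 v* X N)"
      using c unfolding d_def
      by (intro near_rank_one(1)[where e = e, OF it(2) t A0 X0 axis_simplex _ c(1) e m]) (auto simp: axis_def)
    moreover have "0 < c * mass (row i A) / 2" using c m by simp
    \<comment> \<open>The scalar \<open>a\<close> may be zero in the cone; closeness to
      \<open>A\<close> excludes this, since it gives \<open>X N\<close> positive mass on the vertex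
      \<open>i\<close>.\<close>
    ultimately have "X N \<noteq> 0" by auto
    then have a0: "0 < a" using a by (cases "a = 0") auto
    obtain d' where d': "d' > 0" "\<And>B. (\<forall>k<n. dist (B k) (M (w k)) < d') \<Longrightarrow>
        dist (mat_prod B n) (word w n) < d / (2 * K * a)"
      using dist_mat_prod_less[of "d / (2 * K * a)" n "\<lambda>k. M (w k)"] d K a0 by auto
    have "\<forall>k. \<exists>U. k < n \<longrightarrow> U \<in> sets \<phi> \<and> 0 < measure \<phi> U \<and> (\<forall>y\<in>U. dist (M y) (M (w k)) < d')"
      using regular[OF _ d'(1)] a(3) by blast
    from choice[OF this] obtain U where U: "\<And>k. k < n \<Longrightarrow> U k \<in> sets \<phi> \<and> 0 < measure \<phi> (U k) \<and> (\<forall>y\<in>U k. dist (M y) (M (w k)) < d')"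
      by blast
    have main: "c * mass (row i A) / 2 / a \<le> mass (\<mu> v* word y n) \<and>
          l1norm (normalized (\<mu> v* word y n) - normalized (row i A)) < e"
      if y: "\<forall>k<n. y k \<in> U k" and \<mu>: "\<mu> \<in> prob_simplex" "c \<le> \<mu> $ i" for y \<mu>
    proof -
      define B where "B = word y n"
      have "y k \<in> space \<phi>" if "k < n" for k using U[OF that] y that sets.sets_into_space by blast
      then have B0: "0 \<le> (a *\<^sub>R B) $ i $ j" for i j unfolding B_def using a0 mat_prod_M_nonneg by simp
      have "norm (B - word w n) < d / (2 * K * a)"
        using d'(2)[of "\<lambda>k. M (y k)"] U y unfolding B_def dist_norm[symmetric] by blast
      then have "a * norm (B - word w n) < d / (2 * K)"
        using a0 K by (simp add: field_simps)
      then have 1: "norm (a *\<^sub>R B - X N) < d / (2 * K)"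
        using a0 unfolding a(1) scaleR_diff_right[symmetric] by simp
      have "norm (a *\<^sub>R B - A) \<le> norm (a *\<^sub>R B - X N) + norm (X N - A)"
        using norm_triangle_ineq[of "a *\<^sub>R B - X N" "X N - A"] by simp
      also have "\<dots> < d / (2 * K) + d / (2 * K)" using 1 N by simp
      also have "\<dots> = d / K" by simp
      finally have "entry_norm (a *\<^sub>R B - A) < d" by (rule near)
      \<comment> \<open>Scaling by \<open>a\<close> leaves normalized vectors unchanged and
        multiplies masses by \<open>a\<close>, so the estimates for \<open>a\<close> times the word
        give those for the word itself.\<close>
      note near_rank_one[OF it(2) t A0 B0 \<mu> c(1) e m this[unfolded d_def]]
      then show ?thesis
        using a0 unfolding B_def[symmetric]
        by (simp add: vm_scaleR_right mass_scaleR normalized_scaleR pos_divide_le_eq mult_ac)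
    qed
    show "contracts (normalized (row i A)) i c e"
      unfolding contracts_def using a(2) U main c a0 m
      by (intro exI[of _ n] conjI exI[of _ U] exI[of _ "c * mass (row i A) / 2 / a"]) auto
  qed
qed

end

section \<open>Contraction of the oscillation\<close>

context filter_model
begin

text \<open>Restricting the integral over each letter to \<open>U k\<close> discards nonnegative
  contributions only.\<close>

lemma steps_lower_words:
  assumes F: "hom_lip L F" "\<And>u. u \<in> nonneg_cone \<Longrightarrow> 0 \<le> F u" and v: "v \<in> nonneg_cone"
    and U: "\<And>k. k < n \<Longrightarrow> U k \<in> sets \<phi> \<and> 0 < measure \<phi> (U k)" and b: "0 \<le> b"
    and words: "\<And>y. (\<forall>k<n. y k \<in> U k) \<Longrightarrow> b \<le> F (v v* word y n)"
  shows "b * (\<Prod>k<n. measure \<phi> (U k)) \<le> (step ^^ n) F v"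
  using v U words
proof (induction n arbitrary: v U)
  case (Suc n)
  let ?c = "b * (\<Prod>k<n. measure \<phi> (U (Suc k)))"
  have U0: "U 0 \<in> sets \<phi>" "0 < measure \<phi> (U 0)" using Suc.prems(2)[of 0] by auto
  then have fin: "emeasure \<phi> (U 0) < \<infinity>"
    by (metis measure_def enn2real_top infinity_ennreal_def less_irrefl top.not_eq_extremum)
  have "b * (\<Prod>k<Suc n. measure \<phi> (U k)) = (\<integral>y. ?c * indicator (U 0) y \<partial>\<phi>)"
    using U0 sets.Int_space_eq2[OF U0(1)] by (simp add: prod.lessThan_Suc_shift del: prod.lessThan_Suc)
  also have "\<dots> \<le> (\<integral>y. (step ^^ n) F (v v* M y) \<partial>\<phi>)"
  proof (rule integral_mono)
    show "integrable \<phi> (\<lambda>y. ?c * indicator (U 0) y)" using U0 fin by (intro integrable_mult_right) simp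
    show "integrable \<phi> (\<lambda>y. (step ^^ n) F (v v* M y))"
      by (rule integrable_step[OF hom_lip_steps[OF F(1)] Suc.prems(1)])
    fix y assume y: "y \<in> space \<phi>"
    show "?c * indicator (U 0) y \<le> (step ^^ n) F (v v* M y)"
    proof (cases "y \<in> U 0")
      case True
      have "?c \<le> (step ^^ n) F (v v* M y)"
      proof (rule Suc.IH[of "v v* M y" "\<lambda>k. U (Suc k)"])
        show "v v* M y \<in> nonneg_cone" by (rule vM_cone[OF y Suc.prems(1)])
        fix z assume z: "\<forall>k<n. z k \<in> U (Suc k)"
        have "b \<le> F (v v* mat_prod (\<lambda>k. M (case_nat y z k)) (Suc n))"
          using z True by (intro Suc.prems(3)) (auto split: nat.split)
        then show "b \<le> F (v v* M y v* word z n)"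
          by (simp add: mat_prod_Suc_shift vector_matrix_mul_assoc del: mat_prod.simps)
      qed (use Suc.prems(2) in auto)
      then show ?thesis using True by simp
    qed (use steps_nonneg[OF F vM_cone[OF y Suc.prems(1)]] in simp)
  qed
  finally show ?case unfolding funpow.simps comp_apply step_def[of "(step ^^ n) F"] .
next
  case 0
  then show ?case by simp
qed

text \<open>The filter runs for a random time \<open>r\<close> drawn from \<open>\<alpha>\<close>,
  which lets the signal reach a given state, and then for \<open>n\<close> further steps, during
  which a contracting word may occur.\<close>

definition mix :: "(nat \<Rightarrow> real) \<Rightarrow> nat set \<Rightarrow> nat \<Rightarrow> (real ^ 'e \<Rightarrow> real) \<Rightarrow> real ^ 'e \<Rightarrow> real" where
  "mix \<alpha> I n F v = (\<Sum>r\<in>I. \<alpha> r * (step ^^ (r + n)) F v)"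

end

text \<open>Used with two choices of weights: a single time with weight one for an aperiodic signal,
  and equal weights on an initial segment for Cesaro averages.\<close>

locale mixing_weights = regular_filter_model \<phi> M
  for \<phi> :: "'f measure" and M :: "'f \<Rightarrow> real ^ 'e ^ 'e::finite" +
  fixes \<alpha> :: "nat \<Rightarrow> real" and I :: "nat set"
  assumes I: "finite I" and \<alpha>: "\<And>r. r \<in> I \<Longrightarrow> 0 \<le> \<alpha> r" "(\<Sum>r\<in>I. \<alpha> r) = 1"
begin

lemma mix_hom_lip:
  assumes "hom_lip L F" shows "hom_lip L (mix \<alpha> I n F)"
proof -
  have "hom_lip ((\<Sum>r\<in>I. \<bar>\<alpha> r\<bar>) * L) (\<lambda>v. \<Sum>r\<in>I. \<alpha> r * (step ^^ (r + n)) F v)"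
    by (rule hom_lip_sum[OF I hom_lipD(1)[OF assms] hom_lip_steps[OF assms]])
  moreover have "(\<Sum>r\<in>I. \<bar>\<alpha> r\<bar>) = 1"
    using \<alpha> by (metis abs_of_nonneg sum.cong)
  ultimately show ?thesis by (simp add: mix_def[abs_def])
qed

text \<open>On the simplex \<open>mass\<close> is one, so this is the compatibility of
  \<open>mix\<close> with affine changes of the values.\<close>

lemma mix_affine:
  assumes h: "hom_lip L h" and v: "v \<in> nonneg_cone"
  shows "mix \<alpha> I n (\<lambda>v. a * h v + b * mass v) v = a * mix \<alpha> I n h v + b * mass v"
proof -
  have "(step ^^ k) (\<lambda>v. a * h v + b * mass v) v = a * (step ^^ k) h v + b * mass v" for k
    using steps_add[OF hom_lip_cmult[OF h, of a] hom_lip_cmult[OF hom_lip_mass, of b] v, of k]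
    by (simp add: steps_cmult steps_mass)
  then have "mix \<alpha> I n (\<lambda>v. a * h v + b * mass v) v = (\<Sum>r\<in>I. a * (\<alpha> r * (step ^^ (r + n)) h v) + \<alpha> r * (b * mass v))"
    unfolding mix_def by (intro sum.cong) (simp_all add: algebra_simps)
  then show ?thesis
    by (simp add: sum.distrib mix_def flip: sum_distrib_left sum_distrib_right) (simp add: \<alpha>(2))
qed

text \<open>A Doeblin condition: from every start, \<open>mix\<close> puts weight at least
  \<open>p\<close> near \<open>\<theta>\<close>. It is tested on nonnegative homogeneous functions
  instead of sets, and \<open>p\<close>, \<open>n\<close> must serve all Lipschitz constants, so
  that the same \<open>p\<close> can be used at every stage of an iteration.\<close>

definition minorizes :: "real ^ 'e \<Rightarrow> real \<Rightarrow> real \<Rightarrow> nat \<Rightarrow> bool" where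
  "minorizes \<theta> e p n \<longleftrightarrow> (\<forall>H L s. hom_lip L H \<longrightarrow> (\<forall>u\<in>nonneg_cone. 0 \<le> H u) \<longrightarrow> 0 \<le> s \<longrightarrow>
       (\<forall>x\<in>prob_simplex. l1norm (x - \<theta>) < e \<longrightarrow> s \<le> H x) \<longrightarrow> (\<forall>\<mu>\<in>prob_simplex. p * s \<le> mix \<alpha> I n H \<mu>))"

text \<open>The words help only vectors charging \<open>i\<close> by at least \<open>c\<close>. The
  resulting lower bound is weakened to a multiple of the linear function
  \<open>v $ i - c * mass v\<close>, whose iterates are given by powers of \<open>Q\<close>. The
  mixed probability of \<open>i\<close> is at least \<open>2 * c\<close>, so
  \<open>2 * c - c = c\<close> survives, uniformly in the start.\<close>

lemma mix_lower:
  assumes KR: "condition_KR \<phi> M"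
    and pos: "\<And>i j. 0 < (\<Sum>r\<in>I. \<alpha> r * mat_power Q r $ j $ i)"
  obtains \<theta> where "\<theta> \<in> prob_simplex"
    "\<And>e. 0 < e \<Longrightarrow> \<exists>p n. 0 < p \<and> p \<le> 1 \<and> minorizes \<theta> e p n"
proof -
  obtain \<theta> i where \<theta>: "\<theta> \<in> prob_simplex"
    and words: "\<And>c e. 0 < c \<Longrightarrow> c \<le> 1 \<Longrightarrow> 0 < e \<Longrightarrow> contracts \<theta> i c e"
    using contracting_words[OF KR] by blast
  define S where "S j = (\<Sum>r\<in>I. \<alpha> r * mat_power Q r $ j $ i)" for j
  \<comment> \<open>Half of the smallest mixed probability of \<open>i\<close>, capped because
    \<open>contracts\<close> is available for \<open>c \<le> 1\<close>.\<close>
  define c where "c = min (Min (range S) / 2) 1"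
  have S: "0 < S j" for j unfolding S_def by (rule pos)
  have "Min (range S) \<in> range S" by (rule Min_in) auto
  then have c: "0 < c" "c \<le> 1" using S by (auto simp: c_def)
  have Sc: "2 * c \<le> S j" for j
  proof -
    have "2 * c \<le> Min (range S)" unfolding c_def by linarith
    moreover have "Min (range S) \<le> S j" by (rule Min_le) auto
    ultimately show ?thesis by linarith
  qed
  show ?thesis
  proof (rule that[OF \<theta>])
    fix e :: real assume e: "0 < e"
    obtain n U \<kappa> where \<kappa>: "0 < \<kappa>" and U: "\<And>k. k < n \<Longrightarrow> U k \<in> sets \<phi> \<and> 0 < measure \<phi> (U k)"
      and w: "\<And>y \<mu>. (\<forall>k<n. y k \<in> U k) \<Longrightarrow> \<mu>\<in>prob_simplex \<Longrightarrow> c \<le> \<mu> $ i \<Longrightarrow>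
          \<kappa> \<le> mass (\<mu> v* word y n) \<and>
          l1norm (normalized (\<mu> v* word y n) - \<theta>) < e"
      using words[OF c e] unfolding contracts_def by blast
    define \<eta> where "\<eta> = \<kappa> * (\<Prod>k<n. measure \<phi> (U k))"
    have \<eta>: "0 < \<eta>" unfolding \<eta>_def using \<kappa> U by (intro mult_pos_pos prod_pos) auto
    \<comment> \<open>The cap at 1 makes \<open>1 - p / 2\<close> a positive contraction
      factor.\<close>
    define p where "p = min (\<eta> * c) 1"
    have p: "0 < p" "p \<le> 1" using \<eta> c by (auto simp: p_def)
    have "p * s \<le> mix \<alpha> I n H \<mu>"
      if H: "hom_lip L H" "\<forall>u\<in>nonneg_cone. 0 \<le> H u" and s: "0 \<le> s"
        and near: "\<forall>x\<in>prob_simplex. l1norm (x - \<theta>) < e \<longrightarrow> s \<le> H x" and \<mu>: "\<mu> \<in> prob_simplex" for H L s \<mu>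
    proof -
      define J where "J = (step ^^ n) H"
      have J: "hom_lip L J" unfolding J_def by (rule hom_lip_steps[OF H(1)])
      have J0: "0 \<le> J v" if "v \<in> nonneg_cone" for v
        unfolding J_def by (rule steps_nonneg[OF H(1) _ that]) (use H(2) in auto)
      have J1: "\<eta> * s \<le> J v" if v: "v \<in> prob_simplex" "c \<le> v $ i" for v
      proof -
        have "\<kappa> * s * (\<Prod>k<n. measure \<phi> (U k)) \<le> J v"
          unfolding J_def
        proof (rule steps_lower_words[OF H(1) _ simplex_cone[OF v(1)] U])
          show "0 \<le> \<kappa> * s" using \<kappa> s by simp
          fix y assume y: "\<forall>k<n. y k \<in> U k"
          let ?B = "word y n"
          have "y k \<in> space \<phi>" if "k < n" for k using U[OF that] y that sets.sets_into_space by blast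
          then have Bc: "v v* ?B \<in> nonneg_cone"
            using v(1) by (intro vm_cone simplex_cone mat_prod_M_nonneg)
          have wv: "\<kappa> \<le> mass (v v* ?B)" "l1norm (normalized (v v* ?B) - \<theta>) < e" using w[OF y v] by auto
          then have "s \<le> H (normalized (v v* ?B))"
            using near \<kappa> Bc by (auto intro!: normalized_simplex)
          then have "\<kappa> * s \<le> mass (v v* ?B) * H (normalized (v v* ?B))"
            using wv(1) s \<kappa> by (intro mult_mono) auto
          then show "\<kappa> * s \<le> H (v v* ?B)" using hom_lip_normalized[OF H(1) Bc] by simp
        qed (use H(2) in auto)
        then show ?thesis by (simp add: \<eta>_def mult_ac)
      qed
      \<comment> \<open>After normalization: if the coordinate is at least \<open>c\<close>, then
        \<open>v $ i - c \<le> 1\<close> and the word bound applies; otherwise the left side is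
        negative or zero.\<close>
      have lin: "(\<eta> * s) * (v $ i + (- c) * mass v) \<le> J v" if v: "v \<in> nonneg_cone" for v
      proof (cases "mass v = 0")
        case True
        then show ?thesis using mass_zero_cone[OF v True] J0 by simp
      next
        case False
        let ?v = "normalized v"
        have vs: "?v \<in> prob_simplex" using v False by (rule normalized_simplex)
        have "(\<eta> * s) * (?v $ i - c) \<le> J ?v"
        proof (cases "c \<le> ?v $ i")
          case True
          have "?v $ i \<le> 1" using nth_le_mass[of ?v i] vs by (simp add: simplex_iff)
          then have "(\<eta> * s) * (?v $ i - c) \<le> (\<eta> * s) * 1"
            using \<eta> s c by (intro mult_left_mono) auto
          then show ?thesis using J1[OF vs True] by simp
        next
          case False
          then have "(\<eta> * s) * (?v $ i - c) \<le> 0" using \<eta> s by (intro mult_nonneg_nonpos) auto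
          then show ?thesis using J0[OF simplex_cone[OF vs]] by linarith
        qed
        then have "mass v * ((\<eta> * s) * (?v $ i - c)) \<le> mass v * J ?v"
          using mass_nonneg[OF v] by (rule mult_left_mono)
        also have "\<dots> = J v" by (rule hom_lip_normalized[OF J v])
        finally show ?thesis using False by (simp add: normalized_def algebra_simps)
      qed
      have hl: "hom_lip (1 + \<bar>-c\<bar> * 1) (\<lambda>v. v $ i + (- c) * mass v)"
        by (intro hom_lip_add hom_lip_cmult hom_lip_nth hom_lip_mass)
      have r: "(\<eta> * s) * ((\<mu> v* mat_power Q r) $ i - c) \<le> (step ^^ (r + n)) H \<mu>" for r
      proof -
        have "(step ^^ r) (\<lambda>v. (\<eta> * s) * (v $ i + (- c) * mass v)) \<mu> \<le> (step ^^ r) J \<mu>"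
          by (rule steps_mono[OF hom_lip_cmult[OF hl] J simplex_cone[OF \<mu>] lin])
        then show ?thesis
          using steps_add[OF hom_lip_nth hom_lip_cmult[OF hom_lip_mass] simplex_cone[OF \<mu>], of r i "- c"]
            steps_nth[OF simplex_cone[OF \<mu>], of r i] \<mu> steps_cmult[of r "-c" mass]
          by (simp add: steps_cmult steps_mass simplex_iff J_def funpow_add)
      qed
      have "p * s \<le> (\<eta> * c) * s" using s by (intro mult_right_mono) (simp_all add: p_def)
      also have "\<dots> = (\<eta> * s) * c" by simp
      also have "\<dots> \<le> (\<eta> * s) * ((\<Sum>r\<in>I. \<alpha> r * (\<mu> v* mat_power Q r) $ i) - c)"
      proof (rule mult_left_mono)
        have "(\<Sum>r\<in>I. \<alpha> r * (\<mu> v* mat_power Q r) $ i) = (\<Sum>r\<in>I. \<Sum>j\<in>UNIV. \<mu> $ j * (\<alpha> r * mat_power Q r $ j $ i))"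
          by (simp add: vector_matrix_nth sum_distrib_left mult_ac)
        also have "\<dots> = (\<Sum>j\<in>UNIV. \<mu> $ j * S j)"
          unfolding S_def by (subst sum.swap) (simp add: sum_distrib_left)
        also have "\<dots> \<ge> (\<Sum>j\<in>UNIV. \<mu> $ j * (2 * c))"
          using Sc \<mu> by (intro sum_mono mult_left_mono) (auto simp: prob_simplex_def)
        also have "(\<Sum>j\<in>UNIV. \<mu> $ j * (2 * c)) = 2 * c"
          using \<mu> by (simp add: sum_distrib_right[symmetric] prob_simplex_def)
        finally show "c \<le> (\<Sum>r\<in>I. \<alpha> r * (\<mu> v* mat_power Q r) $ i) - c" by simp
      qed (use \<eta> s in simp)
      also have "\<dots> = (\<Sum>r\<in>I. \<alpha> r * ((\<eta> * s) * ((\<mu> v* mat_power Q r) $ i - c)))"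
      proof -
        have "(\<Sum>r\<in>I. \<alpha> r * ((\<eta> * s) * ((\<mu> v* mat_power Q r) $ i - c)))
            = (\<eta> * s) * (\<Sum>r\<in>I. \<alpha> r * (\<mu> v* mat_power Q r) $ i) - (\<eta> * s) * c * (\<Sum>r\<in>I. \<alpha> r)"
          by (simp add: algebra_simps sum_subtractf sum_distrib_left)
        then show ?thesis using \<alpha>(2) by (simp add: algebra_simps)
      qed
      also have "\<dots> \<le> mix \<alpha> I n H \<mu>"
        unfolding mix_def using r \<alpha>(1) by (intro sum_mono mult_left_mono) auto
      finally show ?thesis .
    qed
    then show "\<exists>p n. 0 < p \<and> p \<le> 1 \<and> minorizes \<theta> e p n"
      unfolding minorizes_def using p by (intro exI[of _ p] exI[of _ n]) blast
  qed
qed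

text \<open>The minorization concerns nonnegative functions, so it is applied to
  \<open>h - A * mass\<close>, which on the simplex is \<open>h - A\<close>.\<close>

lemma mix_raises_minimum:
  assumes low: "minorizes \<theta> e p n"
    and h: "hom_lip L h" and A: "\<And>\<mu>. \<mu> \<in> prob_simplex \<Longrightarrow> A \<le> h \<mu>" and s: "0 \<le> s"
    and near: "\<And>x. x \<in> prob_simplex \<Longrightarrow> l1norm (x - \<theta>) < e \<Longrightarrow> A + s \<le> h x"
    and \<mu>: "\<mu> \<in> prob_simplex"
  shows "A + p * s \<le> mix \<alpha> I n h \<mu>"
proof -
  let ?H = "\<lambda>v. 1 * h v + (- A) * mass v"
  have hl: "hom_lip (\<bar>1\<bar> * L + \<bar>-A\<bar> * 1) ?H"
    by (intro hom_lip_add hom_lip_cmult h hom_lip_mass)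
  have H0: "\<forall>u\<in>nonneg_cone. 0 \<le> ?H u"
  proof
    fix u :: "real ^ 'e" assume u: "u \<in> nonneg_cone"
    show "0 \<le> ?H u"
    proof (cases "mass u = 0")
      case True
      then show ?thesis using mass_zero_cone[OF u True] hom_lip_zero[OF h] by simp
    next
      case False
      have "mass u * A \<le> mass u * h (normalized u)"
        using A normalized_simplex[OF u False] mass_nonneg[OF u] by (intro mult_left_mono)
      then show ?thesis using hom_lip_normalized[OF h u] by (simp add: mult.commute)
    qed
  qed
  have "\<forall>x\<in>prob_simplex. l1norm (x - \<theta>) < e \<longrightarrow> s \<le> ?H x"
    using near by (auto simp: simplex_iff algebra_simps)
  with low[unfolded minorizes_def, rule_format, OF hl _ s _ \<mu>] H0 have "p * s \<le> mix \<alpha> I n ?H \<mu>" by blast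
  then show ?thesis
    using mix_affine[OF h simplex_cone[OF \<mu>], of n 1 "- A"] \<mu> by (simp add: simplex_iff)
qed

text \<open>Near \<open>\<theta>\<close> the function differs from \<open>h \<theta>\<close> by at
  most \<open>L * e\<close>. If \<open>h \<theta>\<close> lies in the upper half of the interval
  from \<open>A\<close> to \<open>B\<close>, the lower bound can be raised, otherwise the upper
  bound can be lowered, by \<open>p * s\<close> in either case.\<close>

lemma mix_contracts:
  assumes low: "minorizes \<theta> e p n"
    and p: "0 < p" and e: "0 < e" and \<theta>: "\<theta> \<in> prob_simplex" and h: "hom_lip L h"
    and A: "\<And>\<mu>. \<mu> \<in> prob_simplex \<Longrightarrow> A \<le> h \<mu>" and B: "\<And>\<mu>. \<mu> \<in> prob_simplex \<Longrightarrow> h \<mu> \<le> B"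
  shows "\<exists>A' B'. (\<forall>\<mu>\<in>prob_simplex. A' \<le> mix \<alpha> I n h \<mu> \<and> mix \<alpha> I n h \<mu> \<le> B') \<and>
    B' - A' \<le> (1 - p / 2) * (B - A) + p * (L * e)"
proof -
  \<comment> \<open>Half of the length minus the variation of \<open>h\<close> near
    \<open>\<theta>\<close>. When the length is below \<open>2 * (L * e)\<close> this is negative
    and the old bounds are kept, which \<open>t\<close> accounts for.\<close>
  define s where "s = (B - A) / 2 - L * e"
  define t where "t = max s 0"
  have s': "A + s = (A + B) / 2 - L * e" "B - s = (A + B) / 2 + L * e"
    by (simp_all add: s_def field_simps)
  have near: "\<bar>h x - h \<theta>\<bar> \<le> L * e" if "x \<in> prob_simplex" "l1norm (x - \<theta>) < e" for x
  proof -
    have "\<bar>h x - h \<theta>\<bar> \<le> L * l1norm (x - \<theta>)" using that \<theta> by (intro hom_lipD(4)[OF h] simplex_cone)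
    also have "\<dots> \<le> L * e" using that hom_lipD(1)[OF h] by (intro mult_left_mono) auto
    finally show ?thesis .
  qed
  note up = mix_raises_minimum[OF low h A]
  have neg: "mix \<alpha> I n (\<lambda>v. - h v) \<mu> = - mix \<alpha> I n h \<mu>" if "\<mu> \<in> prob_simplex" for \<mu>
    using mix_affine[OF h simplex_cone[OF that], of n "-1" 0] by simp
  have down: "mix \<alpha> I n h \<mu> \<le> B - p * s"
    if "0 \<le> s" "\<And>x. x \<in> prob_simplex \<Longrightarrow> l1norm (x - \<theta>) < e \<Longrightarrow> h x \<le> B - s" "\<mu> \<in> prob_simplex" for s \<mu>
    using mix_raises_minimum[OF low hom_lip_minus[OF h], of "- B" s \<mu>] that B neg[of \<mu>] by fastforce
  have A0: "A \<le> mix \<alpha> I n h \<mu>" "mix \<alpha> I n h \<mu> \<le> B" if "\<mu> \<in> prob_simplex" for \<mu>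
    using up[of 0 \<mu>] down[of 0 \<mu>] that A B by auto
  have len: "B - A - p * t \<le> (1 - p / 2) * (B - A) + p * (L * e)"
  proof -
    have "p * s \<le> p * t" using p by (simp add: t_def)
    then show ?thesis by (simp add: s_def algebra_simps)
  qed
  consider "s < 0" | "0 \<le> s" "(A + B) / 2 \<le> h \<theta>" | "0 \<le> s" "h \<theta> \<le> (A + B) / 2" by linarith
  then show ?thesis
  proof cases
    case 1
    then show ?thesis using A0 len by (intro exI[of _ A] exI[of _ B]) (auto simp: t_def)
  next
    case 2
    have "A + s \<le> h x" if "x \<in> prob_simplex" "l1norm (x - \<theta>) < e" for x
      using abs_le_D2[OF near[OF that]] 2(2) unfolding s' by linarith
    then have "A + p * s \<le> mix \<alpha> I n h \<mu>" if "\<mu> \<in> prob_simplex" for \<mu>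
      using up[of s \<mu>] 2(1) that by blast
    then show ?thesis using A0 len 2(1) by (intro exI[of _ "A + p * s"] exI[of _ B]) (auto simp: t_def)
  next
    case 3
    have "h x \<le> B - s" if "x \<in> prob_simplex" "l1norm (x - \<theta>) < e" for x
      using abs_le_D1[OF near[OF that]] 3(2) unfolding s' by linarith
    then have "mix \<alpha> I n h \<mu> \<le> B - p * s" if "\<mu> \<in> prob_simplex" for \<mu>
      using down[of s \<mu>] 3(1) that by blast
    then show ?thesis using A0 len 3(1) by (intro exI[of _ A] exI[of _ "B - p * s"]) (auto simp: t_def)
  qed
qed

text \<open>Since \<open>p\<close> depends on \<open>e\<close> but not on the function,
  \<open>mix_contracts\<close> can be iterated. The invariant \<open>R\<close> records how the
  current function is related to \<open>g\<close>: as an iterate of it, or as a function with the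
  same Cesaro limits.\<close>

lemma small_oscillation:
  assumes KR: "condition_KR \<phi> M"
    and pos: "\<And>i j. 0 < (\<Sum>r\<in>I. \<alpha> r * mat_power Q r $ j $ i)"
    and d: "0 < d" and g: "R g" and R: "\<And>h. R h \<Longrightarrow> hom_lip L h" "\<And>h n. R h \<Longrightarrow> R (mix \<alpha> I n h)"
  obtains h A B where "R h" "\<And>\<mu>. \<mu> \<in> prob_simplex \<Longrightarrow> A \<le> h \<mu>" "\<And>\<mu>. \<mu> \<in> prob_simplex \<Longrightarrow> h \<mu> \<le> B" "B - A \<le> d"
proof -
  obtain \<theta> where \<theta>: "\<theta> \<in> prob_simplex"
    and low: "\<And>e. 0 < e \<Longrightarrow> \<exists>p n. 0 < p \<and> p \<le> 1 \<and> minorizes \<theta> e p n"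
    using mix_lower[OF KR pos] by blast
  have L: "0 \<le> L" using R(1)[OF g] by (rule hom_lipD)
  \<comment> \<open>Makes the oscillation that cannot be removed, \<open>2 * (L * e)\<close>, at
    most \<open>d / 2\<close>.\<close>
  define e where "e = d / (4 * (L + 1))"
  have e: "0 < e" using d L by (simp add: e_def)
  have Le: "2 * (L * e) \<le> d / 2"
  proof -
    have "L * e \<le> (L + 1) * e" using e by simp
    also have "\<dots> = d / 4" using L by (simp add: e_def field_simps)
    finally show ?thesis by simp
  qed
  obtain p n where p: "0 < p" "p \<le> 1"
    and lw: "minorizes \<theta> e p n"
    using low[OF e] by blast
  \<comment> \<open>\<open>2 * (L * e)\<close> is the fixed point of the affine recursion in
    \<open>mix_contracts\<close>; the excess over it decays geometrically from the initial length
    \<open>2 * L\<close>.\<close>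
  have iter: "\<exists>h A B. R h \<and> (\<forall>\<mu>\<in>prob_simplex. A \<le> h \<mu> \<and> h \<mu> \<le> B) \<and> B - A \<le> (1 - p / 2) ^ j * (2 * L) + 2 * (L * e)" for j
  proof (induction j)
    case 0
    have "\<bar>g \<mu>\<bar> \<le> L" if "\<mu> \<in> prob_simplex" for \<mu>
      using hom_lip_bound[OF R(1)[OF g], of \<mu>] that by (simp add: simplex_iff)
    then have "\<forall>\<mu>\<in>prob_simplex. - L \<le> g \<mu> \<and> g \<mu> \<le> L" by (metis abs_le_iff minus_le_iff)
    then show ?case using g L e by (intro exI[of _ g] exI[of _ "- L"] exI[of _ L]) simp
  next
    case (Suc j)
    then obtain h A B where h: "R h" "\<And>\<mu>. \<mu> \<in> prob_simplex \<Longrightarrow> A \<le> h \<mu>" "\<And>\<mu>. \<mu> \<in> prob_simplex \<Longrightarrow> h \<mu> \<le> B"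
      and le: "B - A \<le> (1 - p / 2) ^ j * (2 * L) + 2 * (L * e)" by blast
    obtain A' B' where AB: "\<forall>\<mu>\<in>prob_simplex. A' \<le> mix \<alpha> I n h \<mu> \<and> mix \<alpha> I n h \<mu> \<le> B'"
      "B' - A' \<le> (1 - p / 2) * (B - A) + p * (L * e)"
      using mix_contracts[OF lw p(1) e \<theta> R(1)[OF h(1)] h(2,3)] by blast
    have "(1 - p / 2) * (B - A) \<le> (1 - p / 2) * ((1 - p / 2) ^ j * (2 * L) + 2 * (L * e))"
      using p le by (intro mult_left_mono) auto
    then have "B' - A' \<le> (1 - p / 2) ^ Suc j * (2 * L) + 2 * (L * e)"
      using AB(2) by (simp add: algebra_simps)
    then show ?case using AB(1) R(2)[OF h(1)] by blast
  qed
  have "0 < d / 2 / (2 * L + 1)" using d L by simp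
  then obtain j where j: "(1 - p / 2) ^ j < d / 2 / (2 * L + 1)"
    using real_arch_pow_inv[of "d / 2 / (2 * L + 1)" "1 - p / 2"] p by auto
  have "(1 - p / 2) ^ j * (2 * L) \<le> (1 - p / 2) ^ j * (2 * L + 1)"
    using p by (intro mult_left_mono) auto
  also have "\<dots> \<le> d / 2"
    using j L less_imp_le[of "(1 - p / 2) ^ j * (2 * L + 1)" "d / 2"] by (subst (asm) pos_less_divide_eq) auto
  finally have "(1 - p / 2) ^ j * (2 * L) + 2 * (L * e) \<le> d" using Le by linarith
  then show ?thesis using iter[of j] that by (meson order_trans)
qed

end

section \<open>Test functions and weak convergence\<close>

text \<open>The bound on the values is carried along because the Lipschitz estimate of a product
  needs it.\<close>

lemma polynomial_lipschitz_simplex: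
  assumes "real_polynomial_function (g :: real ^ 'e::finite \<Rightarrow> real)"
  shows "\<exists>K\<ge>0. \<exists>C\<ge>0. \<forall>x\<in>prob_simplex. \<bar>g x\<bar> \<le> C \<and> (\<forall>y\<in>prob_simplex. \<bar>g x - g y\<bar> \<le> K * l1norm (x - y))"
  using assms
proof induction
  case (linear f)
  interpret bounded_linear f by fact
  obtain K where K: "0 < K" "\<And>x. norm (f x) \<le> norm x * K" using pos_bounded by blast
  have 1: "\<bar>f x\<bar> \<le> K * l1norm x" for x
  proof -
    have "K * norm x \<le> K * l1norm x" using K(1) norm_le_l1norm[of x] by (intro mult_left_mono) auto
    then show ?thesis using K(2)[of x] by (simp add: mult.commute)
  qed
  have "\<bar>f x\<bar> \<le> K" if "x \<in> prob_simplex" for x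
    using 1[of x] that by (simp add: simplex_iff l1norm_cone)
  moreover have "\<bar>f x - f y\<bar> \<le> K * l1norm (x - y)" for x y using 1[of "x - y"] by (simp add: diff)
  ultimately show ?case using K(1) less_imp_le by blast
next
  case (const c)
  then show ?case by (intro exI[of _ 0] conjI exI[of _ "\<bar>c\<bar>"]) auto
next
  case (add f g)
  obtain K C where f: "0 \<le> K" "0 \<le> C"
    "\<forall>x\<in>prob_simplex. \<bar>f x\<bar> \<le> C \<and> (\<forall>y\<in>prob_simplex. \<bar>f x - f y\<bar> \<le> K * l1norm (x - y))"
    using add.IH(1) by (elim exE conjE)
  obtain K' C' where g: "0 \<le> K'" "0 \<le> C'"
    "\<forall>x\<in>prob_simplex. \<bar>g x\<bar> \<le> C' \<and> (\<forall>y\<in>prob_simplex. \<bar>g x - g y\<bar> \<le> K' * l1norm (x - y))"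
    using add.IH(2) by (elim exE conjE)
  have *: "0 \<le> K" "0 \<le> C" "0 \<le> K'" "0 \<le> C'"
    "\<And>x. x \<in> prob_simplex \<Longrightarrow> \<bar>f x\<bar> \<le> C" "\<And>x. x \<in> prob_simplex \<Longrightarrow> \<bar>g x\<bar> \<le> C'"
    "\<And>x y. x \<in> prob_simplex \<Longrightarrow> y \<in> prob_simplex \<Longrightarrow> \<bar>f x - f y\<bar> \<le> K * l1norm (x - y)"
    "\<And>x y. x \<in> prob_simplex \<Longrightarrow> y \<in> prob_simplex \<Longrightarrow> \<bar>g x - g y\<bar> \<le> K' * l1norm (x - y)"
    using f g by simp_all
  have "\<bar>f x + g x\<bar> \<le> C + C'" if "x \<in> prob_simplex" for x
    using *(5,6)[OF that] by linarith
  moreover have "\<bar>f x + g x - (f y + g y)\<bar> \<le> (K + K') * l1norm (x - y)" if "x \<in> prob_simplex" "y \<in> prob_simplex" for x y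
    using *(7,8)[OF that] unfolding distrib_right by linarith
  ultimately show ?case using *(1-4) by (intro exI[of _ "K + K'"] conjI exI[of _ "C + C'"]) auto
next
  case (mult f g)
  obtain K C where f: "0 \<le> K" "0 \<le> C"
    "\<forall>x\<in>prob_simplex. \<bar>f x\<bar> \<le> C \<and> (\<forall>y\<in>prob_simplex. \<bar>f x - f y\<bar> \<le> K * l1norm (x - y))"
    using mult.IH(1) by (elim exE conjE)
  obtain K' C' where g: "0 \<le> K'" "0 \<le> C'"
    "\<forall>x\<in>prob_simplex. \<bar>g x\<bar> \<le> C' \<and> (\<forall>y\<in>prob_simplex. \<bar>g x - g y\<bar> \<le> K' * l1norm (x - y))"
    using mult.IH(2) by (elim exE conjE)
  have *: "0 \<le> K" "0 \<le> C" "0 \<le> K'" "0 \<le> C'"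
    "\<And>x. x \<in> prob_simplex \<Longrightarrow> \<bar>f x\<bar> \<le> C" "\<And>x. x \<in> prob_simplex \<Longrightarrow> \<bar>g x\<bar> \<le> C'"
    "\<And>x y. x \<in> prob_simplex \<Longrightarrow> y \<in> prob_simplex \<Longrightarrow> \<bar>f x - f y\<bar> \<le> K * l1norm (x - y)"
    "\<And>x y. x \<in> prob_simplex \<Longrightarrow> y \<in> prob_simplex \<Longrightarrow> \<bar>g x - g y\<bar> \<le> K' * l1norm (x - y)"
    using f g by simp_all
  have "\<bar>f x * g x\<bar> \<le> C * C'" if "x \<in> prob_simplex" for x
    unfolding abs_mult using * that by (intro mult_mono) auto
  moreover have "\<bar>f x * g x - f y * g y\<bar> \<le> (K * C' + C * K') * l1norm (x - y)"
    if "x \<in> prob_simplex" "y \<in> prob_simplex" for x y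
  proof -
    have "\<bar>f x * g x - f y * g y\<bar> = \<bar>(f x - f y) * g x + f y * (g x - g y)\<bar>" by (simp add: algebra_simps)
    also have "\<dots> \<le> \<bar>f x - f y\<bar> * \<bar>g x\<bar> + \<bar>f y\<bar> * \<bar>g x - g y\<bar>"
      by (intro order_trans[OF abs_triangle_ineq]) (simp add: abs_mult)
    also have "\<dots> \<le> (K * l1norm (x - y)) * C' + C * (K' * l1norm (x - y))"
      using * that by (intro add_mono mult_mono) auto
    finally show ?thesis by (simp add: algebra_simps)
  qed
  ultimately show ?case using *(1-4)
    by (intro exI[of _ "K * C' + C * K'"] conjI exI[of _ "C * C'"]) auto
qed

text \<open>Polynomials are dense by Stone-Weierstrass and Lipschitz on the simplex, so they have
  homogeneous Lipschitz extensions. Hence such functions suffice to test equality and weak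
  convergence.\<close>

lemma hom_lip_approximation:
  fixes f :: "real ^ 'e::finite \<Rightarrow> real"
  assumes f: "continuous_on prob_simplex f" and d: "0 < d"
  obtains L G where "hom_lip L G" "\<And>x. x \<in> prob_simplex \<Longrightarrow> \<bar>f x - G x\<bar> \<le> d"
proof -
  obtain g where g: "real_polynomial_function g" "\<And>x. x \<in> prob_simplex \<Longrightarrow> norm (f x - g x) < d"
    using Stone_Weierstrass_polynomial_function[OF compact_simplex f d]
    by (auto simp: real_polynomial_function_eq)
  obtain K C where KC: "0 \<le> K" "0 \<le> C" "\<And>x. x \<in> prob_simplex \<Longrightarrow> \<bar>g x\<bar> \<le> C"
    "\<And>x y. x \<in> prob_simplex \<Longrightarrow> y \<in> prob_simplex \<Longrightarrow> \<bar>g x - g y\<bar> \<le> K * l1norm (x - y)"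
    using polynomial_lipschitz_simplex[OF g(1)] by blast
  have "continuous_on UNIV g"
    using g(1) by (intro continuous_at_imp_continuous_on) (auto simp: continuous_real_polymonial_function)
  then have "g \<in> borel_measurable borel" by (rule borel_measurable_continuous_onI)
  then have "hom_lip (C + 2 * K) (\<lambda>v. mass v * g (normalized v))"
    using KC by (intro hom_lip_extension)
  moreover have "\<bar>f x - mass x * g (normalized x)\<bar> \<le> d" if "x \<in> prob_simplex" for x
    using g(2)[OF that] that by (simp add: simplex_iff normalized_def)
  ultimately show ?thesis by (rule that)
qed

lemma simplex_prob_space:
  assumes "N \<in> simplex_laws"
  shows "prob_space N" "sets N = sets simplex_borel" "space N = prob_simplex"
  using assms sets_eq_imp_space_eq[of N simplex_borel] by (auto simp: space_prob_algebra space_simplex_borel)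

lemma continuous_integrable_simplex:
  fixes f :: "real ^ 'e::finite \<Rightarrow> real"
  assumes "continuous_on prob_simplex f" "N \<in> simplex_laws"
  shows "integrable N f"
proof -
  note N = simplex_prob_space[OF assms(2)]
  interpret prob_space N by (rule N)
  have "bounded (f ` prob_simplex)"
    by (rule compact_imp_bounded[OF compact_continuous_image[OF assms(1) compact_simplex]])
  then obtain B where "\<And>x. x \<in> prob_simplex \<Longrightarrow> norm (f x) \<le> B" unfolding bounded_iff by auto
  moreover have "f \<in> borel_measurable N"
    using borel_measurable_continuous_on_restrict[OF assms(1)] N(2)
    by (simp add: simplex_borel_def cong: measurable_cong_sets)
  ultimately show ?thesis
    by (intro integrable_const_bound[of _ B]) (auto simp: N(3))
qed

lemma integral_approximation:
  fixes f :: "real ^ 'e::finite \<Rightarrow> real"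
  assumes f: "continuous_on prob_simplex f" and G: "integrable N G"
    and d: "\<And>x. x \<in> prob_simplex \<Longrightarrow> \<bar>f x - G x\<bar> \<le> d" and N: "N \<in> simplex_laws"
  shows "\<bar>(\<integral>x. f x \<partial>N) - (\<integral>x. G x \<partial>N)\<bar> \<le> d"
proof -
  note N' = simplex_prob_space[OF N]
  interpret prob_space N by (rule N')
  note fi = continuous_integrable_simplex[OF f N]
  have "\<bar>(\<integral>x. f x \<partial>N) - (\<integral>x. G x \<partial>N)\<bar> = \<bar>\<integral>x. f x - G x \<partial>N\<bar>" using fi G by simp
  also have "\<dots> \<le> (\<integral>x. \<bar>f x - G x\<bar> \<partial>N)" by (rule integral_abs_bound)
  also have "\<dots> \<le> (\<integral>x. d \<partial>N)" using fi G d N'(3) by (intro integral_mono) auto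
  finally show ?thesis by (simp add: prob_space)
qed

text \<open>Equality of integrals passes to continuous functions by approximation, to closed sets as
  limits of \<open>max 0 (1 - real k * infdist x C)\<close>, and to all Borel sets because the
  closed subsets are a generator stable under intersection.\<close>

lemma simplex_measure_eqI:
  fixes N N' :: "(real ^ 'e::finite) measure"
  assumes N: "N \<in> simplex_laws" and N': "N' \<in> simplex_laws"
    and eq: "\<And>L F. hom_lip L F \<Longrightarrow> (\<integral>x. F x \<partial>N) = (\<integral>x. F x \<partial>N')"
    and int: "\<And>L F. hom_lip L F \<Longrightarrow> integrable N F" "\<And>L F. hom_lip L F \<Longrightarrow> integrable N' F"
  shows "N = N'"
proof -
  note n = simplex_prob_space[OF N] and n' = simplex_prob_space[OF N']
  interpret N: prob_space N by (rule n)
  interpret N': prob_space N' by (rule n')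
  have eq_cont: "(\<integral>x. f x \<partial>N) = (\<integral>x. f x \<partial>N')" if f: "continuous_on prob_simplex f" for f :: "real ^ 'e \<Rightarrow> real"
  proof (rule ccontr)
    assume ne: "(\<integral>x. f x \<partial>N) \<noteq> (\<integral>x. f x \<partial>N')"
    define d where "d = \<bar>(\<integral>x. f x \<partial>N) - (\<integral>x. f x \<partial>N')\<bar> / 3"
    have d: "0 < d" using ne by (simp add: d_def)
    obtain L G where G: "hom_lip L G" "\<And>x. x \<in> prob_simplex \<Longrightarrow> \<bar>f x - G x\<bar> \<le> d"
      using hom_lip_approximation[OF f d] by blast
    have "\<bar>(\<integral>x. f x \<partial>N) - (\<integral>x. G x \<partial>N)\<bar> \<le> d"
      by (rule integral_approximation[OF f int(1)[OF G(1)] G(2) N])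
    moreover have "\<bar>(\<integral>x. f x \<partial>N') - (\<integral>x. G x \<partial>N')\<bar> \<le> d"
      by (rule integral_approximation[OF f int(2)[OF G(1)] G(2) N'])
    moreover have "\<bar>(\<integral>x. f x \<partial>N) - (\<integral>x. f x \<partial>N')\<bar> = 3 * d" by (simp add: d_def)
    ultimately show False using d eq[OF G(1)] by linarith
  qed
  define E where "E = {C :: (real ^ 'e) set. closed C \<and> C \<subseteq> prob_simplex}"
  have meas: "measure N C = measure N' C" if C: "C \<in> E" for C
  proof (cases "C = {}")
    case False
    have lim: "(\<lambda>k. \<integral>x. max 0 (1 - real k * infdist x C) \<partial>K) \<longlonglongrightarrow> measure K C"
      if K: "K \<in> simplex_laws" for K
    proof -
      note k = simplex_prob_space[OF K]
      interpret prob_space K by (rule k)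
      have CK: "C \<in> sets K" using C k(2) by (auto simp: E_def sets_simplex_borel)
      have "(\<lambda>k. \<integral>x. max 0 (1 - real k * infdist x C) \<partial>K) \<longlonglongrightarrow> (\<integral>x. indicator C x \<partial>K)"
      proof (rule integral_dominated_convergence[where w = "\<lambda>_. 1"])
        show "(\<lambda>x. max 0 (1 - real k * infdist x C)) \<in> borel_measurable K" for k
          by (intro borel_measurable_integrable[OF continuous_integrable_simplex[OF _ K]] continuous_intros)
        show "AE x in K. (\<lambda>k. max 0 (1 - real k * infdist x C)) \<longlonglongrightarrow> indicator C x"
        proof (intro AE_I2)
          fix x
          show "(\<lambda>k. max 0 (1 - real k * infdist x C)) \<longlonglongrightarrow> indicator C x"
          proof (cases "x \<in> C")
            case True
            then show ?thesis by simp
          next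
            case F: False
            then have p: "0 < infdist x C"
              using C \<open>C \<noteq> {}\<close> in_closed_iff_infdist_zero[of C x] infdist_nonneg[of x C] by (auto simp: E_def less_le)
            obtain m where m: "1 / infdist x C < real m" using reals_Archimedean2 by blast
            have "max 0 (1 - real k * infdist x C) = 0" if "m \<le> k" for k
            proof -
              have "1 < real m * infdist x C" using m p by (simp add: pos_divide_less_eq)
              also have "\<dots> \<le> real k * infdist x C" using that p by (intro mult_right_mono) auto
              finally show ?thesis by simp
            qed
            then have "\<forall>\<^sub>F k in sequentially. max 0 (1 - real k * infdist x C) = 0"
              unfolding eventually_sequentially by blast
            then show ?thesis using F by (simp add: tendsto_eventually)
          qed
        qed
        show "AE x in K. norm (max 0 (1 - real k * infdist x C)) \<le> 1" for k
          by (intro AE_I2) (simp add: infdist_nonneg)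
      qed (use CK in auto)
      then show ?thesis using CK by simp
    qed
    have "(\<integral>x. max 0 (1 - real k * infdist x C) \<partial>N) = (\<integral>x. max 0 (1 - real k * infdist x C) \<partial>N')" for k
      by (intro eq_cont continuous_intros)
    then show ?thesis using lim[OF N] lim[OF N'] LIMSEQ_unique by simp
  qed simp
  have gen: "sets simplex_borel = sigma_sets prob_simplex E"
  proof -
    have "sets simplex_borel = (\<inter>) prob_simplex ` sigma_sets UNIV {C :: (real ^ 'e) set. closed C}"
      unfolding simplex_borel_def sets_restrict_space by (simp add: borel_eq_closed)
    also have "\<dots> = sigma_sets prob_simplex ((\<inter>) prob_simplex ` {C. closed C})"
      by (rule sigma_sets_Int) (auto intro: closed_simplex)
    also have "(\<inter>) prob_simplex ` {C. closed C} = E"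
      unfolding E_def using closed_simplex by (auto simp: image_iff intro!: closed_Int)
    finally show ?thesis .
  qed
  show ?thesis
  proof (rule measure_eqI_generator_eq[of E prob_simplex N N' "\<lambda>_. prob_simplex"])
    show "Int_stable E" by (auto simp: E_def Int_stable_def)
    show "E \<subseteq> Pow prob_simplex" by (auto simp: E_def)
    show "emeasure N X = emeasure N' X" if "X \<in> E" for X
      using meas[OF that] by (simp add: N.emeasure_eq_measure N'.emeasure_eq_measure)
    show "sets N = sigma_sets prob_simplex E" "sets N' = sigma_sets prob_simplex E" using n n' gen by auto
    show "range (\<lambda>_. prob_simplex) \<subseteq> E" using closed_simplex by (auto simp: E_def)
  qed auto
qed

text \<open>Membership of \<open>Ns n\<close> is demanded from \<open>n = 1\<close> on, where Cesaro
  means become probability measures.\<close>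

lemma weakly_convergesI:
  fixes N :: "(real ^ 'e::finite) measure"
  assumes N: "N \<in> simplex_laws"
    and Ns: "\<And>n. n \<ge> 1 \<Longrightarrow> Ns n \<in> simplex_laws"
    and int: "\<And>L (F :: real ^ 'e \<Rightarrow> real) K. hom_lip L F \<Longrightarrow> K \<in> simplex_laws \<Longrightarrow> integrable K F"
    and lim: "\<And>L F. hom_lip L F \<Longrightarrow> (\<lambda>n. \<integral>x. F x \<partial>Ns n) \<longlonglongrightarrow> (\<integral>x. F x \<partial>N)"
  shows "weakly_converges Ns N"
  unfolding weakly_converges_def
proof (intro allI impI LIMSEQ_I)
  fix f :: "real ^ 'e \<Rightarrow> real" and r :: real
  assume f: "continuous_on prob_simplex f \<and> bounded (f ` prob_simplex)" and r: "0 < r"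
  obtain L G where G: "hom_lip L G" "\<And>x. x \<in> prob_simplex \<Longrightarrow> \<bar>f x - G x\<bar> \<le> r / 4"
    using hom_lip_approximation[of f "r / 4"] f r by auto
  obtain n0 where n0: "\<And>n. n \<ge> n0 \<Longrightarrow> \<bar>(\<integral>x. G x \<partial>Ns n) - (\<integral>x. G x \<partial>N)\<bar> < r / 4"
    using LIMSEQ_D[OF lim[OF G(1)], of "r / 4"] r by auto
  show "\<exists>n0. \<forall>n\<ge>n0. norm ((\<integral>x. f x \<partial>Ns n) - (\<integral>x. f x \<partial>N)) < r"
  proof (intro exI allI impI)
    fix n assume n: "max n0 1 \<le> n"
    have fc: "continuous_on prob_simplex f" using f by simp
    have 1: "Ns n \<in> simplex_laws" using n Ns by simp
    have "\<bar>(\<integral>x. f x \<partial>Ns n) - (\<integral>x. G x \<partial>Ns n)\<bar> \<le> r / 4"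
      by (rule integral_approximation[OF fc int[OF G(1) 1] G(2) 1])
    moreover have "\<bar>(\<integral>x. f x \<partial>N) - (\<integral>x. G x \<partial>N)\<bar> \<le> r / 4"
      by (rule integral_approximation[OF fc int[OF G(1) N] G(2) N])
    moreover have "\<bar>(\<integral>x. G x \<partial>Ns n) - (\<integral>x. G x \<partial>N)\<bar> < r / 4" using n0 n by simp
    ultimately show "norm ((\<integral>x. f x \<partial>Ns n) - (\<integral>x. f x \<partial>N)) < r" unfolding real_norm_def by linarith
  qed
qed

section \<open>Numerical semigroups\<close>

text \<open>Let \<open>d\<close> be the least positive difference of two elements. A nonzero
  remainder of an element modulo \<open>d\<close> would be a smaller difference, so \<open>d\<close>
  divides everything and equals 1. The semigroup, with zero added, then contains some
  \<open>b\<close> and \<open>b + 1\<close>.\<close>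

lemma numerical_semigroup:
  fixes S :: "nat set"
  assumes add: "\<And>a b. a \<in> S \<Longrightarrow> b \<in> S \<Longrightarrow> a + b \<in> S" and gcd: "Gcd S = 1"
  shows "\<exists>n0. \<forall>n\<ge>n0. n \<in> S"
proof -
  define T where "T = insert 0 S"
  have Tadd: "a + b \<in> T" if "a \<in> T" "b \<in> T" for a b using that add by (auto simp: T_def)
  have Tmult: "k * a \<in> T" if "a \<in> T" for k a
    by (induction k) (use Tadd that in \<open>auto simp: T_def\<close>)
  define D where "D d \<longleftrightarrow> 0 < d \<and> (\<exists>b\<in>T. b + d \<in> T)" for d
  have "\<exists>s\<in>S. s \<noteq> 0" using gcd Gcd_0_iff[of S] by auto
  then have "\<exists>d. D d" by (auto simp: D_def T_def)
  define d where "d = (LEAST d. D d)"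
  have d: "D d" unfolding d_def using \<open>\<exists>d. D d\<close> by (rule LeastI_ex)
  have least: "d \<le> r" if "D r" for r unfolding d_def using that by (rule Least_le)
  obtain b where b: "b \<in> T" "b + d \<in> T" "0 < d" using d by (auto simp: D_def)
  have "d dvd s" if "s \<in> S" for s
  proof (rule ccontr)
    assume "\<not> d dvd s"
    then have r: "0 < s mod d" by (simp add: dvd_eq_mod_eq_0)
    have "(s div d) * (b + d) + s mod d = s + (s div d) * b"
      by (metis add.commute add.left_commute distrib_left div_mult_mod_eq)
    moreover have "s + (s div d) * b \<in> T"
      by (rule Tadd[OF _ Tmult[OF b(1)]]) (simp add: T_def that)
    moreover have "(s div d) * (b + d) \<in> T" by (rule Tmult[OF b(2)])
    ultimately have "D (s mod d)" using r unfolding D_def by metis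
    then show False using least[of "s mod d"] mod_less_divisor[OF b(3), of s] by simp
  qed
  then have "d dvd 1" using gcd by (metis Gcd_greatest)
  then have d1: "b + 1 \<in> T" using b(2) by simp
  have "n \<in> S" if n: "b * b + 1 \<le> n" for n
  proof -
    have "n \<in> T"
    proof (cases "b = 0")
      case True
      then show ?thesis using Tmult[of 1 n] d1 by simp
    next
      case False
      have "b \<le> n div b" using n False by (metis add_leD1 div_le_mono nonzero_mult_div_cancel_right)
      then have le: "n mod b \<le> n div b" using False by (meson less_imp_le mod_less_divisor neq0_conv order_trans)
      \<comment> \<open>Start from \<open>n div b\<close> copies of \<open>b\<close> and exchange
        \<open>n mod b\<close> of them for \<open>b + 1\<close>; there are enough copies because
        \<open>b * b \<le> n\<close>.\<close>
      have "n = (n div b - n mod b) * b + (n mod b) * (b + 1)"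
      proof -
        have "(n div b - n mod b) * b + (n mod b) * (b + 1) = (n div b - n mod b + n mod b) * b + n mod b"
          by (simp add: distrib_left distrib_right del: le_add_diff_inverse2)
        then show ?thesis using le by simp
      qed
      then show ?thesis using Tadd[OF Tmult[OF b(1)] Tmult[OF d1]] by metis
    qed
    then show ?thesis using n by (simp add: T_def)
  qed
  then show ?thesis by blast
qed

section \<open>Uniqueness and convergence under condition (KR)\<close>

text \<open>Each shift by one telescopes to a bounded boundary term divided by \<open>n\<close>; the
  induction adds up \<open>s\<close> of them.\<close>

lemma average_shift_tendsto:
  fixes x :: "nat \<Rightarrow> real"
  assumes "\<And>k. \<bar>x k\<bar> \<le> C"
  shows "(\<lambda>n. (\<Sum>k=1..n. x (k + s) - x k) / real n) \<longlonglongrightarrow> 0"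
proof (induction s)
  case (Suc s)
  have tel: "(\<Sum>k=1..n. x (k + Suc s) - x (k + s)) = x (n + Suc s) - x (Suc s)" for n
    by (induction n) auto
  have 1: "(\<lambda>n. (x (n + Suc s) - x (Suc s)) / real n) \<longlonglongrightarrow> 0"
  proof (rule Lim_null_comparison)
    show "\<forall>\<^sub>F n in sequentially. norm ((x (n + Suc s) - x (Suc s)) / real n) \<le> (2 * C) / real n"
    proof (intro always_eventually allI)
      fix n
      have "\<bar>x (n + Suc s) - x (Suc s)\<bar> \<le> 2 * C"
        using assms[of "n + Suc s"] assms[of "Suc s"] by linarith
      then show "norm ((x (n + Suc s) - x (Suc s)) / real n) \<le> (2 * C) / real n"
        by (simp add: divide_right_mono)
    qed
    show "(\<lambda>n. (2 * C) / real n) \<longlonglongrightarrow> 0" by (rule lim_const_over_n)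
  qed
  have "(\<Sum>k=1..n. x (k + Suc s) - x k) / real n
      = (x (n + Suc s) - x (Suc s)) / real n + (\<Sum>k=1..n. x (k + s) - x k) / real n" for n
    unfolding tel[symmetric] add_divide_distrib[symmetric] sum.distrib[symmetric] by simp
  then show ?case using tendsto_add[OF 1 Suc.IH] by simp
qed simp

context filter_model
begin

text \<open>A Cesaro mean is the mixture over a uniformly chosen time. In this form measure axioms
  and integrals come from the monadic bind instead of \<open>measure_of\<close>.\<close>

lemma cesaro_mean_bind:
  assumes N: "N \<in> simplex_laws" and n: "1 \<le> n"
  shows "cesaro_mean \<phi> M N n = measure_pmf (pmf_of_set {1..n}) \<bind> (\<lambda>k. (filter_step \<phi> M ^^ k) N)"
    and "cesaro_mean \<phi> M N n \<in> simplex_laws"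
proof -
  let ?p = "measure_pmf (pmf_of_set {1..n})" and ?K = "\<lambda>k. (filter_step \<phi> M ^^ k) N"
  have p: "?p \<in> space (prob_algebra (count_space UNIV))"
    by (simp add: space_prob_algebra measure_pmf.prob_space_axioms)
  have K: "?K \<in> count_space UNIV \<rightarrow>\<^sub>M prob_algebra simplex_borel"
    using filter_steps_prob[OF N] by simp
  have B: "?p \<bind> ?K \<in> simplex_laws"
    using prob_space_bind'[OF p K] sets_bind'[OF p K] by (simp add: space_prob_algebra)
  note Bs = simplex_prob_space[OF B]
  have "emeasure (?p \<bind> ?K) A = (\<Sum>k=1..n. emeasure (?K k) A) / of_nat n" if "A \<in> sets simplex_borel" for A
    unfolding emeasure_bind_prob_algebra[OF p K that]
    using n by (subst nn_integral_pmf_of_set) auto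
  moreover have "sigma_sets prob_simplex (sets simplex_borel) = sets (simplex_borel :: (real ^ 'e) measure)"
    using sets.sigma_sets_eq[of "simplex_borel :: (real ^ 'e) measure"] by (simp add: space_simplex_borel)
  moreover have "sets simplex_borel \<subseteq> Pow (prob_simplex :: (real ^ 'e) set)"
    by (auto simp: sets_simplex_borel)
  ultimately have "cesaro_mean \<phi> M N n = measure_of prob_simplex (sets simplex_borel) (emeasure (?p \<bind> ?K))"
    unfolding cesaro_mean_def by (intro measure_of_eq) auto
  also have "\<dots> = ?p \<bind> ?K" using measure_of_of_measure[of "?p \<bind> ?K"] Bs by simp
  finally show eq: "cesaro_mean \<phi> M N n = ?p \<bind> ?K" .
  show "cesaro_mean \<phi> M N n \<in> simplex_laws" unfolding eq by (rule B)
qed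

lemma integral_cesaro_mean:
  assumes N: "N \<in> simplex_laws" and n: "1 \<le> n" and F: "hom_lip L F"
  shows "(\<integral>\<nu>. F \<nu> \<partial>cesaro_mean \<phi> M N n) = (\<Sum>k=1..n. \<integral>\<mu>. (step ^^ k) F \<mu> \<partial>N) / real n"
proof -
  let ?p = "measure_pmf (pmf_of_set {1..n})" and ?K = "\<lambda>k. (filter_step \<phi> M ^^ k) N"
  have "(\<integral>\<nu>. F \<nu> \<partial>cesaro_mean \<phi> M N n) = (\<integral>k. \<integral>\<nu>. F \<nu> \<partial>?K k \<partial>?p)"
    unfolding cesaro_mean_bind(1)[OF N n]
  proof (rule integral_bind)
    show "F \<in> borel_measurable simplex_borel"
      unfolding simplex_borel_def using hom_lipD(2)[OF F] by (rule measurable_restrict_space1)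
    show "\<bar>F x\<bar> \<le> L" if "x \<in> space simplex_borel" for x
      using hom_lip_bound[OF F, of x] that by (simp add: space_simplex_borel simplex_iff)
    show "?K \<in> ?p \<rightarrow>\<^sub>M subprob_algebra simplex_borel"
      using filter_steps_prob[OF N] prob_space_imp_subprob_space
      by (auto simp: space_prob_algebra space_subprob_algebra measurable_pmf_measure1)
    show "finite_measure ?p" by unfold_locales
    show "AE k in ?p. emeasure (?K k) (space (?K k)) \<le> ennreal 1"
      using simplex_prob_space(1)[OF filter_steps_prob[OF N]]
      by (intro AE_I2) (simp add: prob_space.emeasure_space_1)
  qed
  also have "\<dots> = (\<Sum>k=1..n. \<integral>\<nu>. F \<nu> \<partial>?K k) / real n"
    using n by (subst integral_pmf_of_set) auto
  finally show ?thesis by (simp add: integral_filter_steps[OF F N])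
qed

lemma steps_lower_bound:
  assumes h: "hom_lip L h" and A: "\<And>\<mu>. \<mu> \<in> prob_simplex \<Longrightarrow> A \<le> h \<mu>" and \<mu>: "\<mu> \<in> prob_simplex"
  shows "A \<le> (step ^^ k) h \<mu>"
proof -
  have "A * mass v \<le> h v" if v: "v \<in> nonneg_cone" for v
  proof (cases "mass v = 0")
    case True
    then show ?thesis using mass_zero_cone[OF v True] hom_lip_zero[OF h] by simp
  next
    case False
    have "mass v * A \<le> mass v * h (normalized v)"
      using A normalized_simplex[OF v False] mass_nonneg[OF v] by (intro mult_left_mono)
    then show ?thesis using hom_lip_normalized[OF h v] by (simp add: mult.commute)
  qed
  then have "(step ^^ k) (\<lambda>v. A * mass v) \<mu> \<le> (step ^^ k) h \<mu>"
    by (rule steps_mono[OF hom_lip_cmult[OF hom_lip_mass] h simplex_cone[OF \<mu>]])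
  then show ?thesis using \<mu> by (simp add: steps_cmult steps_mass simplex_iff)
qed

lemma integral_steps_bounds:
  assumes h: "hom_lip L h" and N: "N \<in> simplex_laws"
    and AB: "\<And>\<mu>. \<mu> \<in> prob_simplex \<Longrightarrow> A \<le> h \<mu>" "\<And>\<mu>. \<mu> \<in> prob_simplex \<Longrightarrow> h \<mu> \<le> B"
  shows "A \<le> (\<integral>\<mu>. (step ^^ k) h \<mu> \<partial>N)" "(\<integral>\<mu>. (step ^^ k) h \<mu> \<partial>N) \<le> B"
proof -
  note n = simplex_prob_space[OF N]
  interpret prob_space N by (rule n)
  note int = hom_lip_integrable[OF hom_lip_steps[OF h] N]
  have "- B \<le> (step ^^ k) (\<lambda>v. - h v) \<mu>" if "\<mu> \<in> prob_simplex" for \<mu>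
    by (rule steps_lower_bound[OF hom_lip_minus[OF h] _ that]) (use AB(2) in simp)
  then have B: "(step ^^ k) h \<mu> \<le> B" if "\<mu> \<in> prob_simplex" for \<mu>
    using that steps_cmult[of k "-1" h] by simp
  show "A \<le> (\<integral>\<mu>. (step ^^ k) h \<mu> \<partial>N)"
    using steps_lower_bound[OF h AB(1)] n(3) by (intro integral_ge_const int AE_I2) auto
  show "(\<integral>\<mu>. (step ^^ k) h \<mu> \<partial>N) \<le> B"
    using B n(3) by (intro integral_le_const int AE_I2) auto
qed

lemma invariant_filter_steps:
  assumes "invariant_measure \<phi> M N" shows "(filter_step \<phi> M ^^ k) N = N"
  by (induction k) (use assms in \<open>simp_all add: invariant_measure_def\<close>)

lemma integral_invariant_steps:
  assumes "invariant_measure \<phi> M N" "hom_lip L F"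
  shows "(\<integral>\<mu>. (step ^^ k) F \<mu> \<partial>N) = (\<integral>\<mu>. F \<mu> \<partial>N)"
  using integral_filter_steps[OF assms(2), of N k] invariant_filter_steps[OF assms(1), of k] assms(1)
  by (simp add: invariant_measure_def)

lemma mat_power_add: "mat_power A (m + n) = mat_power A m ** mat_power A n" for A :: "real ^ 'e ^ 'e"
  by (induction n) (simp_all add: mat_power_def matrix_mul_assoc)

lemma Q_power_add_ge: "mat_power Q m $ i $ k * mat_power Q n $ k $ j \<le> mat_power Q (m + n) $ i $ j"
proof -
  have "mat_power Q m $ i $ k * mat_power Q n $ k $ j \<le> (\<Sum>k\<in>UNIV. mat_power Q m $ i $ k * mat_power Q n $ k $ j)"
    by (rule member_le_sum) (auto intro!: mult_nonneg_nonneg Q_power_nonneg)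
  then show ?thesis by (simp add: mat_power_add matrix_matrix_mult_def)
qed

text \<open>The return times to \<open>i\<close> are closed under addition and have gcd 1, so all
  large times belong to them; a fixed path from \<open>j\<close> to \<open>i\<close> comes before.
  Finitely many pairs admit a common threshold.\<close>

lemma aperiodic_eventually_positive:
  assumes "aperiodic_mat Q"
  obtains r where "\<And>i j. 0 < mat_power Q r $ j $ i"
proof -
  have "eventually (\<lambda>r. 0 < mat_power Q r $ j $ i) sequentially" for i j
  proof -
    let ?S = "{n. n \<ge> 1 \<and> mat_power Q n $ i $ i > 0}"
    obtain m where m: "mat_power Q m $ j $ i > 0"
      using Q_irreducible unfolding irreducible_mat_def by blast
    have "\<exists>n0. \<forall>n\<ge>n0. n \<in> ?S"
    proof (rule numerical_semigroup)
      show "a + b \<in> ?S" if "a \<in> ?S" "b \<in> ?S" for a b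
        using that Q_power_add_ge[of a i i b i] mult_pos_pos by (auto intro: less_le_trans)
      show "Gcd ?S = 1" using assms by (simp add: aperiodic_mat_def)
    qed
    then obtain n0 where n0: "\<And>n. n \<ge> n0 \<Longrightarrow> n \<in> ?S" by blast
    have "0 < mat_power Q r $ j $ i" if "m + n0 \<le> r" for r
    proof -
      have "0 < mat_power Q m $ j $ i * mat_power Q (r - m) $ i $ i"
        using m n0[of "r - m"] that by simp
      also have "\<dots> \<le> mat_power Q r $ j $ i" using Q_power_add_ge[of m j i "r - m" i] that by simp
      finally show ?thesis .
    qed
    then show ?thesis unfolding eventually_sequentially by blast
  qed
  then have "eventually (\<lambda>r. \<forall>i j. 0 < mat_power Q r $ j $ i) sequentially"
    by (intro eventually_all_finite)
  then show ?thesis using that by (auto simp: eventually_sequentially)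
qed

lemma irreducible_average_positive:
  obtains R where "1 \<le> R" "\<And>i j. 0 < (\<Sum>r\<in>{1..R}. 1 / real R * mat_power Q r $ j $ i)"
proof -
  have "\<forall>p. \<exists>n. n \<ge> 1 \<and> mat_power Q n $ fst p $ snd p > 0"
    using Q_irreducible unfolding irreducible_mat_def by blast
  then obtain m where m: "\<And>p. m p \<ge> 1 \<and> mat_power Q (m p) $ fst p $ snd p > 0" by metis
  \<comment> \<open>At least one passage time of every pair of states lies in the segment up to
    \<open>R\<close>.\<close>
  define R where "R = Max (range m)"
  have R: "m p \<le> R" for p unfolding R_def by simp
  have R1: "1 \<le> R" using m R order_trans by blast
  have "0 < (\<Sum>r\<in>{1..R}. 1 / real R * mat_power Q r $ j $ i)" for i j
  proof (rule sum_pos2[where i = "m (j, i)"])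
    show "0 < 1 / real R * mat_power Q (m (j, i)) $ j $ i" using m[of "(j, i)"] R1 by simp
    show "0 \<le> 1 / real R * mat_power Q r $ j $ i" for r by (simp add: Q_power_nonneg)
    show "m (j, i) \<in> {1..R}" using m R by simp
  qed simp
  then show ?thesis using that[OF R1] by blast
qed

end

section \<open>Merging of iterates and of their averages for any two initial laws\<close>

context regular_filter_model
begin

text \<open>For an aperiodic signal a single time \<open>r\<close> suffices, so \<open>mix\<close>
  is a power of the operator and small oscillation is reached by an iterate of \<open>g\<close>.
  Further steps keep the values within the same bounds, so the integrals against any two laws stay
  close forever.\<close>

lemma KR_steps_merge:
  assumes KR: "condition_KR \<phi> M" and ap: "aperiodic_mat Q" and g: "hom_lip L g" and d: "0 < d"
    and N: "N \<in> simplex_laws" and N': "N' \<in> simplex_laws"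
  shows "\<exists>m. \<forall>k\<ge>m. \<bar>(\<integral>\<mu>. (step ^^ k) g \<mu> \<partial>N) - (\<integral>\<mu>. (step ^^ k) g \<mu> \<partial>N')\<bar> \<le> d"
proof -
  obtain r where r: "\<And>i j. 0 < mat_power Q r $ j $ i" using aperiodic_eventually_positive[OF ap] by blast
  interpret mixing_weights \<phi> M "\<lambda>_. 1" "{r}" by unfold_locales auto
  define R where "R h \<longleftrightarrow> hom_lip L h \<and> (\<exists>m. \<forall>v\<in>nonneg_cone. h v = (step ^^ m) g v)" for h
  obtain h A B where h: "R h" "\<And>\<mu>. \<mu> \<in> prob_simplex \<Longrightarrow> A \<le> h \<mu>" "\<And>\<mu>. \<mu> \<in> prob_simplex \<Longrightarrow> h \<mu> \<le> B" "B - A \<le> d"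
  proof (rule small_oscillation[where R = R, OF KR _ d])
    show "0 < (\<Sum>r\<in>{r}. 1 * mat_power Q r $ j $ i)" for i j using r by simp
    show "R g" using g unfolding R_def by (auto intro: exI[of _ 0])
    show "hom_lip L h" if "R h" for h using that by (simp add: R_def)
    fix h n assume "R h"
    then obtain m where h: "hom_lip L h" and m: "\<And>v. v \<in> nonneg_cone \<Longrightarrow> h v = (step ^^ m) g v"
      unfolding R_def by blast
    have "mix (\<lambda>_. 1) {r} n h v = (step ^^ (r + n + m)) g v" if "v \<in> nonneg_cone" for v
      using steps_cong[OF that m, where n = "r + n"] by (simp add: mix_def funpow_add)
    then show "R (mix (\<lambda>_. 1) {r} n h)" unfolding R_def using mix_hom_lip[OF h] by blast
  qed blast
  then obtain m where m: "\<And>v. v \<in> nonneg_cone \<Longrightarrow> h v = (step ^^ m) g v" and hl: "hom_lip L h"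
    unfolding R_def by blast
  have b: "A \<le> (\<integral>\<mu>. (step ^^ k) g \<mu> \<partial>K) \<and> (\<integral>\<mu>. (step ^^ k) g \<mu> \<partial>K) \<le> B"
    if K: "K \<in> simplex_laws" and k: "m \<le> k" for K k
  proof -
    have "(step ^^ (k - m)) h \<mu> = (step ^^ k) g \<mu>" if "\<mu> \<in> prob_simplex" for \<mu>
      using steps_cong[OF simplex_cone[OF that] m, where n = "k - m"] k funpow_add[of "k - m" m step] by simp
    then have "(\<integral>\<mu>. (step ^^ (k - m)) h \<mu> \<partial>K) = (\<integral>\<mu>. (step ^^ k) g \<mu> \<partial>K)"
      using simplex_prob_space(3)[OF K] by (intro Bochner_Integration.integral_cong) auto
    then show ?thesis using integral_steps_bounds[OF hl K h(2,3), of "k - m"] by simp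
  qed
  have "\<bar>(\<integral>\<mu>. (step ^^ k) g \<mu> \<partial>N) - (\<integral>\<mu>. (step ^^ k) g \<mu> \<partial>N')\<bar> \<le> d" if "m \<le> k" for k
    using b[OF N that] b[OF N' that] h(4) by linarith
  then show ?thesis by blast
qed

text \<open>Several times must be mixed, so the contracted function \<open>h\<close> is no longer an
  iterate of \<open>g\<close>. It is a convex combination of iterates, however, and time shifts do
  not change Cesaro limits; \<open>R\<close> records this asymptotic equality for every initial
  law.\<close>

lemma KR_averages_merge:
  assumes KR: "condition_KR \<phi> M" and g: "hom_lip L g"
    and N: "N \<in> simplex_laws" and N': "N' \<in> simplex_laws"
  shows "(\<lambda>n. (\<Sum>k=1..n. \<integral>\<mu>. (step ^^ k) g \<mu> \<partial>N) / real n - (\<Sum>k=1..n. \<integral>\<mu>. (step ^^ k) g \<mu> \<partial>N') / real n) \<longlonglongrightarrow> 0"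
proof -
  obtain r where r1: "1 \<le> r" and r: "\<And>i j. 0 < (\<Sum>s\<in>{1..r}. 1 / real r * mat_power Q s $ j $ i)"
    using irreducible_average_positive by blast
  interpret mixing_weights \<phi> M "\<lambda>_. 1 / real r" "{1..r}" using r1 by unfold_locales auto
  define x where "x K h k = (\<integral>\<mu>. (step ^^ k) h \<mu> \<partial>K)" for K h k
  define R where "R h \<longleftrightarrow> hom_lip L h \<and> (\<forall>K\<in>simplex_laws.
    (\<lambda>n. (\<Sum>k=1..n. x K h k - x K g k) / real n) \<longlonglongrightarrow> 0)" for h
  show ?thesis
  proof (rule LIMSEQ_I)
    fix d :: real assume d: "0 < d"
    \<comment> \<open>The budget \<open>d\<close> is split into \<open>d / 2\<close> for the
      oscillation of \<open>h\<close> and \<open>d / 4\<close> for each of the two replacements of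
      \<open>g\<close> by \<open>h\<close>.\<close>
    obtain h A B where h: "R h" "\<And>\<mu>. \<mu> \<in> prob_simplex \<Longrightarrow> A \<le> h \<mu>" "\<And>\<mu>. \<mu> \<in> prob_simplex \<Longrightarrow> h \<mu> \<le> B" "B - A \<le> d / 2"
    proof (rule small_oscillation[where R = R and d = "d / 2", OF KR r])
      show "R g" using g unfolding R_def by simp
      show "hom_lip L h" if "R h" for h using that by (simp add: R_def)
      fix h n assume "R h"
      then have h: "hom_lip L h" and lim: "\<And>K. K \<in> simplex_laws \<Longrightarrow> (\<lambda>n. (\<Sum>k=1..n. x K h k - x K g k) / real n) \<longlonglongrightarrow> 0"
        unfolding R_def by auto
      have "(\<lambda>N. (\<Sum>k=1..N. x K (mix (\<lambda>_. 1 / real r) {1..r} n h) k - x K g k) / real N) \<longlonglongrightarrow> 0"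
        if K: "K \<in> simplex_laws" for K
      proof -
        have hm: "x K (mix (\<lambda>_. 1 / real r) {1..r} n h) k = (\<Sum>s=1..r. 1 / real r * x K h (k + (s + n)))" for k
        proof -
          have "x K (mix (\<lambda>_. 1 / real r) {1..r} n h) k = (\<integral>\<mu>. (\<Sum>s=1..r. 1 / real r * (step ^^ (k + (s + n))) h \<mu>) \<partial>K)"
            unfolding x_def
          proof (rule Bochner_Integration.integral_cong[OF refl])
            fix \<mu> assume "\<mu> \<in> space K"
            then have "\<mu> \<in> nonneg_cone" using simplex_prob_space(3)[OF K] by (simp add: simplex_cone)
            from steps_sum[OF hom_lip_steps[OF h] this, of k "\<lambda>_. 1 / real r" "\<lambda>s. s + n" "{1..r}"]
            show "(step ^^ k) (mix (\<lambda>_. 1 / real r) {1..r} n h) \<mu> = (\<Sum>s=1..r. 1 / real r * (step ^^ (k + (s + n))) h \<mu>)"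
              by (simp add: mix_def[abs_def] funpow_add)
          qed
          also have "\<dots> = (\<Sum>s=1..r. 1 / real r * x K h (k + (s + n)))"
            unfolding x_def using hom_lip_integrable[OF hom_lip_steps[OF h] K]
            by (subst Bochner_Integration.integral_sum) auto
          finally show ?thesis .
        qed
        have bnd: "\<bar>x K h k\<bar> \<le> L" for k
        proof -
          have "- L \<le> h \<mu> \<and> h \<mu> \<le> L" if "\<mu> \<in> prob_simplex" for \<mu>
            using hom_lip_bound[OF h, of \<mu>] that by (simp add: simplex_iff abs_le_iff)
          then have "- L \<le> x K h k \<and> x K h k \<le> L"
            unfolding x_def using integral_steps_bounds[OF h K] by blast
          then show ?thesis by (simp add: abs_le_iff)
        qed
        \<comment> \<open>The error of the mixture is the old error plus a finite combination of
          time shift errors, each tending to zero.\<close>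
        have "(\<Sum>k=1..N. x K (mix (\<lambda>_. 1 / real r) {1..r} n h) k - x K g k) / real N
          = (\<Sum>s=1..r. 1 / real r * ((\<Sum>k=1..N. x K h (k + (s + n)) - x K h k) / real N)) + (\<Sum>k=1..N. x K h k - x K g k) / real N" for N
        proof -
          have "(\<Sum>s=1..r. 1 / real r * ((\<Sum>k=1..N. x K h (k + (s + n)) - x K h k) / real N))
            = (\<Sum>k=1..N. \<Sum>s=1..r. 1 / real r * (x K h (k + (s + n)) - x K h k)) / real N"
            by (subst sum.swap) (simp add: sum_divide_distrib sum_distrib_left)
          also have "(\<Sum>k=1..N. \<Sum>s=1..r. 1 / real r * (x K h (k + (s + n)) - x K h k))
            = (\<Sum>k=1..N. x K (mix (\<lambda>_. 1 / real r) {1..r} n h) k - x K h k)"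
            unfolding hm using r1 by (simp add: right_diff_distrib sum_subtractf)
          finally show ?thesis
            by (simp add: add_divide_distrib[symmetric] sum.distrib[symmetric])
        qed
        moreover have "(\<lambda>N. (\<Sum>s=1..r. 1 / real r * ((\<Sum>k=1..N. x K h (k + (s + n)) - x K h k) / real N)) + (\<Sum>k=1..N. x K h k - x K g k) / real N)
          \<longlonglongrightarrow> (\<Sum>s=1..r. 1 / real r * 0) + 0"
          by (intro tendsto_add tendsto_sum tendsto_mult_left average_shift_tendsto[of _ L] bnd lim K)
        ultimately show ?thesis by simp
      qed
      then show "R (mix (\<lambda>_. 1 / real r) {1..r} n h)" unfolding R_def using mix_hom_lip[OF h] by blast
    qed (use d in auto)
    have hl: "hom_lip L h" using h(1) by (simp add: R_def)
    have close: "\<exists>n0. \<forall>n\<ge>n0. \<bar>(\<Sum>k=1..n. x K h k - x K g k) / real n\<bar> < d / 4"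
      if "K \<in> simplex_laws" for K
      using LIMSEQ_D[of "\<lambda>n. (\<Sum>k=1..n. x K h k - x K g k) / real n" 0 "d / 4"] h(1) that d
      unfolding R_def by simp
    obtain n1 n2 where n1: "\<And>n. n \<ge> n1 \<Longrightarrow> \<bar>(\<Sum>k=1..n. x N h k - x N g k) / real n\<bar> < d / 4"
      and n2: "\<And>n. n \<ge> n2 \<Longrightarrow> \<bar>(\<Sum>k=1..n. x N' h k - x N' g k) / real n\<bar> < d / 4"
      using close[OF N] close[OF N'] by blast
    have mid: "\<bar>(\<Sum>k=1..n. x N h k) / real n - (\<Sum>k=1..n. x N' h k) / real n\<bar> \<le> d / 2" for n
    proof -
      have "\<bar>\<Sum>k=1..n. x N h k - x N' h k\<bar> \<le> (\<Sum>k=1..n. d / 2)"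
      proof (rule order_trans[OF sum_abs sum_mono])
        fix k
        show "\<bar>x N h k - x N' h k\<bar> \<le> d / 2"
          using integral_steps_bounds[OF hl N h(2,3), of k] integral_steps_bounds[OF hl N' h(2,3), of k] h(4)
          unfolding x_def by linarith
      qed
      then have "\<bar>\<Sum>k=1..n. x N h k - x N' h k\<bar> / real n \<le> d / 2"
        using d by (cases "n = 0") (auto simp: pos_divide_le_eq mult.commute)
      then show ?thesis by (simp add: sum_subtractf diff_divide_distrib[symmetric])
    qed
    show "\<exists>n0. \<forall>n\<ge>n0. norm ((\<Sum>k=1..n. \<integral>\<mu>. (step ^^ k) g \<mu> \<partial>N) / real n - (\<Sum>k=1..n. \<integral>\<mu>. (step ^^ k) g \<mu> \<partial>N') / real n - 0) < d"
    proof (intro exI allI impI)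
      fix n assume n: "max n1 n2 \<le> n"
      have "\<bar>(\<Sum>k=1..n. x N h k) / real n - (\<Sum>k=1..n. x N g k) / real n\<bar> < d / 4"
        using n1[of n] n by (simp add: sum_subtractf diff_divide_distrib)
      moreover have "\<bar>(\<Sum>k=1..n. x N' h k) / real n - (\<Sum>k=1..n. x N' g k) / real n\<bar> < d / 4"
        using n2[of n] n by (simp add: sum_subtractf diff_divide_distrib)
      ultimately show "norm ((\<Sum>k=1..n. \<integral>\<mu>. (step ^^ k) g \<mu> \<partial>N) / real n - (\<Sum>k=1..n. \<integral>\<mu>. (step ^^ k) g \<mu> \<partial>N') / real n - 0) < d"
        using mid[of n] unfolding x_def[symmetric] real_norm_def diff_0_right by linarith
    qed
  qed
qed

lemma KR_cesaro_integral:
  assumes KR: "condition_KR \<phi> M" and N: "invariant_measure \<phi> M N" and g: "hom_lip L g"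
    and K: "K \<in> simplex_laws"
  shows "(\<lambda>n. (\<Sum>k=1..n. \<integral>\<mu>. (step ^^ k) g \<mu> \<partial>K) / real n) \<longlonglongrightarrow> (\<integral>\<mu>. g \<mu> \<partial>N)"
proof -
  have N': "N \<in> simplex_laws" using N by (simp add: invariant_measure_def)
  have "\<forall>\<^sub>F n in sequentially. (\<Sum>k=1..n. \<integral>\<mu>. (step ^^ k) g \<mu> \<partial>N) / real n = (\<integral>\<mu>. g \<mu> \<partial>N)"
    unfolding eventually_sequentially integral_invariant_steps[OF N g] by (intro exI[of _ 1]) auto
  then have "(\<lambda>n. (\<Sum>k=1..n. \<integral>\<mu>. (step ^^ k) g \<mu> \<partial>N) / real n) \<longlonglongrightarrow> (\<integral>\<mu>. g \<mu> \<partial>N)"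
    by (rule tendsto_eventually)
  from tendsto_add[OF KR_averages_merge[OF KR g K N'] this] show ?thesis by simp
qed

text \<open>Integrals against an invariant law do not change in time, so comparing any law with
  \<open>N\<close> identifies the limit. Existence of \<open>N\<close> is supplied separately by the
  law of \<open>pi_min\<close>.\<close>

theorem KR_ergodic:
  assumes KR: "condition_KR \<phi> M" and N: "invariant_measure \<phi> M N"
  shows "invariant_measure \<phi> M N' \<Longrightarrow> N' = N"
    and "K \<in> simplex_laws \<Longrightarrow> weakly_converges (\<lambda>n. cesaro_mean \<phi> M K n) N"
    and "aperiodic_mat Q \<Longrightarrow> K \<in> simplex_laws \<Longrightarrow>
      weakly_converges (\<lambda>n. (filter_step \<phi> M ^^ n) K) N"
proof -
  have NP: "N \<in> simplex_laws" using N by (simp add: invariant_measure_def)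
  show "N' = N" if N': "invariant_measure \<phi> M N'"
  proof (rule simplex_measure_eqI[OF _ NP])
    show NP': "N' \<in> simplex_laws" using N' by (simp add: invariant_measure_def)
    show "(\<integral>x. F x \<partial>N') = (\<integral>x. F x \<partial>N)" if "hom_lip L F" for L F
      using KR_cesaro_integral[OF KR N that NP'] KR_cesaro_integral[OF KR N' that NP'] by (rule LIMSEQ_unique[symmetric])
  qed (use hom_lip_integrable NP N' in \<open>auto simp: invariant_measure_def\<close>)
  show "weakly_converges (\<lambda>n. cesaro_mean \<phi> M K n) N" if K: "K \<in> simplex_laws"
  proof (rule weakly_convergesI[OF NP cesaro_mean_bind(2)[OF K] hom_lip_integrable])
    fix L and F :: "real ^ 'e \<Rightarrow> real" assume F: "hom_lip L F"
    have "\<forall>\<^sub>F n in sequentially. (\<Sum>k=1..n. \<integral>\<mu>. (step ^^ k) F \<mu> \<partial>K) / real n = (\<integral>x. F x \<partial>cesaro_mean \<phi> M K n)"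
      unfolding eventually_sequentially using integral_cesaro_mean[OF K _ F] by (intro exI[of _ 1]) auto
    from Lim_transform_eventually[OF KR_cesaro_integral[OF KR N F K] this]
    show "(\<lambda>n. \<integral>x. F x \<partial>cesaro_mean \<phi> M K n) \<longlonglongrightarrow> (\<integral>x. F x \<partial>N)" .
  qed
  show "weakly_converges (\<lambda>n. (filter_step \<phi> M ^^ n) K) N"
    if ap: "aperiodic_mat Q" and K: "K \<in> simplex_laws"
  proof (rule weakly_convergesI[OF NP filter_steps_prob[OF K] hom_lip_integrable])
    fix L and F :: "real ^ 'e \<Rightarrow> real" assume F: "hom_lip L F"
    show "(\<lambda>n. \<integral>x. F x \<partial>(filter_step \<phi> M ^^ n) K) \<longlonglongrightarrow> (\<integral>x. F x \<partial>N)"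
    proof (rule LIMSEQ_I)
      fix d :: real assume d: "0 < d"
      have "0 < d / 2" using d by simp
      from KR_steps_merge[OF KR ap F this K NP]
      obtain m where "\<And>k. k \<ge> m \<Longrightarrow> \<bar>(\<integral>\<mu>. (step ^^ k) F \<mu> \<partial>K) - (\<integral>\<mu>. (step ^^ k) F \<mu> \<partial>N)\<bar> \<le> d / 2" by blast
      then show "\<exists>n0. \<forall>n\<ge>n0. norm ((\<integral>x. F x \<partial>(filter_step \<phi> M ^^ n) K) - (\<integral>x. F x \<partial>N)) < d"
        using d unfolding integral_filter_steps[OF F K] integral_invariant_steps[OF N F]
        by (intro exI[of _ m]) fastforce
    qed
  qed
qed

end

section \<open>Convergence of conditional probabilities along monotone filtrations\<close>

text \<open>Along a subsequence whose increments have L1 norm at most \<open>(1 / 2) ^ k\<close>,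
  the increments are absolutely summable almost everywhere.\<close>

lemma (in prob_space) L1_cauchy_AE_convergent:
  fixes V :: "nat \<Rightarrow> 'a \<Rightarrow> real"
  assumes [measurable]: "\<And>n. V n \<in> borel_measurable M"
    and int: "\<And>n. integrable M (V n)"
    and cauchy: "\<And>e. 0 < e \<Longrightarrow> \<exists>N. \<forall>m\<ge>N. \<forall>n\<ge>N. (\<integral>x. \<bar>V m x - V n x\<bar> \<partial>M) < e"
  obtains r where "strict_mono (r :: nat \<Rightarrow> nat)" "AE x in M. convergent (\<lambda>k. V (r k) x)"
proof -
  have "\<forall>k. \<exists>N. \<forall>m\<ge>N. \<forall>n\<ge>N. (\<integral>x. \<bar>V m x - V n x\<bar> \<partial>M) < (1 / 2) ^ k"
    using cauchy by simp
  then obtain N where N: "\<And>k m n. N k \<le> m \<Longrightarrow> N k \<le> n \<Longrightarrow> (\<integral>x. \<bar>V m x - V n x\<bar> \<partial>M) < (1 / 2) ^ k"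
    by metis
  define r where "r = rec_nat (N 0) (\<lambda>k m. max (Suc m) (N (Suc k)))"
  have r_Suc: "r (Suc k) = max (Suc (r k)) (N (Suc k))" for k by (simp add: r_def)
  have r: "strict_mono r" by (rule strict_monoI_Suc) (simp add: r_Suc)
  have rN: "N k \<le> r k" for k by (cases k) (simp_all add: r_Suc, simp add: r_def)
  define d where "d k x = V (r (Suc k)) x - V (r k) x" for k x
  have [measurable]: "d k \<in> borel_measurable M" for k unfolding d_def by measurable
  have di: "integrable M (\<lambda>x. \<bar>d k x\<bar>)" for k unfolding d_def using int by auto
  have "(\<integral>\<^sup>+x. (\<Sum>k. ennreal \<bar>d k x\<bar>) \<partial>M) = (\<Sum>k. \<integral>\<^sup>+x. ennreal \<bar>d k x\<bar> \<partial>M)"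
    by (rule nn_integral_suminf) measurable
  also have "\<dots> \<le> (\<Sum>k. ennreal ((1 / 2) ^ k))"
  proof (intro suminf_le)
    fix k
    have "(\<integral>x. \<bar>d k x\<bar> \<partial>M) \<le> (1 / 2) ^ k"
      unfolding d_def using N[OF _ rN, of k "r (Suc k)"] order_trans[OF rN[of k] strict_mono_less_eq[OF r, THEN iffD2, of k "Suc k"]]
      by (intro less_imp_le) simp
    then show "(\<integral>\<^sup>+x. ennreal \<bar>d k x\<bar> \<partial>M) \<le> ennreal ((1 / 2) ^ k)"
      by (subst nn_integral_eq_integral[OF di]) (auto intro: ennreal_leI)
  qed auto
  also have "\<dots> = ennreal (\<Sum>k. (1 / 2) ^ k)"
    by (rule suminf_ennreal2) (auto intro: summable_geometric)
  also have "\<dots> < \<infinity>" by simp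
  finally have "(\<integral>\<^sup>+x. (\<Sum>k. ennreal \<bar>d k x\<bar>) \<partial>M) \<noteq> \<infinity>" by simp
  then have "AE x in M. (\<Sum>k. ennreal \<bar>d k x\<bar>) \<noteq> \<infinity>"
    by (intro nn_integral_PInf_AE) measurable
  then have "AE x in M. convergent (\<lambda>k. V (r k) x)"
  proof eventually_elim
    case (elim x)
    have "summable (\<lambda>k. \<bar>d k x\<bar>)" using elim by (intro summable_suminf_not_top) auto
    then have "summable (\<lambda>k. d k x)" by (rule summable_rabs_cancel)
    then have "convergent (\<lambda>n. \<Sum>k<n. d k x)" by (simp add: summable_iff_convergent)
    moreover have "(\<Sum>k<n. d k x) = V (r n) x - V (r 0) x" for n
      unfolding d_def by (rule sum_lessThan_telescope)
    ultimately show ?case using convergent_add_const_right_iff[of "\<lambda>n. V (r n) x" "- V (r 0) x"] by simp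
  qed
  then show ?thesis using that r by blast
qed

lemma (in prob_space) subalgebra_sigma_finite: "subalgebra M F \<Longrightarrow> sigma_finite_subalgebra M F"
  by (intro finite_measure_subalgebra_is_sigma_finite) (simp add: finite_measure_subalgebra_def finite_measure_subalgebra_axioms_def finite_measure_axioms)

lemma (in prob_space) cond_prob_bounds:
  assumes "subalgebra M F" "B \<in> sets M"
  shows "AE x in M. 0 \<le> real_cond_exp M F (indicator B) x \<and> real_cond_exp M F (indicator B) x \<le> 1"
proof -
  interpret sigma_finite_subalgebra M F using assms(1) by (rule subalgebra_sigma_finite)
  have "integrable M (indicator B :: 'a \<Rightarrow> real)" using assms(2) by (simp add: emeasure_eq_measure)
  then have "AE x in M. 0 \<le> real_cond_exp M F (indicator B) x" "AE x in M. real_cond_exp M F (indicator B) x \<le> 1"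
    by (auto intro!: real_cond_exp_ge_c real_cond_exp_le_c simp: indicator_le_1)
  then show ?thesis by eventually_elim simp
qed

text \<open>The increment \<open>W - V\<close> is orthogonal to \<open>V\<close>: projecting the
  indicator through either field gives the same inner product with \<open>V\<close>, since
  \<open>V\<close> is measurable for both.\<close>

lemma (in prob_space) cond_prob_pythagoras:
  assumes F: "subalgebra M F" and G: "subalgebra M G" and FG: "sets F \<subseteq> sets G" and B: "B \<in> sets M"
  shows "(\<integral>x. (real_cond_exp M G (indicator B) x - real_cond_exp M F (indicator B) x)\<^sup>2 \<partial>M)
    = (\<integral>x. (real_cond_exp M G (indicator B) x)\<^sup>2 \<partial>M) - (\<integral>x. (real_cond_exp M F (indicator B) x)\<^sup>2 \<partial>M)"
proof -
  interpret F: sigma_finite_subalgebra M F using F by (rule subalgebra_sigma_finite)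
  interpret G: sigma_finite_subalgebra M G using G by (rule subalgebra_sigma_finite)
  let ?Z = "indicator B :: 'a \<Rightarrow> real"
  define V where "V = real_cond_exp M F ?Z"
  define W where "W = real_cond_exp M G ?Z"
  have VF: "V \<in> borel_measurable F" and VM [measurable]: "V \<in> borel_measurable M"
    and WG: "W \<in> borel_measurable G" and WM [measurable]: "W \<in> borel_measurable M"
    by (auto simp: V_def W_def)
  have "subalgebra G F" using F G FG by (auto simp: subalgebra_def)
  then have VG: "V \<in> borel_measurable G" using VF by (rule measurable_from_subalg)
  have Zm: "?Z \<in> borel_measurable M" using B by simp
  have bV: "AE x in M. \<bar>V x\<bar> \<le> 1" and bW: "AE x in M. \<bar>W x\<bar> \<le> 1"
    using cond_prob_bounds[OF F B] cond_prob_bounds[OF G B] unfolding V_def W_def by (eventually_elim; simp)+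
  have int: "integrable M (\<lambda>x. f x * g x)"
    if "f \<in> borel_measurable M" "g \<in> borel_measurable M" "AE x in M. \<bar>f x\<bar> \<le> 1" "AE x in M. \<bar>g x\<bar> \<le> 1" for f g :: "'a \<Rightarrow> real"
  proof (rule integrable_const_bound[of _ 1])
    show "AE x in M. norm (f x * g x) \<le> 1"
      using that(3,4) by eventually_elim (simp add: abs_mult mult_le_one)
  qed (use that in measurable)
  have bZ: "AE x in M. \<bar>?Z x\<bar> \<le> 1" by (auto simp: indicator_def)
  have "(\<integral>x. V x * W x \<partial>M) = (\<integral>x. V x * ?Z x \<partial>M)"
    unfolding W_def by (rule G.real_cond_exp_intg(2)[OF int[OF VM Zm bV bZ] VG Zm])
  also have "\<dots> = (\<integral>x. V x * V x \<partial>M)"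
    using F.real_cond_exp_intg(2)[OF int[OF VM Zm bV bZ] VF Zm] unfolding V_def[symmetric] by simp
  finally have VW: "(\<integral>x. V x * W x \<partial>M) = (\<integral>x. V x * V x \<partial>M)" .
  have "(\<integral>x. (W x - V x)\<^sup>2 \<partial>M) = (\<integral>x. W x * W x - 2 * (V x * W x) + V x * V x \<partial>M)"
    by (intro Bochner_Integration.integral_cong) (auto simp: power2_eq_square algebra_simps)
  also have "\<dots> = (\<integral>x. W x * W x \<partial>M) - 2 * (\<integral>x. V x * W x \<partial>M) + (\<integral>x. V x * V x \<partial>M)"
    using int[OF WM WM bW bW] int[OF VM WM bV bW] int[OF VM VM bV bV] by simp
  finally show ?thesis unfolding VW V_def[symmetric] W_def[symmetric] by (simp add: power2_eq_square)
qed

text \<open>The second moments are bounded and monotone, hence convergent, and by Pythagoras their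
  differences are the squared L2 distances. Increasing and decreasing fields are covered
  alike.\<close>

lemma (in prob_space) monotone_cond_prob_cauchy:
  fixes H :: "nat \<Rightarrow> 'a measure"
  assumes H: "\<And>n. subalgebra M (H n)" and B: "B \<in> sets M"
    and mono: "(\<forall>m n. m \<le> n \<longrightarrow> sets (H m) \<subseteq> sets (H n)) \<or> (\<forall>m n. m \<le> n \<longrightarrow> sets (H n) \<subseteq> sets (H m))"
    and e: "0 < e"
  shows "\<exists>N. \<forall>m\<ge>N. \<forall>n\<ge>N. (\<integral>x. \<bar>real_cond_exp M (H m) (indicator B) x - real_cond_exp M (H n) (indicator B) x\<bar> \<partial>M) < e"
proof -
  define V where "V n = real_cond_exp M (H n) (indicator B)" for n
  define c where "c n = (\<integral>x. (V n x)\<^sup>2 \<partial>M)" for n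
  have Vm [measurable]: "V n \<in> borel_measurable M" for n unfolding V_def by simp
  have bV: "AE x in M. \<bar>V n x\<bar> \<le> 1" for n
    using cond_prob_bounds[OF H[of n] B] unfolding V_def by eventually_elim simp
  have c: "0 \<le> c n" "c n \<le> 1" for n
  proof -
    show "0 \<le> c n" unfolding c_def by simp
    have "c n \<le> (\<integral>x. 1 \<partial>M)" unfolding c_def
    proof (rule integral_mono_AE)
      show "AE x in M. (V n x)\<^sup>2 \<le> 1" using bV[of n] by eventually_elim (simp add: abs_square_le_1)
      then show "integrable M (\<lambda>x. (V n x)\<^sup>2)" by (intro integrable_const_bound[of _ 1]) auto
    qed simp
    then show "c n \<le> 1" by (simp add: prob_space)
  qed
  have sq: "(\<integral>x. (V m x - V n x)\<^sup>2 \<partial>M) = \<bar>c m - c n\<bar>" for m n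
  proof -
    have *: "(\<integral>x. (V m x - V n x)\<^sup>2 \<partial>M) = \<bar>c m - c n\<bar>" if "sets (H n) \<subseteq> sets (H m)" for m n
    proof -
      have "(\<integral>x. (V m x - V n x)\<^sup>2 \<partial>M) = c m - c n"
        unfolding V_def c_def by (rule cond_prob_pythagoras[OF H H that B])
      moreover have "0 \<le> (\<integral>x. (V m x - V n x)\<^sup>2 \<partial>M)" by simp
      ultimately show ?thesis by simp
    qed
    have "sets (H n) \<subseteq> sets (H m) \<or> sets (H m) \<subseteq> sets (H n)" using mono by (meson nat_le_linear)
    then show ?thesis using *[of n m] *[of m n] by (auto simp: power2_commute abs_minus_commute)
  qed
  have "convergent c"
  proof -
    have mono_c: "c m \<le> c n" if "sets (H m) \<subseteq> sets (H n)" for m n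
    proof -
      have "(\<integral>x. (V n x - V m x)\<^sup>2 \<partial>M) = c n - c m"
        unfolding V_def c_def by (rule cond_prob_pythagoras[OF H H that B])
      moreover have "0 \<le> (\<integral>x. (V n x - V m x)\<^sup>2 \<partial>M)" by simp
      ultimately show ?thesis by simp
    qed
    have "monoseq c"
      using mono mono_c unfolding monoseq_def by blast
    moreover have "Bseq c" using c by (intro BseqI'[of _ 1]) simp
    ultimately show ?thesis by (rule Bseq_monoseq_convergent[rotated])
  qed
  then have "Cauchy c" by (rule convergent_Cauchy)
  have "0 < (e / 2)\<^sup>2" using e by simp
  then obtain N where N: "\<And>m n. N \<le> m \<Longrightarrow> N \<le> n \<Longrightarrow> \<bar>c m - c n\<bar> < (e / 2)\<^sup>2"
    using \<open>Cauchy c\<close> unfolding Cauchy_def dist_real_def by blast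
  have "(\<integral>x. \<bar>V m x - V n x\<bar> \<partial>M) < e" if "N \<le> m" "N \<le> n" for m n
  proof -
    have i1: "integrable M (\<lambda>x. (V m x - V n x)\<^sup>2)"
    proof (rule integrable_const_bound[of _ 4])
      show "AE x in M. norm ((V m x - V n x)\<^sup>2) \<le> 4"
        using bV[of m] bV[of n]
      proof eventually_elim
        case (elim x)
        then have "\<bar>V m x - V n x\<bar> \<le> 2" by linarith
        then have "\<bar>V m x - V n x\<bar>\<^sup>2 \<le> 2\<^sup>2" by (intro power_mono) auto
        then show ?case by simp
      qed
    qed measurable
    \<comment> \<open>Expanding \<open>(z - e / 2)\<^sup>2 \<ge> 0\<close> bounds z by
      \<open>e / 4 + z\<^sup>2 / e\<close>; with squared L2 distance below
      \<open>(e / 2)\<^sup>2\<close> the two parts add up to less than \<open>e / 2\<close>.\<close>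
    have "(\<integral>x. \<bar>V m x - V n x\<bar> \<partial>M) \<le> (\<integral>x. e / 4 + (1 / e) * (V m x - V n x)\<^sup>2 \<partial>M)"
    proof (rule integral_mono_AE)
      show "AE x in M. \<bar>V m x - V n x\<bar> \<le> e / 4 + 1 / e * (V m x - V n x)\<^sup>2"
      proof (intro AE_I2)
        fix x
        define z where "z = \<bar>V m x - V n x\<bar>"
        have "0 \<le> (z - e / 2)\<^sup>2" by simp
        then have "e * z \<le> e * (e / 4 + 1 / e * z\<^sup>2)" using e by (simp add: power2_eq_square algebra_simps)
        then show "\<bar>V m x - V n x\<bar> \<le> e / 4 + 1 / e * (V m x - V n x)\<^sup>2"
          using e by (simp add: z_def)
      qed
      show "integrable M (\<lambda>x. \<bar>V m x - V n x\<bar>)"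
      proof (rule integrable_const_bound[of _ 2])
        show "AE x in M. norm \<bar>V m x - V n x\<bar> \<le> 2"
          using bV[of m] bV[of n] by eventually_elim simp
      qed measurable
    qed (use i1 in simp)
    also have "\<dots> = e / 4 + (1 / e) * \<bar>c m - c n\<bar>" using i1 by (simp add: prob_space sq)
    also have "\<dots> < e / 4 + (1 / e) * (e / 2)\<^sup>2" using N[OF that] e by (simp add: divide_strict_right_mono)
    also have "\<dots> = e / 2" using e by (simp add: power2_eq_square)
    finally show ?thesis using e by simp
  qed
  then show ?thesis unfolding V_def by blast
qed

text \<open>Levy's upward and downward theorems in L1. An almost sure limit \<open>W\<close> along a
  subsequence is identified as the conditional probability given \<open>K\<close>; the Cauchy
  property then gives convergence of the whole sequence.\<close>

lemma (in prob_space) monotone_cond_prob_limit: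
  fixes H :: "nat \<Rightarrow> 'a measure"
  assumes H: "\<And>n. subalgebra M (H n)" and K: "subalgebra M K" and B: "B \<in> sets M"
    and mono: "(\<forall>m n. m \<le> n \<longrightarrow> sets (H m) \<subseteq> sets (H n)) \<and> sets K = sigma_sets (space M) (\<Union>n. sets (H n))
      \<or> (\<forall>m n. m \<le> n \<longrightarrow> sets (H n) \<subseteq> sets (H m)) \<and> sets K = (\<Inter>n. sets (H n))"
  shows "(\<lambda>n. \<integral>x. \<bar>real_cond_exp M (H n) (indicator B) x - real_cond_exp M K (indicator B) x\<bar> \<partial>M) \<longlonglongrightarrow> 0"
proof -
  let ?Z = "indicator B :: 'a \<Rightarrow> real"
  define V where "V n = real_cond_exp M (H n) ?Z" for n
  have Vm [measurable]: "V n \<in> borel_measurable M" for n unfolding V_def by simp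
  have VH: "V n \<in> borel_measurable (H n)" for n unfolding V_def by simp
  have bV: "AE x in M. \<bar>V n x\<bar> \<le> 1" for n
    using cond_prob_bounds[OF H[of n] B] unfolding V_def by eventually_elim simp
  have Vi: "integrable M (V n)" for n using bV[of n] by (intro integrable_const_bound[of _ 1]) auto
  have Zi: "integrable M ?Z" using B by (simp add: emeasure_eq_measure)
  have cauchy: "\<exists>N. \<forall>m\<ge>N. \<forall>n\<ge>N. (\<integral>x. \<bar>V m x - V n x\<bar> \<partial>M) < e" if "0 < e" for e
    unfolding V_def by (rule monotone_cond_prob_cauchy[OF H B _ that]) (use mono in auto)
  obtain r where r: "strict_mono r" and conv: "AE x in M. convergent (\<lambda>k. V (r k) x)"
    by (rule L1_cauchy_AE_convergent[OF Vm Vi cauchy])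
  define W where "W x = lim (\<lambda>k. V (r k) x)" for x
  have Wlim: "AE x in M. (\<lambda>k. V (r k) x) \<longlonglongrightarrow> W x"
    using conv unfolding W_def by eventually_elim (rule convergent_LIMSEQ_iff[THEN iffD1])
  have Wm [measurable]: "W \<in> borel_measurable M" unfolding W_def[abs_def] by measurable
  have bW: "AE x in M. \<bar>W x\<bar> \<le> 1"
  proof -
    have "AE x in M. \<forall>k. \<bar>V (r k) x\<bar> \<le> 1" using bV by (simp add: AE_all_countable)
    with Wlim show ?thesis
      by eventually_elim (rule LIMSEQ_le_const2[OF tendsto_rabs], auto)
  qed
  have Wi: "integrable M W" using bW by (intro integrable_const_bound[of _ 1]) auto
  have setM: "sets (H n) \<subseteq> sets M" "space (H n) = space M" for n using H[of n] by (auto simp: subalgebra_def)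
  have intA: "(\<integral>x\<in>A. V n x \<partial>M) = (\<integral>x\<in>A. ?Z x \<partial>M)" if "A \<in> sets (H n)" for A n
  proof -
    interpret sigma_finite_subalgebra M "H n" using H by (rule subalgebra_sigma_finite)
    show ?thesis unfolding V_def using real_cond_exp_intA[OF Zi that] by simp
  qed
  have lim_int: "(\<lambda>k. \<integral>x\<in>A. V (r k) x \<partial>M) \<longlonglongrightarrow> (\<integral>x\<in>A. W x \<partial>M)" if A [measurable]: "A \<in> sets M" for A
    unfolding set_lebesgue_integral_def
  proof (rule integral_dominated_convergence[where w = "\<lambda>_. 1"])
    show "AE x in M. (\<lambda>k. indicator A x *\<^sub>R V (r k) x) \<longlonglongrightarrow> indicator A x *\<^sub>R W x"
      using Wlim by eventually_elim (rule tendsto_scaleR[OF tendsto_const])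
    show "AE x in M. norm (indicator A x *\<^sub>R V (r k) x) \<le> 1" for k
      using bV[of "r k"] by eventually_elim (simp add: indicator_def)
  qed auto
  have si: "set_integrable M A f" if "A \<in> sets M" "integrable M f" for A and f :: "'a \<Rightarrow> real"
    unfolding set_integrable_def by (rule integrable_mult_indicator[OF that])
  have WK: "W \<in> borel_measurable K \<and> (\<forall>A\<in>sets K. (\<integral>x\<in>A. ?Z x \<partial>M) = (\<integral>x\<in>A. W x \<partial>M))"
    using mono
  proof (elim disjE conjE)
    assume inc: "\<forall>m n. m \<le> n \<longrightarrow> sets (H m) \<subseteq> sets (H n)" and K': "sets K = sigma_sets (space M) (\<Union>n. sets (H n))"
    have "subalgebra K (H n)" for n
      using K setM[of n] by (auto simp: subalgebra_def K' intro: sigma_sets.Basic)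
    then have "V n \<in> borel_measurable K" for n using VH by (rule measurable_from_subalg)
    then have "W \<in> borel_measurable K" unfolding W_def[abs_def] by measurable
    moreover have "(\<integral>x\<in>A. ?Z x \<partial>M) = (\<integral>x\<in>A. W x \<partial>M)" if "A \<in> sets K" for A
    proof -
      \<comment> \<open>The union of the increasing fields is a pi-system generating
        \<open>K\<close>, and each of its sets belongs to \<open>H (r k)\<close> for all large
        \<open>k\<close>.\<close>
      have "Int_stable (\<Union>n. sets (H n))"
      proof (rule Int_stableI)
        fix a b assume "a \<in> (\<Union>n. sets (H n))" "b \<in> (\<Union>n. sets (H n))"
        then obtain m n where "a \<in> sets (H m)" "b \<in> sets (H n)" by blast
        then have "a \<in> sets (H (max m n))" "b \<in> sets (H (max m n))"
          using inc by (meson max.cobounded1 max.cobounded2 subsetD)+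
        then show "a \<inter> b \<in> (\<Union>n. sets (H n))" by blast
      qed
      moreover have "(\<Union>n. sets (H n)) \<subseteq> Pow (space M)" using setM sets.sets_into_space by blast
      moreover have "A \<in> sigma_sets (space M) (\<Union>n. sets (H n))" using that K' by simp
      ultimately show ?thesis
      proof (induction rule: sigma_sets_induct_disjoint)
        case (basic A)
        then obtain n where n: "A \<in> sets (H n)" by blast
        have "(\<integral>x\<in>A. V (r k) x \<partial>M) = (\<integral>x\<in>A. ?Z x \<partial>M)" if "n \<le> k" for k
          using intA[of A "r k"] n inc seq_suble[OF r, of k] that by (meson order_trans subsetD)
        then have "(\<lambda>k. \<integral>x\<in>A. V (r k) x \<partial>M) \<longlonglongrightarrow> (\<integral>x\<in>A. ?Z x \<partial>M)"
          by (intro tendsto_eventually) (auto simp: eventually_sequentially)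
        then show ?case using lim_int[of A] n setM LIMSEQ_unique by blast
      next
        case empty
        show ?case by (simp add: set_lebesgue_integral_def)
      next
        case (compl A)
        have A: "A \<in> sets M" using compl.hyps K' K by (auto simp: subalgebra_def)
        have tot: "(\<integral>x. f x \<partial>M) = (\<integral>x\<in>A. f x \<partial>M) + (\<integral>x\<in>space M - A. f x \<partial>M)" if "integrable M f" for f :: "'a \<Rightarrow> real"
        proof -
          have "(\<integral>x\<in>A \<union> (space M - A). f x \<partial>M) = (\<integral>x\<in>A. f x \<partial>M) + (\<integral>x\<in>space M - A. f x \<partial>M)"
            using A that by (intro set_integral_Un si) auto
          moreover have "A \<union> (space M - A) = space M" using sets.sets_into_space[OF A] by blast
          ultimately show ?thesis using set_integral_space[OF that] by simp
        qed
        have "(\<integral>x. ?Z x \<partial>M) = (\<integral>x. W x \<partial>M)"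
        proof -
          have "space M \<in> sets (H (r k))" for k using setM(2)[of "r k"] sets.top[of "H (r k)"] by simp
          then have "(\<integral>x\<in>space M. V (r k) x \<partial>M) = (\<integral>x\<in>space M. ?Z x \<partial>M)" for k by (rule intA)
          then have "(\<integral>x\<in>space M. W x \<partial>M) = (\<integral>x\<in>space M. ?Z x \<partial>M)"
            using lim_int[of "space M"] by (simp add: LIMSEQ_const_iff)
          then show ?thesis by (simp add: set_integral_space[OF Wi] set_integral_space[OF Zi])
        qed
        then show ?case using tot[OF Wi] tot[OF Zi] compl.IH by simp
      next
        case (union A)
        have A: "A i \<in> sets M" for i using union.hyps K' K by (auto simp: subalgebra_def)
        have "(\<integral>x\<in>(\<Union>i. A i). f x \<partial>M) = (\<Sum>i. \<integral>x\<in>A i. f x \<partial>M)" if "integrable M f" for f :: "'a \<Rightarrow> real"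
          using A union.hyps(1) that
          by (intro lebesgue_integral_countable_add si) (auto simp: disjoint_family_on_def)
        then show ?case using union.IH Wi Zi by simp
      qed
    qed
    ultimately show ?thesis by blast
  next
    assume dec: "\<forall>m n. m \<le> n \<longrightarrow> sets (H n) \<subseteq> sets (H m)" and K': "sets K = (\<Inter>n. sets (H n))"
    have WH: "W \<in> borel_measurable (H n)" for n
    proof -
      \<comment> \<open>Dropping the first \<open>n\<close> terms does not change the limit, and the
        remaining ones are measurable for \<open>H n\<close>; so \<open>W\<close> is measurable for
        every field of the decreasing sequence.\<close>
      have "(\<lambda>k. V (r k) x) \<longlonglongrightarrow> l \<longleftrightarrow> (\<lambda>k. V (r (k + n)) x) \<longlonglongrightarrow> l" for x l
        using LIMSEQ_ignore_initial_segment[of "\<lambda>k. V (r k) x" l n] LIMSEQ_offset[of "\<lambda>k. V (r k) x" n l] by blast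
      then have "W = (\<lambda>x. lim (\<lambda>k. V (r (k + n)) x))"
        by (simp add: W_def[abs_def] lim_def)
      moreover have "V (r (k + n)) \<in> borel_measurable (H n)" for k
      proof (rule measurable_from_subalg[OF _ VH])
        have "n \<le> r (k + n)" using seq_suble[OF r, of "k + n"] by simp
        then show "subalgebra (H n) (H (r (k + n)))" using dec setM by (auto simp: subalgebra_def)
      qed
      ultimately show ?thesis by simp
    qed
    have "W \<in> borel_measurable K"
    proof (rule measurableI)
      fix A :: "real set" assume "A \<in> sets borel"
      then have "W -` A \<inter> space M \<in> sets (H n)" for n using measurable_sets[OF WH] setM(2) by metis
      then show "W -` A \<inter> space K \<in> sets K" using K K' by (auto simp: subalgebra_def)
    qed simp
    moreover have "(\<integral>x\<in>A. ?Z x \<partial>M) = (\<integral>x\<in>A. W x \<partial>M)" if "A \<in> sets K" for A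
    proof -
      have "A \<in> sets (H (r k))" for k using that K' by auto
      then have "(\<integral>x\<in>A. V (r k) x \<partial>M) = (\<integral>x\<in>A. ?Z x \<partial>M)" for k by (rule intA)
      moreover have "A \<in> sets M" using that K by (auto simp: subalgebra_def)
      ultimately show ?thesis using lim_int[of A] by (simp add: LIMSEQ_const_iff)
    qed
    ultimately show ?thesis by blast
  qed
  interpret K: sigma_finite_subalgebra M K using K by (rule subalgebra_sigma_finite)
  have WKe: "AE x in M. real_cond_exp M K ?Z x = W x"
    using WK Zi Wi by (intro K.real_cond_exp_charact) auto
  show ?thesis
  proof (rule LIMSEQ_I)
    fix e :: real assume e: "0 < e"
    obtain N where N: "\<And>m n. N \<le> m \<Longrightarrow> N \<le> n \<Longrightarrow> (\<integral>x. \<bar>V m x - V n x\<bar> \<partial>M) < e / 2"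
      using cauchy[of "e / 2"] e by auto
    have le: "(\<integral>x. \<bar>V n x - W x\<bar> \<partial>M) \<le> e / 2" if n: "N \<le> n" for n
    proof (rule LIMSEQ_le_const2)
      show "(\<lambda>k. \<integral>x. \<bar>V n x - V (r k) x\<bar> \<partial>M) \<longlonglongrightarrow> (\<integral>x. \<bar>V n x - W x\<bar> \<partial>M)"
      proof (rule integral_dominated_convergence[where w = "\<lambda>_. 2"])
        show "AE x in M. (\<lambda>k. \<bar>V n x - V (r k) x\<bar>) \<longlonglongrightarrow> \<bar>V n x - W x\<bar>"
          using Wlim by eventually_elim (intro tendsto_rabs tendsto_diff tendsto_const)
        show "AE x in M. norm \<bar>V n x - V (r k) x\<bar> \<le> 2" for k
          using bV[of n] bV[of "r k"] by eventually_elim simp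
      qed auto
      have "(\<integral>x. \<bar>V n x - V (r k) x\<bar> \<partial>M) \<le> e / 2" if "N \<le> k" for k
        using N[OF n, of "r k"] that seq_suble[OF r, of k] by (simp add: less_imp_le)
      then show "\<exists>N. \<forall>k\<ge>N. (\<integral>x. \<bar>V n x - V (r k) x\<bar> \<partial>M) \<le> e / 2" by blast
    qed
    have "(\<integral>x. \<bar>V n x - real_cond_exp M K ?Z x\<bar> \<partial>M) = (\<integral>x. \<bar>V n x - W x\<bar> \<partial>M)" for n
    proof (rule integral_cong_AE)
      show "AE x in M. \<bar>V n x - real_cond_exp M K ?Z x\<bar> = \<bar>V n x - W x\<bar>"
        using WKe by eventually_elim simp
    qed measurable
    then have "norm ((\<integral>x. \<bar>V n x - real_cond_exp M K ?Z x\<bar> \<partial>M) - 0) < e" if "N \<le> n" for n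
      using le[OF that] e by simp
    then show "\<exists>N. \<forall>n\<ge>N. norm ((\<integral>x. \<bar>real_cond_exp M (H n) ?Z x - real_cond_exp M K ?Z x\<bar> \<partial>M) - 0) < e"
      unfolding V_def by blast
  qed
qed

section \<open>The filtering recursion on path space\<close>

context hidden_markov_model
begin

lemma space_P: "space P = space (path_space \<phi>)"
  using sets_P by (rule sets_eq_imp_space_eq)

lemma coord_X_measurable [measurable]: "coord_X k \<in> P \<rightarrow>\<^sub>M count_space UNIV"
proof -
  have "(coord_X k :: ('e, 'f) path \<Rightarrow> 'e) \<in> path_space \<phi> \<rightarrow>\<^sub>M count_space UNIV"
    unfolding coord_X_def[abs_def] path_space_def by measurable
  then show ?thesis by (simp add: measurable_cong_sets[OF sets_P refl])
qed

lemma coord_Y_measurable [measurable]: "coord_Y k \<in> P \<rightarrow>\<^sub>M \<phi>"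
proof -
  have "(coord_Y k :: ('e, 'f) path \<Rightarrow> 'f) \<in> path_space \<phi> \<rightarrow>\<^sub>M \<phi>"
    unfolding coord_Y_def[abs_def] path_space_def by measurable
  then show ?thesis by (simp add: measurable_cong_sets[OF sets_P refl])
qed

lemma coord_Y_space: "\<omega> \<in> space P \<Longrightarrow> coord_Y k \<omega> \<in> space \<phi>"
  using measurable_space[OF coord_Y_measurable] .

lemma FX_sets: "sets (FX \<phi> m) = sigma_sets (space P) {coord_X k -` B \<inter> space P | k B. k \<le> m}"
  unfolding FX_def space_P by (rule sets_measure_of) auto

lemma FY_sets: "sets (FY \<phi> n) = sigma_sets (space P) {coord_Y k -` A \<inter> space P | k A. k \<le> n \<and> A \<in> sets \<phi>}"
  unfolding FY_def space_P by (rule sets_measure_of) auto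

lemma FX_subset: "sets (FX \<phi> m :: ('e, 'f) path measure) \<subseteq> sets P"
  unfolding FX_sets by (rule sets.sigma_sets_subset) (auto intro!: measurable_sets[OF coord_X_measurable])

lemma FY_subset: "sets (FY \<phi> m :: ('e, 'f) path measure) \<subseteq> sets P"
  unfolding FY_sets by (rule sets.sigma_sets_subset) (auto intro!: measurable_sets[OF coord_Y_measurable])

lemma GXY_sets: "sets (GXY \<phi> m n :: ('e, 'f) path measure) = sigma_sets (space P) (sets (FX \<phi> m) \<union> sets (FY \<phi> n))"
  unfolding GXY_def space_P[symmetric]
  by (rule sets_measure_of) (use FX_subset FY_subset sets.sets_into_space in blast)

lemma subalgebra_FY: "subalgebra P (FY \<phi> n)"
  using FY_subset by (auto simp: subalgebra_def space_P FY_def space_measure_of_conv)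

lemma subalgebra_GXY: "subalgebra P (GXY \<phi> m n)"
  unfolding subalgebra_def
proof
  show "space (GXY \<phi> m n) = space P" by (simp add: GXY_def space_P space_measure_of_conv)
  show "sets (GXY \<phi> m n) \<subseteq> sets P"
    unfolding GXY_sets using FX_subset FY_subset by (intro sets.sigma_sets_subset) auto
qed

lemma FX_mono: "m \<le> m' \<Longrightarrow> sets (FX \<phi> m :: ('e, 'f) path measure) \<subseteq> sets (FX \<phi> m')"
  unfolding FX_sets by (rule sigma_sets_subseteq) (auto intro: order_trans)

lemma FY_mono: "n \<le> n' \<Longrightarrow> sets (FY \<phi> n :: ('e, 'f) path measure) \<subseteq> sets (FY \<phi> n')"
  unfolding FY_sets by (rule sigma_sets_subseteq) (auto intro: order_trans)

lemma GXY_mono: "m \<le> m' \<Longrightarrow> n \<le> n' \<Longrightarrow> sets (GXY \<phi> m n :: ('e, 'f) path measure) \<subseteq> sets (GXY \<phi> m' n')"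
  unfolding GXY_sets using FX_mono FY_mono by (intro sigma_sets_subseteq) blast

text \<open>An intersection of \<sigma>-fields is a \<sigma>-field, so generating one from it in
  \<open>GXY_inf\<close> adds no sets.\<close>

lemma GXY_inf_sets: "sets (GXY_inf \<phi> n :: ('e, 'f) path measure) = (\<Inter>m\<in>{..n}. sets (GXY \<phi> m n))"
proof -
  let ?I = "\<Inter>m\<in>{..n}. sets (GXY \<phi> m n :: ('e, 'f) path measure)"
  have "?I \<subseteq> sets (GXY \<phi> n n)" by auto
  also have "\<dots> \<subseteq> Pow (space P)"
    using sets.space_closed[of "GXY \<phi> n n :: ('e, 'f) path measure"] subalgebra_GXY[of n n] by (simp add: subalgebra_def)
  finally have "?I \<subseteq> Pow (space P)" .
  then have "sets (GXY_inf \<phi> n :: ('e, 'f) path measure) = sigma_sets (space P) ?I"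
    unfolding GXY_inf_def space_P[symmetric] by (rule sets_measure_of)
  moreover have "sigma_sets (space P) ?I \<subseteq> sets (GXY \<phi> m n)" if "m \<le> n" for m
    using sets.sigma_sets_subset[of ?I "GXY \<phi> m n"] subalgebra_GXY[of m n] that
    by (auto simp: subalgebra_def)
  ultimately show ?thesis by (auto intro: sigma_sets.Basic)
qed

lemma subalgebra_GXY_inf: "subalgebra P (GXY_inf \<phi> n)"
  using subalgebra_GXY[of n n] GXY_inf_sets[of n]
  by (auto simp: subalgebra_def GXY_inf_def space_P space_measure_of_conv)

abbreviation X_event :: "int \<Rightarrow> 'e \<Rightarrow> ('e, 'f) path set" where
  "X_event k i \<equiv> {\<omega> \<in> space P. coord_X k \<omega> = i}"

text \<open>A version of the conditional law of the signal with values in the simplex at every path.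
  \<open>real_cond_exp\<close> guarantees this only almost surely, while the recursion applies
  \<open>M y\<close> pointwise.\<close>

definition is_filter :: "('e, 'f) path measure \<Rightarrow> int \<Rightarrow> (('e, 'f) path \<Rightarrow> real ^ 'e) \<Rightarrow> bool" where
  "is_filter H k U \<longleftrightarrow> subalgebra P H \<and> U \<in> borel_measurable H \<and> (\<forall>\<omega>\<in>space P. U \<omega> \<in> prob_simplex) \<and>
     (\<forall>A\<in>sets H. \<forall>i. P.prob (A \<inter> X_event k i) = (\<integral>\<omega>\<in>A. U \<omega> $ i \<partial>P))"

lemma filterD:
  assumes "is_filter H k U"
  shows "subalgebra P H" "U \<in> borel_measurable H" "\<And>\<omega>. \<omega> \<in> space P \<Longrightarrow> U \<omega> \<in> prob_simplex"
    "\<And>A i. A \<in> sets H \<Longrightarrow> P.prob (A \<inter> X_event k i) = (\<integral>\<omega>\<in>A. U \<omega> $ i \<partial>P)"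
    "U \<in> borel_measurable P"
  using assms measurable_from_subalg unfolding is_filter_def by auto

lemma simplex_nth_bounds: "\<mu> \<in> prob_simplex \<Longrightarrow> 0 \<le> \<mu> $ i \<and> \<mu> $ i \<le> 1"
  using nth_le_mass[of \<mu> i] by (auto simp: simplex_iff nonneg_cone_def)

lemma filter_integrable:
  assumes "is_filter H k U" "A \<in> sets P"
  shows "integrable P (\<lambda>\<omega>. indicator A \<omega> *\<^sub>R U \<omega> $ i)"
proof (rule P.integrable_const_bound[of _ 1])
  show "(\<lambda>\<omega>. indicator A \<omega> *\<^sub>R U \<omega> $ i) \<in> borel_measurable P"
    using filterD(5)[OF assms(1)] assms(2) by measurable
  show "AE \<omega> in P. norm (indicator A \<omega> *\<^sub>R U \<omega> $ i) \<le> 1"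
    using simplex_nth_bounds[OF filterD(3)[OF assms(1)]] by (intro AE_I2) (auto simp: indicator_def)
qed

lemma filter_cond_exp:
  assumes "is_filter H k U"
  shows "AE \<omega> in P. real_cond_exp P H (indicator (X_event k i)) \<omega> = U \<omega> $ i"
proof -
  interpret H: sigma_finite_subalgebra P H
    using filterD(1)[OF assms] by (rule P.subalgebra_sigma_finite)
  have B [measurable]: "X_event k i \<in> sets P" by measurable
  have [measurable]: "U \<in> borel_measurable H" using assms by (rule filterD)
  show ?thesis
  proof (rule H.real_cond_exp_charact)
    fix A assume A: "A \<in> sets H"
    then have AP: "A \<in> sets P" using filterD(1)[OF assms] by (auto simp: subalgebra_def)
    have "(\<integral>\<omega>\<in>A. indicat_real (X_event k i) \<omega> \<partial>P) = (\<integral>\<omega>. indicat_real (A \<inter> X_event k i) \<omega> \<partial>P)"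
      unfolding set_lebesgue_integral_def by (simp add: indicator_inter_arith)
    also have "\<dots> = P.prob (A \<inter> X_event k i)" using AP B by simp
    finally show "(\<integral>\<omega>\<in>A. indicat_real (X_event k i) \<omega> \<partial>P) = (\<integral>\<omega>\<in>A. U \<omega> $ i \<partial>P)"
      using filterD(4)[OF assms A] by simp
  next
    show "integrable P (\<lambda>\<omega>. U \<omega> $ i)"
      using filter_integrable[OF assms sets.top, of i] by (simp cong: Bochner_Integration.integrable_cong)
  qed (use B in \<open>auto simp: P.emeasure_eq_measure\<close>)
qed

text \<open>The Markov property expresses the prediction from the whole past through
  \<open>coord_X k\<close>. Splitting over its values and using that \<open>A\<close> belongs to the
  smaller field \<open>H\<close> replaces \<open>coord_X k\<close> by the filter
  \<open>U\<close>.\<close>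

lemma filter_predict:
  assumes U: "is_filter H k U" and H: "sets H \<subseteq> sets (GXY \<phi> k k)" and A: "A \<in> sets H" and B: "B \<in> sets \<phi>"
  shows "P.prob (A \<inter> {\<omega> \<in> space P. coord_X (k + 1) \<omega> = j \<and> coord_Y (k + 1) \<omega> \<in> B})
    = (\<integral>\<omega>. indicator A \<omega> * (\<integral>y. indicator B y * (U \<omega> v* M y) $ j \<partial>\<phi>) \<partial>P)"
proof -
  interpret G: sigma_finite_subalgebra P "GXY \<phi> k k"
    using subalgebra_GXY by (rule P.subalgebra_sigma_finite)
  define E where "E = {\<omega> \<in> space P. coord_X (k + 1) \<omega> = j \<and> coord_Y (k + 1) \<omega> \<in> B}"
  have E [measurable]: "E \<in> sets P" unfolding E_def using B by measurable
  have AG: "A \<in> sets (GXY \<phi> k k)" using A H by blast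
  then have AP [measurable]: "A \<in> sets P" using subalgebra_GXY by (auto simp: subalgebra_def)
  define m where "m i = (LINT y:B|\<phi>. M y $ i $ j)" for i
  have mk: "AE \<omega> in P. real_cond_exp P (GXY \<phi> k k) (indicator E) \<omega> = m (coord_X k \<omega>)"
    using markov[OF B, of "k + 1" j] unfolding E_def m_def by simp
  have "P.prob (A \<inter> E) = (\<integral>\<omega>. indicat_real (A \<inter> E) \<omega> \<partial>P)" by simp
  also have "\<dots> = (\<integral>\<omega>\<in>A. indicat_real E \<omega> \<partial>P)"
    unfolding set_lebesgue_integral_def by (simp add: indicator_inter_arith)
  also have "\<dots> = (\<integral>\<omega>\<in>A. real_cond_exp P (GXY \<phi> k k) (indicator E) \<omega> \<partial>P)"
    using AG by (intro G.real_cond_exp_intA) (auto simp: P.emeasure_eq_measure)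
  also have "\<dots> = (\<integral>\<omega>\<in>A. m (coord_X k \<omega>) \<partial>P)"
    unfolding set_lebesgue_integral_def using mk
    by (intro integral_cong_AE) (auto elim: eventually_mono)
  also have "\<dots> = (\<integral>\<omega>. (\<Sum>i\<in>UNIV. m i * indicator (A \<inter> X_event k i) \<omega>) \<partial>P)"
    unfolding set_lebesgue_integral_def
    by (intro Bochner_Integration.integral_cong refl)
      (auto simp: indicator_def if_distrib cong: if_cong)
  also have "\<dots> = (\<Sum>i\<in>UNIV. m i * P.prob (A \<inter> X_event k i))"
    by (subst Bochner_Integration.integral_sum) (auto simp: P.emeasure_eq_measure)
  also have "\<dots> = (\<Sum>i\<in>UNIV. m i * (\<integral>\<omega>\<in>A. U \<omega> $ i \<partial>P))"
    by (simp add: filterD(4)[OF U A])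
  also have "\<dots> = (\<integral>\<omega>. (\<Sum>i\<in>UNIV. m i * (indicator A \<omega> *\<^sub>R U \<omega> $ i)) \<partial>P)"
    unfolding set_lebesgue_integral_def using filter_integrable[OF U AP]
    by (subst Bochner_Integration.integral_sum) auto
  also have "\<dots> = (\<integral>\<omega>. indicator A \<omega> * (\<integral>y. indicator B y * (U \<omega> v* M y) $ j \<partial>\<phi>) \<partial>P)"
  proof (intro Bochner_Integration.integral_cong refl)
    fix \<omega>
    have int: "integrable \<phi> (\<lambda>y. indicator B y * M y $ i $ j)" for i
      using integrable_mult_indicator[OF B M_int] by simp
    have "(\<integral>y. indicator B y * (U \<omega> v* M y) $ j \<partial>\<phi>) = (\<integral>y. (\<Sum>i\<in>UNIV. U \<omega> $ i * (indicator B y * M y $ i $ j)) \<partial>\<phi>)"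
      unfolding vector_matrix_nth by (simp add: sum_distrib_left mult.left_commute)
    also have "\<dots> = (\<Sum>i\<in>UNIV. U \<omega> $ i * m i)"
      unfolding m_def set_lebesgue_integral_def using int
      by (subst Bochner_Integration.integral_sum) auto
    finally show "(\<Sum>i\<in>UNIV. m i * (indicator A \<omega> *\<^sub>R U \<omega> $ i)) = indicator A \<omega> * (\<integral>y. indicator B y * (U \<omega> v* M y) $ j \<partial>\<phi>)"
      by (simp add: sum_distrib_left mult_ac)
  qed
  finally show ?thesis unfolding E_def .
qed

text \<open>On the event that the next signal is \<open>j\<close>, the pair of
  \<open>H\<close>-information and next observation has density
  \<open>(U \<omega> v* M y) $ j\<close> with respect to the product of \<open>P\<close> on
  \<open>H\<close> and \<open>\<phi>\<close>. \<open>filter_predict\<close> shows this on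
  rectangles, which determine the measure; \<open>restr_to_subalg\<close> reduces the path to its
  \<open>H\<close>-information.\<close>

lemma filter_joint_law:
  assumes U: "is_filter H k U" and H: "sets H \<subseteq> sets (GXY \<phi> k k)"
    and h [measurable]: "h \<in> borel_measurable (restr_to_subalg P H \<Otimes>\<^sub>M \<phi>)"
  shows "(\<integral>\<^sup>+\<omega>. indicator (X_event (k + 1) j) \<omega> * h (\<omega>, coord_Y (k + 1) \<omega>) \<partial>P)
    = (\<integral>\<^sup>+\<omega>. \<integral>\<^sup>+y. ennreal ((U \<omega> v* M y) $ j) * h (\<omega>, y) \<partial>\<phi> \<partial>P)"
proof -
  let ?R = "restr_to_subalg P H"
  let ?E = "X_event (k + 1) j"
  have sub: "subalgebra P H" using U by (rule filterD)
  have sR: "sets ?R = sets H" "space ?R = space P"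
    using sub by (simp_all add: sets_restr_to_subalg space_restr_to_subalg)
  interpret R: prob_space ?R by (rule prob_space_restr_to_subalg[OF sub P.prob_space_axioms])
  have UR [measurable]: "U \<in> borel_measurable ?R"
    using filterD(2)[OF U] sub by (simp add: measurable_in_subalg)
  have RP: "(\<integral>\<^sup>+\<omega>. f \<omega> \<partial>?R) = (\<integral>\<^sup>+\<omega>. f \<omega> \<partial>P)" if "f \<in> borel_measurable ?R" for f
    using that sR by (intro nn_integral_subalgebra2[OF sub]) (simp cong: measurable_cong_sets)
  have id: "(\<lambda>\<omega>. \<omega>) \<in> P \<rightarrow>\<^sub>M ?R"
    using sub sR by (auto simp: measurable_def subalgebra_def)
  have E [measurable]: "?E \<in> sets P" by measurable
  define dens where "dens p = ennreal ((U (fst p) v* M (snd p)) $ j)" for p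
  have dens [measurable]: "dens \<in> borel_measurable (?R \<Otimes>\<^sub>M \<phi>)"
    unfolding dens_def by measurable
  define T where "T \<omega> = (\<omega>, coord_Y (k + 1) \<omega>)" for \<omega> :: "('e, 'f) path"
  have T: "T \<in> P \<rightarrow>\<^sub>M ?R \<Otimes>\<^sub>M \<phi>"
    unfolding T_def by (intro measurable_Pair id coord_Y_measurable)
  then have T' [measurable]: "T \<in> density P (indicator ?E) \<rightarrow>\<^sub>M ?R \<Otimes>\<^sub>M \<phi>" by simp
  define Nu where "Nu = distr (density P (indicator ?E)) (?R \<Otimes>\<^sub>M \<phi>) T"
  define Mu where "Mu = density (?R \<Otimes>\<^sub>M \<phi>) dens"
  have emNu: "emeasure Nu (A \<times> B) = emeasure P (A \<inter> {\<omega> \<in> space P. coord_X (k + 1) \<omega> = j \<and> coord_Y (k + 1) \<omega> \<in> B})"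
    if A: "A \<in> sets H" and B: "B \<in> sets \<phi>" for A B
  proof -
    have AB: "A \<times> B \<in> sets (?R \<Otimes>\<^sub>M \<phi>)" using A B sR by auto
    have AP: "A \<in> sets P" using A sub by (auto simp: subalgebra_def)
    have TP: "T -` (A \<times> B) \<inter> space P \<in> sets P" using measurable_sets[OF T AB] .
    have "emeasure Nu (A \<times> B) = (\<integral>\<^sup>+\<omega>. indicator ?E \<omega> * indicator (T -` (A \<times> B) \<inter> space P) \<omega> \<partial>P)"
      unfolding Nu_def using emeasure_distr[OF T' AB] TP by (simp add: emeasure_density)
    also have "\<dots> = (\<integral>\<^sup>+\<omega>. indicator (?E \<inter> (T -` (A \<times> B) \<inter> space P)) \<omega> \<partial>P)"
      by (simp add: indicator_inter_arith)
    also have "\<dots> = emeasure P (?E \<inter> (T -` (A \<times> B) \<inter> space P))"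
      by (rule nn_integral_indicator[OF sets.Int[OF E TP]])
    also have "?E \<inter> (T -` (A \<times> B) \<inter> space P) = A \<inter> {\<omega> \<in> space P. coord_X (k + 1) \<omega> = j \<and> coord_Y (k + 1) \<omega> \<in> B}"
      using sets.sets_into_space[OF AP] by (auto simp: T_def)
    finally show ?thesis .
  qed
  have emMu: "emeasure Mu (A \<times> B) = emeasure P (A \<inter> {\<omega> \<in> space P. coord_X (k + 1) \<omega> = j \<and> coord_Y (k + 1) \<omega> \<in> B})"
    if A: "A \<in> sets H" and B: "B \<in> sets \<phi>" for A B
  proof -
    have AB [measurable]: "A \<times> B \<in> sets (?R \<Otimes>\<^sub>M \<phi>)" using A B sR by auto
    have [measurable]: "A \<in> sets ?R" using A sR by simp
    have Uc: "0 \<le> (U \<omega> v* M y) $ j" if "\<omega> \<in> space P" "y \<in> space \<phi>" for \<omega> y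
      using vM_cone[OF that(2) simplex_cone[OF filterD(3)[OF U that(1)]]] by (simp add: nonneg_cone_def)
    have int: "integrable \<phi> (\<lambda>y. indicator B y * (U \<omega> v* M y) $ j)" for \<omega>
      using integrable_mult_indicator[OF B integrable_vM_nth] by simp
    define g where "g \<omega> = (\<integral>y. indicator B y * (U \<omega> v* M y) $ j \<partial>\<phi>)" for \<omega>
    have g0: "0 \<le> g \<omega>" if "\<omega> \<in> space P" for \<omega>
      unfolding g_def using Uc[OF that] by (intro Bochner_Integration.integral_nonneg) auto
    have g1: "g \<omega> \<le> 1" if \<omega>: "\<omega> \<in> space P" for \<omega>
    proof -
      have "g \<omega> \<le> (\<integral>y. (U \<omega> v* M y) $ j \<partial>\<phi>)"
        unfolding g_def using Uc[OF \<omega>]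
        by (intro integral_mono int integrable_vM_nth) (auto simp: indicator_def)
      also have "\<dots> = (U \<omega> v* Q) $ j" by (rule integral_vM_nth)
      also have "\<dots> \<le> 1" using simplex_nth_bounds[OF vQ_simplex[OF filterD(3)[OF U \<omega>]]] by simp
      finally show ?thesis .
    qed
    have gR [measurable]: "g \<in> borel_measurable ?R" unfolding g_def using B by measurable
    then have gP: "g \<in> borel_measurable P" by (rule measurable_compose[OF id])
    have inner: "(\<integral>\<^sup>+y. dens (\<omega>, y) * indicator (A \<times> B) (\<omega>, y) \<partial>\<phi>) = ennreal (indicator A \<omega> * g \<omega>)"
      if \<omega>: "\<omega> \<in> space P" for \<omega>
    proof -
      have "(\<integral>\<^sup>+y. dens (\<omega>, y) * indicator (A \<times> B) (\<omega>, y) \<partial>\<phi>) = (\<integral>\<^sup>+y. ennreal (indicator A \<omega> * (indicator B y * (U \<omega> v* M y) $ j)) \<partial>\<phi>)"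
        by (intro nn_integral_cong) (auto simp: dens_def indicator_def)
      also have "\<dots> = ennreal (\<integral>y. indicator A \<omega> * (indicator B y * (U \<omega> v* M y) $ j) \<partial>\<phi>)"
        using Uc[OF \<omega>] by (intro nn_integral_eq_integral integrable_mult_right int AE_I2) (auto simp: indicator_def)
      finally show ?thesis by (simp add: g_def)
    qed
    have "emeasure Mu (A \<times> B) = (\<integral>\<^sup>+p. dens p * indicator (A \<times> B) p \<partial>(?R \<Otimes>\<^sub>M \<phi>))"
      unfolding Mu_def by (rule emeasure_density[OF dens AB])
    also have "\<dots> = (\<integral>\<^sup>+\<omega>. \<integral>\<^sup>+y. dens (\<omega>, y) * indicator (A \<times> B) (\<omega>, y) \<partial>\<phi> \<partial>?R)"
      by (rule nn_integral_fst[symmetric]) measurable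
    also have "\<dots> = (\<integral>\<^sup>+\<omega>. ennreal (indicator A \<omega> * g \<omega>) \<partial>?R)"
      using inner sR by (intro nn_integral_cong) simp
    also have "\<dots> = (\<integral>\<^sup>+\<omega>. ennreal (indicator A \<omega> * g \<omega>) \<partial>P)" by (rule RP) measurable
    also have "\<dots> = ennreal (\<integral>\<omega>. indicator A \<omega> * g \<omega> \<partial>P)"
    proof (rule nn_integral_eq_integral)
      show "integrable P (\<lambda>\<omega>. indicator A \<omega> * g \<omega>)"
      proof (rule P.integrable_const_bound[of _ 1])
        show "AE \<omega> in P. norm (indicator A \<omega> * g \<omega>) \<le> 1" using g0 g1 by (intro AE_I2) (auto simp: indicator_def)
        have "A \<in> sets P" using A sub by (auto simp: subalgebra_def)
        then show "(\<lambda>\<omega>. indicator A \<omega> * g \<omega>) \<in> borel_measurable P" using gP by measurable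
      qed
      show "AE \<omega> in P. 0 \<le> indicator A \<omega> * g \<omega>" using g0 by (intro AE_I2) (auto simp: indicator_def)
    qed
    also have "\<dots> = emeasure P (A \<inter> {\<omega> \<in> space P. coord_X (k + 1) \<omega> = j \<and> coord_Y (k + 1) \<omega> \<in> B})"
      using filter_predict[OF U H A B, of j] unfolding g_def by (simp add: P.emeasure_eq_measure)
    finally show ?thesis .
  qed
  define Gen where "Gen = {A \<times> B | A B. A \<in> sets H \<and> B \<in> sets \<phi>}"
  have spH: "space P \<in> sets H" using sR sets.top[of ?R] by simp
  have "Mu = Nu"
  proof (rule measure_eqI_generator_eq[of Gen "space P \<times> space \<phi>" Mu Nu "\<lambda>_. space P \<times> space \<phi>"])
    show "Int_stable Gen"
      unfolding Gen_def by (intro Int_stableI) (auto simp: Times_Int_Times, blast intro: sets.Int)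
    show "Gen \<subseteq> Pow (space P \<times> space \<phi>)"
      using sR sets.sets_into_space[of _ ?R] sets.sets_into_space[of _ \<phi>] by (fastforce simp: Gen_def)
    show "emeasure Mu X = emeasure Nu X" if "X \<in> Gen" for X
      using that emMu emNu unfolding Gen_def by auto
    have "sets (?R \<Otimes>\<^sub>M \<phi>) = sigma_sets (space P \<times> space \<phi>) Gen"
      unfolding sets_pair_measure Gen_def by (simp add: sR)
    then show "sets Mu = sigma_sets (space P \<times> space \<phi>) Gen" "sets Nu = sigma_sets (space P \<times> space \<phi>) Gen"
      by (simp_all add: Mu_def Nu_def)
    show "range (\<lambda>_. space P \<times> space \<phi>) \<subseteq> Gen" using spH by (auto simp: Gen_def)
    show "emeasure Mu (space P \<times> space \<phi>) \<noteq> \<infinity>" for i :: nat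
      using emMu[OF spH sets.top] by (simp add: P.emeasure_eq_measure)
  qed simp
  have "(\<integral>\<^sup>+\<omega>. indicator ?E \<omega> * h (\<omega>, coord_Y (k + 1) \<omega>) \<partial>P) = (\<integral>\<^sup>+p. h p \<partial>Nu)"
  proof -
    have "(\<integral>\<^sup>+p. h p \<partial>Nu) = (\<integral>\<^sup>+\<omega>. h (T \<omega>) \<partial>density P (indicator ?E))"
      unfolding Nu_def by (rule nn_integral_distr[OF T']) simp
    also have "\<dots> = (\<integral>\<^sup>+\<omega>. indicator ?E \<omega> * h (T \<omega>) \<partial>P)"
      using measurable_compose[OF T h] E by (intro nn_integral_density) auto
    finally show ?thesis by (simp add: T_def)
  qed
  also have "\<dots> = (\<integral>\<^sup>+p. dens p * h p \<partial>(?R \<Otimes>\<^sub>M \<phi>))"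
    unfolding \<open>Mu = Nu\<close>[symmetric] Mu_def by (rule nn_integral_density) measurable
  also have "\<dots> = (\<integral>\<^sup>+\<omega>. \<integral>\<^sup>+y. dens (\<omega>, y) * h (\<omega>, y) \<partial>\<phi> \<partial>?R)"
    by (rule nn_integral_fst[symmetric]) measurable
  also have "\<dots> = (\<integral>\<^sup>+\<omega>. \<integral>\<^sup>+y. dens (\<omega>, y) * h (\<omega>, y) \<partial>\<phi> \<partial>P)"
    by (rule RP) measurable
  finally show ?thesis by (simp add: dens_def)
qed

lemma filter_joint_law_sum:
  assumes U: "is_filter H k U" and H: "sets H \<subseteq> sets (GXY \<phi> k k)"
    and h [measurable]: "h \<in> borel_measurable (restr_to_subalg P H \<Otimes>\<^sub>M \<phi>)"
  shows "(\<integral>\<^sup>+\<omega>. h (\<omega>, coord_Y (k + 1) \<omega>) \<partial>P)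
    = (\<integral>\<^sup>+\<omega>. \<integral>\<^sup>+y. ennreal (mass (U \<omega> v* M y)) * h (\<omega>, y) \<partial>\<phi> \<partial>P)"
proof -
  let ?R = "restr_to_subalg P H"
  have sub: "subalgebra P H" using U by (rule filterD)
  have UR [measurable]: "U \<in> borel_measurable ?R"
    using filterD(2)[OF U] sub by (simp add: measurable_in_subalg)
  have id: "(\<lambda>\<omega>. \<omega>) \<in> P \<rightarrow>\<^sub>M ?R"
    using sub by (auto simp: measurable_def subalgebra_def sets_restr_to_subalg space_restr_to_subalg)
  have T: "(\<lambda>\<omega>. (\<omega>, coord_Y (k + 1) \<omega>)) \<in> P \<rightarrow>\<^sub>M ?R \<Otimes>\<^sub>M \<phi>"
    by (intro measurable_Pair id coord_Y_measurable)
  have hT [measurable]: "(\<lambda>\<omega>. h (\<omega>, coord_Y (k + 1) \<omega>)) \<in> borel_measurable P"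
    using measurable_compose[OF T h] by simp
  have [measurable]: "(\<lambda>\<omega>. \<integral>\<^sup>+y. ennreal ((U \<omega> v* M y) $ j) * h (\<omega>, y) \<partial>\<phi>) \<in> borel_measurable P" for j
  proof -
    have "(\<lambda>\<omega>. \<integral>\<^sup>+y. ennreal ((U \<omega> v* M y) $ j) * h (\<omega>, y) \<partial>\<phi>) \<in> borel_measurable ?R" by measurable
    then show ?thesis by (rule measurable_compose[OF id])
  qed
  have "(\<integral>\<^sup>+\<omega>. h (\<omega>, coord_Y (k + 1) \<omega>) \<partial>P)
      = (\<integral>\<^sup>+\<omega>. (\<Sum>j\<in>UNIV. indicator (X_event (k + 1) j) \<omega> * h (\<omega>, coord_Y (k + 1) \<omega>)) \<partial>P)"
    by (intro nn_integral_cong)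
      (auto simp: indicator_def if_distrib[of "\<lambda>x. x * _"] sum_distrib_right[symmetric] cong: if_cong)
  also have "\<dots> = (\<Sum>j\<in>UNIV. \<integral>\<^sup>+\<omega>. indicator (X_event (k + 1) j) \<omega> * h (\<omega>, coord_Y (k + 1) \<omega>) \<partial>P)"
    by (rule nn_integral_sum) measurable
  also have "\<dots> = (\<Sum>j\<in>UNIV. \<integral>\<^sup>+\<omega>. \<integral>\<^sup>+y. ennreal ((U \<omega> v* M y) $ j) * h (\<omega>, y) \<partial>\<phi> \<partial>P)"
    by (intro sum.cong refl filter_joint_law[OF U H h])
  also have "\<dots> = (\<integral>\<^sup>+\<omega>. (\<Sum>j\<in>UNIV. \<integral>\<^sup>+y. ennreal ((U \<omega> v* M y) $ j) * h (\<omega>, y) \<partial>\<phi>) \<partial>P)"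
    by (rule nn_integral_sum[symmetric]) measurable
  also have "\<dots> = (\<integral>\<^sup>+\<omega>. \<integral>\<^sup>+y. ennreal (mass (U \<omega> v* M y)) * h (\<omega>, y) \<partial>\<phi> \<partial>P)"
  proof (intro nn_integral_cong)
    fix \<omega> assume \<omega>: "\<omega> \<in> space P"
    then have "\<omega> \<in> space ?R" by (simp add: space_restr_to_subalg)
    then have [measurable]: "(\<lambda>y. h (\<omega>, y)) \<in> borel_measurable \<phi>" by measurable
    have "(\<Sum>j\<in>UNIV. \<integral>\<^sup>+y. ennreal ((U \<omega> v* M y) $ j) * h (\<omega>, y) \<partial>\<phi>)
        = (\<integral>\<^sup>+y. (\<Sum>j\<in>UNIV. ennreal ((U \<omega> v* M y) $ j) * h (\<omega>, y)) \<partial>\<phi>)"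
      by (rule nn_integral_sum[symmetric]) measurable
    also have "\<dots> = (\<integral>\<^sup>+y. ennreal (mass (U \<omega> v* M y)) * h (\<omega>, y) \<partial>\<phi>)"
    proof (intro nn_integral_cong)
      fix y assume y: "y \<in> space \<phi>"
      have "U \<omega> v* M y \<in> nonneg_cone"
        using vM_cone[OF y simplex_cone[OF filterD(3)[OF U \<omega>]]] .
      then show "(\<Sum>j\<in>UNIV. ennreal ((U \<omega> v* M y) $ j) * h (\<omega>, y)) = ennreal (mass (U \<omega> v* M y)) * h (\<omega>, y)"
        unfolding sum_distrib_right[symmetric] mass_def by (simp add: sum_ennreal nonneg_cone_def)
    qed
    finally show "(\<Sum>j\<in>UNIV. \<integral>\<^sup>+y. ennreal ((U \<omega> v* M y) $ j) * h (\<omega>, y) \<partial>\<phi>)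
      = (\<integral>\<^sup>+y. ennreal (mass (U \<omega> v* M y)) * h (\<omega>, y) \<partial>\<phi>)" .
  qed
  finally show ?thesis .
qed

text \<open>Bayes' rule: the filter for the enlarged \<open>\<sigma>\<close>-field is the normalized vector \<open>U v* M Y\<close>.\<close>

lemma filter_update:
  assumes U: "is_filter H k U" and H: "sets H \<subseteq> sets (GXY \<phi> k k)"
    and H': "space H' = space P"
      "sets H' = sigma_sets (space P) (sets H \<union> {coord_Y (k + 1) -` B \<inter> space P | B. B \<in> sets \<phi>})"
  shows "\<exists>U'. is_filter H' (k + 1) U' \<and> (\<forall>F L. hom_lip L F \<longrightarrow> (\<integral>\<omega>. F (U' \<omega>) \<partial>P) = (\<integral>\<omega>. step F (U \<omega>) \<partial>P))"
proof -
  let ?R = "restr_to_subalg P H"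
  have sub: "subalgebra P H" using U by (rule filterD)
  have sR: "sets ?R = sets H" "space ?R = space P"
    using sub by (simp_all add: sets_restr_to_subalg space_restr_to_subalg)
  have UR [measurable]: "U \<in> borel_measurable ?R"
    using filterD(2)[OF U] sub by (simp add: measurable_in_subalg)
  \<comment> \<open>The same default as in \<open>filter_kernel\<close>; in either case
    \<open>mass\<close> times \<open>\<kappa>\<close> is the unnormalized vector.\<close>
  define \<kappa> where "\<kappa> p = (if mass (U (fst p) v* M (snd p)) = 0 then U (fst p) else normalized (U (fst p) v* M (snd p)))" for p
  have \<kappa>m [measurable]: "\<kappa> \<in> borel_measurable (?R \<Otimes>\<^sub>M \<phi>)" unfolding \<kappa>_def by measurable
  define T where "T \<omega> = (\<omega>, coord_Y (k + 1) \<omega>)" for \<omega> :: "('e, 'f) path"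
  have cone: "U \<omega> v* M y \<in> nonneg_cone" if "\<omega> \<in> space P" "y \<in> space \<phi>" for \<omega> y
    using vM_cone[OF that(2) simplex_cone[OF filterD(3)[OF U that(1)]]] .
  have \<kappa>s: "\<kappa> (\<omega>, y) \<in> prob_simplex" if "\<omega> \<in> space P" "y \<in> space \<phi>" for \<omega> y
    using filterD(3)[OF U that(1)] normalized_simplex[OF cone[OF that]] by (simp add: \<kappa>_def)
  have \<kappa>v: "mass (U \<omega> v* M y) *\<^sub>R \<kappa> (\<omega>, y) = U \<omega> v* M y" if "\<omega> \<in> space P" "y \<in> space \<phi>" for \<omega> y
    using mass_normalized[OF cone[OF that]] mass_zero_cone[OF cone[OF that]] by (auto simp: \<kappa>_def)
  have TH: "T \<in> H' \<rightarrow>\<^sub>M ?R \<Otimes>\<^sub>M \<phi>"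
    unfolding T_def
  proof (intro measurable_Pair measurableI)
    show "\<omega> \<in> space ?R" if "\<omega> \<in> space H'" for \<omega> using that H'(1) sR by simp
    show "(\<lambda>\<omega>. \<omega>) -` A \<inter> space H' \<in> sets H'" if "A \<in> sets ?R" for A
    proof -
      have "A \<subseteq> space P" using sets.sets_into_space[OF that] sR by simp
      then show ?thesis using that sR H' by (auto simp: Int_absorb2 intro: sigma_sets.Basic)
    qed
    show "coord_Y (k + 1) \<omega> \<in> space \<phi>" if "\<omega> \<in> space H'" for \<omega> using that H'(1) coord_Y_space by simp
    show "coord_Y (k + 1) -` A \<inter> space H' \<in> sets H'" if "A \<in> sets \<phi>" for A
      using that H' by (auto intro: sigma_sets.Basic)
  qed
  have subH': "subalgebra P H'"
    unfolding subalgebra_def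
  proof
    have "sets H \<subseteq> sets P" using sub by (simp add: subalgebra_def)
    then show "sets H' \<subseteq> sets P"
      unfolding H'(2) by (intro sets.sigma_sets_subset) (auto intro!: measurable_sets[OF coord_Y_measurable])
  qed (rule H'(1))
  have T: "T \<in> P \<rightarrow>\<^sub>M ?R \<Otimes>\<^sub>M \<phi>" by (rule measurable_from_subalg[OF subH' TH])
  define U' where "U' \<omega> = \<kappa> (T \<omega>)" for \<omega>
  have U'm: "U' \<in> borel_measurable H'"
    unfolding U'_def[abs_def] by (rule measurable_compose[OF TH \<kappa>m])
  have U'P [measurable]: "U' \<in> borel_measurable P" by (rule measurable_from_subalg[OF subH' U'm])
  have U's: "U' \<omega> \<in> prob_simplex" if "\<omega> \<in> space P" for \<omega>
    unfolding U'_def T_def by (rule \<kappa>s[OF that coord_Y_space[OF that]])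
  have "is_filter H' (k + 1) U'"
    unfolding is_filter_def
  proof (intro conjI ballI allI subH' U'm U's)
    fix D i assume D: "D \<in> sets H'"
    have DP [measurable]: "D \<in> sets P" using D subH' by (auto simp: subalgebra_def)
    \<comment> \<open>Every set of the enlarged field is the preimage under \<open>T\<close> of a
      product measurable set, so the joint law applies to it.\<close>
    have "sets H' \<subseteq> sets (vimage_algebra (space P) T (?R \<Otimes>\<^sub>M \<phi>))"
      unfolding H'(2)
    proof (rule sets.sigma_sets_subset[of _ "vimage_algebra (space P) T (?R \<Otimes>\<^sub>M \<phi>)", unfolded space_vimage_algebra], rule subsetI)
      fix A assume "A \<in> sets H \<union> {coord_Y (k + 1) -` B \<inter> space P | B. B \<in> sets \<phi>}"
      then show "A \<in> sets (vimage_algebra (space P) T (?R \<Otimes>\<^sub>M \<phi>))"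
      proof (elim UnE)
        assume A: "A \<in> sets H"
        then have "A \<subseteq> space P" using sR sets.sets_into_space[of A ?R] by simp
        then have "A = T -` (A \<times> space \<phi>) \<inter> space P" by (auto simp: T_def coord_Y_space)
        moreover have "A \<times> space \<phi> \<in> sets (?R \<Otimes>\<^sub>M \<phi>)" using A sR by auto
        ultimately show ?thesis by (metis in_vimage_algebra)
      next
        assume "A \<in> {coord_Y (k + 1) -` B \<inter> space P | B. B \<in> sets \<phi>}"
        then obtain B where B: "B \<in> sets \<phi>" "A = coord_Y (k + 1) -` B \<inter> space P" by blast
        then have "A = T -` (space P \<times> B) \<inter> space P" by (auto simp: T_def)
        moreover have "space P \<times> B \<in> sets (?R \<Otimes>\<^sub>M \<phi>)" using B(1) sR sets.top[of ?R] by auto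
        ultimately show ?thesis by (metis in_vimage_algebra)
      qed
    qed
    then obtain D2 where D2 [measurable]: "D2 \<in> sets (?R \<Otimes>\<^sub>M \<phi>)" and DT: "D = T -` D2 \<inter> space P"
      using D sets_vimage_algebra2[of T "space P" "?R \<Otimes>\<^sub>M \<phi>"] measurable_space[OF T] by auto
    let ?E = "X_event (k + 1) i"
    have E [measurable]: "?E \<in> sets P" by measurable
    have "emeasure P (D \<inter> ?E) = (\<integral>\<^sup>+\<omega>. indicator (D \<inter> ?E) \<omega> \<partial>P)" by simp
    also have "\<dots> = (\<integral>\<^sup>+\<omega>. indicator ?E \<omega> * indicator D2 (\<omega>, coord_Y (k + 1) \<omega>) \<partial>P)"
      by (intro nn_integral_cong) (auto simp: DT T_def indicator_def)
    also have "\<dots> = (\<integral>\<^sup>+\<omega>. \<integral>\<^sup>+y. ennreal ((U \<omega> v* M y) $ i) * indicator D2 (\<omega>, y) \<partial>\<phi> \<partial>P)"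
      by (rule filter_joint_law[OF U H]) measurable
    also have "\<dots> = (\<integral>\<^sup>+\<omega>. \<integral>\<^sup>+y. ennreal (mass (U \<omega> v* M y)) * (indicator D2 (\<omega>, y) * ennreal (\<kappa> (\<omega>, y) $ i)) \<partial>\<phi> \<partial>P)"
    proof (intro nn_integral_cong)
      fix \<omega> y assume *: "\<omega> \<in> space P" "y \<in> space \<phi>"
      have "(U \<omega> v* M y) $ i = mass (U \<omega> v* M y) * \<kappa> (\<omega>, y) $ i"
        by (subst \<kappa>v[OF *, symmetric]) simp
      then have "ennreal ((U \<omega> v* M y) $ i) = ennreal (mass (U \<omega> v* M y)) * ennreal (\<kappa> (\<omega>, y) $ i)"
        using mass_nonneg[OF cone[OF *]] simplex_nth_bounds[OF \<kappa>s[OF *]] by (simp add: ennreal_mult)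
      then show "ennreal ((U \<omega> v* M y) $ i) * indicator D2 (\<omega>, y)
        = ennreal (mass (U \<omega> v* M y)) * (indicator D2 (\<omega>, y) * ennreal (\<kappa> (\<omega>, y) $ i))"
        by (simp add: mult_ac)
    qed
    also have "\<dots> = (\<integral>\<^sup>+\<omega>. indicator D2 (\<omega>, coord_Y (k + 1) \<omega>) * ennreal (\<kappa> (\<omega>, coord_Y (k + 1) \<omega>) $ i) \<partial>P)"
      by (rule filter_joint_law_sum[OF U H, symmetric]) measurable
    also have "\<dots> = (\<integral>\<^sup>+\<omega>. ennreal (indicator D \<omega> *\<^sub>R U' \<omega> $ i) \<partial>P)"
      by (intro nn_integral_cong) (auto simp: DT U'_def T_def indicator_def)
    also have "\<dots> = ennreal (\<integral>\<omega>\<in>D. U' \<omega> $ i \<partial>P)"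
      unfolding set_lebesgue_integral_def
    proof (rule nn_integral_eq_integral)
      show "integrable P (\<lambda>\<omega>. indicator D \<omega> *\<^sub>R U' \<omega> $ i)"
        using simplex_nth_bounds[OF U's]
        by (intro P.integrable_const_bound[of _ 1]) (auto intro!: AE_I2 simp: indicator_def)
      show "AE \<omega> in P. 0 \<le> indicator D \<omega> *\<^sub>R U' \<omega> $ i"
        using simplex_nth_bounds[OF U's] by (intro AE_I2) (simp add: indicator_def)
    qed
    finally have "ennreal (P.prob (D \<inter> ?E)) = ennreal (\<integral>\<omega>\<in>D. U' \<omega> $ i \<partial>P)" by (simp add: P.emeasure_eq_measure)
    moreover have "0 \<le> (\<integral>\<omega>\<in>D. U' \<omega> $ i \<partial>P)"
      unfolding set_lebesgue_integral_def using simplex_nth_bounds[OF U's]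
      by (intro Bochner_Integration.integral_nonneg) (simp add: indicator_def)
    ultimately show "P.prob (D \<inter> ?E) = (\<integral>\<omega>\<in>D. U' \<omega> $ i \<partial>P)" by simp
  qed
  moreover have "(\<integral>\<omega>. F (U' \<omega>) \<partial>P) = (\<integral>\<omega>. step F (U \<omega>) \<partial>P)" if F: "hom_lip L F" for F L
  proof -
    have L: "0 \<le> L" using F by (rule hom_lipD)
    \<comment> \<open>Adding \<open>L * mass\<close> makes the function nonnegative on the cone, so
      that the joint law for nonnegative integrals can be used; on the simplex it only adds the
      constant \<open>L\<close>.\<close>
    define G where "G v = F v + L * mass v" for v
    have hG: "hom_lip (L + \<bar>L\<bar> * 1) G"
      unfolding G_def[abs_def] by (intro hom_lip_add F hom_lip_cmult hom_lip_mass)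
    have G0: "0 \<le> G v" if "v \<in> nonneg_cone" for v
      using hom_lip_bound[OF F that] by (simp add: G_def)
    have sG: "step G v = step F v + L * mass v" if "v \<in> nonneg_cone" for v
      unfolding G_def[abs_def] using step_add[OF F hom_lip_cmult[OF hom_lip_mass] that, of L] by (simp add: step_cmult step_mass)
    have sG0: "0 \<le> step G v" if "v \<in> nonneg_cone" for v
      using steps_nonneg[OF hG G0 that, of 1] by simp
    have Gb [measurable]: "G \<in> borel_measurable borel" using hG by (rule hom_lipD)
    have Um [measurable]: "U \<in> borel_measurable P" using U by (rule filterD)
    have int: "integrable P (\<lambda>\<omega>. K (W \<omega>))" if K: "hom_lip C K" and W [measurable]: "W \<in> borel_measurable P"
      and Ws: "\<And>\<omega>. \<omega> \<in> space P \<Longrightarrow> W \<omega> \<in> prob_simplex" for C K W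
    proof (rule P.integrable_const_bound[of _ C])
      show "(\<lambda>\<omega>. K (W \<omega>)) \<in> borel_measurable P" using hom_lipD(2)[OF K] by measurable
      show "AE \<omega> in P. norm (K (W \<omega>)) \<le> C"
        using hom_lip_bound[OF K simplex_cone[OF Ws]] Ws by (intro AE_I2) (auto simp: simplex_iff)
    qed
    have "ennreal (\<integral>\<omega>. G (U' \<omega>) \<partial>P) = (\<integral>\<^sup>+\<omega>. ennreal (G (U' \<omega>)) \<partial>P)"
      using G0[OF simplex_cone[OF U's]] by (intro nn_integral_eq_integral[symmetric] int[OF hG U'P U's] AE_I2)
    also have "\<dots> = (\<integral>\<^sup>+\<omega>. ennreal (G (\<kappa> (\<omega>, coord_Y (k + 1) \<omega>))) \<partial>P)"
      by (simp add: U'_def T_def)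
    also have "\<dots> = (\<integral>\<^sup>+\<omega>. \<integral>\<^sup>+y. ennreal (mass (U \<omega> v* M y)) * ennreal (G (\<kappa> (\<omega>, y))) \<partial>\<phi> \<partial>P)"
      by (rule filter_joint_law_sum[OF U H]) measurable
    also have "\<dots> = (\<integral>\<^sup>+\<omega>. ennreal (step G (U \<omega>)) \<partial>P)"
    proof (intro nn_integral_cong)
      fix \<omega> assume \<omega>: "\<omega> \<in> space P"
      have "(\<integral>\<^sup>+y. ennreal (mass (U \<omega> v* M y)) * ennreal (G (\<kappa> (\<omega>, y))) \<partial>\<phi>) = (\<integral>\<^sup>+y. ennreal (G (U \<omega> v* M y)) \<partial>\<phi>)"
      proof (intro nn_integral_cong)
        fix y assume y: "y \<in> space \<phi>"
        have "G (U \<omega> v* M y) = mass (U \<omega> v* M y) * G (\<kappa> (\<omega>, y))"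
          using hom_lipD(3)[OF hG mass_nonneg[OF cone[OF \<omega> y]] simplex_cone[OF \<kappa>s[OF \<omega> y]]] \<kappa>v[OF \<omega> y] by simp
        then show "ennreal (mass (U \<omega> v* M y)) * ennreal (G (\<kappa> (\<omega>, y))) = ennreal (G (U \<omega> v* M y))"
          using mass_nonneg[OF cone[OF \<omega> y]] G0[OF simplex_cone[OF \<kappa>s[OF \<omega> y]]] by (simp add: ennreal_mult)
      qed
      also have "\<dots> = ennreal (step G (U \<omega>))"
        unfolding step_def using G0 cone[OF \<omega>]
        by (intro nn_integral_eq_integral integrable_step[OF hG] simplex_cone filterD(3)[OF U \<omega>] AE_I2) auto
      finally show "(\<integral>\<^sup>+y. ennreal (mass (U \<omega> v* M y)) * ennreal (G (\<kappa> (\<omega>, y))) \<partial>\<phi>) = ennreal (step G (U \<omega>))" .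
    qed
    also have "\<dots> = ennreal (\<integral>\<omega>. step G (U \<omega>) \<partial>P)"
      using sG0[OF simplex_cone[OF filterD(3)[OF U]]]
      by (intro nn_integral_eq_integral int[OF hom_lip_step[OF hG] Um filterD(3)[OF U]] AE_I2)
    finally have "ennreal (\<integral>\<omega>. G (U' \<omega>) \<partial>P) = ennreal (\<integral>\<omega>. step G (U \<omega>) \<partial>P)" .
    moreover have "0 \<le> (\<integral>\<omega>. G (U' \<omega>) \<partial>P)" "0 \<le> (\<integral>\<omega>. step G (U \<omega>) \<partial>P)"
      using G0[OF simplex_cone[OF U's]] sG0[OF simplex_cone[OF filterD(3)[OF U]]]
      by (auto intro!: Bochner_Integration.integral_nonneg)
    ultimately have "(\<integral>\<omega>. G (U' \<omega>) \<partial>P) = (\<integral>\<omega>. step G (U \<omega>) \<partial>P)" by simp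
    moreover have "(\<integral>\<omega>. G (U' \<omega>) \<partial>P) = (\<integral>\<omega>. F (U' \<omega>) + L \<partial>P)"
      using U's by (intro Bochner_Integration.integral_cong) (auto simp: G_def simplex_iff)
    moreover have "(\<integral>\<omega>. step G (U \<omega>) \<partial>P) = (\<integral>\<omega>. step F (U \<omega>) + L \<partial>P)"
      using filterD(3)[OF U] by (intro Bochner_Integration.integral_cong) (auto simp: sG simplex_cone simplex_iff)
    ultimately show ?thesis
      using int[OF F U'P U's] int[OF hom_lip_step[OF F] Um filterD(3)[OF U]] by simp
  qed
  ultimately show ?thesis by blast
qed

definition stationary_vec :: "real ^ 'e" where
  "stationary_vec = (\<chi> i. P.prob (X_event 0 i))"

lemma path_shift_measurable: "path_shift \<in> P \<rightarrow>\<^sub>M P"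
proof -
  have "(\<lambda>\<omega>. (\<lambda>n. coord_X (n + 1) \<omega>, \<lambda>n. coord_Y (n + 1) \<omega>)) \<in> P \<rightarrow>\<^sub>M path_space \<phi>"
    unfolding path_space_def
    by (intro measurable_Pair measurable_abs_UNIV coord_X_measurable coord_Y_measurable)
  then show ?thesis
    unfolding path_shift_def[abs_def] by (simp add: measurable_cong_sets[OF refl sets_P])
qed

lemma coord_X_law: "P.prob (X_event k i) = stationary_vec $ i"
proof -
  have shift: "P.prob (X_event (k + 1) i) = P.prob (X_event k i)" for k
  proof -
    have A: "X_event k i \<in> sets P" by measurable
    have "P.prob (X_event k i) = measure (distr P P path_shift) (X_event k i)"
      by (simp add: stationary)
    also have "\<dots> = P.prob (path_shift -` X_event k i \<inter> space P)"
      by (rule measure_distr[OF path_shift_measurable A])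
    also have "path_shift -` X_event k i \<inter> space P = X_event (k + 1) i"
      using measurable_space[OF path_shift_measurable] by (auto simp: path_shift_def coord_X_def)
    finally show ?thesis by simp
  qed
  show ?thesis
  proof (induction k rule: int_induct[where k = 0])
    case base
    then show ?case by (simp add: stationary_vec_def)
  next
    case (step1 k)
    then show ?case using shift[of k] by simp
  next
    case (step2 k)
    then show ?case using shift[of "k - 1"] by simp
  qed
qed

lemma stationary_vec_simplex: "stationary_vec \<in> prob_simplex"
proof -
  have "(\<Sum>i\<in>UNIV. P.prob (X_event 0 i)) = P.prob (\<Union>i. X_event 0 i)"
    by (rule P.finite_measure_finite_Union[symmetric]) (auto simp: disjoint_family_on_def)
  also have "(\<Union>i. X_event 0 i) = space P" by auto
  finally show ?thesis by (simp add: prob_simplex_def stationary_vec_def P.prob_space)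
qed

text \<open>Observations are added one at a time, each moving one step onto \<open>F\<close>. It
  serves both a start with known signal and a start without any information; they differ in the
  initial vector only.\<close>

lemma filter_chain:
  fixes Hs :: "nat \<Rightarrow> ('e, 'f) path measure"
  assumes U0: "is_filter (Hs 0) k U0" and sp: "\<And>n. space (Hs n) = space P"
    and G: "\<And>n. sets (Hs n) \<subseteq> sets (GXY \<phi> (k + int n) (k + int n))"
    and Suc: "\<And>n. sets (Hs (Suc n)) = sigma_sets (space P) (sets (Hs n) \<union> {coord_Y (k + int n + 1) -` B \<inter> space P | B. B \<in> sets \<phi>})"
  shows "\<exists>U. is_filter (Hs n) (k + int n) U \<and>
    (\<forall>F L. hom_lip L F \<longrightarrow> (\<integral>\<omega>. F (U \<omega>) \<partial>P) = (\<integral>\<omega>. (step ^^ n) F (U0 \<omega>) \<partial>P))"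
proof (induction n)
  case 0
  then show ?case using U0 by auto
next
  case (Suc n)
  then obtain U where U: "is_filter (Hs n) (k + int n) U"
    and e: "\<And>F L. hom_lip L F \<Longrightarrow> (\<integral>\<omega>. F (U \<omega>) \<partial>P) = (\<integral>\<omega>. (step ^^ n) F (U0 \<omega>) \<partial>P)" by blast
  obtain U' where U': "is_filter (Hs (Suc n)) (k + int n + 1) U'"
    and e': "\<And>F L. hom_lip L F \<Longrightarrow> (\<integral>\<omega>. F (U' \<omega>) \<partial>P) = (\<integral>\<omega>. step F (U \<omega>) \<partial>P)"
    using filter_update[OF U G sp assms(4)] by blast
  have "(\<integral>\<omega>. F (U' \<omega>) \<partial>P) = (\<integral>\<omega>. (step ^^ Suc n) F (U0 \<omega>) \<partial>P)" if F: "hom_lip L F" for F L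
    using e'[OF F] e[OF hom_lip_step[OF F]] by (simp add: funpow_Suc_right del: funpow.simps)
  moreover have "k + int (Suc n) = k + int n + 1" by simp
  ultimately show ?case using U' by metis
qed

lemma GXY_Suc:
  assumes "m \<le> n"
  shows "sets (GXY \<phi> m (n + 1) :: ('e, 'f) path measure)
    = sigma_sets (space P) (sets (GXY \<phi> m n) \<union> {coord_Y (n + 1) -` B \<inter> space P | B. B \<in> sets \<phi>})"
    (is "?L = sigma_sets ?\<Omega> ?S")
proof
  have sp: "space (GXY \<phi> m (n + 1) :: ('e, 'f) path measure) = space P"
    using subalgebra_GXY[of m "n + 1"] by (simp add: subalgebra_def)
  have "{coord_Y (n + 1) -` B \<inter> space P | B. B \<in> sets \<phi>} \<subseteq> sets (FY \<phi> (n + 1))"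
    unfolding FY_sets by (auto intro!: sigma_sets.Basic)
  also have "\<dots> \<subseteq> ?L" unfolding GXY_sets by (auto intro: sigma_sets.Basic)
  finally have "?S \<subseteq> ?L" using GXY_mono[of m m n "n + 1"] by auto
  then show "sigma_sets ?\<Omega> ?S \<subseteq> ?L" using sets.sigma_sets_subset[of ?S "GXY \<phi> m (n + 1)"] sp by simp
  have "sets (FX \<phi> m) \<subseteq> sigma_sets ?\<Omega> ?S"
    by (auto simp: GXY_sets intro!: sigma_sets.Basic)
  moreover have "sets (FY \<phi> (n + 1)) \<subseteq> sigma_sets ?\<Omega> ?S"
    unfolding FY_sets
  proof (rule sigma_sets_mono, rule subsetI)
    fix A assume "A \<in> {coord_Y k -` B \<inter> space P | k B. k \<le> n + 1 \<and> B \<in> sets \<phi>}"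
    then obtain k B where A: "A = coord_Y k -` B \<inter> space P" "k \<le> n + 1" "B \<in> sets \<phi>" by blast
    show "A \<in> sigma_sets ?\<Omega> ?S"
    proof (cases "k = n + 1")
      case False
      then have "A \<in> sets (FY \<phi> n)" using A unfolding FY_sets by (intro sigma_sets.Basic CollectI exI[of _ k] exI[of _ B]) auto
      then have "A \<in> sets (GXY \<phi> m n)" unfolding GXY_sets by (auto intro: sigma_sets.Basic)
      then show ?thesis by (auto intro: sigma_sets.Basic)
    qed (use A in \<open>auto intro!: sigma_sets.Basic\<close>)
  qed
  ultimately show "?L \<subseteq> sigma_sets ?\<Omega> ?S"
    unfolding GXY_sets[of m "n + 1"] by (intro sigma_sets_mono) auto
qed

lemma filter_GXY_start: "is_filter (GXY \<phi> m m) m (\<lambda>\<omega>. axis (coord_X m \<omega>) 1)"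
  unfolding is_filter_def
proof (intro conjI ballI allI subalgebra_GXY axis_simplex)
  have sp: "space (GXY \<phi> m m :: ('e, 'f) path measure) = space P"
    using subalgebra_GXY[of m m] by (simp add: subalgebra_def)
  have "(coord_X m :: ('e, 'f) path \<Rightarrow> 'e) \<in> GXY \<phi> m m \<rightarrow>\<^sub>M count_space UNIV"
  proof (rule measurableI)
    fix B :: "'e set"
    have "coord_X m -` B \<inter> space P \<in> sets (FX \<phi> m)" unfolding FX_sets by (auto intro!: sigma_sets.Basic)
    then show "coord_X m -` B \<inter> space (GXY \<phi> m m) \<in> sets (GXY \<phi> m m)"
      unfolding sp GXY_sets by (auto intro: sigma_sets.Basic)
  qed simp
  then show "(\<lambda>\<omega> :: ('e, 'f) path. axis (coord_X m \<omega>) (1 :: real)) \<in> borel_measurable (GXY \<phi> m m)" by measurable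
  fix A :: "('e, 'f) path set" and i assume A: "A \<in> sets (GXY \<phi> m m)"
  then have [measurable]: "A \<in> sets P" using subalgebra_GXY by (auto simp: subalgebra_def)
  have "(\<integral>\<omega>\<in>A. axis (coord_X m \<omega>) 1 $ i \<partial>P) = (\<integral>\<omega>. indicat_real (A \<inter> X_event m i) \<omega> \<partial>P)"
    unfolding set_lebesgue_integral_def
    by (intro Bochner_Integration.integral_cong) (auto simp: indicator_def axis_def)
  also have "\<dots> = P.prob (A \<inter> X_event m i)" by simp
  finally show "P.prob (A \<inter> X_event m i) = (\<integral>\<omega>\<in>A. axis (coord_X m \<omega>) 1 $ i \<partial>P)" by simp
qed

lemma integral_coord_X: "(\<integral>\<omega>. g (coord_X m \<omega>) \<partial>P) = (\<Sum>i\<in>UNIV. stationary_vec $ i * g i)" for g :: "'e \<Rightarrow> real"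
proof -
  have "(\<integral>\<omega>. g (coord_X m \<omega>) \<partial>P) = (\<integral>\<omega>. (\<Sum>i\<in>UNIV. g i * indicator (X_event m i) \<omega>) \<partial>P)"
    by (intro Bochner_Integration.integral_cong) (auto simp: indicator_def if_distrib cong: if_cong)
  also have "\<dots> = (\<Sum>i\<in>UNIV. g i * P.prob (X_event m i))"
    by (subst Bochner_Integration.integral_sum) (auto simp: P.emeasure_eq_measure)
  finally show ?thesis by (simp add: coord_X_law mult.commute)
qed

text \<open>When the signal is known up to time \<open>- n\<close>, the recursion starts from the
  vertex at \<open>coord_X (- int n)\<close>, whose law is \<open>stationary_vec\<close>.\<close>

lemma filter_GXY:
  "\<exists>U. is_filter (GXY \<phi> (- int n) 0) 0 U \<and>
    (\<forall>F L. hom_lip L F \<longrightarrow> (\<integral>\<omega>. F (U \<omega>) \<partial>P) = (\<Sum>i\<in>UNIV. stationary_vec $ i * (step ^^ n) F (axis i 1)))"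
proof -
  have "\<exists>U. is_filter (GXY \<phi> (- int n) (- int n + int n)) (- int n + int n) U \<and>
    (\<forall>F L. hom_lip L F \<longrightarrow> (\<integral>\<omega>. F (U \<omega>) \<partial>P) = (\<integral>\<omega>. (step ^^ n) F (axis (coord_X (- int n) \<omega>) 1) \<partial>P))"
  proof (rule filter_chain[where Hs = "\<lambda>j. GXY \<phi> (- int n) (- int n + int j)"])
    show "is_filter (GXY \<phi> (- int n) (- int n + int 0)) (- int n) (\<lambda>\<omega>. axis (coord_X (- int n) \<omega>) 1)"
      using filter_GXY_start[of "- int n"] by simp
    show "space (GXY \<phi> (- int n) (- int n + int j) :: ('e, 'f) path measure) = space P" for j
      using subalgebra_GXY by (simp add: subalgebra_def)
    show "sets (GXY \<phi> (- int n) (- int n + int j) :: ('e, 'f) path measure) \<subseteq> sets (GXY \<phi> (- int n + int j) (- int n + int j))" for j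
      by (rule GXY_mono) auto
    show "sets (GXY \<phi> (- int n) (- int n + int (Suc j)) :: ('e, 'f) path measure) = sigma_sets (space P)
       (sets (GXY \<phi> (- int n) (- int n + int j)) \<union> {coord_Y (- int n + int j + 1) -` B \<inter> space P |B. B \<in> sets \<phi>})" for j
      using GXY_Suc[of "- int n" "- int n + int j"] by (simp add: add.commute add.left_commute)
  qed
  then show ?thesis by (simp add: integral_coord_X[where g = "\<lambda>i. (step ^^ n) _ (axis i 1)"])
qed

text \<open>Observations at times in the half-open interval from \<open>m\<close> (excluded) to
  \<open>n\<close>. The field \<open>FY\<close> has no first time at which a recursion could start;
  windows start from the trivial field and increase to \<open>FY\<close>.\<close>

definition FY_window :: "int \<Rightarrow> int \<Rightarrow> ('e, 'f) path measure" where
  "FY_window m n = sigma (space P) {coord_Y k -` A \<inter> space P | k A. m < k \<and> k \<le> n \<and> A \<in> sets \<phi>}"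

lemma FY_window_sets: "sets (FY_window m n) = sigma_sets (space P) {coord_Y k -` A \<inter> space P | k A. m < k \<and> k \<le> n \<and> A \<in> sets \<phi>}"
  unfolding FY_window_def by (rule sets_measure_of) auto

lemma FY_window_mono:
  assumes "m' \<le> m" "n \<le> n'" shows "sets (FY_window m n) \<subseteq> sets (FY_window m' n')"
  unfolding FY_window_sets
proof (rule sigma_sets_subseteq, rule subsetI)
  fix A assume "A \<in> {coord_Y k -` B \<inter> space P | k B. m < k \<and> k \<le> n \<and> B \<in> sets \<phi>}"
  then obtain k B where A: "A = coord_Y k -` B \<inter> space P" "m < k" "k \<le> n" "B \<in> sets \<phi>" by blast
  then show "A \<in> {coord_Y k -` B \<inter> space P | k B. m' < k \<and> k \<le> n' \<and> B \<in> sets \<phi>}"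
    using assms by (intro CollectI exI[of _ k] exI[of _ B]) auto
qed

lemma FY_window_subset_FY: "sets (FY_window m n) \<subseteq> sets (FY \<phi> n)"
  unfolding FY_window_sets FY_sets by (rule sigma_sets_subseteq) blast

lemma subalgebra_FY_window: "subalgebra P (FY_window m n)"
  using FY_window_subset_FY FY_subset by (fastforce simp: subalgebra_def FY_window_def space_measure_of_conv)

lemma filter_FY_window:
  "\<exists>U. is_filter (FY_window (- int n) 0) 0 U \<and>
    (\<forall>F L. hom_lip L F \<longrightarrow> (\<integral>\<omega>. F (U \<omega>) \<partial>P) = (step ^^ n) F stationary_vec)"
proof -
  have "\<exists>U. is_filter (FY_window (- int n) (- int n + int n)) (- int n + int n) U \<and>
    (\<forall>F L. hom_lip L F \<longrightarrow> (\<integral>\<omega>. F (U \<omega>) \<partial>P) = (\<integral>\<omega>. (step ^^ n) F stationary_vec \<partial>P))"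
  proof (rule filter_chain[where Hs = "\<lambda>j. FY_window (- int n) (- int n + int j)"])
    have e: "{coord_Y k -` A \<inter> space P | k A. - int n < k \<and> k \<le> - int n \<and> A \<in> sets \<phi>} = {}" by auto
    \<comment> \<open>An empty window generates the trivial field, whose filter is the constant
      \<open>stationary_vec\<close>.\<close>
    have "sets (FY_window (- int n) (- int n)) = {{}, space P}"
      unfolding FY_window_sets e by (rule sigma_sets_empty_eq)
    then show "is_filter (FY_window (- int n) (- int n + int 0)) (- int n) (\<lambda>_. stationary_vec)"
      unfolding is_filter_def of_nat_0 add_0_right
    proof (intro conjI ballI allI subalgebra_FY_window stationary_vec_simplex)
      fix A i assume sets: "sets (FY_window (- int n) (- int n)) = {{}, space P}" and "A \<in> sets (FY_window (- int n) (- int n))"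
      then have "A = {} \<or> A = space P" by simp
      moreover have "space P \<inter> X_event (- int n) i = X_event (- int n) i" by auto
      ultimately show "P.prob (A \<inter> X_event (- int n) i) = (\<integral>\<omega>\<in>A. stationary_vec $ i \<partial>P)"
        by (elim disjE) (simp_all add: set_lebesgue_integral_def coord_X_law P.prob_space)
    qed simp
    show "space (FY_window (- int n) (- int n + int j)) = space P" for j
      using subalgebra_FY_window by (simp add: subalgebra_def)
    show "sets (FY_window (- int n) (- int n + int j)) \<subseteq> sets (GXY \<phi> (- int n + int j) (- int n + int j))" for j
      using FY_window_subset_FY unfolding GXY_sets by (auto intro: sigma_sets.Basic)
    show "sets (FY_window (- int n) (- int n + int (Suc j))) = sigma_sets (space P)
       (sets (FY_window (- int n) (- int n + int j)) \<union> {coord_Y (- int n + int j + 1) -` B \<inter> space P |B. B \<in> sets \<phi>})" (is "?L = ?R") for j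
    proof
      show "?L \<subseteq> ?R"
        unfolding FY_window_sets[of _ "- int n + int (Suc j)"]
      proof (rule sigma_sets_mono, rule subsetI)
        fix A assume "A \<in> {coord_Y k -` B \<inter> space P | k B. - int n < k \<and> k \<le> - int n + int (Suc j) \<and> B \<in> sets \<phi>}"
        then obtain k B where A: "A = coord_Y k -` B \<inter> space P" "- int n < k" "k \<le> - int n + int (Suc j)" "B \<in> sets \<phi>" by blast
        show "A \<in> ?R"
        proof (cases "k = - int n + int j + 1")
          case False
          then have "A \<in> sets (FY_window (- int n) (- int n + int j))"
            using A unfolding FY_window_sets by (auto intro!: sigma_sets.Basic exI[of _ k])
          then show ?thesis by (auto intro: sigma_sets.Basic)
        qed (use A in \<open>auto intro!: sigma_sets.Basic\<close>)
      qed
      show "?R \<subseteq> ?L"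
        unfolding FY_window_sets[of _ "- int n + int (Suc j)"]
      proof (rule sigma_sets_mono, rule Un_least, unfold FY_window_sets[symmetric])
        show "sets (FY_window (- int n) (- int n + int j)) \<subseteq> sets (FY_window (- int n) (- int n + int (Suc j)))"
          by (rule FY_window_mono) auto
        show "{coord_Y (- int n + int j + 1) -` B \<inter> space P |B. B \<in> sets \<phi>} \<subseteq> sets (FY_window (- int n) (- int n + int (Suc j)))"
          unfolding FY_window_sets by (auto intro!: sigma_sets.Basic exI[of _ "- int n + int j + 1"])
      qed
    qed
  qed
  then show ?thesis by (simp add: P.prob_space)
qed

section \<open>The laws of the minimal and maximal filters\<close>

text \<open>The common form of \<open>pi_min\<close> and \<open>pi_max\<close> at time 0, so that
  one convergence lemma treats both.\<close>

definition cond_law :: "('e, 'f) path measure \<Rightarrow> ('e, 'f) path \<Rightarrow> real ^ 'e" where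
  "cond_law H \<omega> = (\<chi> i. real_cond_exp P H (indicator (X_event 0 i)) \<omega>)"

lemma cond_law_measurable [measurable]: "cond_law H \<in> borel_measurable P"
  unfolding borel_measurable_vec_iff cond_law_def by simp

lemma cond_law_simplex:
  assumes "subalgebra P H" shows "AE \<omega> in P. cond_law H \<omega> \<in> prob_simplex"
proof -
  interpret H: sigma_finite_subalgebra P H using assms by (rule P.subalgebra_sigma_finite)
  let ?Z = "\<lambda>i. indicat_real (X_event 0 i)"
  have E [measurable]: "X_event 0 i \<in> sets P" for i by measurable
  have "AE \<omega> in P. \<forall>i. 0 \<le> real_cond_exp P H (?Z i) \<omega>"
    using P.cond_prob_bounds[OF assms E] by (simp add: AE_all_countable)
  moreover have "AE \<omega> in P. real_cond_exp P H (\<lambda>\<omega>. \<Sum>i\<in>UNIV. ?Z i \<omega>) \<omega> = (\<Sum>i\<in>UNIV. real_cond_exp P H (?Z i) \<omega>)"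
    by (rule H.real_cond_exp_sum) (simp add: P.emeasure_eq_measure)
  moreover have "AE \<omega> in P. real_cond_exp P H (\<lambda>\<omega>. \<Sum>i\<in>UNIV. ?Z i \<omega>) \<omega> = 1"
  proof (rule H.real_cond_exp_charact)
    fix A assume A: "A \<in> sets H"
    show "(\<integral>\<omega>\<in>A. (\<Sum>i\<in>UNIV. ?Z i \<omega>) \<partial>P) = (\<integral>\<omega>\<in>A. 1 \<partial>P)"
      unfolding set_lebesgue_integral_def
      by (intro Bochner_Integration.integral_cong refl) (simp add: indicator_def)
  next
    show "integrable P (\<lambda>\<omega>. \<Sum>i\<in>UNIV. ?Z i \<omega>)" by (intro Bochner_Integration.integrable_sum) (simp add: P.emeasure_eq_measure)
  qed auto
  ultimately show ?thesis
    by eventually_elim (simp add: prob_simplex_def cond_law_def)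
qed

lemma filter_cond_law:
  assumes "is_filter H 0 U" shows "AE \<omega> in P. cond_law H \<omega> = U \<omega>"
proof -
  have "AE \<omega> in P. \<forall>i. real_cond_exp P H (indicator (X_event 0 i)) \<omega> = U \<omega> $ i"
    using filter_cond_exp[OF assms] by (simp add: AE_all_countable)
  then show ?thesis by eventually_elim (simp add: cond_law_def vec_eq_iff)
qed

lemma cond_law_integrable:
  assumes "subalgebra P H" "hom_lip L F" shows "integrable P (\<lambda>\<omega>. F (cond_law H \<omega>))"
proof (rule P.integrable_const_bound[of _ L])
  show "(\<lambda>\<omega>. F (cond_law H \<omega>)) \<in> borel_measurable P" using hom_lipD(2)[OF assms(2)] by measurable
  show "AE \<omega> in P. norm (F (cond_law H \<omega>)) \<le> L"
    using cond_law_simplex[OF assms(1)]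
  proof eventually_elim
    case (elim \<omega>)
    then show ?case using hom_lip_bound[OF assms(2), of "cond_law H \<omega>"] by (simp add: simplex_iff)
  qed
qed

text \<open>The Lipschitz bound reduces the claim to L1 convergence of finitely many conditional
  probabilities.\<close>

lemma cond_law_tendsto:
  fixes H :: "nat \<Rightarrow> ('e, 'f) path measure"
  assumes H: "\<And>n. subalgebra P (H n)" and K: "subalgebra P K"
    and mono: "(\<forall>m n. m \<le> n \<longrightarrow> sets (H m) \<subseteq> sets (H n)) \<and> sets K = sigma_sets (space P) (\<Union>n. sets (H n))
      \<or> (\<forall>m n. m \<le> n \<longrightarrow> sets (H n) \<subseteq> sets (H m)) \<and> sets K = (\<Inter>n. sets (H n))"
    and F: "hom_lip L F"
  shows "(\<lambda>n. \<integral>\<omega>. F (cond_law (H n) \<omega>) \<partial>P) \<longlonglongrightarrow> (\<integral>\<omega>. F (cond_law K \<omega>) \<partial>P)"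
proof -
  let ?E = "\<lambda>i. X_event 0 i"
  let ?d = "\<lambda>i n. \<integral>\<omega>. \<bar>real_cond_exp P (H n) (indicator (?E i)) \<omega> - real_cond_exp P K (indicator (?E i)) \<omega>\<bar> \<partial>P"
  have E [measurable]: "?E i \<in> sets P" for i by measurable
  have lim: "?d i \<longlonglongrightarrow> 0" for i
    by (rule P.monotone_cond_prob_limit[OF H K E mono])
  have intd: "integrable P (\<lambda>\<omega>. \<bar>real_cond_exp P (H n) (indicator (?E i)) \<omega> - real_cond_exp P K (indicator (?E i)) \<omega>\<bar>)" for i n
  proof -
    interpret Hn: sigma_finite_subalgebra P "H n" using H by (rule P.subalgebra_sigma_finite)
    interpret K: sigma_finite_subalgebra P K using K by (rule P.subalgebra_sigma_finite)
    have "integrable P (indicat_real (?E i))" by (simp add: P.emeasure_eq_measure)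
    then show ?thesis using Hn.real_cond_exp_int(1) K.real_cond_exp_int(1)
      by (intro integrable_abs Bochner_Integration.integrable_diff)
  qed
  have bound: "\<bar>(\<integral>\<omega>. F (cond_law (H n) \<omega>) \<partial>P) - (\<integral>\<omega>. F (cond_law K \<omega>) \<partial>P)\<bar> \<le> L * (\<Sum>i\<in>UNIV. ?d i n)" for n
  proof -
    have "\<bar>(\<integral>\<omega>. F (cond_law (H n) \<omega>) \<partial>P) - (\<integral>\<omega>. F (cond_law K \<omega>) \<partial>P)\<bar>
        = \<bar>\<integral>\<omega>. F (cond_law (H n) \<omega>) - F (cond_law K \<omega>) \<partial>P\<bar>"
      using cond_law_integrable[OF H F] cond_law_integrable[OF K F] by simp
    also have "\<dots> \<le> (\<integral>\<omega>. \<bar>F (cond_law (H n) \<omega>) - F (cond_law K \<omega>)\<bar> \<partial>P)" by (rule integral_abs_bound)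
    also have "\<dots> \<le> (\<integral>\<omega>. L * (\<Sum>i\<in>UNIV. \<bar>real_cond_exp P (H n) (indicator (?E i)) \<omega> - real_cond_exp P K (indicator (?E i)) \<omega>\<bar>) \<partial>P)"
    proof (rule integral_mono_AE)
      show "integrable P (\<lambda>\<omega>. \<bar>F (cond_law (H n) \<omega>) - F (cond_law K \<omega>)\<bar>)"
        using cond_law_integrable[OF H F] cond_law_integrable[OF K F] by simp
      show "integrable P (\<lambda>\<omega>. L * (\<Sum>i\<in>UNIV. \<bar>real_cond_exp P (H n) (indicator (?E i)) \<omega> - real_cond_exp P K (indicator (?E i)) \<omega>\<bar>))"
        by (intro integrable_mult_right Bochner_Integration.integrable_sum intd)
      show "AE \<omega> in P. \<bar>F (cond_law (H n) \<omega>) - F (cond_law K \<omega>)\<bar>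
        \<le> L * (\<Sum>i\<in>UNIV. \<bar>real_cond_exp P (H n) (indicator (?E i)) \<omega> - real_cond_exp P K (indicator (?E i)) \<omega>\<bar>)"
        using cond_law_simplex[OF H[of n]] cond_law_simplex[OF K]
      proof eventually_elim
        case (elim \<omega>)
        then show ?case
          using hom_lipD(4)[OF F, of "cond_law (H n) \<omega>" "cond_law K \<omega>"]
          by (simp add: simplex_cone l1norm_def) (simp add: cond_law_def)
      qed
    qed
    also have "\<dots> = L * (\<Sum>i\<in>UNIV. ?d i n)"
      using intd by (simp add: Bochner_Integration.integral_sum)
    finally show ?thesis .
  qed
  have "(\<lambda>n. L * (\<Sum>i\<in>UNIV. ?d i n)) \<longlonglongrightarrow> L * (\<Sum>i\<in>(UNIV::'e set). 0)"
    by (intro tendsto_mult_left tendsto_sum lim)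
  then have "(\<lambda>n. (\<integral>\<omega>. F (cond_law (H n) \<omega>) \<partial>P) - (\<integral>\<omega>. F (cond_law K \<omega>) \<partial>P)) \<longlonglongrightarrow> 0"
  proof -
    assume l: "(\<lambda>n. L * (\<Sum>i\<in>UNIV. ?d i n)) \<longlonglongrightarrow> L * (\<Sum>i\<in>(UNIV::'e set). 0)"
    show ?thesis
    proof (rule Lim_null_comparison)
      show "\<forall>\<^sub>F n in sequentially. norm ((\<integral>\<omega>. F (cond_law (H n) \<omega>) \<partial>P) - (\<integral>\<omega>. F (cond_law K \<omega>) \<partial>P)) \<le> L * (\<Sum>i\<in>UNIV. ?d i n)"
        unfolding real_norm_def by (intro always_eventually allI bound)
      show "(\<lambda>n. L * (\<Sum>i\<in>UNIV. ?d i n)) \<longlonglongrightarrow> 0" using l by simp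
    qed
  qed
  then show ?thesis by (rule LIM_zero_cancel)
qed

lemma pi_min_cond_law: "pi_min \<phi> P 0 = cond_law (FY \<phi> 0)"
  by (simp add: fun_eq_iff pi_min_def cond_law_def)

lemma pi_max_cond_law: "pi_max \<phi> P 0 = cond_law (GXY_inf \<phi> 0)"
  by (simp add: fun_eq_iff pi_max_def cond_law_def)

text \<open>The upward martingale limit of the window filters, each of which starts from the
  stationary vector.\<close>

lemma pi_min_limit:
  assumes F: "hom_lip L F"
  shows "(\<lambda>n. (step ^^ n) F stationary_vec) \<longlonglongrightarrow> (\<integral>\<omega>. F (pi_min \<phi> P 0 \<omega>) \<partial>P)"
proof -
  have "(\<lambda>n. \<integral>\<omega>. F (cond_law (FY_window (- int n) 0) \<omega>) \<partial>P) \<longlonglongrightarrow> (\<integral>\<omega>. F (cond_law (FY \<phi> 0) \<omega>) \<partial>P)"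
  proof (rule cond_law_tendsto[OF subalgebra_FY_window subalgebra_FY _ F], intro disjI1 conjI allI impI)
    show "sets (FY_window (- int m) 0) \<subseteq> sets (FY_window (- int n) 0)" if "m \<le> n" for m n
      using that by (intro FY_window_mono) auto
    show "sets (FY \<phi> 0) = sigma_sets (space P) (\<Union>n. sets (FY_window (- int n) 0))"
    proof
      show "sets (FY \<phi> 0) \<subseteq> sigma_sets (space P) (\<Union>n. sets (FY_window (- int n) 0))"
        unfolding FY_sets
      proof (rule sigma_sets_mono, rule subsetI)
        fix A assume "A \<in> {coord_Y k -` B \<inter> space P | k B. k \<le> 0 \<and> B \<in> sets \<phi>}"
        then obtain k B where A: "A = coord_Y k -` B \<inter> space P" "k \<le> 0" "B \<in> sets \<phi>" by blast
        \<comment> \<open>The left end of this window is \<open>k - 1\<close>, because it is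
          excluded.\<close>
        then have "A \<in> sets (FY_window (- int (nat (1 - k))) 0)"
          unfolding FY_window_sets by (auto intro!: sigma_sets.Basic exI[of _ k])
        then show "A \<in> sigma_sets (space P) (\<Union>n. sets (FY_window (- int n) 0))"
          by (intro sigma_sets.Basic) blast
      qed
      show "sigma_sets (space P) (\<Union>n. sets (FY_window (- int n) 0)) \<subseteq> sets (FY \<phi> 0)"
        using sets.sigma_sets_subset[of "\<Union>n. sets (FY_window (- int n) 0)" "FY \<phi> 0"]
          subalgebra_FY[of 0] FY_window_subset_FY by (auto simp: subalgebra_def)
    qed
  qed
  moreover have "(\<integral>\<omega>. F (cond_law (FY_window (- int n) 0) \<omega>) \<partial>P) = (step ^^ n) F stationary_vec" for n
  proof -
    obtain U where U: "is_filter (FY_window (- int n) 0) 0 U" "(\<integral>\<omega>. F (U \<omega>) \<partial>P) = (step ^^ n) F stationary_vec"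
      using filter_FY_window[of n] F by blast
    have [measurable]: "F \<in> borel_measurable borel" "U \<in> borel_measurable P"
      using hom_lipD(2)[OF F] filterD(5)[OF U(1)] by auto
    have "(\<integral>\<omega>. F (cond_law (FY_window (- int n) 0) \<omega>) \<partial>P) = (\<integral>\<omega>. F (U \<omega>) \<partial>P)"
      using filter_cond_law[OF U(1)] by (intro integral_cong_AE) (auto elim: eventually_mono)
    then show ?thesis using U(2) by simp
  qed
  ultimately show ?thesis by (simp add: pi_min_cond_law)
qed

text \<open>The downward martingale limit: the known part of the signal recedes to the remote past,
  and each filter starts from a random vertex.\<close>

lemma pi_max_limit:
  assumes F: "hom_lip L F"
  shows "(\<lambda>n. \<Sum>i\<in>UNIV. stationary_vec $ i * (step ^^ n) F (axis i 1)) \<longlonglongrightarrow> (\<integral>\<omega>. F (pi_max \<phi> P 0 \<omega>) \<partial>P)"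
proof -
  have "(\<lambda>n. \<integral>\<omega>. F (cond_law (GXY \<phi> (- int n) 0) \<omega>) \<partial>P) \<longlonglongrightarrow> (\<integral>\<omega>. F (cond_law (GXY_inf \<phi> 0) \<omega>) \<partial>P)"
  proof (rule cond_law_tendsto[OF subalgebra_GXY subalgebra_GXY_inf _ F], intro disjI2 conjI allI impI)
    show "sets (GXY \<phi> (- int n) 0 :: ('e, 'f) path measure) \<subseteq> sets (GXY \<phi> (- int m) 0)" if "m \<le> n" for m n
      by (rule GXY_mono) (use that in auto)
    have "range (\<lambda>n. - int n) = {..0}"
    proof
      show "{..0} \<subseteq> range (\<lambda>n. - int n)"
      proof
        fix k :: int assume "k \<in> {..0}"
        then have "k = - int (nat (- k))" by simp
        then show "k \<in> range (\<lambda>n. - int n)" by blast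
      qed
    qed auto
    then show "sets (GXY_inf \<phi> 0 :: ('e, 'f) path measure) = (\<Inter>n. sets (GXY \<phi> (- int n) 0))"
      unfolding GXY_inf_sets by (simp add: image_image flip: \<open>range (\<lambda>n. - int n) = {..0}\<close>)
  qed
  moreover have "(\<integral>\<omega>. F (cond_law (GXY \<phi> (- int n) 0) \<omega>) \<partial>P) = (\<Sum>i\<in>UNIV. stationary_vec $ i * (step ^^ n) F (axis i 1))" for n
  proof -
    obtain U where U: "is_filter (GXY \<phi> (- int n) 0) 0 U"
      "(\<integral>\<omega>. F (U \<omega>) \<partial>P) = (\<Sum>i\<in>UNIV. stationary_vec $ i * (step ^^ n) F (axis i 1))"
      using filter_GXY[of n] F by blast
    have [measurable]: "F \<in> borel_measurable borel" "U \<in> borel_measurable P"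
      using hom_lipD(2)[OF F] filterD(5)[OF U(1)] by auto
    have "(\<integral>\<omega>. F (cond_law (GXY \<phi> (- int n) 0) \<omega>) \<partial>P) = (\<integral>\<omega>. F (U \<omega>) \<partial>P)"
      using filter_cond_law[OF U(1)] by (intro integral_cong_AE) (auto elim: eventually_mono)
    then show ?thesis using U(2) by simp
  qed
  ultimately show ?thesis by (simp add: pi_max_cond_law)
qed

end

text \<open>The supremum is attained at the sign pattern of \<open>\<mu> - \<nu>\<close>.\<close>

lemma tv_dist_eq_l1norm: "tv_dist \<mu> \<nu> = l1norm (\<mu> - \<nu>)" for \<mu> \<nu> :: "real ^ 'e::finite"
proof -
  let ?T = "{f :: 'e \<Rightarrow> real. \<forall>i. \<bar>f i\<bar> \<le> 1}"
  let ?g = "\<lambda>f. \<bar>(\<Sum>i\<in>UNIV. \<mu> $ i * f i) - (\<Sum>i\<in>UNIV. \<nu> $ i * f i)\<bar>"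
  have le: "?g f \<le> l1norm (\<mu> - \<nu>)" if "f \<in> ?T" for f
  proof -
    have "?g f = \<bar>\<Sum>i\<in>UNIV. (\<mu> - \<nu>) $ i * f i\<bar>" by (simp add: left_diff_distrib sum_subtractf)
    also have "\<dots> \<le> l1norm (\<mu> - \<nu>)"
      unfolding l1norm_def using that
      by (intro order_trans[OF sum_abs] sum_mono) (simp add: abs_mult mult_left_le)
    finally show ?thesis .
  qed
  show ?thesis
  proof (rule antisym)
    show "tv_dist \<mu> \<nu> \<le> l1norm (\<mu> - \<nu>)"
      unfolding tv_dist_def using le by (intro cSUP_least) (auto intro!: exI[of _ "\<lambda>_. 0"])
    let ?s = "\<lambda>i. sgn ((\<mu> - \<nu>) $ i)"
    have "l1norm (\<mu> - \<nu>) = (\<Sum>i\<in>UNIV. (\<mu> - \<nu>) $ i * ?s i)"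
      unfolding l1norm_def by (simp add: abs_sgn)
    also have "\<dots> \<le> ?g ?s" by (simp add: left_diff_distrib sum_subtractf)
    also have "\<dots> \<le> tv_dist \<mu> \<nu>"
      unfolding tv_dist_def
    proof (rule cSUP_upper)
      show "?s \<in> ?T" by (simp add: sgn_real_def)
      show "bdd_above (?g ` ?T)" using le by (intro bdd_aboveI2)
    qed
    finally show "l1norm (\<mu> - \<nu>) \<le> tv_dist \<mu> \<nu>" .
  qed
qed

section \<open>Words under the product measure\<close>

context filter_model
begin

lemma words_measurable:
  "(\<lambda>y. v v* word y n) \<in> borel_measurable (\<Pi>\<^sub>M k\<in>{..<n}. \<phi>)"
proof -
  \<comment> \<open>A larger index set \<open>J\<close> is allowed so that shorter words can be
    treated on the same product space.\<close>
  have "(\<lambda>y. v v* word y n) \<in> borel_measurable (\<Pi>\<^sub>M k\<in>J. \<phi>)" if "{..<n} \<subseteq> J" for J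
    using that
  proof (induction n)
    case (Suc n)
    have "(\<lambda>y. y n) \<in> (\<Pi>\<^sub>M k\<in>J. \<phi>) \<rightarrow>\<^sub>M \<phi>"
      using Suc.prems by (intro measurable_component_singleton) auto
    then have [measurable]: "(\<lambda>y. M (y n)) \<in> borel_measurable (\<Pi>\<^sub>M k\<in>J. \<phi>)"
      by (rule measurable_compose[OF _ M_meas])
    have [measurable]: "(\<lambda>y. v v* word y n) \<in> borel_measurable (\<Pi>\<^sub>M k\<in>J. \<phi>)"
      by (rule Suc.IH) (use Suc.prems in auto)
    show ?case by (simp add: vector_matrix_mul_assoc[symmetric])
  qed simp
  then show ?thesis by blast
qed

lemma mat_prod_cong: "(\<And>k. k < n \<Longrightarrow> A k = B k) \<Longrightarrow> mat_prod A n = mat_prod B n"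
  by (induction n) auto

text \<open>This links the iterates to the product measure in condition (C). The last letter is
  integrated first and absorbed into \<open>F\<close>, so the induction generalizes over
  \<open>F\<close>.\<close>

lemma nn_integral_words:
  assumes F: "hom_lip L F" "\<And>u. u \<in> nonneg_cone \<Longrightarrow> 0 \<le> F u" and v: "v \<in> nonneg_cone"
  shows "(\<integral>\<^sup>+y. ennreal (F (v v* word y n)) \<partial>(\<Pi>\<^sub>M k\<in>{..<n}. \<phi>)) = ennreal ((step ^^ n) F v)"
  using F
proof (induction n arbitrary: F)
  case 0
  interpret product_sigma_finite "\<lambda>_ :: nat. \<phi>" ..
  show ?case by (simp add: PiM_empty nn_integral_count_space_finite)
next
  case (Suc n)
  interpret product_sigma_finite "\<lambda>_ :: nat. \<phi>" ..
  have [measurable]: "F \<in> borel_measurable borel" using Suc.prems(1) by (rule hom_lipD)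
  have ins: "{..<Suc n} = insert n {..<n}" by auto
  have "(\<integral>\<^sup>+y. ennreal (F (v v* mat_prod (\<lambda>k. M (y k)) (Suc n))) \<partial>(\<Pi>\<^sub>M k\<in>{..<Suc n}. \<phi>))
      = (\<integral>\<^sup>+x. \<integral>\<^sup>+y. ennreal (F (v v* mat_prod (\<lambda>k. M ((x(n := y)) k)) (Suc n))) \<partial>\<phi> \<partial>(\<Pi>\<^sub>M k\<in>{..<n}. \<phi>))"
    unfolding ins using words_measurable[of v "Suc n"]
    by (intro product_nn_integral_insert) (auto simp: lessThan_Suc simp del: mat_prod.simps)
  also have "\<dots> = (\<integral>\<^sup>+x. ennreal (step F (v v* word x n)) \<partial>(\<Pi>\<^sub>M k\<in>{..<n}. \<phi>))"
  proof (intro nn_integral_cong)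
    fix x assume x: "x \<in> space (\<Pi>\<^sub>M k\<in>{..<n}. \<phi>)"
    let ?u = "v v* word x n"
    have u: "?u \<in> nonneg_cone"
      using x v by (intro vm_cone mat_prod_M_nonneg) (auto simp: space_PiM PiE_iff)
    have "mat_prod (\<lambda>k. M ((x(n := y)) k)) n = word x n" for y
      by (rule mat_prod_cong) simp
    then have "(\<integral>\<^sup>+y. ennreal (F (v v* mat_prod (\<lambda>k. M ((x(n := y)) k)) (Suc n))) \<partial>\<phi>) = (\<integral>\<^sup>+y. ennreal (F (?u v* M y)) \<partial>\<phi>)"
      by (simp add: vector_matrix_mul_assoc[symmetric])
    also have "\<dots> = ennreal (step F ?u)"
      unfolding step_def using Suc.prems vM_cone u
      by (intro nn_integral_eq_integral integrable_step[OF Suc.prems(1) u] AE_I2) auto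
    finally show "(\<integral>\<^sup>+y. ennreal (F (v v* mat_prod (\<lambda>k. M ((x(n := y)) k)) (Suc n))) \<partial>\<phi>) = ennreal (step F ?u)" .
  qed
  also have "\<dots> = ennreal ((step ^^ n) (step F) v)"
    using steps_nonneg[OF Suc.prems, of _ 1] by (intro Suc.IH hom_lip_step[OF Suc.prems(1)]) auto
  finally show ?case by (simp add: funpow_Suc_right del: funpow.simps)
qed

text \<open>A nonnegative function with zero integral vanishes almost everywhere. Applied to the
  distance of \<open>f\<close> from one of its extreme values, it shows that extremality persists
  along almost every word.\<close>

lemma words_AE_zero:
  assumes F: "hom_lip L F" "\<And>u. u \<in> nonneg_cone \<Longrightarrow> 0 \<le> F u" and v: "v \<in> nonneg_cone" "(step ^^ n) F v = 0"
  shows "AE y in (\<Pi>\<^sub>M k\<in>{..<n}. \<phi>). F (v v* word y n) = 0"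
proof -
  have [measurable]: "F \<in> borel_measurable borel" using F(1) by (rule hom_lipD)
  note words_measurable[measurable]
  have "AE y in (\<Pi>\<^sub>M k\<in>{..<n}. \<phi>). ennreal (F (v v* word y n)) = 0"
  proof (subst nn_integral_0_iff_AE[symmetric])
    have "(\<integral>\<^sup>+y. ennreal (F (v v* word y n)) \<partial>(\<Pi>\<^sub>M k\<in>{..<n}. \<phi>)) = ennreal ((step ^^ n) F v)"
      by (rule nn_integral_words[OF F(1) _ v(1)]) (rule F(2))
    then show "(\<integral>\<^sup>+y. ennreal (F (v v* word y n)) \<partial>(\<Pi>\<^sub>M k\<in>{..<n}. \<phi>)) = 0"
      using v(2) by simp
  qed measurable
  with AE_space show ?thesis
  proof eventually_elim
    case (elim y)
    then have "v v* word y n \<in> nonneg_cone"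
      using v(1) by (intro vm_cone mat_prod_M_nonneg) (auto simp: space_PiM PiE_iff)
    then show ?case using elim(2) F(2) by (simp add: ennreal_eq_0_iff antisym)
  qed
qed

end

section \<open>Stationarity of the signal law and invariance of the laws of both filters\<close>

context hidden_markov_model
begin

text \<open>The mean of the filter with one observation is computed twice: by the recursion, and as
  the law of \<open>coord_X 0\<close>.\<close>

lemma stationary_vec_invariant: "stationary_vec v* Q = stationary_vec"
proof -
  obtain U where U: "is_filter (FY_window (- int 1) 0) 0 U"
    and e: "\<And>F L. hom_lip L F \<Longrightarrow> (\<integral>\<omega>. F (U \<omega>) \<partial>P) = (step ^^ 1) F stationary_vec"
    using filter_FY_window[of 1] by blast
  have "space (FY_window (- int 1) 0) = space P"
    using subalgebra_FY_window[of "- int 1" 0] unfolding subalgebra_def by (rule conjunct1)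
  then have sp: "space P \<in> sets (FY_window (- int 1) 0)" using sets.top by metis
  have "(stationary_vec v* Q) $ j = stationary_vec $ j" for j
  proof -
    have "(stationary_vec v* Q) $ j = (\<integral>\<omega>. U \<omega> $ j \<partial>P)" using e[OF hom_lip_nth] by (simp add: step_nth)
    also have "\<dots> = (\<integral>\<omega>\<in>space P. U \<omega> $ j \<partial>P)"
      unfolding set_lebesgue_integral_def by (intro Bochner_Integration.integral_cong) auto
    also have "\<dots> = P.prob (space P \<inter> X_event 0 j)" using filterD(4)[OF U sp] by simp
    also have "space P \<inter> X_event 0 j = X_event 0 j" by auto
    finally show ?thesis by (simp add: coord_X_law)
  qed
  then show ?thesis by (simp add: vec_eq_iff)
qed

text \<open>The vertex on the exceptional null set makes the map take values in the simplex
  everywhere.\<close>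

definition law :: "(('e, 'f) path \<Rightarrow> real ^ 'e) \<Rightarrow> (real ^ 'e) measure" where
  "law W = distr P simplex_borel (\<lambda>\<omega>. if W \<omega> \<in> prob_simplex then W \<omega> else axis undefined 1)"

lemma law_prob:
  assumes [measurable]: "W \<in> borel_measurable P"
  shows "(\<lambda>\<omega>. if W \<omega> \<in> prob_simplex then W \<omega> else axis undefined 1) \<in> P \<rightarrow>\<^sub>M simplex_borel"
    and "law W \<in> simplex_laws"
proof -
  have "(\<lambda>\<omega>. if W \<omega> \<in> prob_simplex then W \<omega> else axis undefined 1) \<in> borel_measurable P" by measurable
  then show m: "(\<lambda>\<omega>. if W \<omega> \<in> prob_simplex then W \<omega> else axis undefined 1) \<in> P \<rightarrow>\<^sub>M simplex_borel"
    unfolding simplex_borel_def by (intro measurable_restrict_space2) (auto simp: axis_simplex)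
  show "law W \<in> simplex_laws"
    unfolding law_def using P.prob_space_distr[OF m] by (simp add: space_prob_algebra)
qed

lemma integral_law:
  assumes W [measurable]: "W \<in> borel_measurable P" and ae: "AE \<omega> in P. W \<omega> \<in> prob_simplex" and F: "hom_lip L F"
  shows "(\<integral>\<mu>. F \<mu> \<partial>law W) = (\<integral>\<omega>. F (W \<omega>) \<partial>P)"
proof -
  have [measurable]: "F \<in> borel_measurable borel" using F by (rule hom_lipD)
  have "F \<in> borel_measurable simplex_borel"
    unfolding simplex_borel_def by (rule measurable_restrict_space1) measurable
  then have "(\<integral>\<mu>. F \<mu> \<partial>law W) = (\<integral>\<omega>. F (if W \<omega> \<in> prob_simplex then W \<omega> else axis undefined 1) \<partial>P)"
    unfolding law_def by (rule integral_distr[OF law_prob(1)[OF W]])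
  also have "\<dots> = (\<integral>\<omega>. F (W \<omega>) \<partial>P)"
    using ae by (intro integral_cong_AE) (auto elim: eventually_mono)
  finally show ?thesis .
qed

lemma invariant_law:
  assumes W: "W \<in> borel_measurable P" and ae: "AE \<omega> in P. W \<omega> \<in> prob_simplex"
    and inv: "\<And>L F. hom_lip L F \<Longrightarrow> (\<integral>\<omega>. step F (W \<omega>) \<partial>P) = (\<integral>\<omega>. F (W \<omega>) \<partial>P)"
  shows "invariant_measure \<phi> M (law W)"
  unfolding invariant_measure_def
proof
  show N: "law W \<in> simplex_laws" by (rule law_prob(2)[OF W])
  show "filter_step \<phi> M (law W) = law W"
  proof (rule simplex_measure_eqI[OF filter_step_prob[OF N] N])
    fix L and F :: "real ^ 'e \<Rightarrow> real" assume F: "hom_lip L F"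
    show "(\<integral>x. F x \<partial>filter_step \<phi> M (law W)) = (\<integral>x. F x \<partial>law W)"
      using inv[OF F] integral_law[OF W ae F] integral_law[OF W ae hom_lip_step[OF F]]
      by (simp add: integral_filter_step[OF F N])
    show "integrable (filter_step \<phi> M (law W)) F" by (rule hom_lip_integrable[OF F filter_step_prob[OF N]])
    show "integrable (law W) F" by (rule hom_lip_integrable[OF F N])
  qed
qed

lemma pi_min_measurable [measurable]: "pi_min \<phi> P 0 \<in> borel_measurable P"
  and pi_max_measurable [measurable]: "pi_max \<phi> P 0 \<in> borel_measurable P"
  by (simp_all add: pi_min_cond_law pi_max_cond_law)

lemma pi_min_simplex: "AE \<omega> in P. pi_min \<phi> P 0 \<omega> \<in> prob_simplex"
  unfolding pi_min_cond_law by (rule cond_law_simplex[OF subalgebra_FY])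

lemma pi_max_simplex: "AE \<omega> in P. pi_max \<phi> P 0 \<omega> \<in> prob_simplex"
  unfolding pi_max_cond_law by (rule cond_law_simplex[OF subalgebra_GXY_inf])

text \<open>Replacing \<open>F\<close> by \<open>step F\<close> shifts the approximating sequence by
  one index, which leaves its limit unchanged.\<close>

lemma pi_min_invariant: "invariant_measure \<phi> M (law (pi_min \<phi> P 0))"
proof (rule invariant_law[OF pi_min_measurable pi_min_simplex])
  fix L and F :: "real ^ 'e \<Rightarrow> real" assume F: "hom_lip L F"
  have "(\<lambda>n. (step ^^ Suc n) F stationary_vec) \<longlonglongrightarrow> (\<integral>\<omega>. F (pi_min \<phi> P 0 \<omega>) \<partial>P)"
    using pi_min_limit[OF F] by (rule LIMSEQ_Suc)
  then show "(\<integral>\<omega>. step F (pi_min \<phi> P 0 \<omega>) \<partial>P) = (\<integral>\<omega>. F (pi_min \<phi> P 0 \<omega>) \<partial>P)"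
    using pi_min_limit[OF hom_lip_step[OF F]] LIMSEQ_unique by (simp add: funpow_Suc_right del: funpow.simps) blast
qed

lemma pi_max_invariant: "invariant_measure \<phi> M (law (pi_max \<phi> P 0))"
proof (rule invariant_law[OF pi_max_measurable pi_max_simplex])
  fix L and F :: "real ^ 'e \<Rightarrow> real" assume F: "hom_lip L F"
  have "(\<lambda>n. \<Sum>i\<in>UNIV. stationary_vec $ i * (step ^^ Suc n) F (axis i 1)) \<longlonglongrightarrow> (\<integral>\<omega>. F (pi_max \<phi> P 0 \<omega>) \<partial>P)"
    using pi_max_limit[OF F] by (rule LIMSEQ_Suc)
  then show "(\<integral>\<omega>. step F (pi_max \<phi> P 0 \<omega>) \<partial>P) = (\<integral>\<omega>. F (pi_max \<phi> P 0 \<omega>) \<partial>P)"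
    using pi_max_limit[OF hom_lip_step[OF F]] LIMSEQ_unique by (simp add: funpow_Suc_right del: funpow.simps) blast
qed

end

section \<open>The equivalences\<close>

locale invariant_sublinear_hmm = hidden_markov_model \<phi> M P + invariant_sublinear \<phi> M f L
  for \<phi> :: "'f measure" and M :: "'f \<Rightarrow> real ^ 'e ^ 'e::finite" and P f L
begin

definition bot_value :: real where "bot_value = f stationary_vec"
definition top_value :: real where "top_value = f (axis undefined 1)"

lemma bot_le: "\<mu> \<in> prob_simplex \<Longrightarrow> bot_value \<le> f \<mu>"
  unfolding bot_value_def by (rule f_stationary_le[OF stationary_vec_simplex stationary_vec_invariant])

lemma le_top: "\<mu> \<in> prob_simplex \<Longrightarrow> f \<mu> \<le> top_value"
  unfolding top_value_def by (rule f_le_vertex)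

lemma integral_pi_min: "(\<integral>\<omega>. f (pi_min \<phi> P 0 \<omega>) \<partial>P) = bot_value"
proof -
  have "(\<lambda>n. (step ^^ n) f stationary_vec) = (\<lambda>n. bot_value)"
    by (simp add: f_steps[OF simplex_cone[OF stationary_vec_simplex]] bot_value_def)
  then show ?thesis using pi_min_limit[OF f_hom_lip] by (simp add: LIMSEQ_const_iff)
qed

lemma integral_pi_max: "(\<integral>\<omega>. f (pi_max \<phi> P 0 \<omega>) \<partial>P) = top_value"
proof -
  have "(\<Sum>i\<in>UNIV. stationary_vec $ i * (step ^^ n) f (axis i 1)) = top_value" for n
  proof -
    have "(\<Sum>i\<in>UNIV. stationary_vec $ i * (step ^^ n) f (axis i 1)) = (\<Sum>i\<in>UNIV. stationary_vec $ i * top_value)"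
      unfolding top_value_def f_steps[OF axis_cone] by (intro sum.cong refl arg_cong2[where f = "(*)"] f_vertices_const)
    also have "\<dots> = top_value"
      using stationary_vec_simplex by (simp add: sum_distrib_right[symmetric] prob_simplex_def)
    finally show ?thesis .
  qed
  then show ?thesis using pi_max_limit[OF f_hom_lip] by (simp add: LIMSEQ_const_iff)
qed

text \<open>The mean of \<open>f\<close> at the filter equals its pointwise lower bound, so the
  nonnegative difference vanishes almost surely.\<close>

lemma f_pi_min: "AE \<omega> in P. f (pi_min \<phi> P 0 \<omega>) = bot_value"
proof -
  have int: "integrable P (\<lambda>\<omega>. f (pi_min \<phi> P 0 \<omega>))"
    unfolding pi_min_cond_law by (rule cond_law_integrable[OF subalgebra_FY f_hom_lip])
  have "AE \<omega> in P. f (pi_min \<phi> P 0 \<omega>) - bot_value = 0"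
  proof (subst integral_nonneg_eq_0_iff_AE[symmetric])
    show "AE \<omega> in P. 0 \<le> f (pi_min \<phi> P 0 \<omega>) - bot_value"
      using pi_min_simplex by eventually_elim (simp add: bot_le)
  qed (use int integral_pi_min in \<open>simp_all add: P.prob_space\<close>)
  then show ?thesis by simp
qed

lemma f_pi_max: "AE \<omega> in P. f (pi_max \<phi> P 0 \<omega>) = top_value"
proof -
  have int: "integrable P (\<lambda>\<omega>. f (pi_max \<phi> P 0 \<omega>))"
    unfolding pi_max_cond_law by (rule cond_law_integrable[OF subalgebra_GXY_inf f_hom_lip])
  have "AE \<omega> in P. top_value - f (pi_max \<phi> P 0 \<omega>) = 0"
  proof (subst integral_nonneg_eq_0_iff_AE[symmetric])
    show "AE \<omega> in P. 0 \<le> top_value - f (pi_max \<phi> P 0 \<omega>)"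
      using pi_max_simplex by eventually_elim (simp add: le_top)
  qed (use int integral_pi_max in \<open>simp_all add: P.prob_space\<close>)
  then show ?thesis by eventually_elim simp
qed

lemma unique_imp_bot_eq_top:
  assumes "\<exists>!N. invariant_measure \<phi> M N" shows "bot_value = top_value"
proof -
  have "law (pi_min \<phi> P 0) = law (pi_max \<phi> P 0)"
    using assms pi_min_invariant pi_max_invariant by blast
  then show ?thesis
    using integral_law[OF pi_min_measurable pi_min_simplex f_hom_lip]
      integral_law[OF pi_max_measurable pi_max_simplex f_hom_lip] integral_pi_min integral_pi_max by simp
qed

lemma bounds_cone:
  assumes "v \<in> nonneg_cone" shows "bot_value * mass v \<le> f v" "f v \<le> top_value * mass v"
proof -
  have "mass v * bot_value \<le> mass v * f (normalized v) \<and> mass v * f (normalized v) \<le> mass v * top_value"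
  proof (cases "mass v = 0")
    case False
    then show ?thesis
      using bot_le le_top normalized_simplex[OF assms False] mass_nonneg[OF assms] by (auto intro!: mult_left_mono)
  qed simp
  then show "bot_value * mass v \<le> f v" "f v \<le> top_value * mass v"
    using hom_lip_normalized[OF f_hom_lip assms] by (simp_all add: mult.commute)
qed

text \<open>If the extremes differ, some path yields \<open>\<mu>\<close> and \<open>\<nu>\<close>
  in \<open>S\<close> at which \<open>f\<close> is minimal and maximal. Invariance makes both
  properties persist along almost every word, in particular along one in \<open>Ob\<close>. The two
  normalized images then differ in \<open>f\<close> by the full gap, although (C) puts them closer
  than the Lipschitz bound allows.\<close>

lemma condition_C_imp_bot_eq_top:
  assumes C: "condition_C \<phi> M P" shows "bot_value = top_value"
proof (rule ccontr)
  assume ne: "bot_value \<noteq> top_value"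
  have "bot_value \<le> top_value" unfolding top_value_def by (rule bot_le[OF axis_simplex])
  then have pos: "0 < top_value - bot_value" using ne by simp
  have L: "0 \<le> L" using f_hom_lip by (rule hom_lipD)
  \<comment> \<open>Chosen so that \<open>(L + 1) * e\<close> is the gap; \<open>L + 1\<close>
    avoids a zero divisor.\<close>
  define e where "e = (top_value - bot_value) / (L + 1)"
  have e: "0 < e" using pos L by (simp add: e_def)
  obtain N S Ob where S: "S \<in> sets simplex_borel" and Ob: "Ob \<in> sets (\<Pi>\<^sub>M k\<in>{..<N}. \<phi>)"
    and PS: "measure P {\<omega> \<in> space P. pi_min \<phi> P 0 \<omega> \<in> S \<and> pi_max \<phi> P 0 \<omega> \<in> S} > 0"
    and Opos: "emeasure (\<Pi>\<^sub>M k\<in>{..<N}. \<phi>) Ob > 0"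
    and mpos: "\<forall>\<mu>\<in>S. \<forall>y\<in>Ob. mass (\<mu> v* word y N) > 0"
    and close: "\<forall>\<mu>\<in>S. \<forall>\<nu>\<in>S. \<forall>y\<in>Ob.
           tv_dist (normalized (\<mu> v* word y N)) (normalized (\<nu> v* word y N)) < e"
    using C[unfolded condition_C_def, rule_format, OF e] by (elim exE bexE conjE)
  let ?E = "{\<omega> \<in> space P. pi_min \<phi> P 0 \<omega> \<in> S \<and> pi_max \<phi> P 0 \<omega> \<in> S}"
  have "\<exists>\<omega>\<in>?E. f (pi_min \<phi> P 0 \<omega>) = bot_value \<and> f (pi_max \<phi> P 0 \<omega>) = top_value"
  proof (rule ccontr)
    assume no: "\<not> ?thesis"
    have "AE \<omega> in P. \<omega> \<notin> ?E"
      using f_pi_min f_pi_max by eventually_elim (use no in blast)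
    \<comment> \<open>Nonmeasurable sets have \<open>measure\<close> zero, so positivity already
      gives measurability.\<close>
    moreover have "?E \<in> sets P"
      using PS measure_notin_sets[of ?E P] by (intro ccontr[of "?E \<in> sets P"]) simp
    ultimately have "P.prob ?E = 0" by (subst P.prob_eq_0) auto
    then show False using PS by simp
  qed
  then obtain \<mu> \<nu> where \<mu>: "\<mu> \<in> S" "f \<mu> = bot_value" and \<nu>: "\<nu> \<in> S" "f \<nu> = top_value" by blast
  have \<mu>s: "\<mu> \<in> prob_simplex" "\<nu> \<in> prob_simplex" using \<mu> \<nu> S by (auto simp: sets_simplex_borel)
  note cones = simplex_cone[OF \<mu>s(1)] simplex_cone[OF \<mu>s(2)]
  let ?B = "\<lambda>y. word y N"
  \<comment> \<open>The function \<open>f - bot_value * mass\<close> is nonnegative on the cone, and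
    all its iterates vanish at the minimizer \<open>\<mu>\<close>.\<close>
  have ae1: "AE y in (\<Pi>\<^sub>M k\<in>{..<N}. \<phi>). f (\<mu> v* ?B y) + (- bot_value) * mass (\<mu> v* ?B y) = 0"
  proof (rule words_AE_zero)
    show "hom_lip (L + \<bar>- bot_value\<bar> * 1) (\<lambda>v. f v + (- bot_value) * mass v)"
      by (intro hom_lip_add f_hom_lip hom_lip_cmult hom_lip_mass)
    show "(step ^^ N) (\<lambda>v. f v + (- bot_value) * mass v) \<mu> = 0"
      using steps_add[OF f_hom_lip hom_lip_cmult[OF hom_lip_mass] cones(1), of N "- bot_value"] \<mu> \<mu>s
      unfolding steps_cmult steps_mass f_steps[OF cones(1)] by (simp add: simplex_iff)
  qed (use bounds_cone cones in auto)
  have neg: "(step ^^ N) (\<lambda>v. - f v) \<nu> = - top_value"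
    using steps_cmult[of N "- 1" f] \<nu>(2) by (simp add: f_steps[OF cones(2)])
  have ae2: "AE y in (\<Pi>\<^sub>M k\<in>{..<N}. \<phi>). - f (\<nu> v* ?B y) + top_value * mass (\<nu> v* ?B y) = 0"
  proof (rule words_AE_zero)
    show "hom_lip (L + \<bar>top_value\<bar> * 1) (\<lambda>v. - f v + top_value * mass v)"
      by (intro hom_lip_add hom_lip_minus f_hom_lip hom_lip_cmult hom_lip_mass)
    show "(step ^^ N) (\<lambda>v. - f v + top_value * mass v) \<nu> = 0"
      using steps_add[OF hom_lip_minus[OF f_hom_lip] hom_lip_cmult[OF hom_lip_mass] cones(2), of N top_value]
        neg \<mu>s by (simp add: steps_cmult steps_mass simplex_iff)
  qed (use bounds_cone cones in auto)
  have "\<exists>y\<in>Ob. f (\<mu> v* ?B y) = bot_value * mass (\<mu> v* ?B y) \<and> f (\<nu> v* ?B y) = top_value * mass (\<nu> v* ?B y)"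
  proof (rule ccontr)
    assume no: "\<not> ?thesis"
    have "AE y in (\<Pi>\<^sub>M k\<in>{..<N}. \<phi>). y \<notin> Ob"
      using ae1 ae2 by eventually_elim (use no in auto)
    then have "emeasure (\<Pi>\<^sub>M k\<in>{..<N}. \<phi>) Ob = 0"
      using Ob by (subst (asm) AE_iff_measurable[of Ob]) (auto dest: sets.sets_into_space)
    then show False using Opos by simp
  qed
  then obtain y where y: "y \<in> Ob" "f (\<mu> v* ?B y) = bot_value * mass (\<mu> v* ?B y)"
    "f (\<nu> v* ?B y) = top_value * mass (\<nu> v* ?B y)" by blast
  have "\<And>k. k < N \<Longrightarrow> y k \<in> space \<phi>"
    using sets.sets_into_space[OF Ob] y(1) by (auto simp: space_PiM)
  then have Bc: "\<mu> v* ?B y \<in> nonneg_cone" "\<nu> v* ?B y \<in> nonneg_cone"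
    using cones by (auto intro!: vm_cone mat_prod_M_nonneg)
  have m: "0 < mass (\<mu> v* ?B y)" "0 < mass (\<nu> v* ?B y)" using mpos \<mu>(1) \<nu>(1) y(1) by auto
  let ?\<mu> = "normalized (\<mu> v* ?B y)" and ?\<nu> = "normalized (\<nu> v* ?B y)"
  have ns: "?\<mu> \<in> prob_simplex" "?\<nu> \<in> prob_simplex" using Bc m by (auto intro!: normalized_simplex)
  have "f ?\<mu> = bot_value" "f ?\<nu> = top_value"
    using hom_lip_normalized[OF f_hom_lip Bc(1)] hom_lip_normalized[OF f_hom_lip Bc(2)] y m
    by (auto simp: mult.commute)
  then have "top_value - bot_value \<le> L * l1norm (?\<nu> - ?\<mu>)"
    using hom_lipD(4)[OF f_hom_lip simplex_cone[OF ns(2)] simplex_cone[OF ns(1)]] by simp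
  also have "\<dots> \<le> (L + 1) * l1norm (?\<nu> - ?\<mu>)" by (simp add: distrib_right)
  also have "\<dots> < (L + 1) * e"
    using close[rule_format, OF \<nu>(1) \<mu>(1) y(1)] L by (intro mult_strict_left_mono) (auto simp: tv_dist_eq_l1norm)
  also have "\<dots> = top_value - bot_value" using L by (simp add: e_def)
  finally show False by simp
qed

end

section \<open>From coinciding extremes to (KR), and from (KR) to (C)\<close>

context hidden_markov_model
begin

text \<open>Uniqueness and (C) both reach (KR) through this criterion. If \<open>f\<close> agrees at
  the stationary vector and at the vertices, the averaged gap between the weighted row norms and the
  norm at \<open>stationary_vec\<close> tends to zero, which feeds
  \<open>rank_one_limit\<close>.\<close>

lemma KR_if:
  assumes "\<And>f L. invariant_sublinear_hmm \<phi> M P f L \<Longrightarrow> f stationary_vec = f (axis undefined 1)"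
  shows "condition_KR \<phi> M"
proof -
  obtain f k where f: "hom_lip 1 f" and k: "strict_mono (k :: nat \<Rightarrow> nat)"
    and lim: "\<And>v. v \<in> nonneg_cone \<Longrightarrow> (\<lambda>n. average norm (k n) v) \<longlonglongrightarrow> f v"
    and f2: "\<And>v. v \<in> nonneg_cone \<Longrightarrow> step f v = f v"
    and f3: "\<And>v w. v \<in> nonneg_cone \<Longrightarrow> w \<in> nonneg_cone \<Longrightarrow> f (v + w) \<le> f v + f w"
    and f4: "\<And>v. v \<in> nonneg_cone \<Longrightarrow> f (v v* Q) \<le> f v"
    by (rule invariant_function_exists) blast
  interpret invariant_sublinear_hmm \<phi> M P f 1
    by unfold_locales (use f f2 f3 f4 in auto)
  have eq: "f stationary_vec = f (axis i 1)" for i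
    using assms[OF invariant_sublinear_hmm_axioms] f_vertices_const by metis
  let ?g = "\<lambda>n. (\<Sum>i\<in>UNIV. stationary_vec $ i * (step ^^ n) norm (axis i 1)) - (step ^^ n) norm stationary_vec"
  show ?thesis
  proof (rule rank_one_limit[OF stationary_vec_simplex stationary_pos[OF stationary_vec_simplex stationary_vec_invariant]])
    fix e :: real assume e: "0 < e"
    have "(\<lambda>n. (\<Sum>i\<in>UNIV. stationary_vec $ i * average norm (k n) (axis i 1)) - average norm (k n) stationary_vec)
      \<longlonglongrightarrow> (\<Sum>i\<in>UNIV. stationary_vec $ i * f (axis i 1)) - f stationary_vec"
      by (intro tendsto_intros lim axis_cone simplex_cone[OF stationary_vec_simplex])
    also have "(\<Sum>i\<in>UNIV. stationary_vec $ i * f (axis i 1)) = f stationary_vec"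
      using stationary_vec_simplex by (simp add: eq[symmetric] sum_distrib_right[symmetric] prob_simplex_def)
    finally have "(\<lambda>n. (\<Sum>i\<in>UNIV. stationary_vec $ i * average norm (k n) (axis i 1)) - average norm (k n) stationary_vec) \<longlonglongrightarrow> 0"
      by simp
    from order_tendstoD(2)[OF this e] obtain n0 where n0: "\<And>n. n \<ge> n0 \<Longrightarrow>
      (\<Sum>i\<in>UNIV. stationary_vec $ i * average norm (k n) (axis i 1)) - average norm (k n) stationary_vec < e"
      unfolding eventually_sequentially by blast
    \<comment> \<open>The successor ensures that the average has at least one term.\<close>
    define m where "m = k (Suc n0)"
    have m: "1 \<le> m" unfolding m_def using seq_suble[OF k, of "Suc n0"] by simp
    have "(\<Sum>i\<in>UNIV. stationary_vec $ i * average norm m (axis i 1)) - average norm m stationary_vec = (\<Sum>j=1..m. (1 / real m) * ?g j)"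
    proof -
      have "(\<Sum>i\<in>UNIV. stationary_vec $ i * average norm m (axis i 1))
        = (\<Sum>j=1..m. (1 / real m) * (\<Sum>i\<in>UNIV. stationary_vec $ i * (step ^^ j) norm (axis i 1)))"
        unfolding average_def sum_distrib_left by (subst sum.swap) (simp add: mult.left_commute)
      then show ?thesis by (simp add: average_def right_diff_distrib sum_subtractf diff_divide_distrib)
    qed
    moreover have "n0 \<le> Suc n0" by simp
    ultimately have lt: "(\<Sum>j=1..m. (1 / real m) * ?g j) < e" using n0[of "Suc n0"] unfolding m_def by simp
    \<comment> \<open>An average below \<open>e\<close> has a term below \<open>e\<close>; no
      monotonicity of the gap in \<open>n\<close> is involved.\<close>
    show "\<exists>n\<ge>1. ?g n < e"
    proof (rule ccontr)
      assume "\<not> (\<exists>n\<ge>1. ?g n < e)"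
      then have "(\<Sum>j=1..m. (1 / real m) * e) \<le> (\<Sum>j=1..m. (1 / real m) * ?g j)"
        by (intro sum_mono mult_left_mono) (auto simp: not_less)
      moreover have "(\<Sum>j=1..m. (1 / real m) * e) = e" using m by simp
      ultimately show False using lt by simp
    qed
  qed
qed

lemma unique_imp_KR:
  assumes "\<exists>!N. invariant_measure \<phi> M N" shows "condition_KR \<phi> M"
proof (rule KR_if)
  fix f L assume "invariant_sublinear_hmm \<phi> M P f L"
  then interpret invariant_sublinear_hmm \<phi> M P f L .
  show "f stationary_vec = f (axis undefined 1)"
    using unique_imp_bot_eq_top[OF assms] by (simp add: bot_value_def top_value_def)
qed

lemma condition_C_imp_KR:
  assumes "condition_C \<phi> M P" shows "condition_KR \<phi> M"
proof (rule KR_if)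
  fix f L assume "invariant_sublinear_hmm \<phi> M P f L"
  then interpret invariant_sublinear_hmm \<phi> M P f L .
  show "f stationary_vec = f (axis undefined 1)"
    using condition_C_imp_bot_eq_top[OF assms] by (simp add: bot_value_def top_value_def)
qed

text \<open>The set where the conditional probability is not positive belongs to \<open>H\<close>,
  so the event has probability zero on it. Thus on \<open>coord_X 0 = i\<close> the minimal and the
  maximal filter charge \<open>i\<close> simultaneously.\<close>

lemma cond_law_pos:
  assumes "subalgebra P H" shows "AE \<omega> in P. coord_X 0 \<omega> = i \<longrightarrow> 0 < cond_law H \<omega> $ i"
proof -
  interpret H: sigma_finite_subalgebra P H using assms by (rule P.subalgebra_sigma_finite)
  let ?E = "X_event 0 i"
  define V where "V = real_cond_exp P H (indicator ?E)"
  have [measurable]: "?E \<in> sets P" by measurable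
  have VH: "V \<in> borel_measurable H" by (simp add: V_def)
  have sp: "space H = space P" using assms by (simp add: subalgebra_def)
  define A where "A = {\<omega> \<in> space P. V \<omega> \<le> 0}"
  have A: "A \<in> sets H"
    unfolding A_def sp[symmetric] using VH by measurable
  then have AP [measurable]: "A \<in> sets P" using assms by (auto simp: subalgebra_def)
  have "P.prob (A \<inter> ?E) = (\<integral>\<omega>\<in>A. indicat_real ?E \<omega> \<partial>P)"
    unfolding set_lebesgue_integral_def by (simp add: indicator_inter_arith[symmetric])
  also have "\<dots> = (\<integral>\<omega>\<in>A. V \<omega> \<partial>P)"
    unfolding V_def using A by (intro H.real_cond_exp_intA) (auto simp: P.emeasure_eq_measure)
  also have "\<dots> \<le> 0"
  proof -
    have "0 \<le> (\<integral>\<omega>. - (indicator A \<omega> *\<^sub>R V \<omega>) \<partial>P)"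
      by (intro Bochner_Integration.integral_nonneg) (auto simp: A_def indicator_def)
    then show ?thesis by (simp add: set_lebesgue_integral_def)
  qed
  finally have "P.prob (A \<inter> ?E) = 0" by (simp add: measure_le_0_iff)
  then have "AE \<omega> in P. \<omega> \<notin> A \<inter> ?E" by (subst (asm) P.prob_eq_0) auto
  with AE_space show ?thesis
    by eventually_elim (auto simp: A_def V_def cond_law_def)
qed

end

locale regular_hidden_markov_model = hidden_markov_model \<phi> M P + regular_filter_model \<phi> M
  for \<phi> :: "'f measure" and M :: "'f \<Rightarrow> real ^ 'e ^ 'e::finite" and P
begin

text \<open>On the event \<open>coord_X 0 = i\<close> both filters charge \<open>i\<close>, so for
  some threshold \<open>c\<close> both do so by at least \<open>c\<close> with positive probability.
  This fixes the set of vectors; the words are chosen afterwards, since they depend on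
  \<open>c\<close>.\<close>

lemma KR_imp_condition_C:
  assumes KR: "condition_KR \<phi> M" shows "condition_C \<phi> M P"
  unfolding condition_C_def
proof (intro allI impI)
  fix e :: real assume e: "0 < e"
  obtain \<theta> i where \<theta>: "\<theta> \<in> prob_simplex"
    and words: "\<And>c e. 0 < c \<Longrightarrow> c \<le> 1 \<Longrightarrow> 0 < e \<Longrightarrow> contracts \<theta> i c e"
    using contracting_words[OF KR] by blast
  define S where "S c = {\<mu> \<in> prob_simplex. c \<le> \<mu> $ i}" for c
  have S: "S c \<in> sets borel" for c
    unfolding S_def by measurable
  define E where "E n = {\<omega> \<in> space P. pi_min \<phi> P 0 \<omega> \<in> S (1 / real (Suc n)) \<and> pi_max \<phi> P 0 \<omega> \<in> S (1 / real (Suc n))}" for n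
  have E [measurable]: "E n \<in> sets P" for n
    unfolding E_def using S[measurable] by measurable
  have "\<exists>n. 0 < P.prob (E n)"
  proof (rule ccontr)
    assume "\<not> ?thesis"
    then have "P.prob (E n) = 0" for n by (metis measure_nonneg not_less order_antisym_conv)
    then have "AE \<omega> in P. \<omega> \<notin> E n" for n using P.prob_eq_0[OF E, of n] by simp
    then have "AE \<omega> in P. \<forall>n. \<omega> \<notin> E n" by (simp add: AE_all_countable)
    moreover have "AE \<omega> in P. coord_X 0 \<omega> = i \<longrightarrow> 0 < pi_min \<phi> P 0 \<omega> $ i"
      unfolding pi_min_cond_law by (rule cond_law_pos[OF subalgebra_FY])
    moreover have "AE \<omega> in P. coord_X 0 \<omega> = i \<longrightarrow> 0 < pi_max \<phi> P 0 \<omega> $ i"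
      unfolding pi_max_cond_law by (rule cond_law_pos[OF subalgebra_GXY_inf])
    ultimately have "AE \<omega> in P. \<omega> \<notin> X_event 0 i"
      using pi_min_simplex pi_max_simplex AE_space
    proof eventually_elim
      case (elim \<omega>)
      show ?case
      proof
        assume "\<omega> \<in> X_event 0 i"
        then have *: "0 < min (pi_min \<phi> P 0 \<omega> $ i) (pi_max \<phi> P 0 \<omega> $ i)" using elim by simp
        obtain n where n: "inverse (real (Suc n)) < min (pi_min \<phi> P 0 \<omega> $ i) (pi_max \<phi> P 0 \<omega> $ i)"
          using reals_Archimedean[OF *] by blast
        then have "1 / real (Suc n) \<le> pi_min \<phi> P 0 \<omega> $ i" "1 / real (Suc n) \<le> pi_max \<phi> P 0 \<omega> $ i"
          by (simp_all only: inverse_eq_divide min_less_iff_conj less_imp_le)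
        then have "\<omega> \<in> E n" unfolding E_def S_def using elim(4-6) by blast
        then show False using elim(1) by blast
      qed
    qed
    then have "P.prob (X_event 0 i) = 0" by (subst P.prob_eq_0) auto
    then show False
      using stationary_pos[OF stationary_vec_simplex stationary_vec_invariant, of i] by (simp add: coord_X_law)
  qed
  then obtain n where n: "0 < P.prob (E n)" by blast
  define c where "c = 1 / real (Suc n)"
  have c: "0 < c" "c \<le> 1" by (simp_all add: c_def)
  \<comment> \<open>Two images within \<open>e / 2\<close> of \<open>\<theta>\<close> are within
    \<open>e\<close> of each other.\<close>
  have "0 < e / 2" using e by simp
  from words[OF c this, unfolded contracts_def] obtain N U \<kappa> where N: "1 \<le> N" and \<kappa>: "0 < \<kappa>"
    and U: "\<forall>k<N. U k \<in> sets \<phi> \<and> 0 < measure \<phi> (U k)"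
    and w: "\<forall>y. (\<forall>k<N. y k \<in> U k) \<longrightarrow> (\<forall>\<mu>\<in>prob_simplex. c \<le> \<mu> $ i \<longrightarrow>
          \<kappa> \<le> mass (\<mu> v* word y N) \<and>
          l1norm (normalized (\<mu> v* word y N) - \<theta>) < e / 2)" by blast
  interpret product_sigma_finite "\<lambda>_ :: nat. \<phi>" ..
  let ?O = "PiE {..<N} U"
  have w': "\<kappa> \<le> mass (\<mu> v* word y N)" "l1norm (normalized (\<mu> v* word y N) - \<theta>) < e / 2"
    if "\<mu> \<in> S c" "y \<in> ?O" for \<mu> y
    using w that by (auto simp: S_def PiE_iff)
  show "\<exists>N\<ge>1. \<exists>S\<in>sets simplex_borel. \<exists>Ob\<in>sets (\<Pi>\<^sub>M k\<in>{..<N}. \<phi>).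
        measure P {\<omega> \<in> space P. pi_min \<phi> P 0 \<omega> \<in> S \<and> pi_max \<phi> P 0 \<omega> \<in> S} > 0 \<and>
        emeasure (\<Pi>\<^sub>M k\<in>{..<N}. \<phi>) Ob > 0 \<and>
        (\<forall>\<mu>\<in>S. \<forall>y\<in>Ob. mass (\<mu> v* word y N) > 0) \<and>
        (\<forall>\<mu>\<in>S. \<forall>\<nu>\<in>S. \<forall>y\<in>Ob.
           tv_dist (normalized (\<mu> v* word y N))
                   (normalized (\<nu> v* word y N)) < e)"
  proof (intro exI[of _ N] conjI N bexI[of _ "S c"] bexI[of _ ?O] ballI)
    show "measure P {\<omega> \<in> space P. pi_min \<phi> P 0 \<omega> \<in> S c \<and> pi_max \<phi> P 0 \<omega> \<in> S c} > 0"
      using n by (simp add: E_def c_def)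
    have "emeasure (\<Pi>\<^sub>M k\<in>{..<N}. \<phi>) ?O = (\<Prod>k<N. emeasure \<phi> (U k))"
      using U by (intro emeasure_PiM) auto
    moreover have "0 < emeasure \<phi> (U k)" if "k < N" for k
      using U that by (auto simp: measure_def zero_less_iff_neq_zero)
    ultimately show "emeasure (\<Pi>\<^sub>M k\<in>{..<N}. \<phi>) ?O > 0"
      by (simp add: zero_less_iff_neq_zero)
    show "?O \<in> sets (\<Pi>\<^sub>M k\<in>{..<N}. \<phi>)" using U by (intro sets_PiM_I_finite) auto
    show "S c \<in> sets simplex_borel" using S by (auto simp: sets_simplex_borel S_def)
    show "mass (\<mu> v* word y N) > 0" if "\<mu> \<in> S c" "y \<in> ?O" for \<mu> y
      using w'(1)[OF that] \<kappa> by simp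
    fix \<mu> \<nu> y assume *: "\<mu> \<in> S c" "\<nu> \<in> S c" "y \<in> ?O"
    let ?\<mu> = "normalized (\<mu> v* word y N)" and ?\<nu> = "normalized (\<nu> v* word y N)"
    have "l1norm (?\<mu> - ?\<nu>) \<le> l1norm (?\<mu> - \<theta>) + l1norm (\<theta> - ?\<nu>)"
      using l1norm_triangle[of "?\<mu> - \<theta>" "\<theta> - ?\<nu>"] by simp
    then show "tv_dist ?\<mu> ?\<nu> < e"
      using w'(2)[OF *(1,3)] w'(2)[OF *(2,3)] by (simp add: tv_dist_eq_l1norm l1norm_minus_commute[of \<theta>])
  qed
qed

text \<open>(KR) is the hub: it implies the other two conditions, and each of them implies
  it.\<close>

lemma unique_ergodicity:
  shows "((\<exists>!N. invariant_measure \<phi> M N) \<longleftrightarrow> condition_KR \<phi> M) \<and>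
    (condition_KR \<phi> M \<longleftrightarrow> condition_C \<phi> M P) \<and>
    ((\<exists>!N. invariant_measure \<phi> M N) \<or> condition_KR \<phi> M \<or> condition_C \<phi> M P \<longrightarrow>
      (\<exists>N. invariant_measure \<phi> M N \<and> (\<forall>N'. invariant_measure \<phi> M N' \<longrightarrow> N' = N) \<and>
        (\<forall>N0 \<in> simplex_laws. weakly_converges (\<lambda>n. cesaro_mean \<phi> M N0 n) N) \<and>
        (aperiodic_mat Q \<longrightarrow> (\<forall>N0 \<in> simplex_laws.
           weakly_converges (\<lambda>n. (filter_step \<phi> M ^^ n) N0) N))))"
proof -
  have KR: "(\<exists>N. invariant_measure \<phi> M N \<and> (\<forall>N'. invariant_measure \<phi> M N' \<longrightarrow> N' = N) \<and>
        (\<forall>N0 \<in> simplex_laws. weakly_converges (\<lambda>n. cesaro_mean \<phi> M N0 n) N) \<and>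
        (aperiodic_mat Q \<longrightarrow> (\<forall>N0 \<in> simplex_laws.
           weakly_converges (\<lambda>n. (filter_step \<phi> M ^^ n) N0) N)))" if "condition_KR \<phi> M"
    using pi_min_invariant KR_ergodic[OF that pi_min_invariant] by (intro exI[of _ "law (pi_min \<phi> P 0)"]) blast
  then have "condition_KR \<phi> M \<Longrightarrow> \<exists>!N. invariant_measure \<phi> M N" by blast
  then show ?thesis using KR unique_imp_KR condition_C_imp_KR KR_imp_condition_C by blast
qed

end

section \<open>The two kinds of observation space\<close>

lemma regular_count_space:
  assumes "hidden_markov_model (count_space F) M P"
  shows "regular_hidden_markov_model (count_space F) M P"
proof -
  interpret hidden_markov_model "count_space F" M P by fact
  show ?thesis
  proof
    fix w and d :: real assume "w \<in> space (count_space F)" "0 < d"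
    then show "\<exists>U\<in>sets (count_space F). 0 < measure (count_space F) U \<and> (\<forall>y\<in>U. dist (M y) (M w) < d)"
      by (intro bexI[of _ "{w}"]) (auto simp: measure_count_space)
  qed
qed

text \<open>Balls have positive finite Lebesgue measure, and by continuity \<open>M\<close> varies
  little on a small one.\<close>

lemma regular_lborel:
  assumes "hidden_markov_model lborel M P" and cont: "continuous_on UNIV M"
  shows "regular_hidden_markov_model lborel M P"
proof -
  interpret hidden_markov_model lborel M P by fact
  show ?thesis
  proof
    fix w and d :: real assume d: "0 < d"
    obtain r where r: "0 < r" "\<And>y. dist y w < r \<Longrightarrow> dist (M y) (M w) < d"
      using cont d unfolding continuous_on_iff by (metis UNIV_I)
    have "emeasure lborel (ball w r) \<noteq> \<infinity>" using emeasure_lborel_ball_finite[of w r] by simp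
    moreover have "emeasure lborel (ball w r) \<noteq> 0"
    proof
      assume "emeasure lborel (ball w r) = 0"
      then have "ball w r \<in> null_sets lborel" by auto
      then have "negligible (ball w r)" by (simp add: negligible_iff_null_sets null_sets_completionI)
      then show False using open_not_negligible[of "ball w r"] r by simp
    qed
    ultimately have "0 < measure lborel (ball w r)"
      by (simp add: measure_def enn2real_positive_iff zero_less_iff_neq_zero less_top)
    then show "\<exists>U\<in>sets lborel. 0 < measure lborel U \<and> (\<forall>y\<in>U. dist (M y) (M w) < d)"
      using r by (intro bexI[of _ "ball w r"]) (auto simp: dist_commute)
  qed
qed

theorem theorem2p7:
  fixes F :: "'f set"
    and M :: "'f \<Rightarrow> real ^ 'e ^ 'e::finite"
    and P :: "('e, 'f) path measure"
    and M' :: "real ^ 'd::finite \<Rightarrow> real ^ 'e ^ 'e"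
    and P' :: "('e, real ^ 'd) path measure"
  shows
    "(countable F \<and> hidden_markov_model (count_space F) M P \<longrightarrow>
       ((\<exists>!\<MM>. invariant_measure (count_space F) M \<MM>) \<longleftrightarrow> condition_KR (count_space F) M) \<and>
       (condition_KR (count_space F) M \<longleftrightarrow> condition_C (count_space F) M P) \<and>
       ((\<exists>!\<MM>. invariant_measure (count_space F) M \<MM>) \<or> condition_KR (count_space F) M \<or> condition_C (count_space F) M P \<longrightarrow>
         (\<exists>\<MM>. invariant_measure (count_space F) M \<MM> \<and>
           (\<forall>\<MM>'. invariant_measure (count_space F) M \<MM>' \<longrightarrow> \<MM>' = \<MM>) \<and>
           (\<forall>\<MM>\<^sub>0 \<in> space (prob_algebra simplex_borel).
              weakly_converges (\<lambda>n. cesaro_mean (count_space F) M \<MM>\<^sub>0 n) \<MM>) \<and>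
           (aperiodic_mat (signal_matrix (count_space F) M) \<longrightarrow>
              (\<forall>\<MM>\<^sub>0 \<in> space (prob_algebra simplex_borel).
                 weakly_converges (\<lambda>n. (filter_step (count_space F) M ^^ n) \<MM>\<^sub>0) \<MM>))))) \<and>
     (hidden_markov_model lborel M' P' \<and> continuous_on UNIV M' \<longrightarrow>
       ((\<exists>!\<MM>. invariant_measure lborel M' \<MM>) \<longleftrightarrow> condition_KR lborel M') \<and>
       (condition_KR lborel M' \<longleftrightarrow> condition_C lborel M' P') \<and>
       ((\<exists>!\<MM>. invariant_measure lborel M' \<MM>) \<or> condition_KR lborel M' \<or> condition_C lborel M' P' \<longrightarrow>
         (\<exists>\<MM>. invariant_measure lborel M' \<MM> \<and>
           (\<forall>\<MM>'. invariant_measure lborel M' \<MM>' \<longrightarrow> \<MM>' = \<MM>) \<and>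
           (\<forall>\<MM>\<^sub>0 \<in> space (prob_algebra simplex_borel).
              weakly_converges (\<lambda>n. cesaro_mean lborel M' \<MM>\<^sub>0 n) \<MM>) \<and>
           (aperiodic_mat (signal_matrix lborel M') \<longrightarrow>
              (\<forall>\<MM>\<^sub>0 \<in> space (prob_algebra simplex_borel).
                 weakly_converges (\<lambda>n. (filter_step lborel M' ^^ n) \<MM>\<^sub>0) \<MM>)))))"
  by (rule conjI; rule impI; elim conjE; rule regular_hidden_markov_model.unique_ergodicity;
      (rule regular_count_space | rule regular_lborel); assumption)

end
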